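(* Let $\mathbf{A}=(A^{(i)}_j)_{0\le i\le r,\ \delta_{i,0}\le j\le m_i}$ be a tuple of linear endomorphisms of $V=\mathbb{C}^n$ such that $m_i\le1$ for $i=0,\dots,r$, the matrices $A^{(i)}_1$ are semi-simple for all $i$, and $V$ is irreducible as an $\langle\mathbf{A}\rangle$-module. The case $m_i=0$ is identified with the case $m_i=1$ and $A^{(i)}_1=0$. (i) If $\mathrm{idx}(\mathbf{A})=2$, then $\mathbf{A}$ is transformed to a tuple of rank one (i.e. of matrices of size $1$) by applying additions and middle convolutions finitely many times. (ii) If $\mathrm{idx}(\mathbf{A})=0$, then by applying middle convolutions and additions finitely many times $\mathbf{A}$ is transformed to a tuple whose types of multiplicities at the singularities (omitting the singularities $i$ for which both $A^{(i)}_1$ and $A^{(i)}_0$ are scalar, and up to the order of the singularities) form one of the following lists, for some integer $d\ge1$. Four singularities: - $\{(d,d),(d,d),(d,d),(d,d)\}$. Three singularities: - $\{(d,d,d),(d,d,d),(d,d,d)\}$; - $\{(2d,2d),(d,d,d,d),(d,d,d,d)\}$; - $\{(3d,3d),(2d,2d,2d),(d,d,d,d,d,d)\}$; - $\{(d,d)-((d),(d)),\ (d,d),\ (d,d)\}$. Two singularities: - $\{(d,d)-((d),(d)),\ (d,d)-((d),(d))\}$; - $\{(d,d,d)-((d),(d),(d)),\ (d,d,d)\}$; - $\{(d,d,d,d)-((d),(d),(d),(d)),\ (2d,2d)\}$; - $\{(2d,2d)-((d,d),(d,d)),\ (d,d,d,d)\}$; - $\{(3d,2d)-((d,d,d),(2d)),\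 (d,d,d,d,d)\}$; - $\{(2d,2d,2d)-((d,d),(d,d),(d,d)),\ (3d,3d)\}$; - $\{(3d,3d,2d)-((d,d,d),(d,d,d),(2d)),\ (4d,4d)\}$; - $\{(5d,4d,3d)-((d,d,d,d,d),(2d,2d),(3d)),\ (6d,6d)\}$; - $\{(5d,4d)-((d,d,d,d,d),(2d,2d)),\ (3d,3d,3d)\}$; - $\{(3d,3d)-((d,d,d),(d,d,d)),\ (2d,2d,2d)\}$; - $\{(5d,3d)-((d,d,d,d,d),(3d)),\ (2d,2d,2d,2d)\}$; - $\{(4d,3d)-((2d,2d),(3d)),\ (d,d,d,d,d,d,d)\}$.
   Context: Here $r\ge1$ and $m_0,\dots,m_r\ge0$ are integers, $\delta$ is the Kronecker delta (so $A^{(0)}_0$ is not an entry of the tuple); for every tuple of this kind one sets $A^{(0)}_0:=-(A^{(1)}_0+\dots+A^{(r)}_0)$. Let $M=r+\sum_{i=0}^rm_i$. $V$ is irreducible as an $\langle\mathbf{A}\rangle$-module if there is no nonzero proper subspace $W\subset V$ with $A^{(i)}_jW\subset W$ for all entries. The indices $i=0,\dots,r$ are called the singularities (index $0$ corresponds to the point $\infty$). Index of rigidity: for $i=0,\dots,r$ let $A^{(i)}\in\mathrm{End}(V^{\oplus(m_i+1)})$ be the block upper triangular Toeplitz matrix with first block row $(A^{(i)}_{m_i},\dots,A^{(i)}_0)$ (so $A^{(i)}=\begin{pmatrix}A^{(i)}_1&A^{(i)}_0\\0&A^{(i)}_1\end{pmatrix}$ if $m_i=1$, and $A^{(i)}=A^{(i)}_0$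 if $m_i=0$). Let $\mathcal{C}^{(i)}$ be the space of block upper triangular Toeplitz matrices $C^{(i)}$ with first block row $(C^{(i)}_{m_i},\dots,C^{(i)}_0)$, $C^{(i)}_j\in\mathrm{End}(V)$, such that $A^{(i)}C^{(i)}=C^{(i)}A^{(i)}$. Then $\mathrm{idx}(\mathbf{A})=\sum_{i=0}^r\dim\mathcal{C}^{(i)}-(M-1)(\dim V)^2$. Addition: for $\overline{\mu}=(\mu^{(i)}_j)_{0\le i\le r,\,\delta_{i,0}\le j\le m_i}\in\mathbb{C}^M$, the addition $M_{\overline{\mu}}$ replaces each $A^{(i)}_j$ by $A^{(i)}_j+\mu^{(i)}_jI_n$. Middle convolution: let $V'=\bigoplus_{i=0}^rV^{(i)}$ with $V^{(0)}=V^{\oplus m_0}$, $V^{(i)}=V^{\oplus(m_i+1)}$ for $i\ge1$; elements are $v=(v^{(i)}_j)$ with $v^{(i)}_j\in V$, $0\le i\le r$, $\delta_{i,0}\le j\le m_i$. Put $S(v)=\sum_{i=0}^r\sum_{j=\delta_{i,0}}^{m_i}A^{(i)}_jv^{(i)}_j$. For $\mu\in\mathbb{C}$ define $\tilde A^{(i)}_j\in\mathrm{End}(V')$ by $u=\tilde A^{(i)}_jv$, where $u^{(i)}_{j'}=\mu v^{(i)}_{j'-j}$ for $j'>j$; $u^{(0)}_j=S(v)$ if $i=0$; $u^{(i)}_j=\mu v^{(i)}_0+S(v)$ if $i\ne0$; all other components of $u$ are $0$. Define subspaces of $V'$: - $\mathcal{K}=\bigoplus_{i=0}^r\mathcal{K}^{(i)}$,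 $\mathcal{K}^{(0)}=\{0\}$, and for $i\ge1$, $\mathcal{K}^{(i)}=\{(v^{(i)}_{m_i},\dots,v^{(i)}_0)^T\in V^{(i)}: A^{(i)}(v^{(i)}_{m_i},\dots,v^{(i)}_0)^T=0\}$; - for $\mu\ne0$, $\mathcal{L}(\mu)$ is the set of $v\in V'$ for which there is $\ell\in V$ with $v^{(i)}_j=0$ for all $i\ne0,j\ne0$, $v^{(1)}_0=\dots=v^{(r)}_0=-\ell$, and $(v^{(0)}_{m_0},\dots,v^{(0)}_1,\ell)^T$ is annihilated by the matrix obtained from $A^{(0)}$ by replacing its upper right block $A^{(0)}_0$ by $A^{(0)}_0-\mu I_n$; - $\mathcal{L}(0)=\{v\in V':S(v)=0\}$. The subspaces $\mathcal{K}$ and $\mathcal{L}(\mu)$ are invariant under all $\tilde A^{(i)}_j$. The middle convolution $mc_\mu(\mathbf{A})$ is the tuple (with the same $r,m_0,\dots,m_r$) of endomorphisms of $V'/(\mathcal{K}+\mathcal{L}(\mu))$ induced by the $\tilde A^{(i)}_j$. The matrices $L(\mathbf{q};\underline{\lambda})$: for integers $q_1\ge\dots\ge q_p\ge1$ and $\lambda_1,\dots,\lambda_p\in\mathbb{C}$, $L(q_1,\dots,q_p;\lambda_1,\dots,\lambda_p)$ is the block matrix with diagonal blocks $\lambda_1I_{q_1},\dots,\lambda_pI_{q_p}$, blocks $I_{q_1,q_2},\dots,I_{q_{p-1},q_p}$ on the first block superdiagonal, and zeros elsewhere, where $I_{a,b}$ is the $a\times b$ matrix with $(i,j)$-entry $\delta_{i,j}$.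 Every square complex matrix is conjugate to some $L(\mathbf{q};\underline{\lambda})$. Type of multiplicities at singularity $i$, i.e. of the pair $(A_1,A_0)=(A^{(i)}_1,A^{(i)}_0)$ with $A_1$ semi-simple: choose $P$ invertible with $P^{-1}A_1P=\mathrm{diag}(d_1I_{n_1},\dots,d_kI_{n_k})$, $d_1,\dots,d_k$ pairwise distinct, and write $P^{-1}A_0P=(A_0^{[a,b]})_{1\le a,b\le k}$ in blocks of sizes $n_a\times n_b$. If $A_0^{[l,l]}$ is conjugate to $L(n_{l,1},\dots,n_{l,p_l};\lambda_{l,1},\dots,\lambda_{l,p_l})$ for $l=1,\dots,k$, the type is $(n_1,\dots,n_k)-((n_{1,1},\dots,n_{1,p_1}),\dots,(n_{k,1},\dots,n_{k,p_k}))$. When $k=1$ (i.e. $A_1$ is scalar, which can be made $A_1=0$ by addition) the type $(n)-((n_{1,1},\dots,n_{1,p_1}))$ is abbreviated to $(n_{1,1},\dots,n_{1,p_1})$. *)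

theory Defs
  imports Complex_Main "HOL-Library.Multiset" "Jordan_Normal_Form.VS_Connect"
begin

text \<open>
  Throughout, \<open>r\<close> and \<open>m 0, \<dots>, m r\<close> are the numbers fixing the shape of a tuple, and a tuple of
  endomorphisms of \<open>\<complex>\<^sup>n\<close> is a function \<open>A\<close> with \<open>A i j\<close> standing for \<open>A\<^sup>(\<^sup>i\<^sup>)\<^sub>j\<close>.
  Only its values at the index pairs in \<open>entries r m\<close> are meaningful.
\<close>

type_synonym mat_tuple = "nat \<Rightarrow> nat \<Rightarrow> complex mat"

definition entries :: "nat \<Rightarrow> (nat \<Rightarrow> nat) \<Rightarrow> (nat \<times> nat) set" where
  "entries r m = {(i, j). i \<le> r \<and> (if i = 0 then 1 else 0) \<le> j \<and> j \<le> m i}"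

definition is_tuple :: "nat \<Rightarrow> (nat \<Rightarrow> nat) \<Rightarrow> nat \<Rightarrow> mat_tuple \<Rightarrow> bool" where
  "is_tuple r m n A \<longleftrightarrow> (\<forall>(i, j) \<in> entries r m. A i j \<in> carrier_mat n n)"

text \<open>
  The tuple completed by \<open>A\<^sup>(\<^sup>0\<^sup>)\<^sub>0 = - (A\<^sup>(\<^sup>1\<^sup>)\<^sub>0 + \<dots> + A\<^sup>(\<^sup>r\<^sup>)\<^sub>0)\<close>. The value is zero for \<open>j > m i\<close>;
  for \<open>m i = 0\<close> this is the identification with the case \<open>m i = 1\<close>, \<open>A\<^sup>(\<^sup>i\<^sup>)\<^sub>1 = 0\<close>.
\<close>

definition coef :: "nat \<Rightarrow> (nat \<Rightarrow> nat) \<Rightarrow> nat \<Rightarrow> mat_tuple \<Rightarrow> mat_tuple" where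
  "coef r m n A i j =
     (if i = 0 \<and> j = 0 then mat n n (\<lambda>(a, b). - (\<Sum>i' = 1..r. A i' 0 $$ (a, b)))
      else if j \<le> m i then A i j
      else 0\<^sub>m n n)"

definition irreducible_tuple :: "nat \<Rightarrow> (nat \<Rightarrow> nat) \<Rightarrow> nat \<Rightarrow> mat_tuple \<Rightarrow> bool" where
  "irreducible_tuple r m n A \<longleftrightarrow>
     (\<forall>W. subspace class_ring W (module_vec TYPE(complex) n) \<longrightarrow>
          (\<forall>(i, j) \<in> entries r m. \<forall>w \<in> W. A i j *\<^sub>v w \<in> W) \<longrightarrow>
          W = {0\<^sub>v n} \<or> W = carrier_vec n)"

definition semisimple_mat :: "complex mat \<Rightarrow> bool" where
  "semisimple_mat X \<longleftrightarrow> (\<exists>D. diagonal_mat D \<and> similar_mat X D)"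

definition scalar_mat :: "nat \<Rightarrow> complex mat \<Rightarrow> bool" where
  "scalar_mat n X \<longleftrightarrow> (\<exists>c. X = c \<cdot>\<^sub>m 1\<^sub>m n)"


section \<open>Index of rigidity\<close>

text \<open>Block upper triangular Toeplitz matrix with \<open>n \<times> n\<close> blocks and first block row \<open>(X k, \<dots>, X 0)\<close>.\<close>

definition block_toeplitz :: "nat \<Rightarrow> nat \<Rightarrow> (nat \<Rightarrow> complex mat) \<Rightarrow> complex mat" where
  "block_toeplitz n k X = mat (n * (k + 1)) (n * (k + 1))
     (\<lambda>(a, b). if a div n \<le> b div n
               then X (k - (b div n - a div n)) $$ (a mod n, b mod n) else 0)"

definition toeplitz_centralizer :: "nat \<Rightarrow> (nat \<Rightarrow> nat) \<Rightarrow> nat \<Rightarrow> mat_tuple \<Rightarrow> nat \<Rightarrow> complex mat set" where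
  "toeplitz_centralizer r m n A i =
     {block_toeplitz n (m i) C | C. (\<forall>j \<le> m i. C j \<in> carrier_mat n n) \<and>
        block_toeplitz n (m i) (coef r m n A i) * block_toeplitz n (m i) C =
        block_toeplitz n (m i) C * block_toeplitz n (m i) (coef r m n A i)}"

definition mat_subspace_dim :: "nat \<Rightarrow> complex mat set \<Rightarrow> nat" where
  "mat_subspace_dim N U =
     vectorspace.dim class_ring ((module_mat TYPE(complex) N N)\<lparr>carrier := U\<rparr>)"

definition num_entries :: "nat \<Rightarrow> (nat \<Rightarrow> nat) \<Rightarrow> nat" where
  "num_entries r m = r + (\<Sum>i \<le> r. m i)"

definition idx :: "nat \<Rightarrow> (nat \<Rightarrow> nat) \<Rightarrow> nat \<Rightarrow> mat_tuple \<Rightarrow> int" where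
  "idx r m n A =
     (\<Sum>i \<le> r. int (mat_subspace_dim (n * (m i + 1)) (toeplitz_centralizer r m n A i)))
     - (int (num_entries r m) - 1) * (int n)\<^sup>2"


section \<open>Addition and middle convolution\<close>

definition addition :: "nat \<Rightarrow> (nat \<Rightarrow> nat \<Rightarrow> complex) \<Rightarrow> mat_tuple \<Rightarrow> mat_tuple" where
  "addition n \<mu> A = (\<lambda>i j. A i j + \<mu> i j \<cdot>\<^sub>m 1\<^sub>m n)"

text \<open>
  Elements of \<open>V'\<close> are families \<open>v\<close> with \<open>v i j\<close> standing for \<open>v\<^sup>(\<^sup>i\<^sup>)\<^sub>j\<close>, extended by zero outside
  \<open>entries r m\<close>.
\<close>

type_synonym vec_family = "nat \<Rightarrow> nat \<Rightarrow> complex vec"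

definition conv_space :: "nat \<Rightarrow> (nat \<Rightarrow> nat) \<Rightarrow> nat \<Rightarrow> vec_family set" where
  "conv_space r m n =
     {v. \<forall>i j. v i j \<in> carrier_vec n \<and> ((i, j) \<notin> entries r m \<longrightarrow> v i j = 0\<^sub>v n)}"

definition conv_sum :: "nat \<Rightarrow> (nat \<Rightarrow> nat) \<Rightarrow> nat \<Rightarrow> mat_tuple \<Rightarrow> vec_family \<Rightarrow> complex vec" where
  "conv_sum r m n A v = vec n (\<lambda>a. \<Sum>(i, j) \<in> entries r m. (A i j *\<^sub>v v i j) $ a)"

definition conv_op ::
  "nat \<Rightarrow> (nat \<Rightarrow> nat) \<Rightarrow> nat \<Rightarrow> complex \<Rightarrow> mat_tuple \<Rightarrow> nat \<Rightarrow> nat \<Rightarrow> vec_family \<Rightarrow> vec_family" where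
  "conv_op r m n \<mu> A i j v = (\<lambda>i' j'.
     if (i', j') \<notin> entries r m \<or> i' \<noteq> i then 0\<^sub>v n
     else if j < j' then \<mu> \<cdot>\<^sub>v v i (j' - j)
     else if j' = j then
       (if i = 0 then conv_sum r m n A v else \<mu> \<cdot>\<^sub>v v i 0 + conv_sum r m n A v)
     else 0\<^sub>v n)"

text \<open>The column vector \<open>(x k, \<dots>, x 0)\<^sup>T\<close>.\<close>

definition stack :: "nat \<Rightarrow> nat \<Rightarrow> (nat \<Rightarrow> complex vec) \<Rightarrow> complex vec" where
  "stack n k x = vec (n * (k + 1)) (\<lambda>a. x (k - a div n) $ (a mod n))"

definition K_space :: "nat \<Rightarrow> (nat \<Rightarrow> nat) \<Rightarrow> nat \<Rightarrow> mat_tuple \<Rightarrow> vec_family set" where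
  "K_space r m n A = {v \<in> conv_space r m n.
     (\<forall>j. v 0 j = 0\<^sub>v n) \<and>
     (\<forall>i \<in> {1..r}. block_toeplitz n (m i) (coef r m n A i) *\<^sub>v stack n (m i) (v i)
                    = 0\<^sub>v (n * (m i + 1)))}"

definition L_space :: "nat \<Rightarrow> (nat \<Rightarrow> nat) \<Rightarrow> nat \<Rightarrow> complex \<Rightarrow> mat_tuple \<Rightarrow> vec_family set" where
  "L_space r m n \<mu> A =
     (if \<mu> = 0 then {v \<in> conv_space r m n. conv_sum r m n A v = 0\<^sub>v n}
      else {v \<in> conv_space r m n. \<exists>l \<in> carrier_vec n.
        (\<forall>i \<in> {1..r}. \<forall>j \<in> {1..m i}. v i j = 0\<^sub>v n) \<and>
        (\<forall>i \<in> {1..r}. v i 0 = - l) \<and>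
        block_toeplitz n (m 0)
            ((coef r m n A 0)(0 := coef r m n A 0 0 - \<mu> \<cdot>\<^sub>m 1\<^sub>m n))
          *\<^sub>v stack n (m 0) ((v 0)(0 := l)) = 0\<^sub>v (n * (m 0 + 1))})"

definition KL_space :: "nat \<Rightarrow> (nat \<Rightarrow> nat) \<Rightarrow> nat \<Rightarrow> complex \<Rightarrow> mat_tuple \<Rightarrow> vec_family set" where
  "KL_space r m n \<mu> A =
     {(\<lambda>i j. x i j + y i j) | x y. x \<in> K_space r m n A \<and> y \<in> L_space r m n \<mu> A}"

definition lin_comb :: "nat \<Rightarrow> nat \<Rightarrow> (nat \<Rightarrow> vec_family) \<Rightarrow> complex vec \<Rightarrow> vec_family" where
  "lin_comb n N b c = (\<lambda>i j. vec n (\<lambda>a. \<Sum>k < N. c $ k * b k i j $ a))"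

text \<open>The classes of \<open>b 0, \<dots>, b (N - 1)\<close> form a basis of the quotient of \<open>V'\<close> by \<open>U\<close>.\<close>

definition quotient_basis ::
  "nat \<Rightarrow> (nat \<Rightarrow> nat) \<Rightarrow> nat \<Rightarrow> vec_family set \<Rightarrow> nat \<Rightarrow> (nat \<Rightarrow> vec_family) \<Rightarrow> bool" where
  "quotient_basis r m n U N b \<longleftrightarrow>
     (\<forall>k < N. b k \<in> conv_space r m n) \<and>
     (\<forall>v \<in> conv_space r m n.
        \<exists>!c. c \<in> carrier_vec N \<and> (\<lambda>i j. v i j - lin_comb n N b c i j) \<in> U)"

text \<open>
  \<open>B\<close> consists of the matrices, with respect to some basis of the quotient of \<open>V'\<close> by
  \<open>\<K> + \<L>(\<mu>)\<close>, of the endomorphisms induced by the operators \<open>conv_op\<close>. As the basis is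
  arbitrary, \<open>B\<close> is determined up to simultaneous conjugation.
\<close>

definition is_middle_convolution ::
  "nat \<Rightarrow> (nat \<Rightarrow> nat) \<Rightarrow> nat \<Rightarrow> complex \<Rightarrow> mat_tuple \<Rightarrow> nat \<Rightarrow> mat_tuple \<Rightarrow> bool" where
  "is_middle_convolution r m n \<mu> A N B \<longleftrightarrow>
     is_tuple r m n A \<and> is_tuple r m N B \<and>
     (\<exists>b. quotient_basis r m n (KL_space r m n \<mu> A) N b \<and>
        (\<forall>(i, j) \<in> entries r m. \<forall>k < N.
           (\<lambda>i' j'. conv_op r m n \<mu> A i j (b k) i' j' - lin_comb n N b (col (B i j) k) i' j')
             \<in> KL_space r m n \<mu> A))"

inductive transform_step ::
  "nat \<Rightarrow> (nat \<Rightarrow> nat) \<Rightarrow> nat \<times> mat_tuple \<Rightarrow> nat \<times> mat_tuple \<Rightarrow> bool" for r m where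
  addition: "transform_step r m (n, A) (n, addition n \<mu> A)"
| middle_convolution:
    "is_middle_convolution r m n \<mu> A N B \<Longrightarrow> transform_step r m (n, A) (N, B)"

abbreviation transforms_to ::
  "nat \<Rightarrow> (nat \<Rightarrow> nat) \<Rightarrow> nat \<times> mat_tuple \<Rightarrow> nat \<times> mat_tuple \<Rightarrow> bool" where
  "transforms_to r m \<equiv> rtranclp (transform_step r m)"


section \<open>Types of multiplicities\<close>

text \<open>
  The matrix \<open>L(q\<^sub>1, \<dots>, q\<^sub>p; \<lambda>\<^sub>1, \<dots>, \<lambda>\<^sub>p)\<close>. The upper right block in the recursion is the row
  \<open>(I\<^bsub>q\<^sub>1,q\<^sub>2\<^esub>, 0, \<dots>, 0)\<close>.
\<close>

fun L_mat :: "nat list \<Rightarrow> complex list \<Rightarrow> complex mat" where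
  "L_mat (q # qs) (l # ls) =
     four_block_mat (l \<cdot>\<^sub>m 1\<^sub>m q)
       (mat q (sum_list qs) (\<lambda>(a, b). if b < hd qs \<and> a = b then 1 else 0))
       (0\<^sub>m (sum_list qs) q) (L_mat qs ls)"
| "L_mat _ _ = 0\<^sub>m 0 0"

text \<open>The \<open>l\<close>-th diagonal block of \<open>X\<close> for the block sizes \<open>ns\<close>.\<close>

definition nth_diag_block :: "nat list \<Rightarrow> nat \<Rightarrow> complex mat \<Rightarrow> complex mat" where
  "nth_diag_block ns l X =
     mat (ns ! l) (ns ! l)
       (\<lambda>(a, b). X $$ (sum_list (take l ns) + a, sum_list (take l ns) + b))"

text \<open>
  The type \<open>(n\<^sub>1,\<dots>,n\<^sub>k)-((n\<^sub>1\<^sub>,\<^sub>1,\<dots>,n\<^bsub>1,p\<^sub>1\<^esub>),\<dots>,(n\<^sub>k\<^sub>,\<^sub>1,\<dots>,n\<^bsub>k,p\<^sub>k\<^esub>))\<close> is the pair of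
  \<open>[n\<^sub>1,\<dots>,n\<^sub>k]\<close> and the list of the lists \<open>[n\<^sub>l\<^sub>,\<^sub>1,\<dots>,n\<^bsub>l,p\<^sub>l\<^esub>]\<close>. It is determined by
  \<open>(A\<^sub>1, A\<^sub>0)\<close> up to the order of the eigenvalues of \<open>A\<^sub>1\<close>, hence the relation below.
\<close>

type_synonym mult_type = "nat list \<times> nat list list"

definition has_mult_type :: "nat \<Rightarrow> complex mat \<Rightarrow> complex mat \<Rightarrow> mult_type \<Rightarrow> bool" where
  "has_mult_type n A1 A0 T \<longleftrightarrow>
     (case T of (ns, qss) \<Rightarrow>
       length qss = length ns \<and> (\<forall>k \<in> set ns. 1 \<le> k) \<and> sum_list ns = n \<and>
       (\<forall>qs \<in> set qss. sorted_wrt (\<ge>) qs \<and> (\<forall>q \<in> set qs. 1 \<le> q)) \<and>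
       (\<exists>P Q ds.
          length ds = length ns \<and> distinct ds \<and> P \<in> carrier_mat n n \<and>
          similar_mat_wit A1 (diag_block_mat (map2 (\<lambda>d k. d \<cdot>\<^sub>m 1\<^sub>m k) ds ns)) P Q \<and>
          (\<forall>l < length ns. \<exists>ls. length ls = length (qss ! l) \<and>
             similar_mat (nth_diag_block ns l (Q * A0 * P)) (L_mat (qss ! l) ls))))"

text \<open>The abbreviated notation \<open>(q\<^sub>1, \<dots>, q\<^sub>p)\<close> for types with scalar \<open>A\<^sub>1\<close>.\<close>

abbreviation reg :: "nat list \<Rightarrow> mult_type" where
  "reg qs \<equiv> ([sum_list qs], [qs])"

definition idx0_types :: "nat \<Rightarrow> mult_type multiset set" where
  "idx0_types d = {
     {# reg [d,d], reg [d,d], reg [d,d], reg [d,d] #},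

     {# reg [d,d,d], reg [d,d,d], reg [d,d,d] #},
     {# reg [2*d,2*d], reg [d,d,d,d], reg [d,d,d,d] #},
     {# reg [3*d,3*d], reg [2*d,2*d,2*d], reg [d,d,d,d,d,d] #},
     {# ([d,d], [[d],[d]]), reg [d,d], reg [d,d] #},

     {# ([d,d], [[d],[d]]), ([d,d], [[d],[d]]) #},
     {# ([d,d,d], [[d],[d],[d]]), reg [d,d,d] #},
     {# ([d,d,d,d], [[d],[d],[d],[d]]), reg [2*d,2*d] #},
     {# ([2*d,2*d], [[d,d],[d,d]]), reg [d,d,d,d] #},
     {# ([3*d,2*d], [[d,d,d],[2*d]]), reg [d,d,d,d,d] #},
     {# ([2*d,2*d,2*d], [[d,d],[d,d],[d,d]]), reg [3*d,3*d] #},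
     {# ([3*d,3*d,2*d], [[d,d,d],[d,d,d],[2*d]]), reg [4*d,4*d] #},
     {# ([5*d,4*d,3*d], [[d,d,d,d,d],[2*d,2*d],[3*d]]), reg [6*d,6*d] #},
     {# ([5*d,4*d], [[d,d,d,d,d],[2*d,2*d]]), reg [3*d,3*d,3*d] #},
     {# ([3*d,3*d], [[d,d,d],[d,d,d]]), reg [2*d,2*d,2*d] #},
     {# ([5*d,3*d], [[d,d,d,d,d],[3*d]]), reg [2*d,2*d,2*d,2*d] #},
     {# ([4*d,3*d], [[2*d,2*d],[3*d]]), reg [d,d,d,d,d,d,d] #} }"

definition nonscalar_sings :: "nat \<Rightarrow> (nat \<Rightarrow> nat) \<Rightarrow> nat \<Rightarrow> mat_tuple \<Rightarrow> nat set" where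
  "nonscalar_sings r m n A =
     {i. i \<le> r \<and> \<not> (scalar_mat n (coef r m n A i 1) \<and> scalar_mat n (coef r m n A i 0))}"

text \<open>The types at the non-scalar singularities, with the order of the singularities forgotten.\<close>

definition has_mult_types ::
  "nat \<Rightarrow> (nat \<Rightarrow> nat) \<Rightarrow> nat \<Rightarrow> mat_tuple \<Rightarrow> mult_type multiset \<Rightarrow> bool" where
  "has_mult_types r m n A \<T> \<longleftrightarrow>
     (\<exists>t. (\<forall>i \<in> nonscalar_sings r m n A.
             has_mult_type n (coef r m n A i 1) (coef r m n A i 0) (t i)) \<and>
          \<T> = image_mset t (mset_set (nonscalar_sings r m n A)))"

end

theory Submission
  imports Defs "HOL-Library.Product_Plus" "Jordan_Normal_Form.Spectral_Radius"
begin

text \<open>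
  Shift the tuple by scalars, \<open>X\<^sub>i = (A\<^sup>(\<^sup>i\<^sup>)\<^sub>1 - d\<^sub>i, A\<^sup>(\<^sup>i\<^sup>)\<^sub>0 - c\<^sub>i)\<close>, and let \<open>\<mu>\<close> be the sum of the \<open>c\<^sub>i\<close>. A rank
  factorisation of the Toeplitz matrix of \<open>X\<^sub>i\<close> can be written with matrices \<open>P\<^sub>i\<close>, \<open>Q\<^sub>i\<close> and a
  square-zero matrix \<open>N\<^sub>i\<close> of size \<open>w\<^sub>i\<close> such that \<open>X\<^sub>i = (Q\<^sub>i N\<^sub>i P\<^sub>i, Q\<^sub>i P\<^sub>i)\<close>. For the total matrices
  \<open>P\<close> (a column) and \<open>Q\<close> (a row) one has \<open>Q P = - \<mu>\<close>, so \<open>\<mu> + P Q\<close> is \<open>\<mu>\<close> times an idempotent.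
  Factoring it as \<open>P' Q'\<close> gives \<open>Q' P' = \<mu>\<close>, and the tuple \<open>(Q'\<^sub>i N\<^sub>i P'\<^sub>i, Q'\<^sub>i P'\<^sub>i)\<close> is the middle
  convolution of \<open>X\<close> with parameter \<open>\<mu>\<close>, up to a shift by \<open>\<mu>\<close> at \<open>\<infinity>\<close>. Its size is \<open>n' = \<Sum>w\<^sub>i - n\<close>. The construction is
  symmetric in \<open>(P, Q)\<close> and \<open>(P', Q')\<close>. Since the data \<open>(w\<^sub>i, N\<^sub>i)\<close> are kept and \<open>P\<^sub>i Q\<^sub>i\<close> only changes
  by a scalar, the index of rigidity is invariant; irreducibility and semisimplicity are inherited
  as well.

  Let \<open>K\<^sub>i\<close> be the largest possible kernel dimension of a shifted Toeplitz matrix at the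
  singularity \<open>i\<close>; a shift attaining it has \<open>w\<^sub>i = 2 n - K\<^sub>i\<close>. If \<open>\<Sum>K\<^sub>i > 2 r n\<close>, the middle
  convolution lowers the size. Otherwise the local estimate \<open>dim \<C>\<^sup>(\<^sup>i\<^sup>) \<le> n K\<^sub>i\<close> (with the case
  \<open>m\<^sub>i = 0\<close> regarded as \<open>A\<^sup>(\<^sup>i\<^sup>)\<^sub>1 = 0\<close>) makes the index nonpositive. If it is zero, then all the estimates are
  equalities, which forces all blocks to be of the form \<open>L(q,\<dots>,q)\<close>, and
  \<open>\<Sum>(2 n - K\<^sub>i) = 2 n\<close> leaves only the listed types.
\<close>

section \<open>Finitely supported matrices\<close>

text \<open>Each singularity contributes \<open>2 n^2 - 2 n w_i + h_i\<close> to the index, where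
  \<open>h_i\<close> depends only on \<open>w_i\<close>, \<open>N_i\<close> and on
  \<open>P_i Q_i\<close> up to scalars. Summed up, the index is \<open>\<Sum>h_i - 2 n n'\<close>,
  which is symmetric in the two sizes. Finding \<open>h_i\<close> is the main obstacle: the
  centralizer of a Toeplitz matrix cannot be read off from the data directly. An orthogonality
  argument for a symplectic form on the pairs \<open>(Q_i, P_i)\<close> takes the place of normal
  forms.

  The reflection needs \<open>\<mu> \<noteq> 0\<close>. If \<open>\<mu> = 0\<close>, irreducibility
  makes \<open>P\<close> injective and \<open>Q\<close> surjective, and \<open>Q P = 0\<close> then
  forces \<open>2 n \<le> \<Sum>w_i\<close>; so \<open>\<mu>\<close> cannot vanish whenever the size
  would drop.

  All \<open>r + 1\<close> singularities are treated alike, because the completed tuple has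
  vanishing residue sum. The shift by \<open>\<mu>\<close> at infinity restores this condition after
  the residues have been shifted.

  The descent stops at size one, where the index is 2, or at a size of at least two, where the index
  is at most zero. Hence index 2 has to reach size one, and index 0 never does.\<close>

text \<open>
  Matrices of all sizes live in one non-unital ring of finitely supported infinite matrices; the
  \<open>m \<times> n\<close> matrices are its corner \<open>mats m n\<close>. In this way sizes can vary inside a proof.
\<close>

typedef fmat = "{f :: nat \<Rightarrow> nat \<Rightarrow> complex. \<exists>n. \<forall>i j. n \<le> i \<or> n \<le> j \<longrightarrow> f i j = 0}"
  morphisms entry Abs_fmat
  by (rule exI[of _ "\<lambda>_ _. 0"]) auto

setup_lifting type_definition_fmat

lemma fmat_eqI: "(\<And>i j. entry X i j = entry Y i j) \<Longrightarrow> X = Y"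
  by (auto simp: entry_inject[symmetric] fun_eq_iff)

lemma entry_bound: "\<exists>n. \<forall>i j. n \<le> i \<or> n \<le> j \<longrightarrow> entry X i j = 0"
  using entry[of X] by simp

lemma fmat_bound_two:
  obtains n where "\<And>i j. n \<le> i \<or> n \<le> j \<Longrightarrow> entry X i j = 0"
    and "\<And>i j. n \<le> i \<or> n \<le> j \<Longrightarrow> entry Y i j = 0"
proof -
  obtain a where a: "\<And>i j. a \<le> i \<or> a \<le> j \<Longrightarrow> entry X i j = 0" using entry_bound by blast
  obtain b where b: "\<And>i j. b \<le> i \<or> b \<le> j \<Longrightarrow> entry Y i j = 0" using entry_bound by blast
  show ?thesis using a b by (intro that[of "max a b"]) auto
qed

instantiation fmat :: ab_group_add
begin

lift_definition zero_fmat :: fmat is "\<lambda>_ _. 0" by auto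

lift_definition plus_fmat :: "fmat \<Rightarrow> fmat \<Rightarrow> fmat" is "\<lambda>f g i j. f i j + g i j"
proof -
  fix f g :: "nat \<Rightarrow> nat \<Rightarrow> complex"
  assume "\<exists>n. \<forall>i j. n \<le> i \<or> n \<le> j \<longrightarrow> f i j = 0" "\<exists>n. \<forall>i j. n \<le> i \<or> n \<le> j \<longrightarrow> g i j = 0"
  then obtain a b where "\<And>i j. a \<le> i \<or> a \<le> j \<Longrightarrow> f i j = 0" "\<And>i j. b \<le> i \<or> b \<le> j \<Longrightarrow> g i j = 0"
    by blast
  then show "\<exists>n. \<forall>i j. n \<le> i \<or> n \<le> j \<longrightarrow> f i j + g i j = 0" by (intro exI[of _ "max a b"]) auto
qed

lift_definition uminus_fmat :: "fmat \<Rightarrow> fmat" is "\<lambda>f i j. - f i j" by auto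

definition minus_fmat :: "fmat \<Rightarrow> fmat \<Rightarrow> fmat" where "X - Y = X + - (Y :: fmat)"

lemma entry_0 [simp]: "entry 0 i j = 0" by transfer simp

lemma entry_add [simp]: "entry (X + Y) i j = entry X i j + entry Y i j" by transfer simp

lemma entry_uminus [simp]: "entry (- X) i j = - entry X i j" by transfer simp

lemma entry_diff [simp]: "entry (X - Y) i j = entry X i j - entry Y i j"
  by (simp add: minus_fmat_def)

instance
  by standard (rule fmat_eqI, simp)+

end

lemma entry_sum [simp]: "entry (sum f S) i j = (\<Sum>x\<in>S. entry (f x) i j)"
  by (induction S rule: infinite_finite_induct) auto

lift_definition scl :: "complex \<Rightarrow> fmat \<Rightarrow> fmat" (infixr "*\<^sub>F" 75) is "\<lambda>c f i j. c * f i j"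
  by auto

lemma entry_scl [simp]: "entry (c *\<^sub>F X) i j = c * entry X i j"
  by transfer simp

instantiation fmat :: ring
begin

text \<open>The sum runs over the support of a row of the left factor. That set is finite, so no
  common size has to be chosen for the two factors.\<close>

lift_definition times_fmat :: "fmat \<Rightarrow> fmat \<Rightarrow> fmat"
  is "\<lambda>f g i j. \<Sum>k | f i k \<noteq> 0. f i k * g k j"
proof -
  fix f g :: "nat \<Rightarrow> nat \<Rightarrow> complex"
  assume "\<exists>n. \<forall>i j. n \<le> i \<or> n \<le> j \<longrightarrow> f i j = 0" "\<exists>n. \<forall>i j. n \<le> i \<or> n \<le> j \<longrightarrow> g i j = 0"
  then obtain a b where "\<And>i j. a \<le> i \<or> a \<le> j \<Longrightarrow> f i j = 0" "\<And>i j. b \<le> i \<or> b \<le> j \<Longrightarrow> g i j = 0"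
    by blast
  then show "\<exists>n. \<forall>i j. n \<le> i \<or> n \<le> j \<longrightarrow> (\<Sum>k | f i k \<noteq> 0. f i k * g k j) = 0"
    by (intro exI[of _ "max a b"]) auto
qed

lemma entry_times_left:
  assumes "\<And>k. N \<le> k \<Longrightarrow> entry X i k = 0"
  shows "entry (X * Y) i j = (\<Sum>k<N. entry X i k * entry Y k j)"
proof -
  have "entry (X * Y) i j = (\<Sum>k | entry X i k \<noteq> 0. entry X i k * entry Y k j)"
    by transfer simp
  also have "\<dots> = (\<Sum>k<N. entry X i k * entry Y k j)"
  proof (rule sum.mono_neutral_left)
    show "{k. entry X i k \<noteq> 0} \<subseteq> {..<N}" using assms by (auto simp: not_le[symmetric])
  qed auto
  finally show ?thesis .
qed

lemma entry_times_right:
  assumes "\<And>k. N \<le> k \<Longrightarrow> entry Y k j = 0"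
  shows "entry (X * Y) i j = (\<Sum>k<N. entry X i k * entry Y k j)"
proof -
  obtain n where n: "\<And>i j. n \<le> i \<or> n \<le> j \<Longrightarrow> entry X i j = 0" using entry_bound by blast
  have "entry (X * Y) i j = (\<Sum>k<max n N. entry X i k * entry Y k j)"
    using n by (intro entry_times_left) auto
  also have "\<dots> = (\<Sum>k<N. entry X i k * entry Y k j)"
    using assms by (intro sum.mono_neutral_right) auto
  finally show ?thesis .
qed

instance
proof
  fix X Y Z :: fmat
  obtain a where a: "\<And>i j. a \<le> i \<or> a \<le> j \<Longrightarrow> entry X i j = 0" "\<And>i j. a \<le> i \<or> a \<le> j \<Longrightarrow> entry Y i j = 0"
    by (rule fmat_bound_two[of X Y]) blast
  obtain b where b: "\<And>i j. b \<le> i \<or> b \<le> j \<Longrightarrow> entry Z i j = 0" using entry_bound by blast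
  show "X * Y * Z = X * (Y * Z)"
  proof (rule fmat_eqI)
    fix i j
    have "entry (X * Y * Z) i j = (\<Sum>k<b. (\<Sum>l<a. entry X i l * entry Y l k) * entry Z k j)"
      using b a by (subst entry_times_right[of b]) (auto simp: entry_times_left[of a X])
    also have "\<dots> = (\<Sum>l<a. entry X i l * (\<Sum>k<b. entry Y l k * entry Z k j))"
      unfolding sum_distrib_left sum_distrib_right by (subst sum.swap) (simp add: mult.assoc)
    also have "\<dots> = entry (X * (Y * Z)) i j"
      using b a by (subst entry_times_left[of a X]) (auto simp: entry_times_right[of b Z])
    finally show "entry (X * Y * Z) i j = entry (X * (Y * Z)) i j" .
  qed
  show "(X + Y) * Z = X * Z + Y * Z"
    using b by (intro fmat_eqI) (simp add: entry_times_right[of b Z] ring_distribs sum.distrib)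
  show "X * (Y + Z) = X * Y + X * Z"
    using a by (intro fmat_eqI) (simp add: entry_times_left[of a X] ring_distribs sum.distrib)
qed

end

lemma scl_mult_left [simp]: "(c *\<^sub>F X) * Y = c *\<^sub>F (X * Y)"
proof -
  obtain a where "\<And>i j. a \<le> i \<or> a \<le> j \<Longrightarrow> entry X i j = 0" using entry_bound by blast
  then show ?thesis
    by (intro fmat_eqI) (simp add: entry_times_left[of a] sum_distrib_left mult.assoc)
qed

lemma scl_mult_right [simp]: "X * (c *\<^sub>F Y) = c *\<^sub>F (X * Y)"
proof -
  obtain a where "\<And>i j. a \<le> i \<or> a \<le> j \<Longrightarrow> entry X i j = 0" using entry_bound by blast
  then show ?thesis
    by (intro fmat_eqI) (simp add: entry_times_left[of a] sum_distrib_left algebra_simps)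
qed

interpretation fvs: vector_space scl
proof
  fix a b :: complex and x y :: fmat
  show "a *\<^sub>F (x + y) = a *\<^sub>F x + a *\<^sub>F y" by (rule fmat_eqI) (simp add: ring_distribs)
  show "(a + b) *\<^sub>F x = a *\<^sub>F x + b *\<^sub>F x" by (rule fmat_eqI) (simp add: ring_distribs)
  show "a *\<^sub>F b *\<^sub>F x = (a * b) *\<^sub>F x" by (rule fmat_eqI) simp
  show "1 *\<^sub>F x = x" by (rule fmat_eqI) simp
qed

declare fvs.scale_right_distrib [algebra_simps] fvs.scale_left_distrib [algebra_simps]
  fvs.scale_right_diff_distrib [algebra_simps] fvs.scale_left_diff_distrib [algebra_simps]

section \<open>Sizes, corners and coordinate inclusions\<close>

definition rowb :: "nat \<Rightarrow> fmat \<Rightarrow> bool" where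
  "rowb m X \<longleftrightarrow> (\<forall>i j. m \<le> i \<longrightarrow> entry X i j = 0)"

definition colb :: "nat \<Rightarrow> fmat \<Rightarrow> bool" where
  "colb n X \<longleftrightarrow> (\<forall>i j. n \<le> j \<longrightarrow> entry X i j = 0)"

definition mats :: "nat \<Rightarrow> nat \<Rightarrow> fmat set" where
  "mats m n = {X. rowb m X \<and> colb n X}"

lemma mats_conv [simp]: "X \<in> mats m n \<longleftrightarrow> rowb m X \<and> colb n X"
  by (simp add: mats_def)

lift_definition idm :: "nat \<Rightarrow> fmat" is "\<lambda>n i j. if i = j \<and> i < n then 1 else 0"
  by (metis not_le)

text \<open>The inclusion of a space of \<open>k\<close> coordinates at offset \<open>p\<close>; its
  transpose \<open>prj p k\<close> is the projection. They cut any matrix into blocks without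
  reference to an ambient size.\<close>

lift_definition emb :: "nat \<Rightarrow> nat \<Rightarrow> fmat" is "\<lambda>p k i j. if i = p + j \<and> j < k then 1 else 0"
proof -
  fix p k :: nat
  show "\<exists>n. \<forall>i j. n \<le> i \<or> n \<le> j \<longrightarrow> (if i = p + j \<and> j < k then 1 else (0 :: complex)) = 0"
    by (intro exI[of _ "p + k"]) auto
qed

lift_definition prj :: "nat \<Rightarrow> nat \<Rightarrow> fmat" is "\<lambda>p k i j. if j = p + i \<and> i < k then 1 else 0"
proof -
  fix p k :: nat
  show "\<exists>n. \<forall>i j. n \<le> i \<or> n \<le> j \<longrightarrow> (if j = p + i \<and> i < k then 1 else (0 :: complex)) = 0"
    by (intro exI[of _ "p + k"]) auto
qed

lift_definition unit_mat :: "nat \<Rightarrow> nat \<Rightarrow> fmat" is "\<lambda>a b i j. if i = a \<and> j = b then 1 else 0"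
proof -
  fix a b :: nat
  show "\<exists>n. \<forall>i j. n \<le> i \<or> n \<le> j \<longrightarrow> (if i = a \<and> j = b then 1 else (0 :: complex)) = 0"
    by (intro exI[of _ "Suc (a + b)"]) auto
qed

lemma entry_idm [simp]: "entry (idm n) i j = (if i = j \<and> i < n then 1 else 0)"
  by transfer simp

lemma entry_emb [simp]: "entry (emb p k) i j = (if i = p + j \<and> j < k then 1 else 0)"
  by transfer simp

lemma entry_prj [simp]: "entry (prj p k) i j = (if j = p + i \<and> i < k then 1 else 0)"
  by transfer simp

lemma entry_unit_mat [simp]: "entry (unit_mat a b) i j = (if i = a \<and> j = b then 1 else 0)"
  by transfer simp

lemma matsD: "X \<in> mats m n \<Longrightarrow> m \<le> i \<or> n \<le> j \<Longrightarrow> entry X i j = 0"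
  by (auto simp: rowb_def colb_def)

lemma matsI: "(\<And>i j. m \<le> i \<or> n \<le> j \<Longrightarrow> entry X i j = 0) \<Longrightarrow> X \<in> mats m n"
  by (auto simp: rowb_def colb_def)

lemma entry_times_colb:
  assumes "colb n X" shows "entry (X * Y) i j = (\<Sum>k<n. entry X i k * entry Y k j)"
  using assms by (intro entry_times_left) (auto simp: colb_def)

lemma entry_times_rowb:
  assumes "rowb n Y" shows "entry (X * Y) i j = (\<Sum>k<n. entry X i k * entry Y k j)"
  using assms by (intro entry_times_right) (auto simp: rowb_def)

lemma rowb_simps [simp]:
  "rowb m 0" "rowb m X \<Longrightarrow> rowb m Y \<Longrightarrow> rowb m (X + Y)" "rowb m X \<Longrightarrow> rowb m (- X)"
  "rowb m X \<Longrightarrow> rowb m Y \<Longrightarrow> rowb m (X - Y)" "rowb m X \<Longrightarrow> rowb m (c *\<^sub>F X)"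
  "\<forall>s. s \<in> S \<longrightarrow> rowb m (f s) \<Longrightarrow> rowb m (sum f S)"
  by (auto simp: rowb_def)

lemma colb_simps [simp]:
  "colb m 0" "colb m X \<Longrightarrow> colb m Y \<Longrightarrow> colb m (X + Y)" "colb m X \<Longrightarrow> colb m (- X)"
  "colb m X \<Longrightarrow> colb m Y \<Longrightarrow> colb m (X - Y)" "colb m X \<Longrightarrow> colb m (c *\<^sub>F X)"
  "\<forall>s. s \<in> S \<longrightarrow> colb m (f s) \<Longrightarrow> colb m (sum f S)"
  by (auto simp: colb_def)

text \<open>A product inherits its row bound from the left factor alone and its column bound from
  the right factor alone. Keeping the two bounds separate lets the simplifier check sizes without
  guessing inner dimensions.\<close>

lemma rowb_times [simp]:
  assumes "rowb m X" shows "rowb m (X * Y)"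
proof -
  obtain N where "\<And>i j. N \<le> i \<or> N \<le> j \<Longrightarrow> entry X i j = 0" using entry_bound by blast
  then have "entry (X * Y) i j = (\<Sum>k<N. entry X i k * entry Y k j)" for i j
    by (intro entry_times_left) auto
  then show ?thesis using assms by (simp add: rowb_def)
qed

lemma colb_times [simp]:
  assumes "colb n Y" shows "colb n (X * Y)"
proof -
  obtain N where "\<And>i j. N \<le> i \<or> N \<le> j \<Longrightarrow> entry X i j = 0" using entry_bound by blast
  then have "entry (X * Y) i j = (\<Sum>k<N. entry X i k * entry Y k j)" for i j
    by (intro entry_times_left) auto
  then show ?thesis using assms by (simp add: colb_def)
qed

lemma bound_leaves [simp]:
  "rowb m (idm n) \<longleftrightarrow> n \<le> m" "colb m (idm n) \<longleftrightarrow> n \<le> m"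
  "p + k \<le> m \<Longrightarrow> rowb m (emb p k)" "k \<le> n \<Longrightarrow> colb n (emb p k)"
  "k \<le> m \<Longrightarrow> rowb m (prj p k)" "p + k \<le> n \<Longrightarrow> colb n (prj p k)"
  "rowb m (unit_mat a b) \<longleftrightarrow> a < m" "colb n (unit_mat a b) \<longleftrightarrow> b < n"
  by (auto simp: rowb_def colb_def not_le[symmetric])

lemma rowb_mono: "rowb m X \<Longrightarrow> m \<le> m' \<Longrightarrow> rowb m' X"
  and colb_mono: "colb m X \<Longrightarrow> m \<le> m' \<Longrightarrow> colb m' X"
  by (auto simp: rowb_def colb_def)

lemma idm_mult [simp]:
  assumes "rowb m X" shows "idm m * X = X"
proof (rule fmat_eqI)
  fix i j
  have "entry (idm m * X) i j = (\<Sum>k<m. if k = i then entry X i j else 0)"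
    by (subst entry_times_colb[of m], simp, rule sum.cong) auto
  also have "\<dots> = entry X i j"
    using assms by (auto simp: rowb_def)
  finally show "entry (idm m * X) i j = entry X i j" .
qed

lemma mult_idm [simp]:
  assumes "colb n X" shows "X * idm n = X"
proof (rule fmat_eqI)
  fix i j
  have "entry (X * idm n) i j = (\<Sum>k<n. if k = j then entry X i j else 0)"
    by (subst entry_times_rowb[of n], simp, rule sum.cong) auto
  also have "\<dots> = entry X i j"
    using assms by (auto simp: colb_def)
  finally show "entry (X * idm n) i j = entry X i j" .
qed

lemma mult_idm_assoc [simp]: "colb n X \<Longrightarrow> X * (idm n * Y) = X * Y"
  by (simp add: mult.assoc[symmetric])

text \<open>Products are normalised to the right, so a relation \<open>A * B = C\<close> meets terms
  of the shape \<open>A * (B * Z)\<close>. This form turns each relation of a construction into the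
  matching rewrite rule.\<close>

lemma mult_eq_assoc: "A * B = C \<Longrightarrow> A * (B * Z) = C * (Z :: 'a::semigroup_mult)"
  by (simp add: mult.assoc[symmetric])

lemma idm_0 [simp]: "idm 0 = 0" by (rule fmat_eqI) simp

lemma bound_0 [simp]: "rowb 0 X \<longleftrightarrow> X = 0" "colb 0 X \<longleftrightarrow> X = 0"
  by (auto simp: rowb_def colb_def intro: fmat_eqI)

lemma prj_emb_same [simp]: "prj p k * emb p k = idm k"
proof (rule fmat_eqI)
  fix i j
  have "entry (prj p k * emb p k) i j = (\<Sum>l<p + k. if l = p + j \<and> j < k \<and> l = p + i \<and> i < k then 1 else 0)"
    by (subst entry_times_colb[of "p + k"]) (auto intro!: sum.cong)
  also have "\<dots> = entry (idm k) i j"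
    by (cases "i = j \<and> i < k") (auto simp: sum.delta' intro!: sum.neutral)
  finally show "entry (prj p k * emb p k) i j = entry (idm k) i j" .
qed

lemma prj_emb_disjoint [simp]:
  assumes "p + k \<le> q \<or> q + l \<le> p" shows "prj p k * emb q l = 0"
  by (intro fmat_eqI) (use assms in \<open>auto simp: entry_times_colb[of "p + k" "prj p k"] intro!: sum.neutral\<close>)

lemma entry_emb_mult:
  "entry (emb p k * X) i j = (if p \<le> i \<and> i < p + k then entry X (i - p) j else 0)"
proof -
  have "entry (emb p k * X) i j = (\<Sum>l<k. if l = i - p then (if p \<le> i then entry X (i - p) j else 0) else 0)"
    by (subst entry_times_colb[of k], simp, rule sum.cong) auto
  then show ?thesis by auto
qed

lemma entry_prj_mult:
  "entry (prj p k * X) i j = (if i < k then entry X (p + i) j else 0)"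
proof -
  have "entry (prj p k * X) i j = (\<Sum>l<p + k. if l = p + i then (if i < k then entry X (p + i) j else 0) else 0)"
    by (subst entry_times_colb[of "p + k"], simp, rule sum.cong) auto
  then show ?thesis by auto
qed

lemma entry_mult_emb:
  "entry (X * emb p k) i j = (if j < k then entry X i (p + j) else 0)"
proof -
  have "entry (X * emb p k) i j = (\<Sum>l<p + k. if l = p + j then (if j < k then entry X i (p + j) else 0) else 0)"
    by (subst entry_times_rowb[of "p + k"], simp, rule sum.cong) auto
  then show ?thesis by auto
qed

lemma entry_mult_prj:
  "entry (X * prj p k) i j = (if p \<le> j \<and> j < p + k then entry X i (j - p) else 0)"
proof -
  have "entry (X * prj p k) i j = (\<Sum>l<k. if l = j - p then (if p \<le> j then entry X i (j - p) else 0) else 0)"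
    by (subst entry_times_rowb[of k], simp, rule sum.cong) auto
  then show ?thesis by auto
qed

lemma entry_emb_prj [simp]:
  "entry (emb p k * prj p k) i j = (if i = j \<and> p \<le> i \<and> i < p + k then 1 else 0)"
  by (auto simp: entry_emb_mult)

lemmas prj_emb_assoc [simp] = prj_emb_same [THEN mult_eq_assoc] prj_emb_disjoint [THEN mult_eq_assoc]

lemma idm_split: "idm (a + b) = emb 0 a * prj 0 a + emb a b * prj a b"
  by (intro fmat_eqI) auto

section \<open>The trace and matrix units\<close>

definition tr :: "fmat \<Rightarrow> complex" where "tr X = (\<Sum>i | entry X i i \<noteq> 0. entry X i i)"

lemma tr_bound:
  assumes "\<And>i. N \<le> i \<Longrightarrow> entry X i i = 0" shows "tr X = (\<Sum>i<N. entry X i i)"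
  unfolding tr_def
proof (rule sum.mono_neutral_left)
  show "{k. entry X k k \<noteq> 0} \<subseteq> {..<N}" using assms by (auto simp: not_le[symmetric])
qed auto

lemma tr_add [simp]: "tr (X + Y) = tr X + tr Y"
proof -
  obtain N where "\<And>i j. N \<le> i \<or> N \<le> j \<Longrightarrow> entry X i j = 0" "\<And>i j. N \<le> i \<or> N \<le> j \<Longrightarrow> entry Y i j = 0"
    by (rule fmat_bound_two[of X Y]) blast
  then show ?thesis by (simp add: tr_bound[of N] sum.distrib)
qed

lemma tr_scl [simp]: "tr (c *\<^sub>F X) = c * tr X"
proof -
  obtain a where "\<And>i j. a \<le> i \<or> a \<le> j \<Longrightarrow> entry X i j = 0" using entry_bound by blast
  then show ?thesis by (simp add: tr_bound[of a] sum_distrib_left)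
qed

lemma tr_0 [simp]: "tr 0 = 0" by (simp add: tr_def)

lemma tr_uminus [simp]: "tr (- X) = - tr X"
  using tr_add[of X "- X"] by (simp add: add_eq_0_iff)

lemma tr_diff [simp]: "tr (X - Y) = tr X - tr Y"
  using tr_add[of X "- Y"] by simp

lemma tr_sum [simp]: "tr (sum f S) = (\<Sum>x\<in>S. tr (f x))"
  by (induction S rule: infinite_finite_induct) auto

lemma tr_comm: "tr (X * Y) = tr (Y * X)"
proof -
  obtain N where N: "\<And>i j. N \<le> i \<or> N \<le> j \<Longrightarrow> entry X i j = 0" "\<And>i j. N \<le> i \<or> N \<le> j \<Longrightarrow> entry Y i j = 0"
    by (rule fmat_bound_two[of X Y]) blast
  have "tr (X * Y) = (\<Sum>i<N. \<Sum>k<N. entry X i k * entry Y k i)"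
    using N by (subst tr_bound[of N]) (auto simp: entry_times_left[of N X])
  also have "\<dots> = (\<Sum>k<N. \<Sum>i<N. entry Y k i * entry X i k)"
    by (subst sum.swap) (simp add: mult.commute)
  also have "\<dots> = tr (Y * X)"
    using N by (subst tr_bound[of N]) (auto simp: entry_times_left[of N Y])
  finally show ?thesis .
qed

lemma tr_idm [simp]: "tr (idm n) = of_nat n"
  by (subst tr_bound[of n]) auto

lemma entry_mult_unit_mat:
  "entry (X * unit_mat a b) i j = (if j = b then entry X i a else 0)"
  by (subst entry_times_rowb[of "Suc a"])
     (auto simp: if_distrib[of "\<lambda>x. _ * x"] sum.delta cong: if_cong)

lemma entry_unit_mat_mult:
  "entry (unit_mat a b * X) i j = (if i = a then entry X b j else 0)"
  by (subst entry_times_colb[of "Suc b"])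
     (auto simp: if_distrib[of "\<lambda>x. x * _"] sum.delta cong: if_cong)

lemma tr_mult_unit_mat: "tr (X * unit_mat a b) = entry X b a"
  by (subst tr_bound[of "Suc b"]) (auto simp: entry_mult_unit_mat)

lemma idm_eq_sum_unit_mat: "idm n = (\<Sum>a<n. unit_mat a b * unit_mat b a)"
proof (rule fmat_eqI)
  fix i j
  have "entry (\<Sum>a<n. unit_mat a b * unit_mat b a) i j = (\<Sum>a<n. if a = j then (if i = j then 1 else 0) else 0)"
    by (auto simp: entry_mult_unit_mat intro!: sum.cong)
  then show "entry (idm n) i j = entry (\<Sum>a<n. unit_mat a b * unit_mat b a) i j"
    by auto
qed

section \<open>Dimensions of subspaces\<close>

locale complex_space = vector_space scale
  for scale :: "complex \<Rightarrow> 'b::ab_group_add \<Rightarrow> 'b"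
begin

text \<open>The space of all finitely supported matrices has infinite dimension, so finiteness is
  carried by each subspace separately.\<close>

definition fin_span :: "'b set \<Rightarrow> bool" where
  "fin_span U \<longleftrightarrow> (\<exists>B. finite B \<and> U \<subseteq> span B)"

lemma fin_span_subset: "fin_span U \<Longrightarrow> V \<subseteq> U \<Longrightarrow> fin_span V"
  unfolding fin_span_def by blast

lemma fin_span_basis:
  assumes "fin_span U" "subspace U"
  obtains B where "B \<subseteq> U" "finite B" "independent B" "span B = U" "card B = dim U"
proof -
  obtain B where B: "B \<subseteq> U" "independent B" "U \<subseteq> span B" "card B = dim U"
    using basis_exists[of U] by blast
  moreover obtain S where "finite S" "U \<subseteq> span S" using assms(1) by (auto simp: fin_span_def)
  then have "finite B" using independent_span_bound[of S B] B by auto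
  moreover have "span B = U" using B assms(2) by (simp add: span_subspace)
  ultimately show ?thesis using that by blast
qed

lemma fin_span_extend:
  assumes "fin_span U" "subspace U" "C \<subseteq> U" "independent C"
  obtains B where "C \<subseteq> B" "B \<subseteq> U" "finite B" "independent B" "span B = U" "card B = dim U"
proof -
  obtain B where B: "C \<subseteq> B" "B \<subseteq> U" "independent B" "U \<subseteq> span B"
    using maximal_independent_subset_extend[OF assms(3,4)] by blast
  moreover obtain S where "finite S" "U \<subseteq> span S" using assms(1) by (auto simp: fin_span_def)
  then have "finite B" using independent_span_bound[of S B] B by auto
  moreover have "span B = U" using B assms(2) by (simp add: span_subspace)
  moreover have "card B = dim U" using B basis_card_eq_dim by blast
  ultimately show ?thesis using that by blast
qed

lemma dim_mono_fin:
  assumes "fin_span U" "subspace U" "V \<subseteq> U"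
  shows "dim V \<le> dim U"
proof -
  obtain B where "finite B" "span B = U" "card B = dim U" using fin_span_basis[OF assms(1,2)] by metis
  then show ?thesis using dim_le_card[of V B] assms(3) by auto
qed

lemma subspace_dim_eq:
  assumes "fin_span U" "subspace U" "subspace V" "V \<subseteq> U" "dim U \<le> dim V"
  shows "V = U"
proof -
  obtain C where C: "C \<subseteq> V" "finite C" "independent C" "span C = V" "card C = dim V"
    using fin_span_basis[OF fin_span_subset[OF assms(1,4)] assms(3)] by metis
  obtain B where B: "C \<subseteq> B" "finite B" "span B = U" "card B = dim U"
    using fin_span_extend[OF assms(1,2), of C] C assms(4) by (metis order_trans)
  have "C = B" using B C assms(5) by (intro card_seteq) auto
  then show ?thesis using B C by simp
qed

lemma independent_span_Int_zero:
  assumes B: "independent B" and "C \<subseteq> B" "D \<subseteq> B" "C \<inter> D = {}" and x: "x \<in> span C" "x \<in> span D"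
  shows "x = 0"
proof -
  have "representation B x b = 0" for b
    using representation_extend[OF B x(1) assms(2)] representation_extend[OF B x(2) assms(3)]
      representation_ne_zero[of C x b] representation_ne_zero[of D x b] assms(4) by auto
  moreover have "x \<in> span B" using x(1) assms(2) span_mono by blast
  ultimately show ?thesis using sum_nonzero_representation_eq[OF B, of x] by simp
qed

lemma dim_zero_space [simp]: "dim {0} = 0"
  using dim_le_card[of "{0}" "{}"] by simp

end

locale complex_space_pair = vs1: complex_space s1 + vs2: complex_space s2
  for s1 :: "complex \<Rightarrow> 'b::ab_group_add \<Rightarrow> 'b" and s2 :: "complex \<Rightarrow> 'c::ab_group_add \<Rightarrow> 'c"
begin

sublocale vector_space_pair s1 s2 ..

lemma fin_span_image:
  assumes "Vector_Spaces.linear s1 s2 f" "vs1.fin_span U" shows "vs2.fin_span (f ` U)"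
proof -
  obtain B where "finite B" "U \<subseteq> vs1.span B" using assms(2) by (auto simp: vs1.fin_span_def)
  then have "finite (f ` B)" "f ` U \<subseteq> vs2.span (f ` B)"
    using linear_span_image[OF assms(1), of B] by auto
  then show ?thesis by (auto simp: vs2.fin_span_def)
qed

lemma subspace_kernel_on:
  assumes "Vector_Spaces.linear s1 s2 f" "vs1.subspace U"
  shows "vs1.subspace {x \<in> U. f x = 0}"
  using assms by (auto simp: vs1.subspace_def linear_0 linear_add linear_scale)

text \<open>A basis \<open>C\<close> of the kernel in \<open>U\<close> is extended to a basis
  \<open>B\<close> of \<open>U\<close>. On the span of \<open>B - C\<close> the map is injective,
  since the spans of \<open>C\<close> and \<open>B - C\<close> meet only in zero.\<close>

theorem rank_nullity:
  assumes f: "Vector_Spaces.linear s1 s2 f" and U: "vs1.fin_span U" "vs1.subspace U"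
  shows "vs1.dim U = vs2.dim (f ` U) + vs1.dim {x \<in> U. f x = 0}"
proof -
  let ?K = "{x \<in> U. f x = 0}"
  have K: "vs1.subspace ?K" by (rule subspace_kernel_on[OF f U(2)])
  obtain C where C: "C \<subseteq> ?K" "finite C" "vs1.independent C" "vs1.span C = ?K" "card C = vs1.dim ?K"
    by (rule vs1.fin_span_basis[OF vs1.fin_span_subset[OF U(1)] K]) blast
  obtain B where B: "C \<subseteq> B" "B \<subseteq> U" "finite B" "vs1.independent B" "vs1.span B = U" "card B = vs1.dim U"
    by (rule vs1.fin_span_extend[OF U _ C(3)]) (use C(1) in auto)
  define D where "D = B - C"
  have D: "vs1.independent D" unfolding D_def using B(4) vs1.independent_mono by blast
  have inj: "inj_on f (vs1.span D)"
  proof (rule linear_inj_on_iff_eq_0[OF f vs1.subspace_span, THEN iffD2], intro ballI impI)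
    fix x assume x: "x \<in> vs1.span D" "f x = 0"
    have "x \<in> U" using x(1) vs1.span_mono[of D B] B(5) by (auto simp: D_def)
    then have "x \<in> vs1.span C" using x(2) C(4) by auto
    then show "x = 0"
      using vs1.independent_span_Int_zero[OF B(4,1), of D x] x(1) by (auto simp: D_def)
  qed
  have "vs2.independent (f ` D)" by (rule linear_independent_injective_image[OF f D inj])
  moreover have "f ` U \<subseteq> vs2.span (f ` D)"
  proof -
    have "f ` B \<subseteq> vs2.span (f ` D)"
    proof (rule image_subsetI)
      fix b assume "b \<in> B"
      then show "f b \<in> vs2.span (f ` D)"
        using C(1) by (cases "b \<in> C") (auto simp: D_def vs2.span_zero intro: vs2.span_base)
    qed
    then have "vs2.span (f ` B) \<subseteq> vs2.span (f ` D)" by (rule vs2.span_minimal) simp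
    then show ?thesis using linear_span_image[OF f, of B] B(5) by simp
  qed
  moreover have "f ` D \<subseteq> f ` U" using B(2) by (auto simp: D_def)
  ultimately have "card (f ` D) = vs2.dim (f ` U)" by (intro vs2.basis_card_eq_dim)
  moreover have "card (f ` D) = card D" using inj vs1.span_superset by (intro card_image) (auto intro: inj_on_subset)
  moreover have "card B = card D + card C" unfolding D_def using B(1,3) C(2)
    by (simp add: card_Diff_subset card_mono)
  ultimately show ?thesis using B(6) C(5) by simp
qed

lemma dim_inj_image:
  assumes f: "Vector_Spaces.linear s1 s2 f" and U: "vs1.fin_span U" "vs1.subspace U"
    and inj: "\<And>x. x \<in> U \<Longrightarrow> f x = 0 \<Longrightarrow> x = 0"
  shows "vs2.dim (f ` U) = vs1.dim U"
proof -
  have "{x \<in> U. f x = 0} = {0}"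
    using inj U(2) by (auto simp: linear_0[OF f] vs1.subspace_0)
  then show ?thesis using rank_nullity[OF f U] by simp
qed

text \<open>The maps are peeled off one at a time by rank and nullity; restricted to the kernel of
  the earlier ones, each image can only shrink.\<close>

lemma dim_le_sum_images:
  assumes "finite I" and f: "\<And>i. i \<in> I \<Longrightarrow> Vector_Spaces.linear s1 s2 (f i)"
    and U: "vs1.fin_span U" "vs1.subspace U"
  shows "vs1.dim U \<le> (\<Sum>i\<in>I. vs2.dim (f i ` U)) + vs1.dim {x \<in> U. \<forall>i\<in>I. f i x = 0}"
  using assms(1) f
proof (induction I rule: finite_induct)
  case empty
  then show ?case by simp
next
  case (insert i I)
  let ?K = "{x \<in> U. \<forall>i\<in>I. f i x = 0}"
  have K: "vs1.subspace ?K"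
    using U(2) insert.prems by (auto simp: vs1.subspace_def linear_0 linear_add linear_scale)
  have fK: "vs1.fin_span ?K" by (rule vs1.fin_span_subset[OF U(1)]) auto
  have fi: "Vector_Spaces.linear s1 s2 (f i)" using insert.prems by simp
  have "vs1.dim ?K = vs2.dim (f i ` ?K) + vs1.dim {x \<in> ?K. f i x = 0}"
    by (rule rank_nullity[OF fi fK K])
  moreover have "vs2.dim (f i ` ?K) \<le> vs2.dim (f i ` U)"
    by (rule vs2.dim_mono_fin[OF fin_span_image[OF fi U(1)] linear_subspace_image[OF fi U(2)]]) auto
  moreover have "{x \<in> ?K. f i x = 0} = {x \<in> U. \<forall>j\<in>insert i I. f j x = 0}" by auto
  moreover have "vs1.dim U \<le> (\<Sum>i\<in>I. vs2.dim (f i ` U)) + vs1.dim ?K"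
    using insert.IH insert.prems by simp
  ultimately show ?case using insert.hyps by simp
qed

end

interpretation fvs: complex_space scl ..

lemma eq_sum_entries:
  assumes "X \<in> mats m n"
  shows "X = (\<Sum>p\<in>{..<m} \<times> {..<n}. entry X (fst p) (snd p) *\<^sub>F unit_mat (fst p) (snd p))"
proof (rule fmat_eqI)
  fix i j
  have "(\<Sum>p\<in>{..<m} \<times> {..<n}. entry X (fst p) (snd p) * (if i = fst p \<and> j = snd p then 1 else 0))
      = (\<Sum>p\<in>{..<m} \<times> {..<n}. if p = (i, j) then entry X i j else 0)"
    by (intro sum.cong) auto
  then show "entry X i j = entry (\<Sum>p\<in>{..<m} \<times> {..<n}. entry X (fst p) (snd p) *\<^sub>F unit_mat (fst p) (snd p)) i j"
    using matsD[OF assms, of i j] by auto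
qed

lemma mats_space:
  shows dim_mats: "fvs.dim (mats m n) = m * n"
    and fin_span_mats: "fvs.fin_span (mats m n)"
    and subspace_mats: "fvs.subspace (mats m n)"
proof -
  let ?I = "{..<m} \<times> {..<n}" and ?u = "\<lambda>p. unit_mat (fst p) (snd p)"
  have inj: "inj_on ?u ?I"
  proof (rule inj_onI)
    fix p q assume "?u p = ?u q"
    then have "entry (?u q) (fst p) (snd p) = 1" by (metis entry_unit_mat)
    then show "p = q" by (auto simp: prod_eq_iff split: if_splits)
  qed
  have sub: "?u ` ?I \<subseteq> mats m n" by auto
  have ind: "fvs.independent (?u ` ?I)"
  proof (rule fvs.independent_if_scalars_zero)
    fix c v assume c: "(\<Sum>v\<in>?u ` ?I. c v *\<^sub>F v) = 0" and "v \<in> ?u ` ?I"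
    then obtain p where p: "p \<in> ?I" "v = ?u p" by auto
    have "0 = entry (\<Sum>q\<in>?I. c (?u q) *\<^sub>F ?u q) (fst p) (snd p)"
      using c by (simp add: sum.reindex[OF inj])
    also have "\<dots> = (\<Sum>q\<in>?I. if q = p then c (?u p) else 0)"
      by (auto simp: prod_eq_iff intro!: sum.cong)
    also have "\<dots> = c v" using p by simp
    finally show "c v = 0" by simp
  qed simp
  have span: "mats m n \<subseteq> fvs.span (?u ` ?I)"
  proof
    fix X assume "X \<in> mats m n"
    then show "X \<in> fvs.span (?u ` ?I)"
      by (subst eq_sum_entries, assumption) (intro fvs.span_sum fvs.span_scale fvs.span_base imageI)
  qed
  show "fvs.dim (mats m n) = m * n"
    using fvs.basis_card_eq_dim[OF sub span ind] card_image[OF inj] by simp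
  show "fvs.fin_span (mats m n)" unfolding fvs.fin_span_def
    by (rule exI[of _ "?u ` ?I"]) (use span in simp)
  show "fvs.subspace (mats m n)" by (auto simp: fvs.subspace_def)
qed

locale to_fmat = complex_space scale for scale :: "complex \<Rightarrow> 'b::ab_group_add \<Rightarrow> 'b"
begin

sublocale complex_space_pair scale scl ..

text \<open>Pairing with a basis of \<open>E\<close> gives an injective map into columns of length
  \<open>dim E\<close>, hence an isomorphism. The basis is chosen to begin with a basis of
  \<open>U\<close>; keeping only those entries leaves a surjection onto columns of length
  \<open>dim U\<close>, and its kernel is the complement.\<close>

lemma dim_perp:
  assumes E: "fin_span E" "subspace E" and U: "subspace U" "U \<subseteq> E"
    and lin: "\<And>u. \<omega> u 0 = 0" "\<And>u x y. \<omega> u (x + y) = \<omega> u x + \<omega> u y"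
      "\<And>u c x. \<omega> u (scale c x) = c * \<omega> u x"
      "\<And>x. \<omega> 0 x = 0" "\<And>u v x. \<omega> (u + v) x = \<omega> u x + \<omega> v x"
      "\<And>c u x. \<omega> (scale c u) x = c * \<omega> u x"
    and nondeg: "\<And>x. x \<in> E \<Longrightarrow> (\<And>u. u \<in> E \<Longrightarrow> \<omega> u x = (0::complex)) \<Longrightarrow> x = 0"
  shows "dim {x \<in> E. \<forall>u\<in>U. \<omega> u x = 0} + dim U = dim E"
proof -
  have fU: "fin_span U" by (rule fin_span_subset[OF E(1) U(2)])
  obtain C where C: "C \<subseteq> U" "finite C" "independent C" "span C = U" "card C = dim U"
    by (rule fin_span_basis[OF fU U(1)])
  obtain B where B: "C \<subseteq> B" "B \<subseteq> E" "finite B" "independent B" "span B = E" "card B = dim E"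
    by (rule fin_span_extend[OF E, of C]) (use C U in auto)
  have span_zero: "\<omega> u x = 0" if "u \<in> span S" "\<And>b. b \<in> S \<Longrightarrow> \<omega> b x = 0" for u x S
    using that(1) by (induction rule: span_induct_alt) (auto simp: lin that(2))
  obtain bs where bs: "set bs = C" "distinct bs" using finite_distinct_list[OF C(2)] by blast
  obtain ds where ds: "set ds = B - C" "distinct ds" using finite_distinct_list[of "B - C"] B(3) by auto
  define es where "es = bs @ ds"
  have es: "set es = B" "distinct es" "length es = dim E" "length bs = dim U"
  proof -
    show "set es = B" "distinct es" using bs ds B(1) by (auto simp: es_def)
    then show "length es = dim E" using distinct_card[of es] B(6) by simp
    show "length bs = dim U" using distinct_card[of bs] bs C(5) by simp
  qed
  define \<Phi> where "\<Phi> l x = (\<Sum>k<length l. \<omega> (l ! k) x *\<^sub>F unit_mat k 0)" for l x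
  have lin\<Phi>: "Vector_Spaces.linear scale scl (\<Phi> l)" for l
    by unfold_locales (auto simp: \<Phi>_def lin sum.distrib fvs.scale_left_distrib fvs.scale_sum_right)
  have e\<Phi>: "entry (\<Phi> l x) i j = (if j = 0 \<and> i < length l then \<omega> (l ! i) x else 0)" for l x i j
  proof -
    have "entry (\<Phi> l x) i j = (\<Sum>k<length l. if k = i then (if j = 0 then \<omega> (l ! i) x else 0) else 0)"
      unfolding \<Phi>_def entry_sum by (rule sum.cong) auto
    then show ?thesis by auto
  qed
  have mem\<Phi>: "\<Phi> l x \<in> mats (length l) 1" for l x
    by (rule matsI) (auto simp: e\<Phi>)
  have \<Phi>0: "\<Phi> l x = 0 \<longleftrightarrow> (\<forall>b\<in>set l. \<omega> b x = 0)" for l x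
  proof
    assume *: "\<Phi> l x = 0"
    show "\<forall>b\<in>set l. \<omega> b x = 0"
    proof
      fix b assume "b \<in> set l"
      then obtain i where "i < length l" "l ! i = b" by (auto simp: in_set_conv_nth)
      then show "\<omega> b x = 0" using e\<Phi>[of l x i 0] * by simp
    qed
  qed (auto simp: \<Phi>_def intro!: sum.neutral)
  have full: "\<Phi> es ` E = mats (length es) 1"
  proof (rule fvs.subspace_dim_eq)
    have "dim E = fvs.dim (\<Phi> es ` E)"
      using dim_inj_image[OF lin\<Phi> E, of es] nondeg span_zero[of _ B] \<Phi>0 es(1) B(5) by metis
    then show "fvs.dim (mats (length es) 1) \<le> fvs.dim (\<Phi> es ` E)" by (simp add: dim_mats es(3))
  qed (use mem\<Phi> in \<open>auto intro: fin_span_mats subspace_mats linear_subspace_image[OF lin\<Phi> E(2)]\<close>)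
  have "\<Phi> bs ` E = mats (length bs) 1"
  proof (intro equalityI subsetI)
    fix Y assume Y: "Y \<in> mats (length bs) 1"
    then have "Y \<in> \<Phi> es ` E" unfolding full by (auto simp: es_def intro: colb_mono rowb_mono)
    then obtain x where x: "x \<in> E" "Y = \<Phi> es x" by auto
    have "Y = \<Phi> bs x"
    proof (rule fmat_eqI)
      fix i j show "entry Y i j = entry (\<Phi> bs x) i j"
        using matsD[OF Y, of i j] unfolding x(2) e\<Phi> by (auto simp: es_def nth_append)
    qed
    with x(1) show "Y \<in> \<Phi> bs ` E" by auto
  qed (use mem\<Phi> in auto)
  moreover have "{x \<in> E. \<Phi> bs x = 0} = {x \<in> E. \<forall>u\<in>U. \<omega> u x = 0}"
    unfolding \<Phi>0 bs(1) using span_zero[of _ C] C(1,4) by blast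
  ultimately show ?thesis
    using rank_nullity[OF lin\<Phi> E, of bs] es(4) by (simp add: dim_mats)
qed

end

section \<open>Rank factorisation\<close>

lemma unit_mat_mult [simp]: "unit_mat a b * unit_mat b c = unit_mat a c"
  by (rule fmat_eqI) (auto simp: entry_mult_unit_mat)

lemma unit_mat_sandwich: "unit_mat a b * (X * unit_mat c d) = entry X b c *\<^sub>F unit_mat a d"
  by (rule fmat_eqI) (auto simp: entry_mult_unit_mat entry_unit_mat_mult mult.assoc[symmetric])

lemma unit_mat_00: "unit_mat 0 0 = idm 1"
  by (rule fmat_eqI) auto

lemma entry_times_zero_row: "\<forall>j. entry X i j = 0 \<Longrightarrow> entry (X * Y) i j = 0"
  by (rule fmat_bound_two[of X Y]) (simp add: entry_times_left)

text \<open>Gaussian elimination in rank-one steps: subtracting the pivot column times the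
  normalised pivot row clears the pivot row and revives no zero row, so the number of nonzero rows
  drops. One-sided inverses of both factors are carried along, because they are what allows
  cancellation later on.\<close>

lemma rank_factorisation:
  assumes "X \<in> mats m n"
  obtains \<rho> y x s t where "y \<in> mats m \<rho>" "x \<in> mats \<rho> n" "s \<in> mats n \<rho>" "t \<in> mats \<rho> m"
    "X = y * x" "x * s = idm \<rho>" "t * y = idm \<rho>"
proof -
  have "\<exists>\<rho> y x s t. y \<in> mats m \<rho> \<and> x \<in> mats \<rho> n \<and> s \<in> mats n \<rho> \<and> t \<in> mats \<rho> m \<and>
    X = y * x \<and> x * s = idm \<rho> \<and> t * y = idm \<rho>"
    using assms
  proof (induction "card {i. \<exists>j. entry X i j \<noteq> 0}" arbitrary: X rule: less_induct)
    case less
    show ?case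
    proof (cases "X = 0")
      case True
      then show ?thesis by (intro exI[of _ 0]) auto
    next
      case False
      then obtain a b where ab: "entry X a b \<noteq> 0" by (metis fmat_eqI entry_0)
      have am: "a < m" and bn: "b < n" using ab less.prems by (meson matsD not_le)+
      define c where "c = entry X a b"
      define y1 where "y1 = X * unit_mat b 0"
      define x1 where "x1 = (1/c) *\<^sub>F (unit_mat 0 a * X)"
      define v where "v = (1/c) *\<^sub>F unit_mat 0 a"
      define u where "u = unit_mat b 0"
      define X' where "X' = X - y1 * x1"
      have mem: "y1 \<in> mats m 1" "x1 \<in> mats 1 n" "v \<in> mats 1 m" "u \<in> mats n 1" "X' \<in> mats m n"
        using less.prems am bn by (simp_all add: y1_def x1_def v_def u_def X'_def)
      have c: "c \<noteq> 0" using ab by (simp add: c_def)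
      have x1u: "x1 * u = idm 1" and vy1: "v * y1 = idm 1"
        using c by (simp_all add: x1_def u_def v_def y1_def mult.assoc unit_mat_sandwich c_def[symmetric] unit_mat_00)
      have X'u: "X' * u = 0"
        using mem by (simp add: X'_def left_diff_distrib mult.assoc x1u) (simp add: y1_def u_def)
      have vX': "v * X' = 0"
        using mem by (simp add: X'_def right_diff_distrib mult_eq_assoc[OF vy1]) (simp add: x1_def v_def)
      have row: "entry X' i j = 0" if "\<forall>j. entry X i j = 0" for i j
        using that by (simp add: X'_def mult.assoc y1_def x1_def entry_mult_unit_mat unit_mat_sandwich entry_times_zero_row)
      have rowa: "entry X' a j = 0" for j
      proof -
        have "entry (v * X') 0 j = (1/c) * entry X' a j" by (simp add: v_def entry_unit_mat_mult)
        then show ?thesis using c by (simp add: vX')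
      qed
      have "{i. \<exists>j. entry X' i j \<noteq> 0} \<subset> {i. \<exists>j. entry X i j \<noteq> 0}"
        using row rowa ab by blast
      moreover have "{i. \<exists>j. entry X i j \<noteq> 0} \<subseteq> {..<m}"
        using less.prems by (auto simp: rowb_def not_le[symmetric])
      then have "finite {i. \<exists>j. entry X i j \<noteq> 0}" by (rule finite_subset) simp
      ultimately have "card {i. \<exists>j. entry X' i j \<noteq> 0} < card {i. \<exists>j. entry X i j \<noteq> 0}"
        by (rule psubset_card_mono[rotated])
      from less.hyps[OF this mem(5)] obtain \<rho> y x s t where
        IH: "y \<in> mats m \<rho>" "x \<in> mats \<rho> n" "s \<in> mats n \<rho>" "t \<in> mats \<rho> m"
          "X' = y * x" "x * s = idm \<rho>" "t * y = idm \<rho>" by blast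
      have xu: "x * u = 0"
      proof -
        have "x * u = t * (y * (x * u))" using mult_eq_assoc[OF IH(7)] IH(2) by simp
        also have "\<dots> = t * (X' * u)" by (simp add: IH(5) mult.assoc)
        finally show ?thesis by (simp add: X'u)
      qed
      have vy: "v * y = 0"
      proof -
        have "v * y = v * (y * (x * s))" using IH(1,6) by simp
        also have "\<dots> = (v * X') * s" by (simp add: IH(5) mult.assoc)
        finally show ?thesis by (simp add: vX')
      qed
      \<comment> \<open>The pivot block has size one; the opaque name keeps the sizes in the form
        \<open>e + \<rho>\<close> to which \<open>idm_split\<close> applies.\<close>
      define e where "e = (1 :: nat)"
      define Y where "Y = y1 * prj 0 e + y * prj e \<rho>"
      define Z where "Z = emb 0 e * x1 + emb e \<rho> * x"
      \<comment> \<open>Since \<open>x * u = 0\<close> and \<open>x1 * u\<close> is the identity,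
        subtracting \<open>u * x1 * s\<close> makes the new part invisible to \<open>x1\<close>
        without changing \<open>x * s\<close>. The correction in \<open>T\<close> is the transposed
        one.\<close>
      define S where "S = u * prj 0 e + (s - u * x1 * s) * prj e \<rho>"
      define T where "T = emb 0 e * v + emb e \<rho> * (t - t * y1 * v)"
      note mem' = mem[folded e_def] IH(1-4) and x1u = x1u[folded e_def] and vy1 = vy1[folded e_def]
      have "Y \<in> mats m (e + \<rho>)" "Z \<in> mats (e + \<rho>) n" "S \<in> mats n (e + \<rho>)" "T \<in> mats (e + \<rho>) m"
        using mem' by (simp_all add: Y_def Z_def S_def T_def mult.assoc)
      moreover have "X = Y * Z"
        using mem' IH(5) by (simp add: Y_def Z_def algebra_simps X'_def)
      moreover have "Z * S = idm (e + \<rho>)"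
        unfolding idm_split using mem' IH(6) by (simp add: S_def Z_def algebra_simps mult_eq_assoc[OF x1u] mult_eq_assoc[OF xu]
            mult_eq_assoc[OF IH(6)])
      moreover have "T * Y = idm (e + \<rho>)"
        unfolding idm_split using mem' IH(7) by (simp add: T_def Y_def algebra_simps mult_eq_assoc[OF vy1] mult_eq_assoc[OF vy]
            mult_eq_assoc[OF IH(7)])
      ultimately show ?thesis by blast
    qed
  qed
  then show ?thesis using that by blast
qed

interpretation ff: complex_space_pair scl scl ..

lemma linear_mult_left: "Vector_Spaces.linear scl scl (\<lambda>X. B * X)"
  by unfold_locales (simp_all add: ring_distribs)

lemma left_inverse_le:
  assumes "C * B = idm a" "B \<in> mats m a" shows "a \<le> m"
proof -
  have "fvs.dim ((*) B ` mats a 1) = fvs.dim (mats a 1)"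
  proof (rule ff.dim_inj_image[OF linear_mult_left fin_span_mats subspace_mats])
    fix x assume x: "x \<in> mats a 1" "B * x = 0"
    then have "x = C * (B * x)" using mult_eq_assoc[OF assms(1), of x] by simp
    then show "x = 0" using x(2) by simp
  qed
  moreover have "fvs.dim ((*) B ` mats a 1) \<le> fvs.dim (mats m 1)"
    by (rule fvs.dim_mono_fin[OF fin_span_mats subspace_mats]) (use assms(2) in auto)
  ultimately show ?thesis by (simp add: dim_mats)
qed

text \<open>Rank plus nullity in matrix form: the columns of \<open>s\<close> and \<open>g\<close>
  together have a left inverse, with rows \<open>p\<close> and \<open>h - h * s * p\<close>. The
  correction makes the latter kill \<open>s\<close>.\<close>

lemma rank_add_kernel_le:
  assumes mem: "p \<in> mats a m" "s \<in> mats m a" "h \<in> mats b m" "g \<in> mats m b"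
    and ps: "p * s = idm a" and hg: "h * g = idm b" and pg: "p * g = 0"
  shows "a + b \<le> m"
proof (rule left_inverse_le)
  show "(emb 0 a * p + emb a b * (h - h * s * p)) * (s * prj 0 a + g * prj a b) = idm (a + b)"
    unfolding idm_split using mem
    by (simp add: algebra_simps ps hg pg mult_eq_assoc[OF ps] mult_eq_assoc[OF hg] mult_eq_assoc[OF pg])
  show "s * prj 0 a + g * prj a b \<in> mats m (a + b)" using mem by simp
qed

text \<open>Cancelling the one-sided inverses in \<open>g * h * g * h = g * h\<close> leaves
  \<open>h * g = idm k\<close>. The trace then identifies the size, which is how sizes of
  complements are computed throughout.\<close>

lemma idempotent_split:
  assumes "e \<in> mats n n" "e * e = e"
  obtains k g h where "g \<in> mats n k" "h \<in> mats k n" "e = g * h" "h * g = idm k" "of_nat k = tr e"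
proof -
  obtain k g h s t where *: "g \<in> mats n k" "h \<in> mats k n" "s \<in> mats n k" "t \<in> mats k n"
    "e = g * h" "h * s = idm k" "t * g = idm k"
    by (rule rank_factorisation[OF assms(1)])
  have "h * g = t * g * (h * g) * (h * s)"
    using * by (simp add: mult.assoc)
  also have "\<dots> = t * (e * e) * s" by (simp add: *(5) mult.assoc)
  also have "\<dots> = t * g * (h * s)" by (simp add: assms(2)) (simp add: *(5) mult.assoc)
  also have "\<dots> = idm k" by (simp add: *)
  finally have hg: "h * g = idm k" .
  have "tr e = of_nat k" using tr_comm[of g h] hg *(5) by simp
  with * hg show ?thesis using that[of g k h] by simp
qed

lemma full_rank_factorisation:
  assumes "X \<in> mats m n"
  obtains \<rho> \<kappa> y x s t g h where "y \<in> mats m \<rho>" "x \<in> mats \<rho> n" "s \<in> mats n \<rho>" "t \<in> mats \<rho> m"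
    "X = y * x" "x * s = idm \<rho>" "t * y = idm \<rho>"
    "g \<in> mats n \<kappa>" "h \<in> mats \<kappa> n" "h * g = idm \<kappa>" "x * g = 0" "h * s = 0"
    "s * x + g * h = idm n" "\<rho> + \<kappa> = n"
proof -
  obtain \<rho> y x s t where 1: "y \<in> mats m \<rho>" "x \<in> mats \<rho> n" "s \<in> mats n \<rho>" "t \<in> mats \<rho> m"
    "X = y * x" "x * s = idm \<rho>" "t * y = idm \<rho>"
    by (rule rank_factorisation[OF assms])
  define e where "e = idm n - s * x"
  have e: "e \<in> mats n n" "e * e = e" using 1
    by (simp_all add: e_def algebra_simps mult_eq_assoc[OF 1(6)])
  obtain \<kappa> g h where 2: "g \<in> mats n \<kappa>" "h \<in> mats \<kappa> n" "e = g * h" "h * g = idm \<kappa>" "of_nat \<kappa> = tr e"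
    by (rule idempotent_split[OF e])
  have xe: "x * e = 0" and es: "e * s = 0" using 1 by (simp_all add: e_def algebra_simps mult_eq_assoc[OF 1(6)])
  have "x * g = x * g * (h * g)" using 2(1,2,4) by simp
  also have "\<dots> = x * e * g" by (simp only: 2(3) mult.assoc)
  finally have xg: "x * g = 0" by (simp add: xe)
  have "h * s = h * g * (h * s)" using 1(3) 2(1,2,4) by simp
  also have "\<dots> = h * (e * s)" by (simp only: 2(3) mult.assoc)
  finally have hs: "h * s = 0" by (simp add: es)
  have "tr (idm n) = tr (s * x) + tr e" by (simp add: e_def)
  then have "of_nat n = (of_nat (\<rho> + \<kappa>) :: complex)" using tr_comm[of s x] 1(6) 2(5) by simp
  then have "\<rho> + \<kappa> = n" using of_nat_eq_iff by metis
  moreover have "s * x + g * h = idm n" using 2(3) by (simp add: e_def algebra_simps)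
  ultimately show ?thesis by (intro that[OF 1 2(1,2) 2(4) xg hs])
qed

text \<open>Square test matrices suffice, because the projection \<open>g * h\<close> onto the
  kernel is one of them.\<close>

lemma left_inverse_exists:
  assumes M: "M \<in> mats m n" and inj: "\<And>x. x \<in> mats n n \<Longrightarrow> M * x = 0 \<Longrightarrow> x = 0"
  obtains T where "T \<in> mats n m" "T * M = idm n"
proof -
  obtain \<rho> \<kappa> y x s t g h where *: "y \<in> mats m \<rho>" "x \<in> mats \<rho> n" "s \<in> mats n \<rho>" "t \<in> mats \<rho> m"
    "M = y * x" "x * s = idm \<rho>" "t * y = idm \<rho>"
    "g \<in> mats n \<kappa>" "h \<in> mats \<kappa> n" "h * g = idm \<kappa>" "x * g = 0" "h * s = 0"
    "s * x + g * h = idm n" "\<rho> + \<kappa> = n"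
    by (rule full_rank_factorisation[OF M])
  have "g * h = 0"
    by (rule inj) (use *(8,9) in simp, simp add: *(5) mult.assoc mult_eq_assoc[OF *(11)])
  then have "s * x = idm n" using *(13) by simp
  then have "(s * t) * M = idm n" using *(2) by (simp add: *(5) mult.assoc mult_eq_assoc[OF *(7)])
  then show ?thesis using that[of "s * t"] *(3,4) by simp
qed

lemma right_inverse_exists:
  assumes M: "M \<in> mats m n" and surj: "\<And>x. x \<in> mats m m \<Longrightarrow> x * M = 0 \<Longrightarrow> x = 0"
  obtains T where "T \<in> mats n m" "M * T = idm m"
proof -
  obtain \<rho> y x s t where *: "y \<in> mats m \<rho>" "x \<in> mats \<rho> n" "s \<in> mats n \<rho>" "t \<in> mats \<rho> m"
    "M = y * x" "x * s = idm \<rho>" "t * y = idm \<rho>"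
    by (rule rank_factorisation[OF M])
  have "idm m - y * t = 0"
    by (rule surj) (use *(1,2,4) in \<open>simp_all add: *(5) algebra_simps mult_eq_assoc[OF *(7)]\<close>)
  then have "M * (s * t) = idm m" using *(4) by (simp add: *(5) mult.assoc mult_eq_assoc[OF *(6)])
  then show ?thesis using that[of "s * t"] *(3,4) by simp
qed

section \<open>Local data\<close>

text \<open>
  The last two conditions say that \<open>(P, N P)\<close> is surjective and \<open>(Q, Q N)\<close> is injective, so that the
  Toeplitz matrix of \<open>(Q N P, Q P)\<close> has rank \<open>w\<close>.
\<close>

definition local_datum :: "nat \<Rightarrow> nat \<Rightarrow> fmat \<Rightarrow> fmat \<Rightarrow> fmat \<Rightarrow> bool" where
  "local_datum n w P Q N \<longleftrightarrow> P \<in> mats w n \<and> Q \<in> mats n w \<and> N \<in> mats w w \<and> N * N = 0 \<and>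
     (\<exists>S0 S1. S0 \<in> mats n w \<and> S1 \<in> mats n w \<and> P * S0 + N * P * S1 = idm w) \<and>
     (\<exists>T0 T1. T0 \<in> mats w n \<and> T1 \<in> mats w n \<and> T0 * Q + T1 * Q * N = idm w)"

lemma local_datum_gen:
  assumes "local_datum n w P Q N" "Y * P = 0" "Y * N * P = 0" "colb w Y" shows "Y = 0"
proof -
  obtain S0 S1 where S: "P * S0 + N * P * S1 = idm w" using assms(1) by (auto simp: local_datum_def)
  have "Y = Y * (P * S0 + N * P * S1)" using assms by (simp add: S)
  also have "\<dots> = (Y * P) * S0 + (Y * N * P) * S1" by (simp add: algebra_simps)
  finally show ?thesis by (simp add: assms)
qed

lemma local_datum_cogen:
  assumes "local_datum n w P Q N" "Q * Y = 0" "Q * N * Y = 0" "rowb w Y" shows "Y = 0"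
proof -
  obtain T0 T1 where T: "T0 * Q + T1 * Q * N = idm w" using assms(1) by (auto simp: local_datum_def)
  have "Y = (T0 * Q + T1 * Q * N) * Y" using assms by (simp add: T)
  also have "\<dots> = T0 * (Q * Y) + T1 * (Q * N * Y)" by (simp add: algebra_simps)
  finally show ?thesis by (simp add: assms)
qed

text \<open>The Toeplitz matrix \<open>M\<close> commutes with the block shift
  \<open>\<tau>\<close>, and \<open>\<tau> * \<tau> = 0\<close>. In a rank factorisation
  \<open>M = q * p\<close> the shift therefore descends to a matrix \<open>N\<close> on the middle
  space, with \<open>N * p = p * \<tau>\<close> and \<open>q * N = \<tau> * q\<close>. One block
  column of \<open>p\<close> and one block row of \<open>q\<close> are then enough: \<open>N\<close>
  recovers the others. Columns are ordered as \<open>(v_1, v_0)\<close>, so the index 1 belongs to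
  offset 0.\<close>

lemma local_datum_exists:
  assumes X: "X0 \<in> mats n n" "X1 \<in> mats n n"
    and g: "g0 \<in> mats n \<kappa>" "g1 \<in> mats n \<kappa>" "h0 \<in> mats \<kappa> n" "h1 \<in> mats \<kappa> n"
    and ker: "X1 * g1 + X0 * g0 = 0" "X1 * g0 = 0" and hg: "h0 * g0 + h1 * g1 = idm \<kappa>"
  obtains w P Q N where "local_datum n w P Q N" "Q * P = X0" "Q * N * P = X1" "w + \<kappa> \<le> 2 * n"
proof -
  define i1 i0 p1 p0 where "i1 = emb 0 n" and "i0 = emb n n" and "p1 = prj 0 n" and "p0 = prj n n"
  have mi: "i1 \<in> mats (n + n) n" "i0 \<in> mats (n + n) n" "p1 \<in> mats n (n + n)" "p0 \<in> mats n (n + n)"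
    by (simp_all add: i1_def i0_def p1_def p0_def)
  have pi: "p1 * i1 = idm n" "p0 * i0 = idm n" "p1 * i0 = 0" "p0 * i1 = 0"
    by (simp_all add: i1_def i0_def p1_def p0_def)
  note pia = pi[THEN mult_eq_assoc]
  have split: "i1 * p1 + i0 * p0 = idm (n + n)"
    by (simp add: i1_def i0_def p1_def p0_def idm_split[of n n])
  define M where "M = i1 * X1 * p1 + i1 * X0 * p0 + i0 * X1 * p0"
  define \<tau> where "\<tau> = i1 * p0"
  have mM: "M \<in> mats (n + n) (n + n)" and m\<tau>: "\<tau> \<in> mats (n + n) (n + n)"
    using mi X by (simp_all add: M_def \<tau>_def mult.assoc)
  have M\<tau>: "M * \<tau> = i1 * X1 * p0" "\<tau> * M = i1 * X1 * p0" "\<tau> * \<tau> = 0"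
    using mi X by (simp_all add: M_def \<tau>_def algebra_simps pi pia)
  obtain w q p s t where F: "q \<in> mats (n + n) w" "p \<in> mats w (n + n)" "s \<in> mats (n + n) w" "t \<in> mats w (n + n)"
    "M = q * p" "p * s = idm w" "t * q = idm w"
    by (rule rank_factorisation[OF mM])
  note Fa = F(6,7)[THEN mult_eq_assoc]
  define N where "N = p * \<tau> * s"
  have pN: "N * p = p * \<tau>"
  proof -
    have "N * p = t * q * (p * \<tau> * s * p)" using F by (simp add: N_def mult.assoc)
    also have "\<dots> = t * (M * \<tau>) * s * p" by (simp add: F(5) mult.assoc)
    also have "\<dots> = t * (\<tau> * M) * s * p" by (simp add: M\<tau>)
    also have "\<dots> = t * (\<tau> * M)" by (simp add: F(5) mult.assoc Fa(1)) (use F in simp)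
    also have "\<dots> = t * (M * \<tau>)" by (simp add: M\<tau>)
    also have "\<dots> = p * \<tau>" using F m\<tau> by (simp add: F(5) mult.assoc Fa(2))
    finally show ?thesis .
  qed
  have qN: "q * N = \<tau> * q"
  proof -
    have "q * N = (M * \<tau>) * s" by (simp add: N_def F(5) mult.assoc)
    also have "\<dots> = \<tau> * M * s" by (simp add: M\<tau>)
    also have "\<dots> = \<tau> * q" using F by (simp add: F(5) mult.assoc)
    finally show ?thesis .
  qed
  define P Q where "P = p * i0" and "Q = p1 * q"
  have NN: "N * N = 0"
  proof -
    have "N * N = N * p * \<tau> * s" by (simp add: N_def mult.assoc)
    also have "\<dots> = p * (\<tau> * \<tau>) * s" by (simp add: pN mult.assoc)
    finally show ?thesis by (simp add: M\<tau>)
  qed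
  have NP: "N * P = p * i1"
    using mi by (simp add: P_def mult.assoc[symmetric] pN) (simp add: mult.assoc \<tau>_def pi)
  have QN: "Q * N = p0 * q"
    using mi F by (simp add: Q_def mult.assoc qN) (simp add: mult.assoc[symmetric] \<tau>_def pi)
  have "Q * P = p1 * M * i0" by (simp add: P_def Q_def F(5) mult.assoc)
  then have QP: "Q * P = X0" using mi X by (simp add: M_def algebra_simps pi pia)
  have "Q * N * P = p0 * M * i0" by (simp add: QN P_def F(5) mult.assoc)
  then have QNP: "Q * N * P = X1" using mi X by (simp add: M_def algebra_simps pi pia)
  have "P * (p0 * s) + N * P * (p1 * s) = p * ((i1 * p1 + i0 * p0) * s)"
    by (simp only: NP) (simp add: P_def algebra_simps)
  also have "\<dots> = idm w" using F by (simp add: split)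
  finally have gen: "P * (p0 * s) + N * P * (p1 * s) = idm w" .
  have "(t * i1) * Q + (t * i0) * Q * N = t * ((i1 * p1 + i0 * p0) * q)"
    by (simp add: mult.assoc QN) (simp add: Q_def algebra_simps)
  also have "\<dots> = idm w" using F by (simp add: split)
  finally have cogen: "(t * i1) * Q + (t * i0) * Q * N = idm w" .
  have "local_datum n w P Q N"
    unfolding local_datum_def
  proof (intro conjI exI)
    show "P * (p0 * s) + N * P * (p1 * s) = idm w" by (rule gen)
    show "(t * i1) * Q + (t * i0) * Q * N = idm w" by (rule cogen)
  qed (use mi F NN m\<tau> in \<open>simp_all add: P_def Q_def N_def mult.assoc\<close>)
  moreover have "w + \<kappa> \<le> n + n"
  proof (rule rank_add_kernel_le[OF F(2,3) _ _ F(6)])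
    define G H where "G = i1 * g1 + i0 * g0" and "H = h1 * p1 + h0 * p0"
    show "H \<in> mats \<kappa> (n + n)" "G \<in> mats (n + n) \<kappa>" using mi g by (simp_all add: G_def H_def)
    show "H * G = idm \<kappa>" using g hg by (simp add: G_def H_def algebra_simps pi pia)
    have "M * G = i1 * (X1 * g1 + X0 * g0) + i0 * (X1 * g0)"
      using g by (simp add: G_def M_def algebra_simps pi pia)
    then have "t * (M * G) = 0" by (simp add: ker)
    then show "p * G = 0" using F by (simp add: F(5) mult.assoc Fa(2))
  qed
  ultimately show ?thesis using that QP QNP by (simp add: mult_2)
qed

section \<open>The reflection underlying the middle convolution\<close>

definition right_ideal :: "fmat set \<Rightarrow> bool" where
  "right_ideal J \<longleftrightarrow> 0 \<in> J \<and> (\<forall>x\<in>J. \<forall>y\<in>J. x + y \<in> J) \<and> (\<forall>x\<in>J. \<forall>y. x * y \<in> J)"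

lemma right_idealD:
  assumes "right_ideal J"
  shows "0 \<in> J" "x \<in> J \<Longrightarrow> y \<in> J \<Longrightarrow> x + y \<in> J" "x \<in> J \<Longrightarrow> x * z \<in> J"
  using assms by (auto simp: right_ideal_def)

lemma right_ideal_scl:
  assumes "right_ideal J" "x \<in> J" shows "c *\<^sub>F x \<in> J"
proof -
  obtain N where "\<And>i j. N \<le> i \<or> N \<le> j \<Longrightarrow> entry x i j = 0" using entry_bound by blast
  then have "colb N x" by (auto simp: colb_def)
  then have "x * (c *\<^sub>F idm N) = c *\<^sub>F x" by (simp del: fvs.scale_cancel_left)
  then show ?thesis using right_idealD(3)[OF assms, of "c *\<^sub>F idm N"] by metis
qed

lemma right_ideal_diff:
  assumes "right_ideal J" "x \<in> J" "y \<in> J" shows "x - y \<in> J"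
  using right_idealD(2)[OF assms(1,2) right_ideal_scl[OF assms(1,3), of "-1"]] by simp

lemma right_ideal_sum:
  assumes "right_ideal J" "\<And>i. i \<in> I \<Longrightarrow> f i \<in> J" shows "sum f I \<in> J"
  using assms(2) by (induction I rule: infinite_finite_induct) (auto intro: right_idealD[OF assms(1)])

text \<open>Right ideals contained in \<open>idm n * R\<close> correspond to the subspaces of \<open>\<complex>\<^sup>n\<close>.\<close>

definition irr_mod :: "nat \<Rightarrow> nat \<Rightarrow> (nat \<Rightarrow> nat \<Rightarrow> fmat) \<Rightarrow> bool" where
  "irr_mod r n X \<longleftrightarrow> (\<forall>J. right_ideal J \<longrightarrow> (\<forall>x\<in>J. rowb n x) \<longrightarrow>
     (\<forall>i\<le>r. \<forall>x\<in>J. X i 0 * x \<in> J \<and> X i 1 * x \<in> J) \<longrightarrow> J = {0} \<or> idm n \<in> J)"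

text \<open>Diagonalisability by eigenspaces: \<open>u d\<close> and \<open>v d\<close> are the
  inclusion and the projection for \<open>d\<close>, of multiplicity \<open>k d\<close>.
  Multiplicities may be zero, so \<open>D\<close> may also contain numbers that are not
  eigenvalues.\<close>

definition spectral :: "nat \<Rightarrow> fmat \<Rightarrow> complex set \<Rightarrow> (complex \<Rightarrow> nat) \<Rightarrow> (complex \<Rightarrow> fmat) \<Rightarrow> (complex \<Rightarrow> fmat) \<Rightarrow> bool" where
  "spectral n A D k u v \<longleftrightarrow> finite D \<and>
     (\<forall>d\<in>D. u d \<in> mats n (k d) \<and> v d \<in> mats (k d) n \<and> v d * u d = idm (k d)) \<and>
     (\<forall>d\<in>D. \<forall>e\<in>D. d \<noteq> e \<longrightarrow> v d * u e = 0) \<and>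
     (\<Sum>d\<in>D. u d * v d) = idm n \<and> A = (\<Sum>d\<in>D. d *\<^sub>F (u d * v d))"

lemma spectral_mult:
  assumes "spectral n A D k u v" "d \<in> D"
  shows spectral_mult_right: "A * u d = d *\<^sub>F u d" and spectral_mult_left: "v d * A = d *\<^sub>F v d"
proof -
  have *: "\<And>e. e \<in> D \<Longrightarrow> v e * u d = (if e = d then idm (k d) else 0)"
    "\<And>e. e \<in> D \<Longrightarrow> v d * u e = (if e = d then idm (k d) else 0)"
    and m: "colb (k d) (u d)" "rowb (k d) (v d)" and fin: "finite D"
    using assms by (auto simp: spectral_def)
  have A: "A = (\<Sum>d\<in>D. d *\<^sub>F (u d * v d))" using assms by (simp add: spectral_def)
  have "A * u d = (\<Sum>e\<in>D. if e = d then d *\<^sub>F u d else 0)"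
    unfolding A sum_distrib_right by (rule sum.cong) (auto simp: mult.assoc * m)
  then show "A * u d = d *\<^sub>F u d" using assms(2) fin by simp
  have "v d * A = (\<Sum>e\<in>D. if e = d then d *\<^sub>F v d else 0)"
    unfolding A sum_distrib_left by (rule sum.cong) (auto simp: *(2)[THEN mult_eq_assoc] m)
  then show "v d * A = d *\<^sub>F v d" using assms(2) fin by simp
qed

lemma spectral_shift:
  assumes "spectral n A D k u v"
  shows "spectral n (A + c *\<^sub>F idm n) ((+) c ` D) (\<lambda>d. k (d - c)) (\<lambda>d. u (d - c)) (\<lambda>d. v (d - c))"
proof -
  have A: "A = (\<Sum>d\<in>D. d *\<^sub>F (u d * v d))" and s: "(\<Sum>d\<in>D. u d * v d) = idm n"
    using assms by (auto simp: spectral_def)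
  have "A + c *\<^sub>F idm n = (\<Sum>d\<in>D. (c + d) *\<^sub>F (u d * v d))"
    unfolding s[symmetric] A fvs.scale_sum_right sum.distrib[symmetric] by (simp add: algebra_simps)
  then show ?thesis using assms by (auto simp: spectral_def sum.reindex)
qed

lemma spectral_nonzero:
  assumes "spectral n A D k u v"
  shows "spectral n A {d \<in> D. k d \<noteq> 0} k u v"
proof -
  have z: "u d * v d = 0" if "d \<in> D" "k d = 0" for d
    using assms that by (auto simp: spectral_def)
  have "(\<Sum>d | d \<in> D \<and> k d \<noteq> 0. u d * v d) = (\<Sum>d\<in>D. u d * v d)"
    "(\<Sum>d | d \<in> D \<and> k d \<noteq> 0. d *\<^sub>F (u d * v d)) = (\<Sum>d\<in>D. d *\<^sub>F (u d * v d))"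
    using assms z by (intro sum.mono_neutral_left; force simp: spectral_def)+
  then show ?thesis using assms by (auto simp: spectral_def)
qed

lemma sum_offsets:
  "idm (\<Sum>i<(m::nat). w i) = (\<Sum>i<m. emb (\<Sum>j<i. w j) (w i) * prj (\<Sum>j<i. w j) (w i))"
proof (induction m)
  case (Suc m)
  have "emb 0 (\<Sum>i<m. w i) * prj 0 (\<Sum>i<m. w i) = idm (\<Sum>i<m. w i)"
    by (rule fmat_eqI) auto
  then show ?case using Suc by (simp add: idm_split)
qed simp

lemma prj_emb_offsets:
  fixes w :: "nat \<Rightarrow> nat"
  shows "prj (\<Sum>j<i. w j) (w i) * emb (\<Sum>j<l. w j) (w l) = (if i = l then idm (w i) else 0)"
proof -
  have *: "(\<Sum>j<a. w j) + w a \<le> (\<Sum>j<b. w j)" if "a < b" for a b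
  proof -
    have "(\<Sum>j<Suc a. w j) \<le> (\<Sum>j<b. w j)" using that by (intro sum_mono2) auto
    then show ?thesis by simp
  qed
  show ?thesis using *[of i l] *[of l i] by (cases i l rule: linorder_cases) auto
qed

lemma block_inclusions:
  fixes w :: "nat \<Rightarrow> nat" and r :: nat
  obtains J K where "\<And>i. i \<le> r \<Longrightarrow> J i \<in> mats (\<Sum>i\<le>r. w i) (w i)" "\<And>i. i \<le> r \<Longrightarrow> K i \<in> mats (w i) (\<Sum>i\<le>r. w i)"
    "\<And>i j. K i * J j = (if i = j then idm (w i) else 0)" "(\<Sum>i\<le>r. J i * K i) = idm (\<Sum>i\<le>r. w i)"
proof -
  let ?W = "\<Sum>i\<le>r. w i"
  define J where "J i = emb (\<Sum>j<i. w j) (w i)" for i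
  define K where "K i = prj (\<Sum>j<i. w j) (w i)" for i
  have JK: "(\<Sum>i\<le>r. J i * K i) = idm ?W"
    unfolding J_def K_def lessThan_Suc_atMost[symmetric] by (rule sum_offsets[symmetric])
  have KJ: "K i * J j = (if i = j then idm (w i) else 0)" for i j
    unfolding K_def J_def by (rule prj_emb_offsets)
  have off: "(\<Sum>j<i. w j) + w i \<le> ?W" if "i \<le> r" for i
  proof -
    have "(\<Sum>j<Suc i. w j) \<le> ?W" using that by (intro sum_mono2) auto
    then show ?thesis by simp
  qed
  have mJ: "J i \<in> mats ?W (w i)" "K i \<in> mats (w i) ?W" if "i \<le> r" for i
    using off[OF that] by (simp_all add: J_def K_def)
  show ?thesis by (rule that[OF mJ KJ JK])
qed

lemma reflection_exists:
  fixes w :: "nat \<Rightarrow> nat"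
  assumes PQ: "\<And>i. i \<le> r \<Longrightarrow> P i \<in> mats (w i) n" "\<And>i. i \<le> r \<Longrightarrow> Q i \<in> mats n (w i)"
    and sum: "(\<Sum>i\<le>r. Q i * P i) = - \<mu> *\<^sub>F idm n" and \<mu>: "\<mu> \<noteq> 0"
  obtains n' P' Q' where "\<And>i. i \<le> r \<Longrightarrow> P' i \<in> mats (w i) n'" "\<And>i. i \<le> r \<Longrightarrow> Q' i \<in> mats n' (w i)"
    "\<And>i j. i \<le> r \<Longrightarrow> j \<le> r \<Longrightarrow> P' i * Q' j = (if i = j then \<mu> *\<^sub>F idm (w i) else 0) + P i * Q j"
    "(\<Sum>i\<le>r. Q' i * P' i) = \<mu> *\<^sub>F idm n'" "n + n' = (\<Sum>i\<le>r. w i)"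
proof -
  define W where "W = (\<Sum>i\<le>r. w i)"
  obtain J K where mJ: "\<And>i. i \<le> r \<Longrightarrow> J i \<in> mats W (w i)" "\<And>i. i \<le> r \<Longrightarrow> K i \<in> mats (w i) W"
    and KJ: "\<And>i j. K i * J j = (if i = j then idm (w i) else 0)" and JK: "(\<Sum>i\<le>r. J i * K i) = idm W"
    by (rule block_inclusions[where r = r and w = w, folded W_def]) blast
  define PP where "PP = (\<Sum>i\<le>r. J i * P i)"
  define QQ where "QQ = (\<Sum>i\<le>r. Q i * K i)"
  have m: "PP \<in> mats W n" "QQ \<in> mats n W" using mJ PQ by (auto simp: PP_def QQ_def)
  have KP: "K i * PP = P i" if "i \<le> r" for i
  proof -
    have "K i * PP = (\<Sum>j\<le>r. if j = i then P i else 0)"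
      unfolding PP_def sum_distrib_left using PQ that by (intro sum.cong) (auto simp: KJ[THEN mult_eq_assoc])
    then show ?thesis using that by simp
  qed
  have QJ: "QQ * J i = Q i" if "i \<le> r" for i
  proof -
    have "QQ * J i = (\<Sum>j\<le>r. if j = i then Q i else 0)"
      unfolding QQ_def sum_distrib_right using PQ that by (intro sum.cong) (auto simp: KJ mult.assoc)
    then show ?thesis using that by simp
  qed
  have QP: "QQ * PP = - \<mu> *\<^sub>F idm n"
  proof -
    have "QQ * PP = (\<Sum>i\<le>r. Q i * P i)"
      unfolding QQ_def sum_distrib_right by (intro sum.cong) (auto simp: mult.assoc KP)
    then show ?thesis using sum by simp
  qed
  define E where "E = \<mu> *\<^sub>F idm W + PP * QQ"
  have mE: "E \<in> mats W W" using m by (simp add: E_def)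
  have EE: "E * E = \<mu> *\<^sub>F E"
    using m by (simp add: E_def algebra_simps mult_eq_assoc[OF QP])
  obtain n' a b s t where F: "a \<in> mats W n'" "b \<in> mats n' W" "s \<in> mats W n'" "t \<in> mats n' W"
    "E = a * b" "b * s = idm n'" "t * a = idm n'"
    by (rule rank_factorisation[OF mE])
  have ba: "b * a = \<mu> *\<^sub>F idm n'"
  proof -
    have "b * a = t * a * (b * a) * (b * s)" using F by (simp add: mult.assoc)
    also have "\<dots> = t * (E * E) * s" by (simp add: F(5) mult.assoc)
    also have "\<dots> = \<mu> *\<^sub>F (t * a * (b * s))" by (simp add: EE) (simp add: F(5) mult.assoc)
    finally show ?thesis using F by simp
  qed
  \<comment> \<open>The two expressions for the trace read \<open>\<mu> * W - \<mu> * n\<close> and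
    \<open>\<mu> * n'\<close>; dividing by \<open>\<mu>\<close> yields the size of the reflected
    tuple.\<close>
  have "tr E = \<mu> * of_nat W + tr (QQ * PP)" by (simp add: E_def tr_comm[of PP])
  moreover have "tr E = \<mu> * of_nat n'" using ba by (simp add: F(5) tr_comm[of a])
  ultimately have "\<mu> * of_nat (n + n') = \<mu> * of_nat W" by (simp add: QP algebra_simps)
  then have nn: "n + n' = W" using \<mu> of_nat_eq_iff by (metis mult_cancel_left)
  show ?thesis
  proof (rule that)
    fix i j assume i: "i \<le> r"
    show "K i * a \<in> mats (w i) n'" "b * J i \<in> mats n' (w i)" using mJ[OF i] F by simp_all
    assume j: "j \<le> r"
    have "(K i * a) * (b * J j) = K i * E * J j" by (simp add: F(5) mult.assoc)
    also have "\<dots> = \<mu> *\<^sub>F (K i * J j) + (K i * PP) * (QQ * J j)"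
      using mJ[OF i] mJ[OF j] by (simp add: E_def algebra_simps)
    finally show "(K i * a) * (b * J j) = (if i = j then \<mu> *\<^sub>F idm (w i) else 0) + P i * Q j"
      by (simp add: KP[OF i] QJ[OF j] KJ)
  next
    have "(\<Sum>i\<le>r. (b * J i) * (K i * a)) = b * (\<Sum>i\<le>r. J i * K i) * a"
      by (simp add: sum_distrib_left sum_distrib_right mult.assoc)
    then show "(\<Sum>i\<le>r. (b * J i) * (K i * a)) = \<mu> *\<^sub>F idm n'" using F by (simp add: JK ba)
  qed (use nn W_def in simp)
qed

text \<open>The output of \<open>reflection_exists\<close> together with irreducibility and
  semisimplicity of the unprimed side. That the primed side is again irreducible, semisimple, of
  positive size and given by local data is derived inside.\<close>

locale reflection =
  fixes r n n' :: nat and \<mu> :: complex and w :: "nat \<Rightarrow> nat" and P Q N P' Q' :: "nat \<Rightarrow> fmat"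
  assumes \<mu>: "\<mu> \<noteq> 0" and n2: "2 \<le> n"
    and ld: "\<And>i. i \<le> r \<Longrightarrow> local_datum n (w i) (P i) (Q i) (N i)"
    and sumQP: "(\<Sum>i\<le>r. Q i * P i) = - \<mu> *\<^sub>F idm n"
    and mP': "\<And>i. i \<le> r \<Longrightarrow> P' i \<in> mats (w i) n'" and mQ': "\<And>i. i \<le> r \<Longrightarrow> Q' i \<in> mats n' (w i)"
    and P'Q': "\<And>i j. i \<le> r \<Longrightarrow> j \<le> r \<Longrightarrow> P' i * Q' j = (if i = j then \<mu> *\<^sub>F idm (w i) else 0) + P i * Q j"
    and sumQP': "(\<Sum>i\<le>r. Q' i * P' i) = \<mu> *\<^sub>F idm n'" and nn': "n + n' = (\<Sum>i\<le>r. w i)"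
    and irr: "irr_mod r n (\<lambda>i j. if j = 0 then Q i * P i else Q i * N i * P i)"
    and ss: "\<And>i. i \<le> r \<Longrightarrow> \<exists>D k u v. spectral n (Q i * N i * P i) D k u v"
begin

lemma mem:
  assumes "i \<le> r"
  shows "P i \<in> mats (w i) n" "Q i \<in> mats n (w i)" "N i \<in> mats (w i) (w i)" "N i * N i = 0"
    "N i * (N i * Y) = 0" "P' i \<in> mats (w i) n'" "Q' i \<in> mats n' (w i)"
proof -
  show *: "P i \<in> mats (w i) n" "Q i \<in> mats n (w i)" "N i \<in> mats (w i) (w i)" "N i * N i = 0"
    using ld[OF assms] by (simp_all add: local_datum_def)
  show "N i * (N i * Y) = 0" by (simp add: mult.assoc[symmetric] *(4))
  show "P' i \<in> mats (w i) n'" "Q' i \<in> mats n' (w i)" using mP' mQ' assms by blast+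
qed

lemma irrD:
  assumes "right_ideal J" "\<And>x. x \<in> J \<Longrightarrow> rowb n x"
    "\<And>i x. i \<le> r \<Longrightarrow> x \<in> J \<Longrightarrow> Q i * (P i * x) \<in> J"
    "\<And>i x. i \<le> r \<Longrightarrow> x \<in> J \<Longrightarrow> Q i * (N i * (P i * x)) \<in> J"
  shows "J = {0} \<or> idm n \<in> J"
  using irr assms unfolding irr_mod_def by (simp add: mult.assoc)

text \<open>If only one singularity were nonzero, its residue would be the scalar
  \<open>- \<mu>\<close>, and an eigenvector of its other matrix would span an invariant line, which
  is impossible for \<open>2 \<le> n\<close>.\<close>

lemma not_isolated:
  assumes i: "i \<le> r" and z: "\<And>j. j \<le> r \<Longrightarrow> j \<noteq> i \<Longrightarrow> Q j * P j = 0 \<and> Q j * N j * P j = 0"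
  shows False
proof -
  have "(\<Sum>j\<le>r. Q j * P j) = (\<Sum>j\<le>r. if j = i then Q i * P i else 0)"
    using z by (intro sum.cong) auto
  then have QPi: "Q i * P i = - \<mu> *\<^sub>F idm n" using i sumQP by simp
  obtain D k u v where "spectral n (Q i * N i * P i) D k u v" using ss[OF i] by blast
  from spectral_nonzero[OF this] obtain D where sp: "spectral n (Q i * N i * P i) D k u v" and k: "\<And>d. d \<in> D \<Longrightarrow> k d \<noteq> 0"
    by blast
  have "D \<noteq> {}"
  proof
    assume "D = {}"
    then have "idm n = 0" using sp by (simp add: spectral_def)
    then have "entry (idm n) 0 0 = 0" by simp
    then show False using n2 by simp
  qed
  then obtain d where d: "d \<in> D" by blast
  have u: "u d \<in> mats n (k d)" "v d * u d = idm (k d)" using sp d by (auto simp: spectral_def)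
  define J where "J = range (\<lambda>y. u d * unit_mat 0 0 * y)"
  have ri: "right_ideal J"
    unfolding right_ideal_def
  proof (intro conjI ballI allI)
    show "0 \<in> J" unfolding J_def by (rule image_eqI[of _ _ 0]) simp_all
    fix x y assume "x \<in> J" then obtain a where x: "x = u d * unit_mat 0 0 * a" by (auto simp: J_def)
    show "x * z \<in> J" for z unfolding J_def x by (rule image_eqI[of _ _ "a * z"]) (simp_all add: mult.assoc)
    assume "y \<in> J" then obtain b where y: "y = u d * unit_mat 0 0 * b" by (auto simp: J_def)
    show "x + y \<in> J" unfolding J_def x y by (rule image_eqI[of _ _ "a + b"]) (simp_all add: ring_distribs)
  qed
  have X0: "Q j * (P j * x) \<in> J" and X1: "Q j * (N j * (P j * x)) \<in> J" if j: "j \<le> r" and x: "x \<in> J" for j x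
  proof -
    have "rowb n x" using x u by (auto simp: J_def mult.assoc)
    have "(Q j * P j) * x \<in> J"
    proof (cases "j = i")
      case True
      then show ?thesis using \<open>rowb n x\<close> right_ideal_scl[OF ri x, of "- \<mu>"] by (simp add: QPi)
    qed (use z j right_idealD[OF ri] in auto)
    then show "Q j * (P j * x) \<in> J" by (simp add: mult.assoc)
    have "(Q j * N j * P j) * x \<in> J"
    proof (cases "j = i")
      case True
      obtain a where a: "x = u d * unit_mat 0 0 * a" using x by (auto simp: J_def)
      have "(Q j * N j * P j) * x = (Q i * N i * P i * u d) * unit_mat 0 0 * a" by (simp add: True a mult.assoc)
      also have "\<dots> = d *\<^sub>F x" by (simp add: spectral_mult_right[OF sp d] a)
      finally show ?thesis using right_ideal_scl[OF ri x] by simp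
    qed (use z j right_idealD[OF ri] in auto)
    then show "Q j * (N j * (P j * x)) \<in> J" by (simp add: mult.assoc)
  qed
  have "J \<noteq> {0}"
  proof
    assume "J = {0}"
    moreover have "u d * unit_mat 0 0 * unit_mat 0 0 \<in> J" by (auto simp: J_def)
    ultimately have "u d * unit_mat 0 0 = 0" by (simp add: mult.assoc)
    then have "v d * (u d * unit_mat 0 0) = 0" by simp
    then have "unit_mat 0 0 = 0" using k[OF d] by (simp add: mult.assoc[symmetric] u)
    then have "entry (unit_mat 0 0) 0 0 = 0" by simp
    then show False by simp
  qed
  moreover have "rowb n x" if "x \<in> J" for x using that u by (auto simp: J_def mult.assoc)
  ultimately have "idm n \<in> J" using irrD[OF ri _ X0 X1] by blast
  then obtain y where "u d * unit_mat 0 0 * y = idm n" by (auto simp: J_def)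
  then have "u d * (unit_mat 0 0 * y * idm n) = idm n" by (simp add: mult.assoc[symmetric])
  then have "n \<le> 1" by (rule left_inverse_le) (simp add: mult.assoc)
  then show False using n2 by simp
qed

end

text \<open>The projection complementary to the given ones supplies the eigenspace of the missing
  eigenvalue 0.\<close>

lemma spectral_complete:
  assumes "finite D" "0 \<notin> D"
    and m: "\<And>d. d \<in> D \<Longrightarrow> u d \<in> mats n (k d) \<and> v d \<in> mats (k d) n"
    and orth: "\<And>d e. d \<in> D \<Longrightarrow> e \<in> D \<Longrightarrow> v d * u e = (if d = e then idm (k d) else 0)"
  shows "\<exists>D' k' u' v'. spectral n (\<Sum>d\<in>D. d *\<^sub>F (u d * v d)) D' k' u' v'"
proof -
  define e where "e = idm n - (\<Sum>d\<in>D. u d * v d)"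
  have eu: "e * u d = 0" if "d \<in> D" for d
  proof -
    have "(\<Sum>c\<in>D. u c * v c) * u d = (\<Sum>c\<in>D. if c = d then u d else 0)"
      unfolding sum_distrib_right using m that by (intro sum.cong) (auto simp: mult.assoc orth)
    then show ?thesis using m[OF that] that assms(1) by (simp add: e_def left_diff_distrib)
  qed
  have ve: "v d * e = 0" if "d \<in> D" for d
  proof -
    have "v d * (\<Sum>c\<in>D. u c * v c) = (\<Sum>c\<in>D. if c = d then v d else 0)"
      unfolding sum_distrib_left using m that by (intro sum.cong) (auto simp: orth[THEN mult_eq_assoc])
    then show ?thesis using m[OF that] that assms(1) by (simp add: e_def right_diff_distrib)
  qed
  have me: "e \<in> mats n n" using m by (auto simp: e_def)
  have "e * (\<Sum>d\<in>D. u d * v d) = 0"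
    unfolding sum_distrib_left by (rule sum.neutral) (simp add: mult.assoc[symmetric] eu)
  then have "e * e = e" using me by (simp add: e_def[symmetric] right_diff_distrib) (simp add: e_def right_diff_distrib)
  then obtain k0 g h where gh: "g \<in> mats n k0" "h \<in> mats k0 n" "e = g * h" "h * g = idm k0"
    by (rule idempotent_split[OF me])
  have hu: "h * u d = 0" if "d \<in> D" for d
  proof -
    have "h * u d = h * g * (h * u d)" using gh(2,4) m[OF that] by simp
    also have "\<dots> = h * (e * u d)" by (simp only: gh(3) mult.assoc)
    finally show ?thesis by (simp add: eu[OF that])
  qed
  have vg: "v d * g = 0" if "d \<in> D" for d
  proof -
    have "v d * g = v d * g * (h * g)" using gh(1,4) m[OF that] by simp
    also have "\<dots> = v d * e * g" by (simp only: gh(3) mult.assoc)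
    finally show ?thesis by (simp add: ve[OF that])
  qed
  have "(\<Sum>d\<in>D. u d * v d) + g * h = idm n" using gh(3) by (simp add: e_def algebra_simps)
  then have "spectral n (\<Sum>d\<in>D. d *\<^sub>F (u d * v d)) (insert 0 D) (k(0 := k0)) (u(0 := g)) (v(0 := h))"
    using assms(1,2) m orth gh hu vg
    unfolding spectral_def
  proof (intro conjI)
    have eq: "(\<Sum>d\<in>D. F ((u(0 := g)) d * (v(0 := h)) d) d) = (\<Sum>d\<in>D. F (u d * v d) d)" for F :: "fmat \<Rightarrow> complex \<Rightarrow> fmat"
      using assms(2) by (intro sum.cong) auto
    assume *: "(\<Sum>d\<in>D. u d * v d) + g * h = idm n"
    show "(\<Sum>d\<in>insert 0 D. (u(0 := g)) d * (v(0 := h)) d) = idm n"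
      using assms(1,2) * eq[of "\<lambda>x d. x"] by (simp add: add.commute)
    show "(\<Sum>d\<in>D. d *\<^sub>F (u d * v d)) = (\<Sum>d\<in>insert 0 D. d *\<^sub>F ((u(0 := g)) d * (v(0 := h)) d))"
      using assms(1,2) eq[of "\<lambda>x d. d *\<^sub>F x"] by simp
  qed (use assms(1,2) m orth gh(1,2,4) hu vg in auto)
  then show ?thesis by blast
qed

section \<open>Local data, irreducibility and semisimplicity on the reflected side\<close>

context reflection
begin

lemma P'Q'_mult:
  assumes "i \<le> r" "j \<le> r" "rowb (w j) z"
  shows "P' i * (Q' j * z) = (if i = j then \<mu> *\<^sub>F z else 0) + P i * (Q j * z)"
proof -
  have "P' i * (Q' j * z) = (P' i * Q' j) * z" by (simp only: mult.assoc)
  also have "\<dots> = (if i = j then \<mu> *\<^sub>F z else 0) + P i * Q j * z"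
    unfolding P'Q'[OF assms(1,2)] using assms(3) by (auto simp: distrib_right)
  finally show ?thesis by (simp only: mult.assoc)
qed

text \<open>If \<open>Q' i * y = 0\<close>, then \<open>P j * (Q i * y)\<close> vanishes for
  \<open>j \<noteq> i\<close> and equals \<open>- \<mu> y\<close> for \<open>j = i\<close>. Hence
  \<open>Q i\<close> maps the common kernel of \<open>Q' i\<close> and \<open>Q' i * N i\<close>
  onto an invariant subspace \<open>U\<close>. If \<open>U\<close> is zero, the same relation gives
  \<open>x = 0\<close>; if \<open>U\<close> is everything, all other singularities vanish, against
  \<open>not_isolated\<close>.\<close>

lemma zero_test_left:
  assumes i: "i \<le> r" and x: "x \<in> mats (w i) (w i)" "Q' i * x = 0" "Q' i * N i * x = 0"
  shows "x = 0"
proof -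
  note mi = mem[OF i]
  define U where "U = {Q i * y | y. rowb (w i) y \<and> Q' i * y = 0 \<and> Q' i * (N i * y) = 0}"
  have QPy: "Q j * (P j * (Q i * y)) = (if j = i then - \<mu> *\<^sub>F (Q i * y) else 0)"
    "Q j * (N j * (P j * (Q i * y))) = (if j = i then - \<mu> *\<^sub>F (Q i * (N i * y)) else 0)"
    if "rowb (w i) y" "Q' i * y = 0" "j \<le> r" for j y
  proof -
    have "P' j * (Q' i * y) = (if j = i then \<mu> *\<^sub>F y else 0) + P j * (Q i * y)"
      using P'Q'_mult[OF that(3) i that(1)] by auto
    then have "P j * (Q i * y) = (if j = i then - \<mu> *\<^sub>F y else 0)"
      using that by (simp add: add_eq_0_iff split: if_splits)
    then show "Q j * (P j * (Q i * y)) = (if j = i then - \<mu> *\<^sub>F (Q i * y) else 0)"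
      "Q j * (N j * (P j * (Q i * y))) = (if j = i then - \<mu> *\<^sub>F (Q i * (N i * y)) else 0)" by auto
  qed
  have ri: "right_ideal U"
    unfolding right_ideal_def
  proof (intro conjI ballI allI)
    show "0 \<in> U" unfolding U_def by (rule CollectI, rule exI[of _ 0]) simp
    fix a b assume "a \<in> U" then obtain y where y: "a = Q i * y" "rowb (w i) y" "Q' i * y = 0" "Q' i * (N i * y) = 0"
      by (auto simp: U_def)
    show "a * z \<in> U" for z unfolding U_def
      by (rule CollectI, rule exI[of _ "y * z"])
        (use y(2) in \<open>simp add: y(1,3,4) mult.assoc mult_eq_assoc[OF y(3)] mult_eq_assoc[OF y(4)[folded mult.assoc], unfolded mult.assoc]\<close>)
    assume "b \<in> U" then obtain y' where y': "b = Q i * y'" "rowb (w i) y'" "Q' i * y' = 0" "Q' i * (N i * y') = 0"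
      by (auto simp: U_def)
    show "a + b \<in> U" unfolding U_def
      by (rule CollectI, rule exI[of _ "y + y'"]) (use y y' in \<open>simp add: distrib_left\<close>)
  qed
  have "U = {0} \<or> idm n \<in> U"
  proof (rule irrD[OF ri])
    show "rowb n a" if "a \<in> U" for a using that mi by (auto simp: U_def)
    fix j a assume j: "j \<le> r" and "a \<in> U"
    then obtain y where y: "a = Q i * y" "rowb (w i) y" "Q' i * y = 0" "Q' i * (N i * y) = 0"
      by (auto simp: U_def)
    show "Q j * (P j * a) \<in> U"
      using right_ideal_scl[OF ri, of a "- \<mu>"] right_idealD(1)[OF ri] \<open>a \<in> U\<close>
      by (simp add: y(1) QPy[OF y(2,3) j])
    have "Q i * (N i * y) \<in> U" unfolding U_def
      by (rule CollectI, rule exI[of _ "N i * y"]) (use y mi in simp)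
    then show "Q j * (N j * (P j * a)) \<in> U"
      using right_ideal_scl[OF ri, of "Q i * (N i * y)" "- \<mu>"] right_idealD(1)[OF ri]
      by (simp add: y(1) QPy[OF y(2,3) j])
  qed
  then show ?thesis
  proof
    assume "U = {0}"
    moreover have "Q i * x \<in> U" unfolding U_def using x by (auto simp: mult.assoc)
    ultimately have "Q i * x = 0" by simp
    moreover have "P' i * (Q' i * x) = \<mu> *\<^sub>F x + P i * (Q i * x)"
      using P'Q'_mult[OF i i, of x] x(1) by simp
    ultimately show ?thesis using x \<mu> by simp
  next
    assume "idm n \<in> U"
    then obtain y where y: "idm n = Q i * y" "rowb (w i) y" "Q' i * y = 0" by (auto simp: U_def)
    have False
    proof (rule not_isolated[OF i])
      fix j assume j: "j \<le> r" "j \<noteq> i"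
      have "Q j * P j = Q j * (P j * idm n)" "Q j * N j * P j = Q j * (N j * (P j * idm n))"
        using mem[OF j(1)] by (simp_all add: mult.assoc)
      then show "Q j * P j = 0 \<and> Q j * N j * P j = 0"
        using QPy[OF y(2,3) j(1)] j(2) by (simp add: y(1))
    qed
    then show ?thesis ..
  qed
qed

text \<open>The counterpart with kernels: the vectors killed by \<open>x * P i\<close> and
  \<open>x * N i * P i\<close> form an invariant subspace, and it contains the image of every
  \<open>Q j\<close> with \<open>j \<noteq> i\<close>. If it is zero, the singularity
  \<open>i\<close> is isolated; if it is everything, generation by \<open>P i\<close> and
  \<open>N i * P i\<close> gives \<open>x = 0\<close>.\<close>

lemma zero_test_right:
  assumes i: "i \<le> r" and x: "x \<in> mats (w i) (w i)" "x * P' i = 0" "x * N i * P' i = 0"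
  shows "x = 0"
proof -
  note mi = mem[OF i]
  define U where "U = {v. rowb n v \<and> x * (P i * v) = 0 \<and> x * (N i * (P i * v)) = 0}"
  have PQ: "x * (P i * (Q j * z)) = (if j = i then - \<mu> *\<^sub>F (x * z) else 0)"
    "x * (N i * (P i * (Q j * z))) = (if j = i then - \<mu> *\<^sub>F (x * (N i * z)) else 0)"
    if "rowb (w j) z" "j \<le> r" for j z
  proof -
    have "P' i * (Q' j * z) = (if i = j then \<mu> *\<^sub>F z else 0) + P i * (Q j * z)"
      by (rule P'Q'_mult[OF i that(2,1)])
    then have *: "P i * (Q j * z) = P' i * (Q' j * z) - (if i = j then \<mu> *\<^sub>F z else 0)"
      by (simp add: algebra_simps)
    show "x * (P i * (Q j * z)) = (if j = i then - \<mu> *\<^sub>F (x * z) else 0)"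
      "x * (N i * (P i * (Q j * z))) = (if j = i then - \<mu> *\<^sub>F (x * (N i * z)) else 0)"
      unfolding * using x(2,3) by (auto simp: right_diff_distrib mult.assoc[symmetric])
  qed
  have ri: "right_ideal U"
    by (auto simp: right_ideal_def U_def distrib_left mult.assoc[symmetric])
  have QU: "Q j * z \<in> U" if "j \<le> r" "j \<noteq> i" "rowb (w j) z" for j z
    using that mem[OF that(1)] PQ[OF that(3,1)] by (simp add: U_def)
  have "U = {0} \<or> idm n \<in> U"
  proof (rule irrD[OF ri])
    show "rowb n a" if "a \<in> U" for a using that by (simp add: U_def)
    fix j a assume j: "j \<le> r" and a: "a \<in> U"
    show "Q j * (P j * a) \<in> U"
    proof (cases "j = i")
      case True
      then show ?thesis using a mi i PQ[of i "P i * a"] by (simp add: U_def)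
    qed (use QU j mem[OF j] in auto)
    show "Q j * (N j * (P j * a)) \<in> U"
    proof (cases "j = i")
      case True
      then show ?thesis using a mi i PQ[of i "N i * (P i * a)"] by (simp add: U_def)
    qed (use QU j mem[OF j] in auto)
  qed
  then show ?thesis
  proof
    assume U: "U = {0}"
    have False
    proof (rule not_isolated[OF i])
      fix j assume j: "j \<le> r" "j \<noteq> i"
      show "Q j * P j = 0 \<and> Q j * N j * P j = 0"
        using QU[OF j, of "P j"] QU[OF j, of "N j * P j"] mem[OF j(1)] by (auto simp: U mult.assoc)
    qed
    then show ?thesis ..
  next
    assume "idm n \<in> U"
    then have "x * P i = 0" "x * N i * P i = 0" using mi by (simp_all add: U_def mult.assoc)
    then show ?thesis using local_datum_gen[OF ld[OF i]] x by simp
  qed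
qed

lemma local_datum': assumes i: "i \<le> r" shows "local_datum n' (w i) (P' i) (Q' i) (N i)"
proof -
  note mi = mem[OF i]
  define e0 e1 p0 p1 where "e0 = emb 0 n'" and "e1 = emb n' n'" and "p0 = prj 0 n'" and "p1 = prj n' n'"
  have m: "e0 \<in> mats (n' + n') n'" "e1 \<in> mats (n' + n') n'" "p0 \<in> mats n' (n' + n')" "p1 \<in> mats n' (n' + n')"
    by (simp_all add: e0_def e1_def p0_def p1_def)
  have pe: "p0 * e0 = idm n'" "p1 * e1 = idm n'" "p0 * e1 = 0" "p1 * e0 = 0"
    by (simp_all add: e0_def e1_def p0_def p1_def)
  note pea = pe[THEN mult_eq_assoc]
  define M where "M = e0 * Q' i + e1 * (Q' i * N i)"
  obtain T where T: "T \<in> mats (w i) (n' + n')" "T * M = idm (w i)"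
  proof (rule left_inverse_exists[of M "n' + n'" "w i"])
    show "M \<in> mats (n' + n') (w i)" using m mi by (simp add: M_def)
    fix x assume x: "x \<in> mats (w i) (w i)" "M * x = 0"
    have "p0 * (M * x) = Q' i * x" "p1 * (M * x) = Q' i * N i * x"
      using mi by (simp_all add: M_def algebra_simps pe pea)
    then show "x = 0" using zero_test_left[OF i x(1)] x(2) by simp
  qed
  define M' where "M' = P' i * p0 + N i * P' i * p1"
  obtain S where S: "S \<in> mats (n' + n') (w i)" "M' * S = idm (w i)"
  proof (rule right_inverse_exists[of M' "w i" "n' + n'"])
    show "M' \<in> mats (w i) (n' + n')" using m mi by (simp add: M'_def mult.assoc)
    fix x assume x: "x \<in> mats (w i) (w i)" "x * M' = 0"
    have "x * M' * e0 = x * P' i" "x * M' * e1 = x * N i * P' i"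
      using mi by (simp_all add: M'_def algebra_simps pe pea)
    then show "x = 0" using zero_test_right[OF i x(1)] x(2) by simp
  qed
  have "P' i * (p0 * S) + N i * P' i * (p1 * S) = idm (w i)"
    using S(2) by (simp add: M'_def algebra_simps)
  moreover have "T * e0 * Q' i + T * e1 * Q' i * N i = idm (w i)"
    using T(2) by (simp add: M_def algebra_simps)
  moreover have "p0 * S \<in> mats n' (w i)" "p1 * S \<in> mats n' (w i)" "T * e0 \<in> mats (w i) n'" "T * e1 \<in> mats (w i) n'"
    using m S(1) T(1) by simp_all
  ultimately show ?thesis unfolding local_datum_def using mi by blast
qed

lemma n'_pos: "1 \<le> n'"
proof (rule ccontr)
  assume "\<not> 1 \<le> n'"
  then have n': "n' = 0" by simp
  have "w i = 0" if i: "i \<le> r" for i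
  proof -
    obtain S0 S1 where "P' i * S0 + N i * P' i * S1 = idm (w i)"
      using local_datum'[OF i] by (auto simp: local_datum_def)
    then have "idm (w i) = 0" using mem[OF i] n' by simp
    then have "rowb 0 (idm (w i))" by simp
    then show ?thesis by (simp del: bound_0)
  qed
  then show False using nn' n2 by simp
qed

text \<open>An invariant \<open>J\<close> on the primed side is carried over in two stages:
  \<open>V i\<close> is the \<open>N i\<close>-stable span of \<open>P' i * J\<close>, and
  \<open>U\<close> is the sum of the \<open>Q i * V i\<close>. Because \<open>P j * Q i\<close> and
  \<open>P' j * Q' i\<close> differ by a scalar, \<open>U\<close> is invariant. The alternative for
  \<open>U\<close> returns to \<open>J\<close> through \<open>\<Sum>Q' i * P' i\<close>, which is
  the nonzero scalar \<open>\<mu>\<close>.\<close>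

lemma irr': "irr_mod r n' (\<lambda>i j. if j = 0 then Q' i * P' i else Q' i * N i * P' i)"
  unfolding irr_mod_def
proof (intro allI impI)
  fix J assume ri: "right_ideal J" and row: "\<forall>x\<in>J. rowb n' x"
    and inv: "\<forall>i\<le>r. \<forall>x\<in>J. (if (0::nat) = 0 then Q' i * P' i else Q' i * N i * P' i) * x \<in> J \<and>
      (if (1::nat) = 0 then Q' i * P' i else Q' i * N i * P' i) * x \<in> J"
  have X0: "Q' i * (P' i * x) \<in> J" and X1: "Q' i * (N i * (P' i * x)) \<in> J" if "i \<le> r" "x \<in> J" for i x
    using inv that by (simp_all add: mult.assoc)
  note rJ = right_idealD[OF ri]
  define V where "V i = {P' i * x + N i * (P' i * y) | x y. x \<in> J \<and> y \<in> J}" for i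
  have V: "right_ideal (V i)" for i
    unfolding right_ideal_def
  proof (intro conjI ballI allI)
    show "0 \<in> V i" unfolding V_def using rJ(1) by (intro CollectI exI[of _ 0]) simp
    fix a b assume "a \<in> V i" then obtain x y where a: "a = P' i * x + N i * (P' i * y)" "x \<in> J" "y \<in> J"
      by (auto simp: V_def)
    show "a * z \<in> V i" for z unfolding V_def
      by (intro CollectI exI[of _ "x * z"] exI[of _ "y * z"]) (use a rJ(3) in \<open>simp add: algebra_simps\<close>)
    assume "b \<in> V i" then obtain x' y' where b: "b = P' i * x' + N i * (P' i * y')" "x' \<in> J" "y' \<in> J"
      by (auto simp: V_def)
    show "a + b \<in> V i" unfolding V_def
      by (intro CollectI exI[of _ "x + x'"] exI[of _ "y + y'"]) (use a b rJ(2) in \<open>simp add: algebra_simps\<close>)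
  qed
  have PV: "P' i * x \<in> V i" if "x \<in> J" for i x
    unfolding V_def using that rJ(1) by (intro CollectI exI[of _ x] exI[of _ 0]) simp
  have NV: "N i * a \<in> V i" if i: "i \<le> r" and "a \<in> V i" for i a
  proof -
    obtain x y where a: "a = P' i * x + N i * (P' i * y)" "x \<in> J" "y \<in> J" using \<open>a \<in> V i\<close> by (auto simp: V_def)
    show ?thesis unfolding V_def
      by (intro CollectI exI[of _ 0] exI[of _ x]) (use a rJ(1) mem[OF i] in \<open>simp add: algebra_simps\<close>)
  qed
  have rV: "rowb (w i) a" if "i \<le> r" "a \<in> V i" for i a
    using that mem[OF that(1)] by (auto simp: V_def)
  have QV: "Q' i * a \<in> J" if "i \<le> r" "a \<in> V i" for i a
    using that X0 X1 rJ(2) by (auto simp: V_def distrib_left)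
  define U where "U = {(\<Sum>i\<le>r. Q i * f i) | f. \<forall>i\<le>r. f i \<in> V i}"
  have U: "right_ideal U"
    unfolding right_ideal_def
  proof (intro conjI ballI allI)
    show "0 \<in> U" unfolding U_def using right_idealD(1)[OF V] by (intro CollectI exI[of _ "\<lambda>_. 0"]) simp
    fix a b assume "a \<in> U" then obtain f where a: "a = (\<Sum>i\<le>r. Q i * f i)" "\<forall>i\<le>r. f i \<in> V i" by (auto simp: U_def)
    show "a * z \<in> U" for z unfolding U_def
      by (intro CollectI exI[of _ "\<lambda>i. f i * z"]) (use a right_idealD(3)[OF V] in \<open>simp add: sum_distrib_right mult.assoc\<close>)
    assume "b \<in> U" then obtain g where b: "b = (\<Sum>i\<le>r. Q i * g i)" "\<forall>i\<le>r. g i \<in> V i" by (auto simp: U_def)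
    show "a + b \<in> U" unfolding U_def
      by (intro CollectI exI[of _ "\<lambda>i. f i + g i"]) (use a b right_idealD(2)[OF V] in \<open>simp add: sum.distrib distrib_left\<close>)
  qed
  have QU: "Q i * a \<in> U" if "i \<le> r" "a \<in> V i" for i a
  proof -
    have "(\<Sum>j\<le>r. Q j * (if j = i then a else 0)) = (\<Sum>j\<le>r. if j = i then Q i * a else 0)"
      by (intro sum.cong) auto
    then show ?thesis unfolding U_def using that right_idealD(1)[OF V]
      by (intro CollectI exI[of _ "\<lambda>j. if j = i then a else 0"]) auto
  qed
  have PU: "P j * a \<in> V j" if j: "j \<le> r" and "a \<in> U" for j a
  proof -
    obtain f where f: "a = (\<Sum>i\<le>r. Q i * f i)" "\<And>i. i \<le> r \<Longrightarrow> f i \<in> V i" using \<open>a \<in> U\<close> by (auto simp: U_def)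
    have "P j * (Q i * f i) \<in> V j" if i: "i \<le> r" for i
    proof -
      have "P j * (Q i * f i) = P' j * (Q' i * f i) - (if j = i then \<mu> *\<^sub>F f j else 0)"
        using P'Q'_mult[OF j i rV[OF i f(2)[OF i]]] by auto
      moreover have "(if j = i then \<mu> *\<^sub>F f j else 0) \<in> V j"
        using right_ideal_scl[OF V f(2)[OF j], of \<mu>] right_idealD(1)[OF V, of j] by auto
      ultimately show ?thesis
        using right_ideal_diff[OF V PV[OF QV[OF i f(2)[OF i]], of j], of "if j = i then \<mu> *\<^sub>F f j else 0"] by metis
    qed
    then show ?thesis unfolding f(1) sum_distrib_left by (intro right_ideal_sum[OF V]) auto
  qed
  have "U = {0} \<or> idm n \<in> U"
  proof (rule irrD[OF U])
    show "rowb n a" if "a \<in> U" for a using that mem by (auto simp: U_def)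
    fix i a assume "i \<le> r" "a \<in> U"
    then show "Q i * (P i * a) \<in> U" "Q i * (N i * (P i * a)) \<in> U" using QU PU NV by blast+
  qed
  then show "J = {0} \<or> idm n' \<in> J"
  proof
    assume U0: "U = {0}"
    have "x = 0" if x: "x \<in> J" for x
    proof -
      have "P' i * x = 0" if i: "i \<le> r" for i
      proof (rule local_datum_cogen[OF ld[OF i]])
        show "Q i * (P' i * x) = 0" "Q i * N i * (P' i * x) = 0"
          using QU[OF i PV[OF x]] QU[OF i NV[OF i PV[OF x]]] by (simp_all add: U0 mult.assoc)
      qed (use mem[OF i] in simp)
      then have "(\<Sum>i\<le>r. Q' i * P' i) * x = 0" by (simp add: sum_distrib_right mult.assoc)
      then show "x = 0" using \<mu> row x by (simp add: sumQP')
    qed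
    then show ?thesis using rJ(1) by blast
  next
    assume U1: "idm n \<in> U"
    have "P' i * z \<in> V i" if i: "i \<le> r" and z: "rowb n' z" for i z
    proof -
      have Pi: "P i \<in> V i" using PU[OF i U1] mem[OF i] by simp
      obtain S0 S1 where S: "P i * S0 + N i * P i * S1 = idm (w i)" using ld[OF i] by (auto simp: local_datum_def)
      have "idm (w i) \<in> V i"
        using right_idealD(2)[OF V right_idealD(3)[OF V Pi, of S0] right_idealD(3)[OF V NV[OF i Pi], of S1]] S by simp
      then have "idm (w i) * (P' i * z) \<in> V i" using right_idealD(3)[OF V] by blast
      then show ?thesis using mem[OF i] by simp
    qed
    then have "(\<Sum>i\<le>r. Q' i * (P' i * idm n')) \<in> J" using QV by (intro right_ideal_sum[OF ri]) auto
    also have "(\<Sum>i\<le>r. Q' i * (P' i * idm n')) = (\<Sum>i\<le>r. Q' i * P' i)"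
      using mem by (intro sum.cong) auto
    finally have "\<mu> *\<^sub>F idm n' \<in> J" by (simp add: sumQP')
    then have "(1 / \<mu>) *\<^sub>F (\<mu> *\<^sub>F idm n') \<in> J" by (rule right_ideal_scl[OF ri])
    then show ?thesis using \<mu> by simp
  qed
qed

text \<open>Semisimplicity of \<open>A = Q i * N i * P i\<close> yields \<open>B\<close> with
  \<open>A * B * A = A\<close>, inverse to \<open>A\<close> on the nonzero eigenspaces. Cancelling
  \<open>Q i\<close> and \<open>P i\<close> sharpens this to
  \<open>N i * P i * B * Q i * N i = N i\<close>, a statement about the middle space that transfers
  to the primed side. Since \<open>N i\<close> squares to zero, \<open>P' i * Q' i\<close> and
  \<open>P i * Q i\<close> agree between two factors \<open>N i\<close>, so the transported
  eigenvectors stay dual to each other.\<close>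

lemma spectral':
  assumes i: "i \<le> r" shows "\<exists>D k u v. spectral n' (Q' i * N i * P' i) D k u v"
proof -
  note mi = mem[OF i]
  define A where "A = Q i * N i * P i"
  obtain D k u v where sp: "spectral n A D k u v" using ss[OF i] by (auto simp: A_def)
  then have fin: "finite D" and A: "A = (\<Sum>d\<in>D. d *\<^sub>F (u d * v d))"
    and uv: "\<And>d. d \<in> D \<Longrightarrow> u d \<in> mats n (k d) \<and> v d \<in> mats (k d) n"
    and vu: "\<And>d e. d \<in> D \<Longrightarrow> e \<in> D \<Longrightarrow> v d * u e = (if d = e then idm (k d) else 0)"
    by (auto simp: spectral_def)
  have Au: "A * u d = d *\<^sub>F u d" "v d * A = d *\<^sub>F v d" if "d \<in> D" for d
    using spectral_mult[OF sp that] by auto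
  define B where "B = (\<Sum>d\<in>D - {0}. (1/d) *\<^sub>F (u d * v d))"
  have ABA: "A * B * A = A"
  proof -
    have "A * B * A = (\<Sum>d\<in>D - {0}. d *\<^sub>F (u d * v d))"
      unfolding B_def sum_distrib_left sum_distrib_right
      by (intro sum.cong) (auto simp: mult.assoc Au(2) mult_eq_assoc[OF Au(1)])
    also have "\<dots> = A" unfolding A using fin by (intro sum.mono_neutral_left) auto
    finally show ?thesis .
  qed
  have NBN: "N i * P i * B * Q i * N i = N i"
  proof -
    define \<Delta> where "\<Delta> = N i * P i * B * Q i * N i - N i"
    have m\<Delta>: "\<Delta> \<in> mats (w i) (w i)" using mi by (simp add: \<Delta>_def mult.assoc)
    have N\<Delta>: "N i * \<Delta> = 0" "\<Delta> * N i = 0" using mi by (simp_all add: \<Delta>_def algebra_simps)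
    have "Q i * \<Delta> * P i = A * B * A - A" by (simp add: \<Delta>_def A_def algebra_simps)
    then have "Q i * \<Delta> * P i = 0" by (simp add: ABA)
    moreover have "Q i * \<Delta> * N i * P i = Q i * (\<Delta> * N i) * P i" by (simp only: mult.assoc)
    then have "Q i * \<Delta> * N i * P i = 0" by (simp only: N\<Delta>) simp
    moreover have "colb (w i) (Q i * \<Delta>)" using m\<Delta> by simp
    ultimately have "Q i * \<Delta> = 0" by (rule local_datum_gen[OF ld[OF i]])
    moreover have "Q i * N i * \<Delta> = 0" by (simp only: mult.assoc N\<Delta>) simp
    moreover have "rowb (w i) \<Delta>" using m\<Delta> by simp
    ultimately have "\<Delta> = 0" by (rule local_datum_cogen[OF ld[OF i]])
    then show ?thesis by (simp add: \<Delta>_def)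
  qed
  define u' v' where "u' d = (1/d) *\<^sub>F (Q' i * N i * P i * u d)" and "v' d = (1/d) *\<^sub>F (v d * Q i * N i * P' i)" for d
  have "\<exists>D' k' u'' v''. spectral n' (\<Sum>d\<in>D - {0}. d *\<^sub>F (u' d * v' d)) D' k' u'' v''"
  proof (rule spectral_complete)
    fix d assume "d \<in> D - {0}"
    then show "u' d \<in> mats n' (k d) \<and> v' d \<in> mats (k d) n'"
      using uv mi by (auto simp: u'_def v'_def mult.assoc)
  next
    fix d e assume de: "d \<in> D - {0}" "e \<in> D - {0}"
    have "N i * (P' i * (Q' i * (N i * Y))) = N i * (P i * (Q i * (N i * Y)))" for Y
    proof -
      have "N i * (P' i * Q' i) * (N i * Y) = N i * (P i * Q i) * (N i * Y)"
        using mi by (simp add: P'Q'[OF i i] algebra_simps)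
      then show ?thesis by (simp add: mult.assoc)
    qed
    then have "v' d * u' e = (1/(d*e)) *\<^sub>F (v d * A * (A * u e))"
      by (simp add: v'_def u'_def A_def mult.assoc)
    also have "\<dots> = v d * u e" using de by (simp add: Au)
    finally show "v' d * u' e = (if d = e then idm (k d) else 0)" using de vu by simp
  qed (use fin in simp_all)
  moreover have "(\<Sum>d\<in>D - {0}. d *\<^sub>F (u' d * v' d)) = Q' i * (N i * P i * B * Q i * N i) * P' i"
    unfolding B_def sum_distrib_left sum_distrib_right
    by (intro sum.cong) (auto simp: u'_def v'_def mult.assoc)
  ultimately show ?thesis by (simp add: NBN)
qed

end

section \<open>Centralizers and the index of rigidity\<close>

definition pscl :: "complex \<Rightarrow> fmat \<times> fmat \<Rightarrow> fmat \<times> fmat" where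
  "pscl c p = (c *\<^sub>F fst p, c *\<^sub>F snd p)"

interpretation pvs: to_fmat pscl
  by unfold_locales (auto simp: pscl_def algebra_simps)

interpretation pp: complex_space_pair pscl pscl ..
interpretation fp: complex_space_pair scl pscl ..

lemma pvs_linear_fst: "Vector_Spaces.linear pscl scl fst"
  by unfold_locales (auto simp: pscl_def)

lemma pvs_prod:
  assumes A: "fvs.fin_span A" "fvs.subspace A" and B: "fvs.fin_span B" "fvs.subspace B"
  shows "pvs.fin_span (A \<times> B)" "pvs.subspace (A \<times> B)" "pvs.dim (A \<times> B) = fvs.dim A + fvs.dim B"
proof -
  have l1: "Vector_Spaces.linear scl pscl (\<lambda>x. (x, 0))" and l2: "Vector_Spaces.linear scl pscl (\<lambda>x. (0, x))"
    by (unfold_locales, auto simp: pscl_def)+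
  show s: "pvs.subspace (A \<times> B)"
    using A B by (auto simp: pvs.subspace_def fvs.subspace_def pscl_def zero_prod_def)
  obtain S T where S: "finite S" "A \<subseteq> fvs.span S" and T: "finite T" "B \<subseteq> fvs.span T"
    using A B by (auto simp: fvs.fin_span_def)
  show f: "pvs.fin_span (A \<times> B)"
    unfolding pvs.fin_span_def
  proof (intro exI conjI)
    let ?U = "(\<lambda>x. (x, 0)) ` S \<union> (\<lambda>x. (0, x)) ` T"
    show "finite ?U" using S T by simp
    show "A \<times> B \<subseteq> pvs.span ?U"
    proof clarify
      fix a b assume "a \<in> A" "b \<in> B"
      then have "(a, 0) \<in> pvs.span ((\<lambda>x. (x, 0)) ` S)" "(0, b) \<in> pvs.span ((\<lambda>x. (0, x)) ` T)"
        using S T fp.linear_span_image[OF l1, of S] fp.linear_span_image[OF l2, of T] by auto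
      then have "(a, 0) \<in> pvs.span ?U" "(0, b) \<in> pvs.span ?U"
        by (meson pvs.span_mono subsetD Un_upper1 Un_upper2)+
      from pvs.span_add[OF this] show "(a, b) \<in> pvs.span ?U" by simp
    qed
  qed
  have "{x \<in> A \<times> B. fst x = 0} = (\<lambda>x. (0, x)) ` B"
    using A by (auto simp: fvs.subspace_def)
  then have "pvs.dim {x \<in> A \<times> B. fst x = 0} = fvs.dim B"
    using fp.dim_inj_image[OF l2 B] by (simp add: zero_prod_def)
  moreover have "fst ` (A \<times> B) = A" using B by (force simp: fvs.subspace_def)
  ultimately show "pvs.dim (A \<times> B) = fvs.dim A + fvs.dim B"
    using pvs.rank_nullity[OF pvs_linear_fst f s] by simp
qed

text \<open>The pairs describe the block upper triangular Toeplitz matrices that commute with the one of \<open>(A1, A0)\<close>.\<close>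

definition ctz :: "nat \<Rightarrow> fmat \<Rightarrow> fmat \<Rightarrow> (fmat \<times> fmat) set" where
  "ctz n A1 A0 = {(C1, C0). C1 \<in> mats n n \<and> C0 \<in> mats n n \<and> A1 * C1 = C1 * A1 \<and>
     A1 * C0 + A0 * C1 = C1 * A0 + C0 * A1}"

definition cdim :: "nat \<Rightarrow> fmat \<Rightarrow> fmat \<Rightarrow> nat" where
  "cdim n A1 A0 = pvs.dim (ctz n A1 A0)"

lemma pvs_mats: "pvs.fin_span (mats a b \<times> mats c d)" "pvs.subspace (mats a b \<times> mats c d)"
    "pvs.dim (mats a b \<times> mats c d) = a * b + c * d"
  using pvs_prod[OF fin_span_mats[of a b] subspace_mats fin_span_mats[of c d] subspace_mats]
  by (simp_all add: dim_mats)

lemma ctz_space: "pvs.subspace (ctz n A1 A0)" "pvs.fin_span (ctz n A1 A0)"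
proof -
  have *: "A1 * C0 + A0 * C1 = C1 * A0 + C0 * A1 \<longleftrightarrow> (A1 * C0 - C0 * A1) + (A0 * C1 - C1 * A0) = 0" for C1 C0
    by (auto simp: algebra_simps)
  define \<phi> where "\<phi> p = (A1 * snd p - snd p * A1) + (A0 * fst p - fst p * A0)" for p
  have "\<phi> (p + q) = \<phi> p + \<phi> q" "\<phi> (pscl c p) = c *\<^sub>F \<phi> p" for p q c
    by (simp_all add: \<phi>_def pscl_def algebra_simps)
  moreover have "ctz n A1 A0 = {p. fst p \<in> mats n n \<and> snd p \<in> mats n n \<and> A1 * fst p = fst p * A1 \<and> \<phi> p = 0}"
    unfolding ctz_def * \<phi>_def by auto
  ultimately show "pvs.subspace (ctz n A1 A0)"
    by (auto simp: pvs.subspace_def distrib_left distrib_right) (auto simp: \<phi>_def pscl_def)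
  show "pvs.fin_span (ctz n A1 A0)"
    by (rule pvs.fin_span_subset[OF pvs_mats(1)[of n n n n]]) (auto simp: ctz_def)
qed

lemma cdim_shift:
  assumes "A1 \<in> mats n n" "A0 \<in> mats n n"
  shows "cdim n (A1 + c *\<^sub>F idm n) (A0 + d *\<^sub>F idm n) = cdim n A1 A0"
proof -
  have "ctz n (A1 + c *\<^sub>F idm n) (A0 + d *\<^sub>F idm n) = ctz n A1 A0"
    unfolding ctz_def by (intro Collect_cong) (auto simp: algebra_simps)
  then show ?thesis by (simp add: cdim_def)
qed

lemma tr_nondegenerate:
  assumes "M \<in> mats m n" "\<And>C. C \<in> mats n m \<Longrightarrow> tr (C * M) = 0" shows "M = 0"
proof (rule fmat_eqI)
  fix i j
  show "entry M i j = entry 0 i j"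
  proof (cases "i < m \<and> j < n")
    case True
    then have "tr (unit_mat j i * M) = 0" by (intro assms(2)) auto
    then show ?thesis by (subst (asm) tr_comm) (simp add: tr_mult_unit_mat)
  next
    case False
    then show ?thesis using matsD[OF assms(1), of i j] by auto
  qed
qed

section \<open>The commutant of the square-zero part and the invariance of the index\<close>

definition commutant :: "nat \<Rightarrow> fmat \<Rightarrow> fmat set" where
  "commutant w N = {Y \<in> mats w w. N * Y = Y * N}"

text \<open>The radical of the alternating form \<open>tr (R * (Y * Y' - Y' * Y))\<close> on the
  commutant; equivalently, the infinitesimal stabiliser of the functional \<open>tr (R * Y)\<close>
  on it.\<close>

definition commutant_rad :: "nat \<Rightarrow> fmat \<Rightarrow> fmat \<Rightarrow> fmat set" where
  "commutant_rad w N R = {Y \<in> commutant w N. \<forall>Y'\<in>commutant w N. tr (R * (Y * Y' - Y' * Y)) = 0}"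

lemma commutant_space: "fvs.subspace (commutant w N)" "fvs.fin_span (commutant w N)"
  "fvs.subspace (commutant_rad w N R)" "fvs.fin_span (commutant_rad w N R)"
proof -
  show "fvs.subspace (commutant w N)"
    by (auto simp: fvs.subspace_def commutant_def algebra_simps)
  then show "fvs.subspace (commutant_rad w N R)"
    by (auto simp: fvs.subspace_def commutant_rad_def algebra_simps)
  show f: "fvs.fin_span (commutant w N)"
    by (rule fvs.fin_span_subset[OF fin_span_mats[of w w]]) (auto simp: commutant_def)
  show "fvs.fin_span (commutant_rad w N R)"
    by (rule fvs.fin_span_subset[OF f]) (auto simp: commutant_rad_def)
qed

lemma commutant_rad_shift:
  "commutant_rad w N (R + \<mu> *\<^sub>F idm w) = commutant_rad w N R"
proof -
  have "tr ((R + \<mu> *\<^sub>F idm w) * (Y * Y' - Y' * Y)) = tr (R * (Y * Y' - Y' * Y))"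
    if "Y \<in> commutant w N" "Y' \<in> commutant w N" for Y Y'
  proof -
    have "(R + \<mu> *\<^sub>F idm w) * (Y * Y' - Y' * Y) = R * (Y * Y' - Y' * Y) + \<mu> *\<^sub>F (Y * Y' - Y' * Y)"
      using that by (simp add: commutant_def distrib_right)
    then show ?thesis by (simp add: tr_comm[of Y Y'])
  qed
  then show ?thesis unfolding commutant_rad_def by (intro Collect_cong) auto
qed

text \<open>The maps \<open>\<alpha>\<close> and \<open>\<beta>\<close> are the infinitesimal actions of the two gauge groups on the pairs
  \<open>(Q, P)\<close>; their images are orthogonal complements for the symplectic form \<open>\<omega>\<close>.\<close>

lemma cdim_local_datum:
  assumes ld: "local_datum n w P Q N"
  shows "cdim n (Q * N * P) (Q * P) + 2 * n * w =
    2 * n * n + fvs.dim (commutant w N) + fvs.dim (commutant_rad w N (P * Q))"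
proof -
  have m: "P \<in> mats w n" "Q \<in> mats n w" "N \<in> mats w w" and NN: "N * N = 0"
    using ld by (auto simp: local_datum_def)
  note NNa = NN[THEN mult_eq_assoc]
  obtain S0 S1 where S: "S0 \<in> mats n w" "S1 \<in> mats n w" "P * S0 + N * P * S1 = idm w"
    using ld by (auto simp: local_datum_def)
  define g where "g = mats n n \<times> mats n n"
  define E where "E = mats n w \<times> mats w n"
  define \<alpha> where "\<alpha> p = (fst p * Q + snd p * Q * N, - (P * fst p + N * P * snd p))" for p
  define \<beta> where "\<beta> Y = (Q * Y, - (Y * P))" for Y
  define \<omega> where "\<omega> p q = tr (fst p * snd q) - tr (fst q * snd p)" for p q
  let ?Z = "commutant w N"
  let ?H = "commutant_rad w N (P * Q)"
  have l\<alpha>: "Vector_Spaces.linear pscl pscl \<alpha>"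
    by unfold_locales (auto simp: \<alpha>_def pscl_def algebra_simps)
  have l\<beta>: "Vector_Spaces.linear scl pscl \<beta>"
    by unfold_locales (auto simp: \<beta>_def pscl_def algebra_simps)
  have g: "pvs.fin_span g" "pvs.subspace g" "pvs.dim g = 2 * n * n"
    using pvs_mats[of n n n n] by (simp_all add: g_def)
  have E: "pvs.fin_span E" "pvs.subspace E" "pvs.dim E = 2 * n * w"
    using pvs_mats[of n w w n] by (simp_all add: E_def)
  have \<beta>inj: "Y = 0" if "Y \<in> ?Z" "\<beta> Y = 0" for Y
  proof (rule local_datum_cogen[OF ld])
    have "Q * N * Y = Q * Y * N" using that by (simp add: commutant_def mult.assoc)
    then show "Q * Y = 0" "Q * N * Y = 0" "rowb w Y"
      using that by (auto simp: \<beta>_def zero_prod_def commutant_def)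
  qed
  have skew: "\<omega> p q = - \<omega> q p" for p q by (simp add: \<omega>_def)
  have perp: "pvs.dim {x \<in> E. \<forall>u\<in>U. \<omega> u x = 0} + pvs.dim U = pvs.dim E"
    if U: "pvs.subspace U" "U \<subseteq> E" for U
  proof (rule pvs.dim_perp[OF E(1,2) U])
    fix x assume x: "x \<in> E" "\<And>u. u \<in> E \<Longrightarrow> \<omega> u x = 0"
    have "snd x = 0"
    proof (rule tr_nondegenerate[of _ w n])
      fix C assume "C \<in> mats n w"
      then show "tr (C * snd x) = 0" using x(2)[of "(C, 0)"] by (simp add: E_def \<omega>_def)
    qed (use x in \<open>auto simp: E_def\<close>)
    moreover have "fst x = 0"
    proof (rule tr_nondegenerate[of _ n w])
      fix C assume "C \<in> mats w n"
      then show "tr (C * fst x) = 0" using x(2)[of "(0, C)"] by (simp add: E_def \<omega>_def tr_comm[of C])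
    qed (use x in \<open>auto simp: E_def\<close>)
    ultimately show "x = 0" by (simp add: prod_eq_iff)
  qed (auto simp: \<omega>_def pscl_def algebra_simps)
  have \<omega>\<alpha>: "\<omega> (\<alpha> C) x = tr (fst C * (Q * snd x + fst x * P)) + tr (snd C * (Q * N * snd x + fst x * N * P))" for C x
    using tr_comm[of "fst x * P" "fst C"] tr_comm[of "fst x * N * P" "snd C"]
    by (simp add: \<omega>_def \<alpha>_def algebra_simps)
  have perp\<alpha>: "{x \<in> E. \<forall>u\<in>\<alpha> ` g. \<omega> u x = 0} =
      {x \<in> E. Q * snd x + fst x * P = 0 \<and> Q * N * snd x + fst x * N * P = 0}"
  proof (intro Collect_cong conj_cong refl iffI conjI)
    fix x assume x: "x \<in> E" and *: "\<forall>u\<in>\<alpha> ` g. \<omega> u x = 0"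
    show "Q * snd x + fst x * P = 0"
    proof (rule tr_nondegenerate[of _ n n])
      fix C assume "C \<in> mats n n"
      then have "\<omega> (\<alpha> (C, 0)) x = 0" using * by (auto simp: g_def)
      then show "tr (C * (Q * snd x + fst x * P)) = 0" by (simp only: \<omega>\<alpha> fst_conv snd_conv) simp
    qed (use x m in \<open>auto simp: E_def\<close>)
    show "Q * N * snd x + fst x * N * P = 0"
    proof (rule tr_nondegenerate[of _ n n])
      fix C assume "C \<in> mats n n"
      then have "\<omega> (\<alpha> (0, C)) x = 0" using * by (auto simp: g_def)
      then show "tr (C * (Q * N * snd x + fst x * N * P)) = 0" by (simp only: \<omega>\<alpha> fst_conv snd_conv) simp
    qed (use x m in \<open>auto simp: E_def mult.assoc\<close>)
  next
    fix x assume "Q * snd x + fst x * P = 0 \<and> Q * N * snd x + fst x * N * P = 0"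
    then show "\<forall>u\<in>\<alpha> ` g. \<omega> u x = 0" by (auto simp: \<omega>\<alpha>)
  qed
  have \<beta>Z: "\<beta> ` ?Z = {x \<in> E. Q * snd x + fst x * P = 0 \<and> Q * N * snd x + fst x * N * P = 0}"
  proof (intro equalityI subsetI)
    fix x assume "x \<in> \<beta> ` ?Z"
    then obtain Y where Y: "Y \<in> mats w w" "N * Y = Y * N" "x = \<beta> Y" by (auto simp: commutant_def)
    then show "x \<in> {x \<in> E. Q * snd x + fst x * P = 0 \<and> Q * N * snd x + fst x * N * P = 0}"
      using m mult_eq_assoc[OF Y(2)] by (auto simp: \<beta>_def E_def mult.assoc)
  next
    fix x assume "x \<in> {x \<in> E. Q * snd x + fst x * P = 0 \<and> Q * N * snd x + fst x * N * P = 0}"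
    then obtain a b where x: "x = (a, b)" "a \<in> mats n w" "b \<in> mats w n"
      "Q * b = - (a * P)" "Q * (N * b) = - (a * (N * P))"
      by (cases x) (auto simp: E_def add_eq_0_iff2 mult.assoc)
    note xa = x(4)[THEN mult_eq_assoc] x(5)[unfolded mult.assoc[symmetric], THEN mult_eq_assoc, unfolded mult.assoc]
    \<comment> \<open>Forced by the two requirements \<open>Y * P = - b\<close> and
      \<open>N * Y = Y * N\<close>: expand \<open>Y = Y * (P * S0 + N * P * S1)\<close>.\<close>
    define Y where "Y = - (b * S0 + N * b * S1)"
    have mY: "Y \<in> mats w w" using x m S by (simp add: Y_def mult.assoc)
    have QY: "Q * Y = a"
    proof -
      have "Q * Y = a * (P * S0 + N * P * S1)" by (simp add: Y_def algebra_simps xa)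
      then show ?thesis using x S by simp
    qed
    have QNY: "Q * N * Y = a * N"
    proof -
      have "Q * N * Y = a * N * (P * S0 + N * P * S1)" by (simp add: Y_def algebra_simps xa NNa)
      then show ?thesis using x m S by simp
    qed
    have YP: "Y * P = - b"
    proof -
      have "Y * P + b = 0"
      proof (rule local_datum_cogen[OF ld])
        have "Q * (Y * P + b) = Q * Y * P + Q * b" by (simp add: algebra_simps)
        then show "Q * (Y * P + b) = 0" by (simp add: QY x)
        have "Q * N * (Y * P + b) = Q * N * Y * P + Q * (N * b)" by (simp add: algebra_simps)
        then show "Q * N * (Y * P + b) = 0" by (simp only: QNY x) (simp add: mult.assoc)
      qed (use mY x in simp)
      then show ?thesis by (simp add: add_eq_0_iff2)
    qed
    have NY: "N * Y = Y * N"
    proof -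
      have "N * Y - Y * N = 0"
      proof (rule local_datum_cogen[OF ld])
        have "Q * (N * Y - Y * N) = Q * N * Y - Q * Y * N" by (simp add: algebra_simps)
        then show "Q * (N * Y - Y * N) = 0" by (simp add: QNY QY)
        have "Q * N * (N * Y - Y * N) = Q * (N * N) * Y - Q * N * Y * N" by (simp add: algebra_simps)
        then show "Q * N * (N * Y - Y * N) = 0" by (simp only: QNY NN) (simp add: NN mult.assoc)
      qed (use mY m in simp)
      then show ?thesis by simp
    qed
    show "x \<in> \<beta> ` ?Z"
      using mY NY by (intro image_eqI[of _ _ Y]) (auto simp: \<beta>_def x QY YP commutant_def)
  qed
  have sub\<beta>: "pvs.subspace (\<beta> ` ?Z)" and sub\<alpha>: "pvs.subspace (\<alpha> ` g)"
    using fp.linear_subspace_image[OF l\<beta>] commutant_space pp.linear_subspace_image[OF l\<alpha> g(2)] by auto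
  have \<alpha>E: "\<alpha> ` g \<subseteq> E" using m by (auto simp: \<alpha>_def g_def E_def mult.assoc)
  have \<beta>E: "\<beta> ` ?Z \<subseteq> E" unfolding \<beta>Z by blast
  have d\<beta>: "pvs.dim (\<beta> ` ?Z) = fvs.dim ?Z"
    by (rule fp.dim_inj_image[OF l\<beta> commutant_space(2,1)]) (use \<beta>inj in blast)
  have dE: "fvs.dim ?Z + pvs.dim (\<alpha> ` g) = 2 * n * w"
    using perp[OF sub\<alpha> \<alpha>E] unfolding perp\<alpha> \<beta>Z[symmetric] by (simp add: d\<beta> E)
  \<comment> \<open>Taking complements a second time: one inclusion is skew-symmetry of
    \<open>\<omega>\<close>, and the dimensions agree.\<close>
  have \<alpha>g: "\<alpha> ` g = {x \<in> E. \<forall>u\<in>\<beta> ` ?Z. \<omega> u x = 0}"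
  proof (rule pvs.subspace_dim_eq)
    show "pvs.subspace {x \<in> E. \<forall>u\<in>\<beta> ` ?Z. \<omega> u x = 0}"
      using E(2) by (auto simp: pvs.subspace_def \<omega>_def pscl_def algebra_simps)
    show "\<alpha> ` g \<subseteq> {x \<in> E. \<forall>u\<in>\<beta> ` ?Z. \<omega> u x = 0}"
    proof
      fix x assume x: "x \<in> \<alpha> ` g"
      have "\<omega> u x = 0" if "u \<in> \<beta> ` ?Z" for u
      proof -
        have "u \<in> {x \<in> E. \<forall>u\<in>\<alpha> ` g. \<omega> u x = 0}" using that unfolding perp\<alpha> \<beta>Z .
        then show ?thesis using x skew[of u x] by auto
      qed
      with x \<alpha>E show "x \<in> {x \<in> E. \<forall>u\<in>\<beta> ` ?Z. \<omega> u x = 0}" by blast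
    qed
    show "pvs.dim {x \<in> E. \<forall>u\<in>\<beta> ` ?Z. \<omega> u x = 0} \<le> pvs.dim (\<alpha> ` g)"
      using perp[OF sub\<beta> \<beta>E] dE by (simp add: d\<beta> E)
  qed (use sub\<alpha> in \<open>auto intro: pvs.fin_span_subset[OF E(1)]\<close>)
  have \<omega>\<beta>: "\<omega> (\<beta> Y') (\<beta> Y) = tr (P * Q * (Y * Y' - Y' * Y))" for Y Y'
    using tr_comm[of "Q * Y' * Y" P] tr_comm[of "Q * Y * Y'" P]
    by (simp add: \<omega>_def \<beta>_def algebra_simps)
  \<comment> \<open>On two vectors of the image of \<open>\<beta>\<close> the form
    \<open>\<omega>\<close> is the trace form of \<open>P * Q\<close>, so intersecting with the
    complement cuts out its radical.\<close>
  have int: "\<alpha> ` g \<inter> \<beta> ` ?Z = \<beta> ` ?H"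
    unfolding \<alpha>g using \<beta>E by (auto simp: commutant_rad_def \<omega>\<beta>)
  \<comment> \<open>Inserted into the two equations that describe the image of
    \<open>\<beta>\<close>, the vector \<open>\<alpha> C\<close> produces exactly the two
    commutation relations.\<close>
  have ctz: "ctz n (Q * N * P) (Q * P) = {C \<in> g. \<alpha> C \<in> \<beta> ` ?Z}"
  proof -
    have "C1 \<in> mats n n \<and> C0 \<in> mats n n \<and> Q * N * P * C1 = C1 * (Q * N * P) \<and>
        Q * N * P * C0 + Q * P * C1 = C1 * (Q * P) + C0 * (Q * N * P) \<longleftrightarrow>
      (C1, C0) \<in> g \<and> \<alpha> (C1, C0) \<in> \<beta> ` ?Z" for C1 C0
    proof -
      have "\<alpha> (C1, C0) \<in> E" if "(C1, C0) \<in> g" using \<alpha>E that by blast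
      moreover have "Q * snd (\<alpha> (C1, C0)) + fst (\<alpha> (C1, C0)) * P =
         (C1 * (Q * P) + C0 * (Q * N * P)) - (Q * N * P * C0 + Q * P * C1)"
        "Q * N * snd (\<alpha> (C1, C0)) + fst (\<alpha> (C1, C0)) * N * P = C1 * (Q * N * P) - Q * N * P * C1"
        by (simp_all add: \<alpha>_def algebra_simps NN NNa)
      ultimately show ?thesis unfolding \<beta>Z by (auto simp: g_def)
    qed
    then show ?thesis by (auto simp: ctz_def)
  qed
  \<comment> \<open>The image of the centralizer under \<open>\<alpha>\<close> has the dimension of
    the radical; the kernel of \<open>\<alpha>\<close> has dimension
    \<open>2 n^2 - dim (\<alpha>\<close> g)\<open>, and\<close>dim (\<alpha>
    \<open>g) = 2 n w - dim ?Z\<close>.\<close>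
  have "pvs.dim (ctz n (Q * N * P) (Q * P)) =
      pvs.dim (\<alpha> ` ctz n (Q * N * P) (Q * P)) + pvs.dim {x \<in> ctz n (Q * N * P) (Q * P). \<alpha> x = 0}"
    by (rule pp.rank_nullity[OF l\<alpha> ctz_space(2,1)])
  also have "\<alpha> ` ctz n (Q * N * P) (Q * P) = \<beta> ` ?H" unfolding ctz int[symmetric] by blast
  also have "{x \<in> ctz n (Q * N * P) (Q * P). \<alpha> x = 0} = {x \<in> g. \<alpha> x = 0}"
  proof -
    have "0 \<in> \<beta> ` ?Z" using sub\<beta> by (rule pvs.subspace_0)
    then show ?thesis unfolding ctz by auto
  qed
  also have "pvs.dim (\<beta> ` ?H) = fvs.dim ?H"
    by (rule fp.dim_inj_image[OF l\<beta> commutant_space(4,3)]) (use \<beta>inj in \<open>auto simp: commutant_rad_def\<close>)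
  finally have "cdim n (Q * N * P) (Q * P) = fvs.dim ?H + pvs.dim {x \<in> g. \<alpha> x = 0}" by (simp add: cdim_def)
  then show ?thesis using pp.rank_nullity[OF l\<alpha> g(1,2)] g(3) dE by simp
qed

text \<open>After summation both sides become \<open>\<Sum>h i - 2 n n'\<close>, because the widths
  add up to \<open>n + n'\<close>. The terms \<open>h i\<close> agree, since
  \<open>P' i * Q' i\<close> is \<open>P i * Q i\<close> plus a scalar and commutators have trace
  zero.\<close>

lemma (in reflection) index_preserved:
  "(\<Sum>i\<le>r. int (cdim n' (Q' i * N i * P' i) (Q' i * P' i))) - 2 * int r * (int n')\<^sup>2 =
   (\<Sum>i\<le>r. int (cdim n (Q i * N i * P i) (Q i * P i))) - 2 * int r * (int n)\<^sup>2"
proof -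
  define h where "h i = int (fvs.dim (commutant (w i) (N i)) + fvs.dim (commutant_rad (w i) (N i) (P i * Q i)))" for i
  have 1: "int (cdim n (Q i * N i * P i) (Q i * P i)) = 2 * (int n)\<^sup>2 - 2 * int n * int (w i) + h i"
    if "i \<le> r" for i
  proof -
    have "int (cdim n (Q i * N i * P i) (Q i * P i) + 2 * n * w i) = int (2 * n * n) + h i"
      unfolding cdim_local_datum[OF ld[OF that]] h_def by simp
    then show ?thesis by (simp add: power2_eq_square)
  qed
  have 2: "int (cdim n' (Q' i * N i * P' i) (Q' i * P' i)) = 2 * (int n')\<^sup>2 - 2 * int n' * int (w i) + h i"
    if "i \<le> r" for i
  proof -
    have "commutant_rad (w i) (N i) (P' i * Q' i) = commutant_rad (w i) (N i) (P i * Q i)"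
      using P'Q'[OF that that] commutant_rad_shift[of "w i" "N i" "P i * Q i" \<mu>] by (simp add: add.commute)
    then have "int (cdim n' (Q' i * N i * P' i) (Q' i * P' i) + 2 * n' * w i) = int (2 * n' * n') + h i"
      unfolding cdim_local_datum[OF local_datum'[OF that]] h_def by simp
    then show ?thesis by (simp add: power2_eq_square)
  qed
  have W: "(\<Sum>i\<le>r. int (w i)) = int n + int n'" using nn' by (metis of_nat_add of_nat_sum)
  have "(\<Sum>i\<le>r. 2 * (int k)\<^sup>2 - 2 * int k * int (w i) + h i)
      = 2 * (int r + 1) * (int k)\<^sup>2 - 2 * int k * (int n + int n') + (\<Sum>i\<le>r. h i)" for k
  proof -
    have "(\<Sum>i\<le>r. 2 * int k * int (w i)) = 2 * int k * (int n + int n')"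
      by (simp only: sum_distrib_left[symmetric] W)
    then show ?thesis by (simp add: sum.distrib sum_subtractf)
  qed
  note s = this
  have "(\<Sum>i\<le>r. int (cdim n (Q i * N i * P i) (Q i * P i))) = (\<Sum>i\<le>r. 2 * (int n)\<^sup>2 - 2 * int n * int (w i) + h i)"
    "(\<Sum>i\<le>r. int (cdim n' (Q' i * N i * P' i) (Q' i * P' i))) = (\<Sum>i\<le>r. 2 * (int n')\<^sup>2 - 2 * int n' * int (w i) + h i)"
    using 1 2 by (auto intro!: sum.cong)
  then show ?thesis unfolding s by (simp add: algebra_simps power2_eq_square)
qed

section \<open>Transfer to matrices of fixed size\<close>

definition to_mat :: "nat \<Rightarrow> nat \<Rightarrow> fmat \<Rightarrow> complex mat" where
  "to_mat m n X = mat m n (\<lambda>(i, j). entry X i j)"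

lift_definition of_mat :: "complex mat \<Rightarrow> fmat"
  is "\<lambda>A i j. if i < dim_row A \<and> j < dim_col A then A $$ (i, j) else 0"
proof -
  fix A :: "complex mat"
  show "\<exists>n. \<forall>i j. n \<le> i \<or> n \<le> j \<longrightarrow> (if i < dim_row A \<and> j < dim_col A then A $$ (i, j) else 0) = 0"
    by (intro exI[of _ "max (dim_row A) (dim_col A)"]) auto
qed

lemma entry_of_mat: "entry (of_mat A) i j = (if i < dim_row A \<and> j < dim_col A then A $$ (i, j) else 0)"
  by (simp add: of_mat.rep_eq)

lemma to_mat_carrier [simp]: "to_mat m n X \<in> carrier_mat m n"
  and to_mat_dim [simp]: "dim_row (to_mat m n X) = m" "dim_col (to_mat m n X) = n"
  by (simp_all add: to_mat_def)

lemma to_mat_index [simp]: "i < m \<Longrightarrow> j < n \<Longrightarrow> to_mat m n X $$ (i, j) = entry X i j"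
  by (simp add: to_mat_def)

lemma of_mat_bounds [simp]: "dim_row A \<le> m \<Longrightarrow> rowb m (of_mat A)" "dim_col A \<le> n \<Longrightarrow> colb n (of_mat A)"
  by (auto simp: rowb_def colb_def entry_of_mat)

lemma of_mat_mats: "A \<in> carrier_mat m n \<Longrightarrow> of_mat A \<in> mats m n"
  by auto

lemma of_mat_to_mat [simp]: "X \<in> mats m n \<Longrightarrow> of_mat (to_mat m n X) = X"
  by (intro fmat_eqI) (auto simp: entry_of_mat rowb_def colb_def)

lemma to_mat_of_mat [simp]: "A \<in> carrier_mat m n \<Longrightarrow> to_mat m n (of_mat A) = A"
  by (intro eq_matI) (auto simp: entry_of_mat)

lemma to_mat_mult:
  assumes "colb k X" shows "to_mat m n (X * Y) = to_mat m k X * to_mat k n Y"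
  by (intro eq_matI) (auto simp: entry_times_colb[OF assms] scalar_prod_def atLeast0LessThan)

lemma to_mat_simps [simp]: "to_mat n n (idm n) = 1\<^sub>m n" "to_mat m n 0 = 0\<^sub>m m n"
  "to_mat m n (X + Y) = to_mat m n X + to_mat m n Y" "to_mat m n (c *\<^sub>F X) = c \<cdot>\<^sub>m to_mat m n X"
  by (auto intro!: eq_matI)

lemma to_mat_inj: "X \<in> mats m n \<Longrightarrow> Y \<in> mats m n \<Longrightarrow> to_mat m n X = to_mat m n Y \<Longrightarrow> X = Y"
  by (metis of_mat_to_mat)

lemma eigenvector_exists:
  assumes "a \<in> mats k k" "1 \<le> k"
  obtains c x where "x \<in> mats k 1" "x \<noteq> 0" "a * x = c *\<^sub>F x"
proof -
  have "spectrum (to_mat k k a) \<noteq> {}" using assms by (intro spectrum_non_empty) auto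
  then obtain c where "eigenvalue (to_mat k k a) c" by (auto simp: spectrum_def)
  then obtain v where v: "v \<in> carrier_vec k" "v \<noteq> 0\<^sub>v k" "to_mat k k a *\<^sub>v v = c \<cdot>\<^sub>v v"
    by (auto simp: eigenvalue_def eigenvector_def)
  define x where "x = of_mat (mat k 1 (\<lambda>(i, j). v $ i))"
  have ex: "entry x i j = (if i < k \<and> j = 0 then v $ i else 0)" for i j by (simp add: x_def entry_of_mat)
  show ?thesis
  proof (rule that)
    show "x \<in> mats k 1" by (simp add: x_def)
    obtain i where "i < k" "v $ i \<noteq> 0" using v(1,2) by (auto simp: vec_eq_iff)
    then have "entry x i 0 \<noteq> 0" by (simp add: ex)
    then show "x \<noteq> 0" by auto
    show "a * x = c *\<^sub>F x"
    proof (rule fmat_eqI)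
      fix i j
      show "entry (a * x) i j = entry (c *\<^sub>F x) i j"
      proof (cases "i < k \<and> j = 0")
        case True
        then have "entry (a * x) i j = (to_mat k k a *\<^sub>v v) $ i"
          using assms(1) v(1) by (simp add: entry_times_colb[of k] scalar_prod_def ex atLeast0LessThan)
        then show ?thesis using True v by (simp add: ex)
      next
        case False
        have "a * x \<in> mats k 1" using assms(1) by (simp add: x_def)
        from matsD[OF this, of i j] show ?thesis using False by (auto simp: ex)
      qed
    qed
  qed
qed

section \<open>Centralizers of square matrices\<close>

text \<open>The defect \<open>idm k - G * H\<close> is idempotent of trace zero, so it splits
  through size zero.\<close>

lemma left_inverse_is_right_inverse:
  assumes "G \<in> mats k k" "H \<in> mats k k" "H * G = idm k" shows "G * H = idm k"
proof -
  define e where "e = idm k - G * H"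
  have e: "e \<in> mats k k" "e * e = e" using assms(1,2)
    by (simp_all add: e_def algebra_simps mult_eq_assoc[OF assms(3)])
  obtain l g h where *: "g \<in> mats k l" "e = g * h" "of_nat l = tr e"
    by (rule idempotent_split[OF e]) blast
  have "tr e = 0" using tr_comm[of G H] assms(3) by (simp add: e_def)
  then have "l = 0" using *(3) by simp
  then have "e = 0" using * by simp
  then show ?thesis by (simp add: e_def)
qed

text \<open>Both injections have complements of size \<open>k - l\<close>, computed by the trace;
  the extension maps one complement onto the other.\<close>

lemma extend_to_invertible:
  assumes m: "\<alpha> \<in> mats k l" "\<beta> \<in> mats k l" "\<alpha>' \<in> mats l k" "\<beta>' \<in> mats l k"
    and inv: "\<alpha>' * \<alpha> = idm l" "\<beta>' * \<beta> = idm l"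
  obtains \<Delta> \<Delta>' where "\<Delta> \<in> mats k k" "\<Delta>' \<in> mats k k" "\<Delta>' * \<Delta> = idm k" "\<Delta> * \<alpha> = \<beta>"
proof -
  have split: "\<exists>g h. g \<in> mats k (k - l) \<and> h \<in> mats (k - l) k \<and> idm k - \<gamma> * \<gamma>' = g * h \<and> h * g = idm (k - l) \<and>
      h * \<gamma> = 0 \<and> \<gamma>' * g = 0"
    if \<gamma>: "\<gamma> \<in> mats k l" "\<gamma>' \<in> mats l k" "\<gamma>' * \<gamma> = idm l" for \<gamma> \<gamma>'
  proof -
    define e where "e = idm k - \<gamma> * \<gamma>'"
    have e: "e \<in> mats k k" "e * e = e" using \<gamma>(1,2)
      by (simp_all add: e_def algebra_simps mult_eq_assoc[OF \<gamma>(3)])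
    obtain l' g h where *: "g \<in> mats k l'" "h \<in> mats l' k" "e = g * h" "h * g = idm l'" "of_nat l' = tr e"
      by (rule idempotent_split[OF e]) blast
    have "tr e = of_nat k - of_nat l" using tr_comm[of \<gamma> \<gamma>'] \<gamma>(3) by (simp add: e_def)
    then have "of_nat (l' + l) = (of_nat k :: complex)" using *(5) by simp
    then have l': "l' = k - l" using of_nat_eq_iff by (metis diff_add_inverse2)
    have ez: "e * \<gamma> = 0" "\<gamma>' * e = 0" using \<gamma>(1,2) by (simp_all add: e_def algebra_simps \<gamma>(3) mult_eq_assoc[OF \<gamma>(3)])
    have "h * \<gamma> = h * g * (h * \<gamma>)" using *(2,4) by simp
    also have "\<dots> = h * (e * \<gamma>)" by (simp only: *(3) mult.assoc)
    finally have 1: "h * \<gamma> = 0" by (simp add: ez)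
    have "\<gamma>' * g = \<gamma>' * g * (h * g)" using *(1,4) by simp
    also have "\<dots> = \<gamma>' * e * g" by (simp only: *(3) mult.assoc)
    finally have 2: "\<gamma>' * g = 0" by (simp add: ez)
    show ?thesis using * 1 2 l' by (intro exI[of _ g] exI[of _ h]) (simp add: e_def)
  qed
  obtain g1 h1 where 1: "g1 \<in> mats k (k - l)" "h1 \<in> mats (k - l) k" "idm k - \<alpha> * \<alpha>' = g1 * h1"
    "h1 * g1 = idm (k - l)" "h1 * \<alpha> = 0" "\<alpha>' * g1 = 0"
    using split[OF m(1,3) inv(1)] by blast
  obtain g2 h2 where 2: "g2 \<in> mats k (k - l)" "h2 \<in> mats (k - l) k" "idm k - \<beta> * \<beta>' = g2 * h2"
    "h2 * g2 = idm (k - l)" "h2 * \<beta> = 0" "\<beta>' * g2 = 0"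
    using split[OF m(2,4) inv(2)] by blast
  show ?thesis
  proof (rule that)
    show "\<beta> * \<alpha>' + g2 * h1 \<in> mats k k" "\<alpha> * \<beta>' + g1 * h2 \<in> mats k k" using m 1(1,2) 2(1,2) by simp_all
    have "(\<alpha> * \<beta>' + g1 * h2) * (\<beta> * \<alpha>' + g2 * h1) = \<alpha> * \<alpha>' + g1 * h1"
      using m 1(1,2) 2(1,2) by (simp add: algebra_simps mult_eq_assoc[OF inv(2)] mult_eq_assoc[OF 2(6)]
        mult_eq_assoc[OF 2(5)] mult_eq_assoc[OF 2(4)])
    also have "\<dots> = idm k" by (simp add: 1(3)[symmetric])
    finally show "(\<alpha> * \<beta>' + g1 * h2) * (\<beta> * \<alpha>' + g2 * h1) = idm k" .
    show "(\<beta> * \<alpha>' + g2 * h1) * \<alpha> = \<beta>" using m by (simp add: algebra_simps inv(1) 1(5))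
  qed
qed

text \<open>The matrix \<open>L(q,...,q; ls)\<close>. The summand \<open>prj q q\<close> is the
  identity block directly to the right of the first diagonal block, absent in the last row of
  blocks.\<close>

fun Lf :: "nat \<Rightarrow> complex list \<Rightarrow> fmat" where
  "Lf q [] = 0"
| "Lf q (l # ls) = l *\<^sub>F idm q + (if ls = [] then 0 else prj q q) +
     emb q (length ls * q) * Lf q ls * prj q (length ls * q)"

lemma Lf_mats: "Lf q ls \<in> mats (length ls * q) (length ls * q)"
proof (induction ls)
  case (Cons l ls)
  have "ls \<noteq> [] \<Longrightarrow> q \<le> length ls * q" by (cases ls) auto
  then have "ls \<noteq> [] \<Longrightarrow> prj q q \<in> mats (q + length ls * q) (q + length ls * q)" by simp
  then show ?case by (auto simp: mult.assoc)
qed simp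

lemma of_mat_L_mat: "of_mat (L_mat (replicate (length ls) q) ls) = Lf q ls
  \<and> L_mat (replicate (length ls) q) ls \<in> carrier_mat (length ls * q) (length ls * q)"
proof (induction ls)
  case Nil
  then show ?case by (auto intro!: fmat_eqI simp: entry_of_mat)
next
  case (Cons l ls)
  define \<rho> where "\<rho> = length ls * q"
  let ?L = "L_mat (replicate (length ls) q) ls"
  have L: "?L \<in> carrier_mat \<rho> \<rho>" "of_mat ?L = Lf q ls" using Cons by (auto simp: \<rho>_def)
  have \<rho>: "sum_list (replicate (length ls) q) = \<rho>" by (simp add: sum_list_replicate \<rho>_def)
  define X where "X = mat q \<rho> (\<lambda>(a, b). if b < hd (replicate (length ls) q) \<and> a = b then 1 else (0::complex))"
  have eq: "L_mat (replicate (length (l # ls)) q) (l # ls) = four_block_mat (l \<cdot>\<^sub>m 1\<^sub>m q) X (0\<^sub>m \<rho> q) ?L"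
    by (simp add: \<rho> X_def)
  have m: "Lf q ls \<in> mats \<rho> \<rho>" unfolding \<rho>_def by (rule Lf_mats)
  have "of_mat (four_block_mat (l \<cdot>\<^sub>m 1\<^sub>m q) X (0\<^sub>m \<rho> q) ?L) = Lf q (l # ls)"
  proof (rule fmat_eqI)
    fix i j
    have 1: "entry (emb q \<rho> * Lf q ls * prj q \<rho>) i j =
        (if q \<le> i \<and> q \<le> j then entry (Lf q ls) (i - q) (j - q) else 0)"
    proof -
      have "i < q + \<rho> \<or> \<rho> \<le> i - q" "j < q + \<rho> \<or> \<rho> \<le> j - q" by arith+
      then show ?thesis using matsD[OF m, of "i - q" "j - q"] by (auto simp: entry_mult_prj entry_emb_mult)
    qed
    have q: "q \<le> \<rho>" if "ls \<noteq> []" using that by (cases ls) (auto simp: \<rho>_def)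
    have 2: "\<rho> = 0" if "ls = []" using that by (simp add: \<rho>_def)
    have h: "hd (replicate (length ls) q) = q" if "ls \<noteq> []" using that by (cases ls) auto
    show "entry (of_mat (four_block_mat (l \<cdot>\<^sub>m 1\<^sub>m q) X (0\<^sub>m \<rho> q) ?L)) i j = entry (Lf q (l # ls)) i j"
    proof (cases "i < q + \<rho> \<and> j < q + \<rho>")
      case True
      have "entry (of_mat (four_block_mat (l \<cdot>\<^sub>m 1\<^sub>m q) X (0\<^sub>m \<rho> q) ?L)) i j =
        (if i < q then if j < q then (if i = j then l else 0)
          else (if ls \<noteq> [] \<and> j - q < q \<and> i = j - q then 1 else 0)
         else if j < q then 0 else entry (Lf q ls) (i - q) (j - q))"
      proof -
        have eL: "entry (Lf q ls) (i - q) (j - q) = ?L $$ (i - q, j - q)" if "q \<le> i" "q \<le> j"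
          unfolding L(2)[symmetric] using True L(1) that by (auto simp: entry_of_mat)
        have eX: "X $$ (i, j - q) = (if ls \<noteq> [] \<and> j - q < q \<and> i = j - q then 1 else 0)" if "i < q" "q \<le> j"
        proof -
          have "j - q < \<rho>" using True that by arith
          moreover have "ls \<noteq> []" using True that 2 by auto
          ultimately show ?thesis using that h by (simp add: X_def)
        qed
        show ?thesis
          using True L(1) eL eX by (simp add: entry_of_mat) (auto simp: X_def)
      qed
      also have "\<dots> = entry (Lf q (l # ls)) i j"
        using True q 2 by (auto simp: 1[unfolded \<rho>_def] \<rho>_def)
      finally show ?thesis .
    next
      case False
      then show ?thesis
        using L(1) matsD[OF Lf_mats[of q "l # ls"], of i j] by (auto simp: entry_of_mat \<rho>_def simp del: Lf.simps)
    qed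
  qed
  then show ?case unfolding eq using L(1) by (simp add: X_def \<rho>_def)
qed

lemma Lf_blocks:
  assumes "\<rho> = length ls * q"
  defines "X \<equiv> (if ls = [] then 0 else idm q)"
  shows "prj 0 q * Lf q (l # ls) = l *\<^sub>F prj 0 q + X * prj q \<rho>"
    "prj q \<rho> * Lf q (l # ls) = Lf q ls * prj q \<rho>" "X \<in> mats q \<rho>"
proof -
  have q: "q \<le> \<rho>" if "ls \<noteq> []" using that by (cases ls) (auto simp: assms(1))
  have m: "Lf q ls \<in> mats \<rho> \<rho>" unfolding assms(1) by (rule Lf_mats)
  have e0: "idm q = emb 0 q" "prj 0 q = idm q" by (auto intro!: fmat_eqI)
  have 1: "prj 0 q * prj q q = X * prj q \<rho>" if "ls \<noteq> []"
    unfolding X_def e0(2) using that q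
    by (auto intro!: fmat_eqI simp: entry_mult_prj)
  have 2: "prj q \<rho> * prj q q = 0"
    by (rule fmat_eqI) (auto simp: entry_prj_mult)
  show "prj 0 q * Lf q (l # ls) = l *\<^sub>F prj 0 q + X * prj q \<rho>"
    using 1 by (auto simp: assms(1)[symmetric] distrib_left mult.assoc X_def)
  have "prj q \<rho> * idm q = 0" by (simp add: e0(1))
  then show "prj q \<rho> * Lf q (l # ls) = Lf q ls * prj q \<rho>"
    using m by (auto simp: assms(1)[symmetric] distrib_left mult.assoc 2)
  show "X \<in> mats q \<rho>" using q by (auto simp: X_def)
qed

text \<open>The first block row of the eigenvector equation says that if the first block of
  \<open>z\<close> vanishes then so does the next one; the remaining rows are the same equation for
  the shorter list.\<close>

lemma Lf_eigenvector_zero: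
  assumes "rowb (length ls * q) z" "Lf q ls * z = c *\<^sub>F z" "ls \<noteq> [] \<longrightarrow> idm q * z = 0"
  shows "z = 0"
  using assms
proof (induction ls arbitrary: z)
  case (Cons l ls)
  define \<rho> where "\<rho> = length ls * q"
  note B = Lf_blocks(1,2)[OF \<rho>_def, where l = l]
  have e0: "prj 0 q = idm q" by (auto intro!: fmat_eqI)
  have z0: "prj 0 q * z = 0" using Cons.prems by (simp add: e0)
  define z' where "z' = prj q \<rho> * z"
  have z: "z = emb q \<rho> * z'"
  proof -
    have "z = (emb 0 q * prj 0 q + emb q \<rho> * prj q \<rho>) * z"
      unfolding idm_split[symmetric] using Cons.prems(1) by (simp add: \<rho>_def)
    also have "\<dots> = emb 0 q * (prj 0 q * z) + emb q \<rho> * z'" by (simp only: distrib_right mult.assoc z'_def)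
    finally show ?thesis by (simp add: z0)
  qed
  have "prj 0 q * (Lf q (l # ls) * z) = l *\<^sub>F (prj 0 q * z) + (if ls = [] then 0 else idm q) * z'"
    unfolding mult.assoc[symmetric] B(1) by (simp add: distrib_right mult.assoc z'_def)
  moreover have "prj 0 q * (Lf q (l # ls) * z) = 0"
    unfolding Cons.prems(2) by (simp add: z0)
  ultimately have "(if ls = [] then 0 else idm q) * z' = 0" by (simp add: z0)
  then have 1: "ls \<noteq> [] \<longrightarrow> idm q * z' = 0" by auto
  have "prj q \<rho> * (Lf q (l # ls) * z) = Lf q ls * z'"
    unfolding mult.assoc[symmetric] B(2) by (simp add: mult.assoc z'_def)
  then have 2: "Lf q ls * z' = c *\<^sub>F z'" unfolding Cons.prems(2) by (simp add: z'_def)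
  have "rowb (length ls * q) z'" by (simp add: z'_def \<rho>_def)
  from Cons.IH[OF this 2 1] show ?case by (simp add: z)
qed simp

text \<open>Every eigenspace of \<open>a\<close> has dimension at most \<open>q\<close>;
  independence of the \<open>\<kappa>\<close> eigenvectors in \<open>g\<close> is expressed by the
  left inverse \<open>h\<close>.\<close>

definition kernel_bound :: "nat \<Rightarrow> nat \<Rightarrow> fmat \<Rightarrow> bool" where
  "kernel_bound k q a \<longleftrightarrow> (\<forall>\<kappa> c g h. g \<in> mats k \<kappa> \<longrightarrow> h \<in> mats \<kappa> k \<longrightarrow> h * g = idm \<kappa> \<longrightarrow>
     a * g = c *\<^sub>F g \<longrightarrow> \<kappa> \<le> q)"

text \<open>The matrix \<open>a\<close> is an extension of \<open>b\<close> by a scalar block; its conjugacy class is determined by the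
  requirement that the off-diagonal block is injective on the kernel of \<open>b - c\<close>.\<close>

lemma extension_conjugate:
  assumes a: "a \<in> mats k k"
    and F: "y \<in> mats k \<rho>" "x \<in> mats \<rho> k" "s \<in> mats k \<rho>" "t \<in> mats \<rho> k" "x * s = idm \<rho>" "t * y = idm \<rho>"
      "g \<in> mats k q" "h \<in> mats q k" "h * g = idm q" "x * g = 0" "h * s = 0" "s * x + g * h = idm k" "\<rho> + q = k"
    and ay: "a - c *\<^sub>F idm k = y * x"
    and \<rho>: "\<rho> = length ls * q"
    and e: "e \<in> mats \<rho> \<rho>" "e' \<in> mats \<rho> \<rho>" "e' * e = idm \<rho>" "(c *\<^sub>F idm \<rho> + x * y) * e = e * Lf q ls"
  obtains G H where "G \<in> mats k k" "H \<in> mats k k" "H * G = idm k" "a * G = G * Lf q (c # ls)"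
proof -
  note Fa = F(5,6,9,10,11)[THEN mult_eq_assoc] and ea = e(3)[THEN mult_eq_assoc]
  define L where "L = Lf q ls"
  have L: "L \<in> mats \<rho> \<rho>" unfolding L_def \<rho> by (rule Lf_mats)
  define M where "M = L - c *\<^sub>F idm \<rho>"
  have M: "M \<in> mats \<rho> \<rho>" using L by (simp add: M_def)
  have eM: "x * y * e = e * M" using e by (simp add: M_def L_def algebra_simps)
  define X where "X = (if ls = [] then 0 else idm q)"
  note B = Lf_blocks(1,2)[OF \<rho>, where l = c, folded X_def L_def]
    Lf_blocks(3)[OF \<rho>, folded X_def]
  \<comment> \<open>With respect to the columns of \<open>g\<close> and \<open>s * e\<close>, the
    matrix \<open>a\<close> is block triangular with diagonal blocks \<open>c\<close> and
    \<open>L\<close> and off-diagonal block \<open>X0\<close>, whereas the target has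
    \<open>X\<close> there. Passing to the columns \<open>g * \<Delta>\<close> and
    \<open>s * e + g * Y\<close> turns the goal into
    \<open>X0 = \<Delta> * X + Y * M\<close>.\<close>
  define X0 where "X0 = h * y * e"
  have X0: "X0 \<in> mats q \<rho>" using F e by (simp add: X0_def mult.assoc)
  have ye: "y * e = g * X0 + s * (e * M)"
  proof -
    have "y * e = (s * x + g * h) * (y * e)" using F(1) by (simp add: F(12))
    also have "\<dots> = s * (x * y * e) + g * X0" by (simp only: X0_def distrib_right mult.assoc)
    finally show ?thesis by (simp add: eM)
  qed
  obtain rM \<kappa> y' x' s' t' gM hM where FM: "y' \<in> mats \<rho> rM" "x' \<in> mats rM \<rho>" "s' \<in> mats \<rho> rM" "t' \<in> mats rM \<rho>"
    "M = y' * x'" "x' * s' = idm rM" "t' * y' = idm rM" "gM \<in> mats \<rho> \<kappa>" "hM \<in> mats \<kappa> \<rho>" "hM * gM = idm \<kappa>"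
    "x' * gM = 0" "hM * s' = 0" "s' * x' + gM * hM = idm \<rho>" "rM + \<kappa> = \<rho>"
    by (rule full_rank_factorisation[OF M])
  have MgM: "M * gM = 0" by (simp add: FM(5) FM(11) mult.assoc)
  have cancel_gM: "z = 0" if "gM * z = 0" "rowb \<kappa> z" for z
    using mult_eq_assoc[OF FM(10), of z] that by simp
  \<comment> \<open>\<open>X\<close> is injective on the kernel of \<open>M\<close>: an eigenvector
    of \<open>L\<close> with vanishing first block is zero.\<close>
  obtain \<alpha>' where \<alpha>': "\<alpha>' \<in> mats \<kappa> q" "\<alpha>' * (X * gM) = idm \<kappa>"
  proof (rule left_inverse_exists[of "X * gM" q \<kappa>])
    show "X * gM \<in> mats q \<kappa>" using B(3) FM(8) by simp
    fix z assume z: "z \<in> mats \<kappa> \<kappa>" "X * gM * z = 0"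
    have "M * (gM * z) = 0" by (simp add: mult.assoc[symmetric] MgM)
    then have "L * (gM * z) = c *\<^sub>F (gM * z)" using FM(8) by (simp add: M_def algebra_simps)
    moreover have "ls \<noteq> [] \<longrightarrow> idm q * (gM * z) = 0" using z(2) by (auto simp: X_def mult.assoc)
    moreover have "rowb (length ls * q) (gM * z)" using FM(8) by (simp add: \<rho>)
    ultimately have "gM * z = 0" unfolding L_def by (intro Lf_eigenvector_zero)
    then show "z = 0" using cancel_gM z(1) by simp
  qed
  \<comment> \<open>\<open>X0\<close> is injective there too, because on the kernel of
    \<open>M\<close> the injective matrix \<open>y * e\<close> coincides with \<open>g * X0\<close>.
    Thus some invertible \<open>\<Delta>\<close> matches the two injections.\<close>
  obtain \<beta>' where \<beta>': "\<beta>' \<in> mats \<kappa> q" "\<beta>' * (X0 * gM) = idm \<kappa>"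
  proof (rule left_inverse_exists[of "X0 * gM" q \<kappa>])
    show "X0 * gM \<in> mats q \<kappa>" using X0 FM(8) by simp
    fix z assume z: "z \<in> mats \<kappa> \<kappa>" "X0 * gM * z = 0"
    have "y * (e * (gM * z)) = (y * e) * gM * z" by (simp add: mult.assoc)
    also have "\<dots> = g * (X0 * gM * z) + s * (e * (M * gM)) * z" by (simp only: ye distrib_right mult.assoc)
    also have "\<dots> = 0" by (simp only: z MgM) simp
    finally have "e' * (t * (y * (e * (gM * z)))) = 0" by simp
    then have "gM * z = 0" using FM(8) e by (simp add: Fa ea)
    then show "z = 0" using cancel_gM z(1) by simp
  qed
  obtain \<Delta> \<Delta>' where \<Delta>: "\<Delta> \<in> mats q q" "\<Delta>' \<in> mats q q" "\<Delta>' * \<Delta> = idm q" "\<Delta> * (X * gM) = X0 * gM"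
    by (rule extend_to_invertible[of "X * gM" q \<kappa> "X0 * gM" \<alpha>' \<beta>'])
      (use B(3) X0 FM(8) \<alpha>' \<beta>' in simp_all)
  \<comment> \<open>By the choice of \<open>\<Delta>\<close> the difference
    \<open>X0 - \<Delta> * X\<close> vanishes on the kernel of \<open>M\<close>, so it is a left
    multiple of \<open>M\<close>; \<open>s' * t'\<close> is a generalised inverse of
    \<open>M\<close>.\<close>
  define Y where "Y = (X0 - \<Delta> * X) * s' * t'"
  have Y: "Y \<in> mats q \<rho>" using X0 \<Delta> FM(4) by (simp add: Y_def mult.assoc)
  have YM: "X0 = \<Delta> * X + Y * M"
  proof -
    have z: "(X0 - \<Delta> * X) * gM = 0" using \<Delta>(4) by (simp add: algebra_simps)
    have "X0 - \<Delta> * X = (X0 - \<Delta> * X) * (s' * x' + gM * hM)" using X0 B(3) by (simp add: FM(13))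
    also have "\<dots> = (X0 - \<Delta> * X) * s' * x' + (X0 - \<Delta> * X) * gM * hM" by (simp only: distrib_left mult.assoc)
    also have "\<dots> = (X0 - \<Delta> * X) * s' * (t' * y') * x'" using FM(3) by (simp add: z FM(7) mult.assoc)
    also have "\<dots> = Y * M" by (simp only: Y_def FM(5) mult.assoc)
    finally show ?thesis by (simp add: algebra_simps)
  qed
  define g2 s2 where "g2 = g * \<Delta>" and "s2 = s * e + g * Y"
  have xs: "x * s2 = e" "x * g2 = 0" "h * s2 = Y" "h * g2 = \<Delta>"
    using F(3,7) e Y \<Delta> by (simp_all add: g2_def s2_def distrib_left F Fa)
  have a': "a * z = c *\<^sub>F z + y * (x * z)" if "rowb k z" for z
  proof -
    have "a * z = (c *\<^sub>F idm k + (a - c *\<^sub>F idm k)) * z" by simp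
    also have "\<dots> = c *\<^sub>F z + y * (x * z)" using that unfolding ay by (simp add: distrib_right mult.assoc)
    finally show ?thesis .
  qed
  have g2: "g2 \<in> mats k q" and s2: "s2 \<in> mats k \<rho>" using F(3,7) e Y \<Delta> by (simp_all add: g2_def s2_def)
  have ag2: "a * g2 = c *\<^sub>F g2" using a'[of g2] g2 by (simp add: xs)
  have as2: "a * s2 = g2 * X + s2 * L"
  proof -
    have "a * s2 = c *\<^sub>F s2 + y * e" using a'[of s2] s2 by (simp add: xs)
    also have "y * e = g * (\<Delta> * X + Y * M) + s * (e * M)" by (simp add: ye YM[symmetric])
    also have "\<dots> = g2 * X + s2 * M" by (simp add: g2_def s2_def algebra_simps)
    finally show ?thesis using s2 L by (simp add: M_def algebra_simps)
  qed
  define G where "G = g2 * prj 0 q + s2 * prj q \<rho>"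
  define H where "H = emb 0 q * \<Delta>' * (h - Y * e' * x) + emb q \<rho> * e' * x"
  have k: "k = q + \<rho>" using F(13) by simp
  show ?thesis
  proof (rule that)
    show mG: "G \<in> mats k k" "H \<in> mats k k" using g2 s2 F(2,8) by (simp_all add: G_def H_def k mult.assoc)
    have "H * g2 = emb 0 q * (\<Delta>' * \<Delta>)" by (simp add: H_def algebra_simps xs)
    then have Hg: "H * g2 = emb 0 q" by (simp add: \<Delta>(3))
    have "H * s2 = emb 0 q * (\<Delta>' * (Y - Y * (e' * e))) + emb q \<rho> * (e' * e)"
      by (simp only: H_def distrib_right left_diff_distrib mult.assoc xs)
    then have Hs: "H * s2 = emb q \<rho>" using Y by (simp add: e(3))
    show "H * G = idm k"
      by (simp only: G_def distrib_left mult.assoc[symmetric] Hg Hs k idm_split)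
    have "a * G = c *\<^sub>F (g2 * prj 0 q) + (g2 * (X * prj q \<rho>) + s2 * (L * prj q \<rho>))"
      by (simp only: G_def distrib_left mult.assoc[symmetric] ag2 as2) (simp add: algebra_simps)
    also have "\<dots> = g2 * (prj 0 q * Lf q (c # ls)) + s2 * (prj q \<rho> * Lf q (c # ls))"
      unfolding B by (simp add: algebra_simps)
    finally show "a * G = G * Lf q (c # ls)" by (simp only: G_def distrib_right mult.assoc)
  qed
qed

text \<open>Write \<open>a - c = y * x\<close> with a \<open>\<kappa>\<close>-dimensional kernel and
  pass to the smaller matrix \<open>b = c + x * y\<close>. The map
  \<open>Y \<mapsto> x * Y * s\<close> sends the commutant of \<open>a\<close> into that of
  \<open>b\<close>; an element of its kernel satisfies \<open>x * Y = 0\<close> and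
  \<open>Y * y = 0\<close>, so it is determined by a \<open>\<kappa> \<times> \<kappa>\<close>
  block. This gives the bound \<open>\<rho> q + \<kappa>^2\<close>, and
  \<open>\<kappa> \<le> q\<close>. Equality forces \<open>\<kappa> = q\<close> and equality for
  \<open>b\<close>, and \<open>extension_conjugate\<close> puts one more block in front.\<close>

theorem commutant_dim_le:
  assumes "a \<in> mats k k" "kernel_bound k q a"
  shows "fvs.dim (commutant k a) \<le> k * q"
    and "fvs.dim (commutant k a) = k * q \<Longrightarrow> \<exists>ls G H. k = length ls * q \<and> G \<in> mats k k \<and> H \<in> mats k k \<and>
      H * G = idm k \<and> a * G = G * Lf q ls"
proof -
  have "fvs.dim (commutant k a) \<le> k * q \<and> (fvs.dim (commutant k a) = k * q \<longrightarrow>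
     (\<exists>ls G H. k = length ls * q \<and> G \<in> mats k k \<and> H \<in> mats k k \<and> H * G = idm k \<and> a * G = G * Lf q ls))"
    using assms
  proof (induction k arbitrary: a rule: less_induct)
    case (less k)
    show ?case
    proof (cases "k = 0")
      case True
      then have "commutant k a = {0}" using less.prems by (auto simp: commutant_def)
      then show ?thesis using True less.prems(1) by (auto intro!: exI[of _ "[]"])
    next
      case False
      then have k1: "1 \<le> k" by simp
      obtain c x1 where x1: "x1 \<in> mats k 1" "x1 \<noteq> 0" "a * x1 = c *\<^sub>F x1"
        by (rule eigenvector_exists[OF less.prems(1) k1])
      have mA: "a - c *\<^sub>F idm k \<in> mats k k" using less.prems(1) by simp
      obtain \<rho> \<kappa> y x s t g h where F: "y \<in> mats k \<rho>" "x \<in> mats \<rho> k" "s \<in> mats k \<rho>" "t \<in> mats \<rho> k"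
        "a - c *\<^sub>F idm k = y * x" "x * s = idm \<rho>" "t * y = idm \<rho>"
        "g \<in> mats k \<kappa>" "h \<in> mats \<kappa> k" "h * g = idm \<kappa>" "x * g = 0" "h * s = 0"
        "s * x + g * h = idm k" "\<rho> + \<kappa> = k"
        by (rule full_rank_factorisation[OF mA])
      note Fa = F(6,7,10,11,12)[THEN mult_eq_assoc]
      have a: "a = c *\<^sub>F idm k + y * x" using F(5) by (simp add: algebra_simps)
      have \<kappa>1: "1 \<le> \<kappa>"
      proof (rule ccontr)
        assume "\<not> 1 \<le> \<kappa>"
        then have "\<kappa> = 0" by simp
        then have sx: "s * x = idm k" using F(8,13) by simp
        have "y * (x * x1) = 0" using x1 by (simp add: F(5)[symmetric] mult.assoc[symmetric] left_diff_distrib)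
        then have "s * (t * (y * (x * x1))) = 0" by simp
        then have "s * (x * x1) = 0" using F(2) by (simp add: Fa)
        then have "x1 = 0" using x1(1) mult_eq_assoc[OF sx, of x1] by simp
        then show False using x1(2) by simp
      qed
      have "a * g = c *\<^sub>F g" using F(8) by (simp add: a distrib_right mult.assoc F(11))
      then have \<kappa>q: "\<kappa> \<le> q" using less.prems(2) F(8,9,10) unfolding kernel_bound_def by blast
      define b where "b = c *\<^sub>F idm \<rho> + x * y"
      have mb: "b \<in> mats \<rho> \<rho>" using F by (simp add: b_def)
      have ay: "a * y = y * b" and xa: "x * a = b * x" using F(1,2) by (simp_all add: a b_def algebra_simps)
      have kb: "kernel_bound \<rho> q b"
        unfolding kernel_bound_def
      proof (intro allI impI)
        fix \<kappa>' \<nu> g' h' assume *: "g' \<in> mats \<rho> \<kappa>'" "h' \<in> mats \<kappa>' \<rho>" "h' * g' = idm \<kappa>'" "b * g' = \<nu> *\<^sub>F g'"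
        \<comment> \<open>Since \<open>a * y = y * b\<close>, the injective matrix \<open>y\<close>
          carries eigenvectors of \<open>b\<close> to eigenvectors of \<open>a\<close>, so the bound
          passes to \<open>b\<close>.\<close>
        have "a * (y * g') = \<nu> *\<^sub>F (y * g')" by (simp add: mult.assoc[symmetric] ay) (simp add: mult.assoc *)
        moreover have "(h' * t) * (y * g') = idm \<kappa>'" using *(1) by (simp add: mult.assoc Fa *(3))
        moreover have "y * g' \<in> mats k \<kappa>'" "h' * t \<in> mats \<kappa>' k" using F(1,4) *(1,2) by simp_all
        ultimately show "\<kappa>' \<le> q" using less.prems(2) unfolding kernel_bound_def by blast
      qed
      have "\<rho> < k" using F(14) \<kappa>1 by simp
      note IH = less.IH[OF this mb kb]
      \<comment> \<open>A projection onto a complement of the image of \<open>y\<close>; the trace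
        shows that its size is \<open>\<kappa>\<close>, like that of the kernel of
        \<open>x\<close>.\<close>
      define e where "e = idm k - y * t"
      have e: "e \<in> mats k k" "e * e = e" using F(1,4)
        by (simp_all add: e_def algebra_simps Fa)
      obtain \<kappa>' g' h' where C: "g' \<in> mats k \<kappa>'" "h' \<in> mats \<kappa>' k" "e = g' * h'" "h' * g' = idm \<kappa>'" "of_nat \<kappa>' = tr e"
        by (rule idempotent_split[OF e])
      have "tr e = of_nat k - of_nat \<rho>" using tr_comm[of y t] F(7) by (simp add: e_def)
      then have "of_nat (\<kappa>' + \<rho>) = (of_nat (\<kappa> + \<rho>) :: complex)" using C(5) F(14) by (metis add.commute of_nat_add diff_add_cancel)
      then have \<kappa>': "\<kappa>' = \<kappa>" using of_nat_eq_iff by (metis add_right_cancel)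
      define \<phi> where "\<phi> Y = x * Y * s" for Y
      have l\<phi>: "Vector_Spaces.linear scl scl \<phi>"
        by unfold_locales (simp_all add: \<phi>_def algebra_simps)
      define K where "K = {Y \<in> commutant k a. \<phi> Y = 0}"
      have comm: "Y * y * x = y * x * Y" if "Y \<in> commutant k a" for Y
      proof -
        have "rowb k Y" "colb k Y" "(c *\<^sub>F idm k + y * x) * Y = Y * (c *\<^sub>F idm k + y * x)"
          using that by (simp_all add: commutant_def a[symmetric])
        then show ?thesis by (simp add: distrib_left distrib_right mult.assoc)
      qed
      have sK: "fvs.subspace K" unfolding K_def by (rule ff.subspace_kernel_on[OF l\<phi> commutant_space(1)])
      have fK: "fvs.fin_span K" by (rule fvs.fin_span_subset[OF commutant_space(2)]) (auto simp: K_def)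
      define \<psi> where "\<psi> Y = h * Y * g'" for Y
      have l\<psi>: "Vector_Spaces.linear scl scl \<psi>"
        by unfold_locales (simp_all add: \<psi>_def algebra_simps)
      have "fvs.dim K = fvs.dim (\<psi> ` K)"
      proof (rule ff.dim_inj_image[OF l\<psi> fK sK, symmetric])
        fix Y assume Y: "Y \<in> K" "\<psi> Y = 0"
        then have mY: "Y \<in> mats k k" and xYs: "x * Y * s = 0" and cY: "Y * y * x = y * x * Y"
          using comm by (auto simp: K_def \<phi>_def commutant_def)
        have "y * (x * (Y * g)) = Y * y * (x * g)" by (simp add: mult.assoc[symmetric] cY)
        then have "t * (y * (x * (Y * g))) = 0" by (simp add: F(11))
        then have xYg: "x * (Y * g) = 0" using F(2) by (simp add: Fa)
        have "x * Y = x * Y * (s * x + g * h)" using mY by (simp add: F(13) mult.assoc)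
        also have "\<dots> = (x * Y * s) * x + x * (Y * g) * h" by (simp only: distrib_left mult.assoc)
        finally have xY: "x * Y = 0" by (simp only: xYs xYg) simp
        have "Y * y = Y * y * (x * s)" using F(1) mY by (simp add: F(6))
        also have "\<dots> = Y * y * x * s" by (simp add: mult.assoc)
        also have "\<dots> = y * (x * Y) * s" by (simp only: cY) (simp only: mult.assoc)
        finally have Yy: "Y * y = 0" by (simp add: xY)
        have sp: "idm k = y * t + g' * h'" using C(3) by (simp add: e_def algebra_simps)
        have "Y = (s * x + g * h) * Y * idm k" using mY by (simp add: F(13))
        also have "\<dots> = s * (x * Y) + g * (h * Y) * idm k" using mY by (simp add: distrib_right mult.assoc)
        also have "\<dots> = g * h * (Y * y) * t + g * \<psi> Y * h'"
          by (simp only: xY sp \<psi>_def distrib_left mult.assoc mult_zero_right add_0_left)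
        finally show "Y = 0" by (simp add: Yy Y(2))
      qed
      also have "\<dots> \<le> fvs.dim (mats \<kappa> \<kappa>)"
        by (rule fvs.dim_mono_fin[OF fin_span_mats subspace_mats]) (use F(9) C(1) \<kappa>' in \<open>auto simp: \<psi>_def mult.assoc\<close>)
      finally have dK: "fvs.dim K \<le> \<kappa> * \<kappa>" by (simp add: dim_mats)
      have im: "\<phi> ` commutant k a \<subseteq> commutant \<rho> b"
      proof
        fix Z assume "Z \<in> \<phi> ` commutant k a"
        then obtain Y where Y: "Y \<in> mats k k" "a * Y = Y * a" "Y * y * x = y * x * Y" "Z = x * Y * s"
          using comm by (auto simp: \<phi>_def commutant_def)
        have "y * (x * (Y * g)) = Y * y * (x * g)" by (simp add: mult.assoc[symmetric] Y(3))
        then have "t * (y * (x * (Y * g))) = 0" by (simp add: F(11))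
        then have xYg: "x * (Y * g) = 0" using F(2) by (simp add: Fa)
        have "x * Y = x * Y * (s * x + g * h)" using Y(1) by (simp add: F(13) mult.assoc)
        also have "\<dots> = Z * x + x * (Y * g) * h" by (simp only: Y(4) distrib_left mult.assoc)
        finally have Zx: "Z * x = x * Y" by (simp add: xYg)
        have "b * Z = (b * x) * Y * s" by (simp add: Y(4) mult.assoc)
        also have "\<dots> = x * Y * (a * s)" by (simp only: xa[symmetric] mult.assoc Y(2)[THEN mult_eq_assoc])
        also have "\<dots> = Z * (x * a) * s" by (simp only: Zx[symmetric] mult.assoc)
        also have "\<dots> = Z * b" using mb by (simp add: xa mult.assoc F(6))
        finally show "Z \<in> commutant \<rho> b" using F(2,3) by (auto simp: commutant_def Y(4) mult.assoc)
      qed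
      have "fvs.dim (\<phi> ` commutant k a) \<le> fvs.dim (commutant \<rho> b)"
        by (rule fvs.dim_mono_fin[OF commutant_space(2,1) im])
      then have le: "fvs.dim (commutant k a) \<le> fvs.dim (commutant \<rho> b) + \<kappa> * \<kappa>"
        using ff.rank_nullity[OF l\<phi> commutant_space(2,1), of k a] dK unfolding K_def by simp
      have kq: "k * q = \<rho> * q + \<kappa> * q" using F(14) by (metis add_mult_distrib)
      have "\<kappa> * \<kappa> \<le> \<kappa> * q" using \<kappa>q by simp
      then have 1: "fvs.dim (commutant k a) \<le> k * q" using le IH kq by linarith
      have 2: "\<exists>ls G H. k = length ls * q \<and> G \<in> mats k k \<and> H \<in> mats k k \<and> H * G = idm k \<and> a * G = G * Lf q ls"
        if eq: "fvs.dim (commutant k a) = k * q"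
      proof -
        have "\<kappa> * q \<le> \<kappa> * \<kappa>" using eq le IH kq by linarith
        then have \<kappa>eq: "\<kappa> = q" using \<kappa>1 \<kappa>q by simp
        then have "fvs.dim (commutant \<rho> b) = \<rho> * q" using eq le IH kq by (metis add_le_cancel_right order_antisym)
        then obtain ls E E' where ls: "\<rho> = length ls * q" "E \<in> mats \<rho> \<rho>" "E' \<in> mats \<rho> \<rho>" "E' * E = idm \<rho>" "b * E = E * Lf q ls"
          using IH by blast
        obtain G H where "G \<in> mats k k" "H \<in> mats k k" "H * G = idm k" "a * G = G * Lf q (c # ls)"
          by (rule extension_conjugate[OF less.prems(1) F(1-4,6,7) F(8-14)[unfolded \<kappa>eq] F(5) ls(1) ls(2-4) ls(5)[unfolded b_def]])
        moreover have "k = length (c # ls) * q" using F(14) ls(1) \<kappa>eq by simp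
        ultimately show ?thesis by blast
      qed
      show ?thesis using 1 2 by blast
    qed
  qed
  then show "fvs.dim (commutant k a) \<le> k * q"
    "fvs.dim (commutant k a) = k * q \<Longrightarrow> \<exists>ls G H. k = length ls * q \<and> G \<in> mats k k \<and> H \<in> mats k k \<and>
      H * G = idm k \<and> a * G = G * Lf q ls" by blast+
qed

section \<open>The local estimate\<close>

lemma max_kernel:
  assumes "a \<in> mats k k"
  obtains q c g h where "kernel_bound k q a" "g \<in> mats k q" "h \<in> mats q k" "h * g = idm q" "a * g = c *\<^sub>F g"
proof -
  define R where "R q \<longleftrightarrow> (\<exists>c g h. g \<in> mats k q \<and> h \<in> mats q k \<and> h * g = idm q \<and> a * g = c *\<^sub>F g)" for q
  have "R 0" unfolding R_def by (intro exI[of _ 0]) simp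
  moreover have "\<forall>q. R q \<longrightarrow> q \<le> k" unfolding R_def using left_inverse_le by blast
  ultimately have 1: "R (Greatest R)" and 2: "\<And>q. R q \<Longrightarrow> q \<le> Greatest R"
    by (auto intro: GreatestI_nat Greatest_le_nat)
  have "kernel_bound k (Greatest R) a" unfolding kernel_bound_def using 2 unfolding R_def by blast
  then show ?thesis using 1 that unfolding R_def by blast
qed

lemma spectral_expand:
  assumes sp: "spectral n A D k u v"
  shows "rowb n X \<Longrightarrow> (\<Sum>e\<in>D. u e * (v e * X)) = X" "colb n X \<Longrightarrow> (\<Sum>e\<in>D. X * u e * v e) = X"
proof -
  have s: "(\<Sum>e\<in>D. u e * v e) = idm n" using sp by (simp add: spectral_def)
  show "(\<Sum>e\<in>D. u e * (v e * X)) = X" if "rowb n X"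
    using that by (simp add: mult.assoc[symmetric] sum_distrib_right[symmetric] s)
  show "(\<Sum>e\<in>D. X * u e * v e) = X" if "colb n X"
    using that by (simp add: mult.assoc sum_distrib_left[symmetric] s)
qed

lemma spectral_dims: "spectral n A D k u v \<Longrightarrow> (\<Sum>d\<in>D. k d) = n"
proof -
  assume sp: "spectral n A D k u v"
  have "of_nat n = tr (\<Sum>d\<in>D. u d * v d)" using sp by (simp add: spectral_def)
  also have "\<dots> = (\<Sum>d\<in>D. tr (v d * u d))" by (simp add: tr_comm)
  also have "\<dots> = (\<Sum>d\<in>D. of_nat (k d))" using sp by (intro sum.cong) (auto simp: spectral_def)
  finally have "of_nat n = (of_nat (\<Sum>d\<in>D. k d) :: complex)" by simp
  then show ?thesis using of_nat_eq_iff by metis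
qed

lemma spectral_commuting_blocks:
  assumes sp: "spectral n A D k u v" and "A * C = C * A" "d \<in> D" "e \<in> D" "d \<noteq> e"
  shows "v d * (C * u e) = 0"
proof -
  have "d *\<^sub>F (v d * (C * u e)) = v d * A * (C * u e)" using spectral_mult_left[OF sp assms(3)] by simp
  also have "\<dots> = v d * (A * C) * u e" by (simp only: mult.assoc)
  also have "\<dots> = v d * (C * (A * u e))" by (simp only: assms(2) mult.assoc)
  also have "\<dots> = e *\<^sub>F (v d * (C * u e))" by (simp add: spectral_mult_right[OF sp assms(4)])
  finally show ?thesis using assms(5) by simp
qed

lemma spectral_commuting_zero:
  assumes sp: "spectral n A D k u v" and C: "C \<in> mats n n" "A * C = C * A"
    and z: "\<And>d. d \<in> D \<Longrightarrow> v d * (C * u d) = 0"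
  shows "C = 0"
proof -
  have "C = (\<Sum>e\<in>D. (\<Sum>d\<in>D. u d * (v d * (C * u e * v e))))"
    using C by (subst spectral_expand(2)[OF sp, of C, symmetric]) (auto simp: spectral_expand(1)[OF sp] intro!: sum.cong)
  also have "\<dots> = 0"
  proof (intro sum.neutral ballI)
    fix e d assume "e \<in> D" "d \<in> D"
    then have "v d * (C * u e) = 0" using z spectral_commuting_blocks[OF sp C(2)] by (cases "d = e") auto
    then have "v d * (C * u e * v e) = 0" by (simp only: mult.assoc[symmetric]) simp
    then show "u d * (v d * (C * u e * v e)) = 0" by simp
  qed
  finally show ?thesis .
qed

text \<open>A centralizing pair is determined by the diagonal blocks of \<open>C1\<close> and
  \<open>C0\<close>: if those of \<open>C1\<close> vanish then \<open>C1 = 0\<close>, because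
  \<open>C1\<close> commutes with \<open>A1\<close>, and then \<open>C0\<close> commutes with
  \<open>A1\<close> as well. In the diagonal blocks of the second relation the commutator of
  \<open>A1\<close> and \<open>C0\<close> disappears, so the block of \<open>C1\<close> commutes
  with the block of \<open>A0\<close>; the block of \<open>C0\<close> is bounded only by its
  size.\<close>

lemma cdim_le_blocks:
  assumes sp: "spectral n A1 D k u v" and A0: "A0 \<in> mats n n"
  shows "cdim n A1 A0 \<le> (\<Sum>d\<in>D. fvs.dim (commutant (k d) (v d * A0 * u d)) + k d * k d)"
proof -
  have fin: "finite D" and uv: "\<And>d. d \<in> D \<Longrightarrow> u d \<in> mats n (k d) \<and> v d \<in> mats (k d) n" using sp by (auto simp: spectral_def)
  define f where "f d p = (v d * (fst p * u d), v d * (snd p * u d))" for d and p :: "fmat \<times> fmat"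
  have lf: "Vector_Spaces.linear pscl pscl (f d)" for d
    by unfold_locales (auto simp: f_def pscl_def algebra_simps)
  have "cdim n A1 A0 \<le> (\<Sum>d\<in>D. pvs.dim (f d ` ctz n A1 A0)) + pvs.dim {x \<in> ctz n A1 A0. \<forall>d\<in>D. f d x = 0}"
    unfolding cdim_def by (rule pp.dim_le_sum_images[OF fin lf ctz_space(2,1)])
  also have "{x \<in> ctz n A1 A0. \<forall>d\<in>D. f d x = 0} = {0}"
  proof -
    have "x = 0" if x: "x \<in> ctz n A1 A0" "\<forall>d\<in>D. f d x = 0" for x
    proof -
      obtain C1 C0 where C: "x = (C1, C0)" "C1 \<in> mats n n" "C0 \<in> mats n n" "A1 * C1 = C1 * A1"
        "A1 * C0 + A0 * C1 = C1 * A0 + C0 * A1" using x(1) by (auto simp: ctz_def)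
      have z: "v d * (C1 * u d) = 0" "v d * (C0 * u d) = 0" if "d \<in> D" for d
        using x(2) that by (auto simp: f_def C(1) zero_prod_def)
      have "C1 = 0" using spectral_commuting_zero[OF sp C(2,4) z(1)] by simp
      moreover from this have "A1 * C0 = C0 * A1" using C(5) by simp
      then have "C0 = 0" using spectral_commuting_zero[OF sp C(3) _ z(2)] by simp
      ultimately show ?thesis by (simp add: C(1) zero_prod_def)
    qed
    moreover have "0 \<in> ctz n A1 A0" by (rule pvs.subspace_0[OF ctz_space(1)])
    moreover have "f d 0 = 0" for d by (simp add: f_def zero_prod_def)
    ultimately show ?thesis by blast
  qed
  also have "(\<Sum>d\<in>D. pvs.dim (f d ` ctz n A1 A0)) + pvs.dim {0}
      \<le> (\<Sum>d\<in>D. fvs.dim (commutant (k d) (v d * A0 * u d)) + k d * k d)"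
  proof -
    have "pvs.dim (f d ` ctz n A1 A0) \<le> fvs.dim (commutant (k d) (v d * A0 * u d)) + k d * k d" if d: "d \<in> D" for d
    proof -
      note P = pvs_prod[OF commutant_space(2,1)[of "k d" "v d * A0 * u d"] fin_span_mats[of "k d" "k d"] subspace_mats]
      have "f d ` ctz n A1 A0 \<subseteq> commutant (k d) (v d * A0 * u d) \<times> mats (k d) (k d)"
      proof
        fix z assume "z \<in> f d ` ctz n A1 A0"
        then obtain C1 C0 where C: "z = (v d * (C1 * u d), v d * (C0 * u d))" "C1 \<in> mats n n" "C0 \<in> mats n n" "A1 * C1 = C1 * A1"
          "A1 * C0 + A0 * C1 = C1 * A0 + C0 * A1" by (auto simp: ctz_def f_def)
        have Cu: "C1 * u d = u d * (v d * (C1 * u d))"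
        proof -
          have "C1 * u d = (\<Sum>e\<in>D. u e * (v e * (C1 * u d)))" using C(2) spectral_expand(1)[OF sp, of "C1 * u d"] by simp
          also have "\<dots> = (\<Sum>e\<in>D. if e = d then u d * (v d * (C1 * u d)) else 0)"
            using spectral_commuting_blocks[OF sp C(4) _ d] by (intro sum.cong) auto
          finally show ?thesis using d fin by simp
        qed
        have vC: "v d * C1 = v d * (C1 * u d) * v d"
        proof -
          have "v d * C1 = (\<Sum>e\<in>D. v d * C1 * u e * v e)" using C(2) spectral_expand(2)[OF sp, of "v d * C1"] by simp
          also have "\<dots> = (\<Sum>e\<in>D. if e = d then v d * (C1 * u d) * v d else 0)"
            using spectral_commuting_blocks[OF sp C(4) d] by (intro sum.cong) (auto simp: mult.assoc[symmetric])
          finally show ?thesis using d fin by simp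
        qed
        have "v d * (A1 * C0 + A0 * C1) * u d = v d * (C1 * A0 + C0 * A1) * u d" by (simp only: C(5))
        then have "(v d * A1) * C0 * u d + v d * A0 * (C1 * u d) = (v d * C1) * A0 * u d + v d * C0 * (A1 * u d)"
          by (simp add: algebra_simps)
        then have "v d * A0 * (C1 * u d) = (v d * C1) * A0 * u d"
          by (simp add: spectral_mult[OF sp d] mult.assoc)
        then have "v d * A0 * (u d * (v d * (C1 * u d))) = (v d * (C1 * u d) * v d) * A0 * u d"
          by (simp only: Cu[symmetric] vC[symmetric])
        then show "z \<in> commutant (k d) (v d * A0 * u d) \<times> mats (k d) (k d)"
          using uv[OF d] by (simp add: C(1) commutant_def mult.assoc)
      qed
      then have "pvs.dim (f d ` ctz n A1 A0) \<le> pvs.dim (commutant (k d) (v d * A0 * u d) \<times> mats (k d) (k d))"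
        by (rule pvs.dim_mono_fin[OF P(1,2)])
      then show ?thesis by (simp add: P(3) dim_mats)
    qed
    then have "(\<Sum>d\<in>D. pvs.dim (f d ` ctz n A1 A0))
        \<le> (\<Sum>d\<in>D. fvs.dim (commutant (k d) (v d * A0 * u d)) + k d * k d)" by (rule sum_mono)
    then show ?thesis by (simp only: pvs.dim_zero_space add_0_right)
  qed
  finally show ?thesis .
qed

text \<open>The pair \<open>(A1, A0)\<close> has the equality type \<open>K\<close>: all blocks have the form \<open>L(q,\<dots>,q)\<close> and
  the numbers \<open>n\<^sub>l + n\<^sub>l\<^sub>,\<^sub>1\<close> have the common value \<open>K\<close>.\<close>

definition balanced :: "nat \<Rightarrow> fmat \<Rightarrow> fmat \<Rightarrow> nat \<Rightarrow> complex set \<Rightarrow> (complex \<Rightarrow> nat) \<Rightarrow> (complex \<Rightarrow> nat) \<Rightarrow> bool" where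
  "balanced n A1 A0 K D p q \<longleftrightarrow> (\<exists>u v. spectral n A1 D (\<lambda>d. p d * q d) u v \<and>
     (\<forall>d\<in>D. 1 \<le> p d \<and> 1 \<le> q d \<and> p d * q d + q d = K \<and>
       (\<exists>ls G H. length ls = p d \<and> G \<in> mats (p d * q d) (p d * q d) \<and> H \<in> mats (p d * q d) (p d * q d) \<and>
          H * G = idm (p d * q d) \<and> v d * A0 * u d * G = G * Lf (q d) ls)))"

text \<open>With \<open>q d\<close> the largest eigenspace dimension of the \<open>d\<close>-th
  block of \<open>A0\<close>, the number \<open>K\<close> is the maximum of
  \<open>k d + q d\<close>. It is realised by shifting with \<open>d0\<close> and an eigenvalue
  \<open>c\<close> of the block. The estimate combines \<open>commutant_dim_le\<close> with
  \<open>k d + q d \<le> K\<close>, and equality forces both for every block. The clause for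
  \<open>A1 = 0\<close> serves the singularities with \<open>m i = 0\<close>, where the tuple has no
  entry that could absorb a shift by \<open>d\<close>.\<close>

lemma local_choice:
  assumes sp: "spectral n A1 D k u v" and A0: "A0 \<in> mats n n" and n: "1 \<le> n"
  obtains K d c g0 g1 h0 h1 where
    "g0 \<in> mats n K" "g1 \<in> mats n K" "h0 \<in> mats K n" "h1 \<in> mats K n"
    "(A1 - d *\<^sub>F idm n) * g1 + (A0 - c *\<^sub>F idm n) * g0 = 0" "(A1 - d *\<^sub>F idm n) * g0 = 0"
    "h0 * g0 + h1 * g1 = idm K" "A1 = 0 \<Longrightarrow> d = 0" "cdim n A1 A0 \<le> n * K"
    "cdim n A1 A0 = n * K \<Longrightarrow> \<exists>D p q. balanced n A1 A0 K D p q"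
proof -
  from spectral_nonzero[OF sp] obtain D where sp: "spectral n A1 D k u v" and k: "\<And>d. d \<in> D \<Longrightarrow> k d \<noteq> 0" by blast
  have fin: "finite D" and uv: "\<And>d. d \<in> D \<Longrightarrow> u d \<in> mats n (k d) \<and> v d \<in> mats (k d) n"
    and vu: "\<And>d. d \<in> D \<Longrightarrow> v d * u d = idm (k d)" and vu0: "\<And>d e. d \<in> D \<Longrightarrow> e \<in> D \<Longrightarrow> d \<noteq> e \<Longrightarrow> v d * u e = 0"
    and sum1: "(\<Sum>d\<in>D. u d * v d) = idm n" using sp by (auto simp: spectral_def)
  define a where "a d = v d * A0 * u d" for d
  have ma: "a d \<in> mats (k d) (k d)" if "d \<in> D" for d using uv[OF that] by (simp add: a_def mult.assoc)
  have "\<exists>q. kernel_bound (k d) q (a d) \<and> (\<exists>c g h. g \<in> mats (k d) q \<and> h \<in> mats q (k d) \<and> h * g = idm q \<and> a d * g = c *\<^sub>F g)"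
    if "d \<in> D" for d by (rule max_kernel[OF ma[OF that]]) blast
  then obtain q where q: "\<And>d. d \<in> D \<Longrightarrow> kernel_bound (k d) (q d) (a d)"
    "\<And>d. d \<in> D \<Longrightarrow> \<exists>c g h. g \<in> mats (k d) (q d) \<and> h \<in> mats (q d) (k d) \<and> h * g = idm (q d) \<and> a d * g = c *\<^sub>F g"
    by metis
  have sk: "(\<Sum>d\<in>D. k d) = n" by (rule spectral_dims[OF sp])
  then have ne: "D \<noteq> {}" using n by auto
  define K where "K = Max ((\<lambda>d. k d + q d) ` D)"
  have "K \<in> (\<lambda>d. k d + q d) ` D" unfolding K_def using fin ne by (intro Max_in) auto
  then obtain d0 where d0: "d0 \<in> D" "K = k d0 + q d0" by auto
  have le: "k d + q d \<le> K" if "d \<in> D" for d unfolding K_def using fin that by (intro Max_ge) auto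
  obtain c g h where g: "g \<in> mats (k d0) (q d0)" "h \<in> mats (q d0) (k d0)" "h * g = idm (q d0)" "a d0 * g = c *\<^sub>F g"
    using q(2)[OF d0(1)] by blast
  note m0 = uv[OF d0(1)] and vu' = vu[OF d0(1)]
  define X1 where "X1 = A1 - d0 *\<^sub>F idm n"
  define X0 where "X0 = A0 - c *\<^sub>F idm n"
  have mX0: "X0 \<in> mats n n" using A0 by (simp add: X0_def)
  \<comment> \<open>The inverse of \<open>X1\<close> on the sum of the other eigenspaces, extended
    by zero to the chosen one.\<close>
  define B where "B = (\<Sum>d\<in>D - {d0}. (1 / (d - d0)) *\<^sub>F (u d * v d))"
  have mB: "B \<in> mats n n" using uv by (auto simp: B_def)
  have X1u: "X1 * u d = (d - d0) *\<^sub>F u d" if "d \<in> D" for d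
    using spectral_mult_right[OF sp that] uv[OF that] by (simp add: X1_def left_diff_distrib fvs.scale_left_diff_distrib)
  have vB: "v d0 * B = 0"
    unfolding B_def sum_distrib_left
  proof (intro sum.neutral ballI)
    fix d assume "d \<in> D - {d0}"
    then have "v d0 * u d = 0" using vu0[OF d0(1), of d] by auto
    then have "v d0 * u d * v d = 0" by simp
    then show "v d0 * ((1 / (d - d0)) *\<^sub>F (u d * v d)) = 0" by (simp only: scl_mult_right mult.assoc) simp
  qed
  have X1B: "X1 * B = idm n - u d0 * v d0"
  proof -
    have "X1 * B = (\<Sum>d\<in>D - {d0}. u d * v d)"
      unfolding B_def sum_distrib_left by (intro sum.cong) (auto simp: mult.assoc[symmetric] X1u)
    then show ?thesis using sum1 sum.remove[OF fin d0(1), of "\<lambda>d. u d * v d"] by (simp add: algebra_simps)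
  qed
  define g0 where "g0 = u d0 * (g * prj (k d0) (q d0))"
  \<comment> \<open>The first term fills the upper slot with the whole eigenspace. The second one
    solves \<open>X1 * g1 = - X0 * g0\<close>, which is possible because \<open>g\<close> consists
    of eigenvectors of the block for \<open>c\<close>, whence
    \<open>v d0 * X0 * g0 = 0\<close>.\<close>
  define g1 where "g1 = u d0 * prj 0 (k d0) - B * (X0 * g0)"
  define h0 where "h0 = emb (k d0) (q d0) * (h * v d0)"
  define h1 where "h1 = emb 0 (k d0) * v d0"
  have bound: "fvs.dim (commutant (k d) (a d)) + k d * k d \<le> k d * K" if d: "d \<in> D" for d
  proof -
    have "fvs.dim (commutant (k d) (a d)) + k d * k d \<le> k d * (k d + q d)"
      using commutant_dim_le(1)[OF ma[OF d] q(1)[OF d]] by (simp add: add_mult_distrib2)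
    also have "\<dots> \<le> k d * K" using le[OF d] by simp
    finally show ?thesis .
  qed
  have nK: "n * K = (\<Sum>d\<in>D. k d * K)" using sk by (simp add: sum_distrib_right[symmetric])
  show ?thesis
  proof (rule that)
    show mg0: "g0 \<in> mats n K" and "g1 \<in> mats n K" "h0 \<in> mats K n" "h1 \<in> mats K n"
      using m0 mX0 mB g by (simp_all add: g0_def g1_def h0_def h1_def d0(2))
    show "(A1 - d0 *\<^sub>F idm n) * g0 = 0"
      using X1u[OF d0(1)] by (simp add: X1_def[symmetric] g0_def mult.assoc[symmetric])
    have "X1 * g1 = - (X1 * B * (X0 * g0))"
      using X1u[OF d0(1)] by (simp add: g1_def right_diff_distrib mult.assoc[symmetric])
    also have "\<dots> = u d0 * (v d0 * (X0 * g0)) - X0 * g0"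
      using mX0 by (simp add: X1B left_diff_distrib mult.assoc)
    also have "v d0 * (X0 * g0) = 0"
    proof -
      have "v d0 * (X0 * g0) = (a d0 * g - c *\<^sub>F (v d0 * u d0 * g)) * prj (k d0) (q d0)"
        using m0 by (simp add: X0_def g0_def a_def algebra_simps)
      then show ?thesis using g by (simp add: vu')
    qed
    finally show "(A1 - d0 *\<^sub>F idm n) * g1 + (A0 - c *\<^sub>F idm n) * g0 = 0"
      by (simp add: X1_def X0_def)
    have "h0 * g0 = emb (k d0) (q d0) * prj (k d0) (q d0)"
      using g by (simp add: h0_def g0_def mult.assoc mult_eq_assoc[OF vu'] mult_eq_assoc[OF g(3)])
    moreover have "h1 * g1 = emb 0 (k d0) * prj 0 (k d0)"
      by (simp add: h1_def g1_def mult.assoc right_diff_distrib mult_eq_assoc[OF vu'] mult_eq_assoc[OF vB])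
    ultimately show "h0 * g0 + h1 * g1 = idm K" by (simp add: d0(2) idm_split add.commute)
    show "d0 = 0" if "A1 = 0"
    proof -
      have "d0 *\<^sub>F u d0 = 0" using spectral_mult_right[OF sp d0(1)] that by simp
      moreover have "u d0 \<noteq> 0"
      proof
        assume "u d0 = 0"
        then have "idm (k d0) = 0" using vu' by simp
        then have "rowb 0 (idm (k d0))" by simp
        then show False using k[OF d0(1)] by (simp del: bound_0)
      qed
      ultimately show ?thesis by simp
    qed
    have "cdim n A1 A0 \<le> (\<Sum>d\<in>D. fvs.dim (commutant (k d) (a d)) + k d * k d)"
      using cdim_le_blocks[OF sp A0] by (simp add: a_def)
    also have "\<dots> \<le> n * K" unfolding nK using bound by (rule sum_mono)
    finally show "cdim n A1 A0 \<le> n * K" .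
    assume eq: "cdim n A1 A0 = n * K"
    have "fvs.dim (commutant (k d) (a d)) + k d * k d = k d * K" if d: "d \<in> D" for d
    proof (rule ccontr)
      assume "fvs.dim (commutant (k d) (a d)) + k d * k d \<noteq> k d * K"
      then have "(\<Sum>d\<in>D. fvs.dim (commutant (k d) (a d)) + k d * k d) < (\<Sum>d\<in>D. k d * K)"
        using bound d fin by (intro sum_strict_mono_ex1) (auto simp: le_less)
      then show False using cdim_le_blocks[OF sp A0] eq nK by (simp add: a_def)
    qed
    note eqd = this
    have E: "k d + q d = K \<and> fvs.dim (commutant (k d) (a d)) = k d * q d" if d: "d \<in> D" for d
    proof -
      have 1: "fvs.dim (commutant (k d) (a d)) \<le> k d * q d" by (rule commutant_dim_le(1)[OF ma[OF d] q(1)[OF d]])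
      have "k d * K \<le> k d * (k d + q d)" using eqd[OF d] 1 by (simp add: add_mult_distrib2)
      then have "K \<le> k d + q d" using k[OF d] by simp
      then have *: "k d + q d = K" using le[OF d] by simp
      then have "k d * K = k d * k d + k d * q d" by (simp add: add_mult_distrib2[symmetric])
      then show ?thesis using * eqd[OF d] by simp
    qed
    have "\<exists>ls. k d = length ls * q d \<and> (\<exists>G H. G \<in> mats (k d) (k d) \<and> H \<in> mats (k d) (k d) \<and> H * G = idm (k d) \<and>
      a d * G = G * Lf (q d) ls)" if d: "d \<in> D" for d
      using commutant_dim_le(2)[OF ma[OF d] q(1)[OF d]] E[OF d] by blast
    then obtain ls where ls: "\<And>d. d \<in> D \<Longrightarrow> k d = length (ls d) * q d" "\<And>d. d \<in> D \<Longrightarrow> (\<exists>G H. G \<in> mats (k d) (k d) \<and> H \<in> mats (k d) (k d) \<and> H * G = idm (k d) \<and>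
      a d * G = G * Lf (q d) (ls d))" by metis
    have "balanced n A1 A0 K D (\<lambda>d. length (ls d)) q"
      unfolding balanced_def
    proof (rule exI[of _ u], rule exI[of _ v], intro conjI ballI)
      show "spectral n A1 D (\<lambda>d. length (ls d) * q d) u v"
        using sp ls(1) by (simp add: spectral_def)
      fix d assume d: "d \<in> D"
      show "1 \<le> length (ls d)" "1 \<le> q d" using k[OF d] ls(1)[OF d] by (auto simp: Suc_le_eq intro: ccontr)
      show "length (ls d) * q d + q d = K" using E[OF d] ls(1)[OF d] by simp
      show "\<exists>ls' G H. length ls' = length (ls d) \<and> G \<in> mats (length (ls d) * q d) (length (ls d) * q d) \<and>
         H \<in> mats (length (ls d) * q d) (length (ls d) * q d) \<and> H * G = idm (length (ls d) * q d) \<and>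
         v d * A0 * u d * G = G * Lf (q d) ls'"
        using ls(2)[OF d] ls(1)[OF d] unfolding a_def by metis
    qed
    then show "\<exists>D p q. balanced n A1 A0 K D p q" by blast
  qed
qed

section \<open>The numerical classification\<close>

text \<open>
  Equality in the local estimate means that the blocks of \<open>A\<^sub>0\<close> are of the form \<open>L(q\<^sub>l,\<dots>,q\<^sub>l)\<close>, with
  \<open>p\<^sub>l\<close> entries, and \<open>(p\<^sub>l + 1) q\<^sub>l = K\<close> for all \<open>l\<close>; so the type is determined by \<open>K\<close> and the list
  of the \<open>p\<^sub>l\<close>.
\<close>

definition split_type :: "nat \<Rightarrow> nat list \<Rightarrow> mult_type" where
  "split_type K ps = (map (\<lambda>p. p * (K div (p + 1))) ps, map (\<lambda>p. replicate p (K div (p + 1))) ps)"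

definition split_data :: "nat \<Rightarrow> nat \<Rightarrow> nat list \<Rightarrow> bool" where
  "split_data n K ps \<longleftrightarrow> ps \<noteq> [] \<and> (\<forall>p\<in>set ps. 1 \<le> p \<and> p + 1 dvd K) \<and>
     n = (\<Sum>p\<leftarrow>ps. p * (K div (p + 1))) \<and> sorted_wrt (\<ge>) ps"

text \<open>
  As \<open>n = K w\<close> for the weight \<open>w\<close>, the condition \<open>\<Sum>(2 n - K\<^sub>i) = 2 n\<close> reads \<open>\<Sum>(2 - 1 / w\<^sub>i) = 2\<close>.
\<close>

definition weight :: "nat list \<Rightarrow> real" where
  "weight ps = (\<Sum>p\<leftarrow>ps. real p / (real p + 1))"

lemma weight_simps [simp]: "weight [] = 0" "weight (p # ps) = real p / (real p + 1) + weight ps"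
  by (simp_all add: weight_def)

lemma split_data_weight:
  assumes "split_data n K ps" shows "real n = real K * weight ps"
proof -
  have "real (p * (K div (p + 1))) = real K * (real p / (real p + 1))" if "p \<in> set ps" for p
  proof -
    have "p + 1 dvd K" using assms that by (simp add: split_data_def)
    then have "real (K div (p + 1)) = real K / (real p + 1)" by (simp add: real_of_nat_div add.commute)
    then show ?thesis by simp
  qed
  then have "map (\<lambda>p. real (p * (K div (p + 1)))) ps = map (\<lambda>p. real K * (real p / (real p + 1))) ps"
    by (intro map_cong refl)
  then have "(\<Sum>p\<leftarrow>ps. real (p * (K div (p + 1)))) = (\<Sum>p\<leftarrow>ps. real K * (real p / (real p + 1)))"
    by (rule arg_cong)
  moreover have "real n = (\<Sum>p\<leftarrow>ps. real (p * (K div (p + 1))))"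
    using assms by (simp only: split_data_def) (simp add: sum_list_of_nat[symmetric] o_def del: of_nat_mult)
  ultimately show ?thesis by (simp only: weight_def sum_list_const_mult)
qed

lemma weight_ge_length:
  assumes "\<forall>p\<in>set ps. 1 \<le> p" shows "real (length ps) / 2 \<le> weight ps"
  using assms
proof (induction ps)
  case (Cons p ps)
  have "1 / 2 \<le> real p / (real p + 1)" using Cons.prems by (simp add: field_simps)
  moreover have "real (length ps) / 2 \<le> weight ps" using Cons by simp
  moreover define t where "t = real p / (real p + 1)"
  ultimately have "1 / 2 \<le> t" "real (length ps) / 2 \<le> weight ps" by simp_all
  then show ?case by (simp add: t_def[symmetric])
qed simp

lemma weight_eq_length:
  assumes "\<forall>p\<in>set ps. 1 \<le> p" "weight ps = real (length ps) / 2" shows "ps = replicate (length ps) 1"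
  using assms
proof (induction ps)
  case (Cons p ps)
  have "1 / 2 \<le> real p / (real p + 1)" using Cons.prems by (simp add: field_simps)
  moreover have "real (length ps) / 2 \<le> weight ps" using Cons.prems by (intro weight_ge_length) auto
  moreover define t where "t = real p / (real p + 1)"
  ultimately have "1 / 2 \<le> t" "real (length ps) / 2 \<le> weight ps" "t + weight ps = (real (length ps) + 1) / 2"
    using Cons.prems(2) by (simp_all add: add.commute)
  then have "t = 1 / 2" "weight ps = real (length ps) / 2" by (simp_all add: field_simps)
  then have "real p / (real p + 1) = 1 / 2" "weight ps = real (length ps) / 2" by (simp_all add: t_def)
  then show ?case using Cons by (simp add: field_simps)
qed simp

text \<open>The smallest denominator is at most 3 because three copies of its reciprocal reach 1;
  this leaves finitely many values of \<open>y\<close>, and \<open>z\<close> is determined.\<close>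

lemma egyptian:
  fixes x y z :: nat
  assumes "1 \<le> x" "x \<le> y" "y \<le> z" "1 / real x + 1 / real y + 1 / real z = 1"
  shows "(x, y, z) \<in> {(3, 3, 3), (2, 4, 4), (2, 3, 6)}"
proof -
  have "1 / real y \<le> 1 / real x" "1 / real z \<le> 1 / real y" using assms(1-3) by (simp_all add: frac_le)
  note le = this
  have pos: "0 < 1 / real y" "0 < 1 / real z" using assms(1-3) by auto
  have "1 \<le> 3 * (1 / real x)" using le assms(4) by linarith
  then have "x \<le> 3" using assms(1) by (simp add: field_simps)
  moreover have "1 / real x < 1" using pos assms(4) by linarith
  then have "x \<noteq> 1" by auto
  ultimately consider "x = 2" | "x = 3" using assms(1) by linarith
  then show ?thesis
  proof cases
    case 1
    then have eq: "1 / real y + 1 / real z = 1 / 2" using assms(4) by simp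
    then have "1 / 2 \<le> 2 * (1 / real y)" using le by linarith
    then have "y \<le> 4" using assms(1,2) by (simp add: field_simps)
    moreover have "1 / real y < 1 / 2" using eq pos by linarith
    then have "2 < y" using assms(1,2) by (simp add: field_simps)
    ultimately consider "y = 3" | "y = 4" by linarith
    then show ?thesis
    proof cases
      case a: 1
      then have "real z = 6" using eq assms by (simp add: field_simps)
      then show ?thesis using 1 a by simp
    next
      case a: 2
      then have "real z = 4" using eq assms by (simp add: field_simps)
      then show ?thesis using 1 a by simp
    qed
  next
    case 2
    then have eq: "1 / real y + 1 / real z = 2 / 3" using assms(4) by simp
    then have "2 / 3 \<le> 2 * (1 / real y)" using le by linarith
    then have y: "y = 3" using assms(1,2) 2 by (simp add: field_simps)
    then have "real z = 3" using eq assms by (simp add: field_simps)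
    then show ?thesis using 2 y by simp
  qed
qed

text \<open>The equation becomes \<open>weight ps = 1 + 1 / (p - 1)\<close>, and each summand of the
  weight is \<open>1 - 1 / (a + 1)\<close>. With two entries this is a sum of three unit fractions
  equal to 1. With three entries the four unit fractions add up to 2, so \<open>p \<le> 3\<close>;
  \<open>p = 2\<close> leads to three unit fractions again and \<open>p = 3\<close> makes all of
  them one half. Four entries already attain the maximal value 2 of the right-hand side.\<close>

lemma one_irregular_one_regular:
  assumes ps: "sorted_wrt (\<ge>) ps" "\<forall>p\<in>set ps. 1 \<le> p" "2 \<le> length ps" and p: "2 \<le> (p::nat)"
    and eq: "1 - 1 / real p = 1 / weight ps"
  shows "(ps, p) \<in> {([1,1,1], 3), ([1,1,1,1], 2), ([2,2], 4), ([3,1], 5), ([2,2,2], 2), ([3,3,1], 2),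
    ([5,2,1], 2), ([5,2], 3), ([3,3], 3), ([5,1], 4), ([2,1], 7)}"
proof -
  have w1: "1 \<le> weight ps" using weight_ge_length[OF ps(2)] ps(3) by simp
  have "weight ps * (1 - 1 / real p) = 1" using eq w1 by simp
  then have w: "weight ps = 1 + 1 / (real p - 1)" using p by (simp add: field_simps)
  have inv: "real z / (real z + 1) = 1 - 1 / (real z + 1)" for z by (simp add: field_simps)
  have t: "1 / (real p - 1) \<le> 1" "0 < 1 / (real p - 1)" using p by (simp_all add: field_simps)
  then have "real (length ps) \<le> 4" using weight_ge_length[OF ps(2)] w by linarith
  then consider "length ps = 2" | "length ps = 3" | "length ps = 4" using ps(3) by linarith
  then show ?thesis
  proof cases
    case 1
    then obtain a b where ab: "ps = [a, b]" by (auto simp: numeral_eq_Suc length_Suc_conv)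
    have le: "b \<le> a" "1 \<le> b" using ps ab by auto
    have "1 / (real a + 1) + 1 / (real b + 1) + 1 / (real p - 1) = 1"
      using w by (simp add: ab inv)
    then have e: "1 / real (a + 1) + 1 / real (b + 1) + 1 / real (p - 1) = 1" using p by (simp add: of_nat_diff add.commute)
    consider "p - 1 \<le> b + 1" | "b + 1 \<le> p - 1" "p - 1 \<le> a + 1" | "a + 1 \<le> p - 1" by linarith
    then show ?thesis
    proof cases
      case 1
      then have "(p - 1, b + 1, a + 1) \<in> {(3, 3, 3), (2, 4, 4), (2, 3, 6)}"
        using e le p by (intro egyptian) auto
      then have "p = 4 \<and> b = 2 \<and> a = 2 \<or> p = 3 \<and> b = 3 \<and> a = 3 \<or> p = 3 \<and> b = 2 \<and> a = 5" using p by auto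
      then show ?thesis by (elim disjE conjE; simp add: ab)
    next
      case 2
      then have "(b + 1, p - 1, a + 1) \<in> {(3, 3, 3), (2, 4, 4), (2, 3, 6)}"
        using e le p by (intro egyptian) auto
      then have "p = 4 \<and> b = 2 \<and> a = 2 \<or> p = 5 \<and> b = 1 \<and> a = 3 \<or> p = 4 \<and> b = 1 \<and> a = 5" using p by auto
      then show ?thesis by (elim disjE conjE; simp add: ab)
    next
      case 3
      then have "(b + 1, a + 1, p - 1) \<in> {(3, 3, 3), (2, 4, 4), (2, 3, 6)}"
        using e le p by (intro egyptian) auto
      then have "p = 4 \<and> b = 2 \<and> a = 2 \<or> p = 5 \<and> b = 1 \<and> a = 3 \<or> p = 7 \<and> b = 1 \<and> a = 2" using p by auto
      then show ?thesis by (elim disjE conjE; simp add: ab)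
    qed
  next
    case 2
    then obtain a b c where abc: "ps = [a, b, c]" by (auto simp: numeral_eq_Suc length_Suc_conv)
    have le: "b \<le> a" "c \<le> b" "1 \<le> c" using ps abc by auto
    have e: "1 / (real a + 1) + 1 / (real b + 1) + 1 / (real c + 1) + 1 / (real p - 1) = 2"
      using w by (simp add: abc inv)
    have h: "1 / (real a + 1) \<le> 1 / 2" "1 / (real b + 1) \<le> 1 / 2" "1 / (real c + 1) \<le> 1 / 2"
      using le by (simp_all add: field_simps)
    have "1 / 2 \<le> 1 / (real p - 1)" using e h by linarith
    then have "p \<le> 3" using p by (simp add: field_simps)
    then consider "p = 2" | "p = 3" using p by linarith
    then show ?thesis
    proof cases
      case 1
      then have "1 / real (c + 1) + 1 / real (b + 1) + 1 / real (a + 1) = 1" using e by (simp add: add.commute)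
      then have "(c + 1, b + 1, a + 1) \<in> {(3, 3, 3), (2, 4, 4), (2, 3, 6)}"
        using le by (intro egyptian) auto
      then have "a = 2 \<and> b = 2 \<and> c = 2 \<or> a = 3 \<and> b = 3 \<and> c = 1 \<or> a = 5 \<and> b = 2 \<and> c = 1" by auto
      then show ?thesis using 1 by (elim disjE conjE; simp add: abc)
    next
      case 2
      then have "1 / (real p - 1) = 1 / 2" by simp
      then have "1 / (real a + 1) = 1 / 2" "1 / (real b + 1) = 1 / 2" "1 / (real c + 1) = 1 / 2"
        using e h by linarith+
      then have "a = 1" "b = 1" "c = 1" by (simp_all add: field_simps)
      then show ?thesis using 2 by (simp add: abc)
    qed
  next
    case 3
    then have "weight ps = real (length ps) / 2" "1 / (real p - 1) = 1"
      using weight_ge_length[OF ps(2)] w t by auto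
    then have "ps = [1,1,1,1]" "p = 2" using weight_eq_length[OF ps(2)] 3 p by (auto simp: numeral_eq_Suc field_simps)
    then show ?thesis by simp
  qed
qed

lemma finite_sorted_list:
  fixes f :: "'a \<Rightarrow> nat"
  assumes "finite S"
  obtains xs where "set xs = S" "distinct xs" "sorted (map f xs)" "length xs = card S"
proof -
  obtain ys where ys: "set ys = S" "distinct ys" using finite_distinct_list[OF assms] by blast
  show ?thesis by (rule that[of "sort_key f ys"]) (use ys distinct_card[OF ys(2)] in auto)
qed

lemma idx0_types_memI:
  "{# reg [d,d], reg [d,d], reg [d,d], reg [d,d] #} \<in> idx0_types d"
  "{# reg [d,d,d], reg [d,d,d], reg [d,d,d] #} \<in> idx0_types d"
  "{# reg [2*d,2*d], reg [d,d,d,d], reg [d,d,d,d] #} \<in> idx0_types d"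
  "{# reg [3*d,3*d], reg [2*d,2*d,2*d], reg [d,d,d,d,d,d] #} \<in> idx0_types d"
  "{# ([d,d], [[d],[d]]), reg [d,d], reg [d,d] #} \<in> idx0_types d"
  "{# ([d,d], [[d],[d]]), ([d,d], [[d],[d]]) #} \<in> idx0_types d"
  "{# ([d,d,d], [[d],[d],[d]]), reg [d,d,d] #} \<in> idx0_types d"
  "{# ([d,d,d,d], [[d],[d],[d],[d]]), reg [2*d,2*d] #} \<in> idx0_types d"
  "{# ([2*d,2*d], [[d,d],[d,d]]), reg [d,d,d,d] #} \<in> idx0_types d"
  "{# ([3*d,2*d], [[d,d,d],[2*d]]), reg [d,d,d,d,d] #} \<in> idx0_types d"
  "{# ([2*d,2*d,2*d], [[d,d],[d,d],[d,d]]), reg [3*d,3*d] #} \<in> idx0_types d"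
  "{# ([3*d,3*d,2*d], [[d,d,d],[d,d,d],[2*d]]), reg [4*d,4*d] #} \<in> idx0_types d"
  "{# ([5*d,4*d,3*d], [[d,d,d,d,d],[2*d,2*d],[3*d]]), reg [6*d,6*d] #} \<in> idx0_types d"
  "{# ([5*d,4*d], [[d,d,d,d,d],[2*d,2*d]]), reg [3*d,3*d,3*d] #} \<in> idx0_types d"
  "{# ([3*d,3*d], [[d,d,d],[d,d,d]]), reg [2*d,2*d,2*d] #} \<in> idx0_types d"
  "{# ([5*d,3*d], [[d,d,d,d,d],[3*d]]), reg [2*d,2*d,2*d,2*d] #} \<in> idx0_types d"
  "{# ([4*d,3*d], [[2*d,2*d],[3*d]]), reg [d,d,d,d,d,d,d] #} \<in> idx0_types d"
  unfolding idx0_types_def by (rule insertI1 | rule insertI2)+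

lemma replicate_values:
  "replicate 1 x = [x]" "replicate 2 x = [x,x]" "replicate 3 x = [x,x,x]" "replicate 4 x = [x,x,x,x]"
  "replicate 5 x = [x,x,x,x,x]" "replicate 6 x = [x,x,x,x,x,x]" "replicate 7 x = [x,x,x,x,x,x,x]"
  by (simp_all add: numeral_eq_Suc)

text \<open>Every \<open>p + 1\<close> divides \<open>K\<close>; the factor in front of
  \<open>d\<close> is the least common multiple of these numbers.\<close>

lemma split_type_values:
  "split_type (2 * d) [1,1] = ([d,d], [[d],[d]])"
  "split_type (2 * d) [1,1,1] = ([d,d,d], [[d],[d],[d]])"
  "split_type (2 * d) [1,1,1,1] = ([d,d,d,d], [[d],[d],[d],[d]])"
  "split_type (3 * d) [2,2] = ([2*d,2*d], [[d,d],[d,d]])"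
  "split_type (4 * d) [3,1] = ([3*d,2*d], [[d,d,d],[2*d]])"
  "split_type (3 * d) [2,2,2] = ([2*d,2*d,2*d], [[d,d],[d,d],[d,d]])"
  "split_type (4 * d) [3,3,1] = ([3*d,3*d,2*d], [[d,d,d],[d,d,d],[2*d]])"
  "split_type (6 * d) [5,2,1] = ([5*d,4*d,3*d], [[d,d,d,d,d],[2*d,2*d],[3*d]])"
  "split_type (6 * d) [5,2] = ([5*d,4*d], [[d,d,d,d,d],[2*d,2*d]])"
  "split_type (4 * d) [3,3] = ([3*d,3*d], [[d,d,d],[d,d,d]])"
  "split_type (6 * d) [5,1] = ([5*d,3*d], [[d,d,d,d,d],[3*d]])"
  "split_type (6 * d) [2,1] = ([4*d,3*d], [[2*d,2*d],[3*d]])"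
  by (simp_all add: split_type_def replicate_values del: One_nat_def)

text \<open>The contributions \<open>e i\<close> add up to 2. A one-element list \<open>[p]\<close>
  contributes \<open>1 - 1 / p\<close>, at least one half and less than 1, the value 0 for
  \<open>p = 1\<close> being excluded; a longer list contributes at least 1, with equality only for
  \<open>[1,1]\<close>. So at most two lists are longer, and each case is an equation in unit
  fractions.\<close>

theorem classification:
  fixes K :: "'a \<Rightarrow> nat" and ps :: "'a \<Rightarrow> nat list"
  assumes fin: "finite S" and n: "1 \<le> n" and data: "\<And>i. i \<in> S \<Longrightarrow> split_data n (K i) (ps i)"
    and ns: "\<And>i. i \<in> S \<Longrightarrow> ps i \<noteq> [1]"
    and sum: "(\<Sum>i\<in>S. 2 * real n - real (K i)) = 2 * real n"
  shows "\<exists>d\<ge>1. image_mset (\<lambda>i. split_type (K i) (ps i)) (mset_set S) \<in> idx0_types d"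
proof -
  define e where "e i = 2 - 1 / weight (ps i)" for i
  have p1: "\<forall>p\<in>set (ps i). 1 \<le> p" and ne: "ps i \<noteq> []" and sorted: "sorted_wrt (\<ge>) (ps i)" if "i \<in> S" for i
    using data[OF that] by (auto simp: split_data_def)
  have wpos: "0 < weight (ps i)" if "i \<in> S" for i
  proof -
    have "1 \<le> length (ps i)" using ne[OF that] by (simp add: Suc_le_eq)
    then show ?thesis using weight_ge_length[OF p1[OF that]] by linarith
  qed
  have Kn: "2 * real n - real (K i) = real n * e i" if "i \<in> S" for i
    using split_data_weight[OF data[OF that]] wpos[OF that] by (simp add: e_def field_simps)
  have "(\<Sum>i\<in>S. 2 * real n - real (K i)) = real n * (\<Sum>i\<in>S. e i)"
    unfolding sum_distrib_left using Kn by (intro sum.cong) auto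
  then have esum: "(\<Sum>i\<in>S. e i) = 2" using sum n by simp
  define I where "I = {i \<in> S. 2 \<le> length (ps i)}"
  define R where "R = {i \<in> S. length (ps i) = 1}"
  define p where "p i = hd (ps i)" for i
  have SIR: "S = I \<union> R" "I \<inter> R = {}" "finite I" "finite R"
  proof -
    have "length (ps i) = 1 \<or> 2 \<le> length (ps i)" if "i \<in> S" for i
      by (cases "length (ps i)") (use ne[OF that] in auto)
    then show "S = I \<union> R" by (auto simp: I_def R_def)
  qed (use fin in \<open>auto simp: I_def R_def\<close>)
  have reg: "ps i = [p i]" "2 \<le> p i" "e i = 1 - 1 / real (p i)" "1 / 2 \<le> e i" "e i < 1" if "i \<in> R" for i
  proof -
    show 1: "ps i = [p i]" using that by (auto simp: R_def p_def length_Suc_conv)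
    then show 2: "2 \<le> p i" using ns[of i] p1[of i] that by (auto simp: R_def le_Suc_eq numeral_2_eq_2 Suc_le_eq)
    show 3: "e i = 1 - 1 / real (p i)" using 2 by (simp add: e_def weight_def) (subst 1, simp add: field_simps)
    show "1 / 2 \<le> e i" "e i < 1" using 2 by (simp_all add: 3 field_simps)
  qed
  have irr: "1 \<le> e i" "e i = 1 \<Longrightarrow> ps i = [1,1]" if "i \<in> I" for i
  proof -
    have *: "i \<in> S" "2 \<le> length (ps i)" using that by (auto simp: I_def)
    have w: "real (length (ps i)) / 2 \<le> weight (ps i)" by (rule weight_ge_length[OF p1[OF *(1)]])
    then have w1: "1 \<le> weight (ps i)" using *(2) by linarith
    then show "1 \<le> e i" by (simp add: e_def)
    assume "e i = 1"
    then have we: "weight (ps i) = 1" using w1 by (simp add: e_def field_simps)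
    then have "length (ps i) = 2" using w *(2) by linarith
    then show "ps i = [1,1]" using weight_eq_length[OF p1[OF *(1)]] we by (simp add: numeral_2_eq_2)
  qed
  have sIR: "(\<Sum>i\<in>I. e i) + (\<Sum>i\<in>R. e i) = 2" using esum SIR by (simp add: sum.union_disjoint)
  have lI: "real (card I) \<le> (\<Sum>i\<in>I. e i)" using sum_mono[of I "\<lambda>_. 1" e] irr by simp
  have lR: "real (card R) / 2 \<le> (\<Sum>i\<in>R. e i)" using sum_mono[of R "\<lambda>_. 1/2" e] reg by simp
  \<comment> \<open>The strict inequality is what rules out two regular singularities without an
    irregular one.\<close>
  have uR: "(\<Sum>i\<in>R. e i) < real (card R) \<or> R = {}"
  proof (cases "R = {}")
    case False
    then have "(\<Sum>i\<in>R. e i) < (\<Sum>i\<in>R. 1)" using reg(5) SIR(4) by (intro sum_strict_mono) auto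
    then show ?thesis by simp
  qed simp
  have nreg: "n = p i * (K i div (p i + 1))" if "i \<in> R" for i
    using data[of i] reg(1)[OF that] that SIR by (auto simp: split_data_def)
  have Treg: "split_type (K i) (ps i) = reg (replicate (p i) (K i div (p i + 1)))" if "i \<in> R" for i
    unfolding split_type_def by (subst (1 2) reg(1)[OF that]) (simp add: sum_list_replicate)
  have q: "K i div Suc (p i) = n div p i" if "i \<in> R" for i
    using nreg[OF that] reg(2)[OF that] by (metis Suc_eq_plus1 not_numeral_le_zero nonzero_mult_div_cancel_left)
  have "card I \<le> 2" using lI lR sIR by linarith
  then consider "card I = 0" | "card I = 1" | "card I = 2" by linarith
  then show ?thesis
  proof cases
    case 1
    then have I: "I = {}" and SR: "S = R" using SIR by auto
    have sR: "(\<Sum>i\<in>R. e i) = 2" using sIR I by simp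
    then have "real (card R) \<le> 4" "2 < real (card R)" using lR uR by auto
    then consider "card R = 3" | "card R = 4" by linarith
    then show ?thesis
    proof cases
      case 1
      obtain xs where xs: "set xs = R" "distinct xs" "sorted (map p xs)" "length xs = card R"
        by (rule finite_sorted_list[OF SIR(4), of p])
      then obtain a b c where abc: "xs = [a,b,c]" using 1 by (auto simp: numeral_eq_Suc length_Suc_conv)
      have R: "R = {a,b,c}" "a \<noteq> b" "a \<noteq> c" "b \<noteq> c" "p a \<le> p b" "p b \<le> p c" using xs abc by auto
      have "(p a, p b, p c) \<in> {(3, 3, 3), (2, 4, 4), (2, 3, 6)}"
        using sR R reg(2)[of a] by (intro egyptian) (auto simp: reg(3))
      then consider "n = 3 * (n div 3)" "p a = 3" "p b = 3" "p c = 3"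
        | "n = 4 * (n div 4)" "p a = 2" "p b = 4" "p c = 4"
        | "n = 6 * (n div 6)" "p a = 2" "p b = 3" "p c = 6"
        using nreg[of c] q[of c] R by auto
      moreover have T: "image_mset (\<lambda>i. split_type (K i) (ps i)) (mset_set S) =
          {# reg (replicate (p a) (n div p a)), reg (replicate (p b) (n div p b)), reg (replicate (p c) (n div p c)) #}"
        using R by (simp add: SR Treg q)
      ultimately show ?thesis
      proof cases
        case 1
        define d where "d = n div 3"
        have nd: "n = 3 * d" using 1 by (simp add: d_def)
        show ?thesis unfolding T 1(2-4) d_def[symmetric] replicate_values
          using idx0_types_memI(2)[of d] nd n by (intro exI[of _ d]) simp
      next
        case 2
        define d where "d = n div 4"
        have nd: "n = 4 * d" using 2 by (simp add: d_def)
        then have n2: "n div 2 = 2 * d" by simp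
        show ?thesis unfolding T 2(2-4) d_def[symmetric] n2 replicate_values
          using idx0_types_memI(3)[of d] nd n by (intro exI[of _ d]) simp
      next
        case 3
        define d where "d = n div 6"
        have nd: "n = 6 * d" using 3 by (simp add: d_def)
        then have n2: "n div 2 = 3 * d" "n div 3 = 2 * d" by simp_all
        show ?thesis unfolding T 3(2-4) d_def[symmetric] n2 replicate_values
          using idx0_types_memI(4)[of d] nd n by (intro exI[of _ d]) simp
      qed
    next
      case 2
      obtain xs where xs: "set xs = R" "distinct xs" "sorted (map p xs)" "length xs = card R"
        by (rule finite_sorted_list[OF SIR(4), of p])
      then obtain a b c d where abc: "xs = [a,b,c,d]" using 2 by (auto simp: numeral_eq_Suc length_Suc_conv)
      have R: "R = {a,b,c,d}" "distinct [a,b,c,d]" using xs abc by auto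
      have p2: "p i = 2" if i: "i \<in> R" for i
      proof -
        \<comment> \<open>Four terms of at least one half with sum 2 are all equal to one
          half.\<close>
        have "(\<Sum>i\<in>R. e i - 1 / 2) = 0" using sR 2 by (simp add: sum_subtractf)
        then have "e i - 1 / 2 = 0" using sum_nonneg_eq_0_iff[of R "\<lambda>i. e i - 1 / 2"] SIR(4) reg(4) i by auto
        then show ?thesis using reg(2,3)[OF i] by (simp add: field_simps)
      qed
      define k where "k = n div 2"
      have nk: "n = 2 * k" using nreg[of a] p2[of a] R by (auto simp: k_def)
      have q2: "K i div (2 + 1) = k" if "i \<in> R" for i using q[OF that] p2[OF that] by (simp add: k_def)
      have T: "image_mset (\<lambda>i. split_type (K i) (ps i)) (mset_set S) =
          {# reg (replicate 2 k), reg (replicate 2 k), reg (replicate 2 k), reg (replicate 2 k) #}"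
        using R q2 by (simp add: SR Treg p2)
      show ?thesis unfolding T replicate_values using idx0_types_memI(1)[of k] n nk
        by (intro exI[of _ k]) simp
    qed
  next
    case 2
    then obtain i where I: "I = {i}" by (auto simp: card_1_singleton_iff)
    then have iS: "i \<in> S" and li: "2 \<le> length (ps i)" by (auto simp: I_def)
    have sR: "(\<Sum>j\<in>R. e j) = 1 / weight (ps i)" using sIR by (simp add: I e_def)
    have e1: "1 \<le> e i" using irr I by simp
    have es: "e i + (\<Sum>j\<in>R. e j) = 2" using sIR I by simp
    have "real (card R) \<le> 2" using lR e1 es by linarith
    moreover have "R \<noteq> {}" using sR wpos[OF iS] by auto
    then have "card R \<noteq> 0" using SIR(4) by simp
    ultimately consider "card R = 1" | "card R = 2" by linarith
    then show ?thesis
    proof cases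
      case 1
      then obtain j where R: "R = {j}" by (auto simp: card_1_singleton_iff)
      have jR: "j \<in> R" by (simp add: R)
      have ij: "i \<noteq> j" using SIR(2) I R by auto
      have S: "S = {i, j}" using SIR(1) I R by auto
      have T: "image_mset (\<lambda>i. split_type (K i) (ps i)) (mset_set S) =
          {# split_type (K i) (ps i), reg (replicate (p j) (n div p j)) #}"
        using ij R by (simp add: S Treg q)
      have "1 - 1 / real (p j) = 1 / weight (ps i)" using sR R reg(3)[OF jR] by simp
      then have "(ps i, p j) \<in> {([1,1,1], 3), ([1,1,1,1], 2), ([2,2], 4), ([3,1], 5), ([2,2,2], 2), ([3,3,1], 2),
          ([5,2,1], 2), ([5,2], 3), ([3,3], 3), ([5,1], 4), ([2,1], 7)}"
        by (rule one_irregular_one_regular[OF sorted[OF iS] p1[OF iS] li reg(2)[OF jR]])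
      moreover have dv: "\<And>q. q \<in> set (ps i) \<Longrightarrow> q + 1 dvd K i" and ni: "n = (\<Sum>p\<leftarrow>ps i. p * (K i div (p + 1)))"
        using data[OF iS] by (auto simp: split_data_def)
      have pick: ?thesis if "d \<ge> 1" "{# split_type (K i) (ps i), reg (replicate (p j) (n div p j)) #} \<in> idx0_types d" for d
        unfolding T using that by blast
      ultimately show ?thesis
      proof (elim insertE emptyE)
        define d where "d = K i div 2"
        assume *: "(ps i, p j) = ([1,1,1], 3)"
        have k: "K i = 2 * d" using dv[of 1] * by (auto simp: d_def simp del: One_nat_def)
        have nd: "n = 3 * d" "n div 3 = d" using ni * by (simp_all add: k del: One_nat_def)
        show ?thesis by (rule pick[of d]) (use nd n in simp, use * nd idx0_types_memI(7)[of d] in \<open>simp only: prod.inject k split_type_values replicate_values\<close>)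
      next
        define d where "d = K i div 2"
        assume *: "(ps i, p j) = ([1,1,1,1], 2)"
        have k: "K i = 2 * d" using dv[of 1] * by (auto simp: d_def simp del: One_nat_def)
        have nd: "n = 4 * d" "n div 2 = 2 * d" using ni * by (simp_all add: k del: One_nat_def)
        show ?thesis by (rule pick[of d]) (use nd n in simp, use * nd idx0_types_memI(8)[of d] in \<open>simp only: prod.inject k split_type_values replicate_values\<close>)
      next
        define d where "d = K i div 3"
        assume *: "(ps i, p j) = ([2,2], 4)"
        have k: "K i = 3 * d" using dv[of 2] * by (auto simp: d_def simp del: One_nat_def)
        have nd: "n = 4 * d" "n div 4 = d" using ni * by (simp_all add: k del: One_nat_def)
        show ?thesis by (rule pick[of d]) (use nd n in simp, use * nd idx0_types_memI(9)[of d] in \<open>simp only: prod.inject k split_type_values replicate_values\<close>)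
      next
        define d where "d = K i div 4"
        assume *: "(ps i, p j) = ([3,1], 5)"
        have k: "K i = 4 * d" using dv[of 3] * by (auto simp: d_def simp del: One_nat_def)
        have nd: "n = 5 * d" "n div 5 = d" using ni * by (simp_all add: k del: One_nat_def)
        show ?thesis by (rule pick[of d]) (use nd n in simp, use * nd idx0_types_memI(10)[of d] in \<open>simp only: prod.inject k split_type_values replicate_values\<close>)
      next
        define d where "d = K i div 3"
        assume *: "(ps i, p j) = ([2,2,2], 2)"
        have k: "K i = 3 * d" using dv[of 2] * by (auto simp: d_def simp del: One_nat_def)
        have nd: "n = 6 * d" "n div 2 = 3 * d" using ni * by (simp_all add: k del: One_nat_def)
        show ?thesis by (rule pick[of d]) (use nd n in simp, use * nd idx0_types_memI(11)[of d] in \<open>simp only: prod.inject k split_type_values replicate_values\<close>)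
      next
        define d where "d = K i div 4"
        assume *: "(ps i, p j) = ([3,3,1], 2)"
        have k: "K i = 4 * d" using dv[of 3] * by (auto simp: d_def simp del: One_nat_def)
        have nd: "n = 8 * d" "n div 2 = 4 * d" using ni * by (simp_all add: k del: One_nat_def)
        show ?thesis by (rule pick[of d]) (use nd n in simp, use * nd idx0_types_memI(12)[of d] in \<open>simp only: prod.inject k split_type_values replicate_values\<close>)
      next
        define d where "d = K i div 6"
        assume *: "(ps i, p j) = ([5,2,1], 2)"
        have k: "K i = 6 * d" using dv[of 5] * by (auto simp: d_def simp del: One_nat_def)
        have nd: "n = 12 * d" "n div 2 = 6 * d" using ni * by (simp_all add: k del: One_nat_def)
        show ?thesis by (rule pick[of d]) (use nd n in simp, use * nd idx0_types_memI(13)[of d] in \<open>simp only: prod.inject k split_type_values replicate_values\<close>)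
      next
        define d where "d = K i div 6"
        assume *: "(ps i, p j) = ([5,2], 3)"
        have k: "K i = 6 * d" using dv[of 5] * by (auto simp: d_def simp del: One_nat_def)
        have nd: "n = 9 * d" "n div 3 = 3 * d" using ni * by (simp_all add: k del: One_nat_def)
        show ?thesis by (rule pick[of d]) (use nd n in simp, use * nd idx0_types_memI(14)[of d] in \<open>simp only: prod.inject k split_type_values replicate_values\<close>)
      next
        define d where "d = K i div 4"
        assume *: "(ps i, p j) = ([3,3], 3)"
        have k: "K i = 4 * d" using dv[of 3] * by (auto simp: d_def simp del: One_nat_def)
        have nd: "n = 6 * d" "n div 3 = 2 * d" using ni * by (simp_all add: k del: One_nat_def)
        show ?thesis by (rule pick[of d]) (use nd n in simp, use * nd idx0_types_memI(15)[of d] in \<open>simp only: prod.inject k split_type_values replicate_values\<close>)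
      next
        define d where "d = K i div 6"
        assume *: "(ps i, p j) = ([5,1], 4)"
        have k: "K i = 6 * d" using dv[of 5] * by (auto simp: d_def simp del: One_nat_def)
        have nd: "n = 8 * d" "n div 4 = 2 * d" using ni * by (simp_all add: k del: One_nat_def)
        show ?thesis by (rule pick[of d]) (use nd n in simp, use * nd idx0_types_memI(16)[of d] in \<open>simp only: prod.inject k split_type_values replicate_values\<close>)
      next
        define d where "d = K i div 6"
        assume *: "(ps i, p j) = ([2,1], 7)"
        \<comment> \<open>No single \<open>p + 1\<close> equals 6 here; divisibility by 3 and by 2
          has to be combined.\<close>
        have k: "K i = 6 * d" using dv[of 2] dv[of 1] * by (simp add: d_def) presburger
        have nd: "n = 7 * d" "n div 7 = d" using ni * by (simp_all add: k del: One_nat_def)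
        show ?thesis by (rule pick[of d]) (use nd n in simp, use * nd idx0_types_memI(17)[of d] in \<open>simp only: prod.inject k split_type_values replicate_values\<close>)
      qed
    next
      case 2
      then obtain a b where R: "R = {a, b}" "a \<noteq> b" by (auto simp: card_2_iff)
      \<comment> \<open>The lower bounds 1, one half and one half already exhaust the total
        2.\<close>
      have "e i = 1" "e a = 1 / 2" "e b = 1 / 2" using es R reg(4)[of a] reg(4)[of b] e1 by auto
      then have psi: "ps i = [1,1]" and p2: "p a = 2" "p b = 2"
        using irr(2)[of i] reg(2,3)[of a] reg(2,3)[of b] I R by (auto simp: field_simps)
      have S: "S = {i, a, b}" "i \<noteq> a" "i \<noteq> b" using SIR(1,2) I R by auto
      define d where "d = K i div 2"
      have k: "K i = 2 * d" and nd: "n = 2 * d" "n div 2 = d" using data[OF iS] by (auto simp: psi d_def split_data_def simp del: One_nat_def)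
      have q2: "K a div (2 + 1) = d" "K b div (2 + 1) = d" using q[of a] q[of b] R p2 nd(2) by auto
      have T: "image_mset (\<lambda>i. split_type (K i) (ps i)) (mset_set S) =
          {# ([d,d], [[d],[d]]), reg [d,d], reg [d,d] #}"
        using S R p2 q2 by (simp add: Treg q nd(2) psi k split_type_values replicate_values del: One_nat_def)
      show ?thesis unfolding T using idx0_types_memI(5)[of d] nd n by (intro exI[of _ d]) auto
    qed
  next
    case 3
    then obtain a b where I: "I = {a, b}" "a \<noteq> b" by (auto simp: card_2_iff)
    have e: "e a + e b + (\<Sum>i\<in>R. e i) = 2" "1 \<le> e a" "1 \<le> e b" using sIR I irr(1)[of a] irr(1)[of b] by auto
    moreover have "0 \<le> (\<Sum>i\<in>R. e i)" using lR by linarith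
    ultimately have *: "e a = 1" "e b = 1" "(\<Sum>i\<in>R. e i) = 0" by linarith+
    have "card R = 0" using lR *(3) by simp
    then have S: "S = {a, b}" using SIR I by simp
    have ps: "ps a = [1,1]" "ps b = [1,1]" using irr(2) I * by auto
    define d where "d = n div 2"
    have k: "K a = 2 * d" "K b = 2 * d" and nd: "n = 2 * d"
    proof -
      have "2 dvd K a" "2 dvd K b" "n = K a div 2 + K a div 2" "n = K b div 2 + K b div 2"
        using data[of a] data[of b] by (simp_all add: S ps split_data_def del: One_nat_def)
      then show "K a = 2 * d" "K b = 2 * d" "n = 2 * d" unfolding d_def by presburger+
    qed
    have T: "image_mset (\<lambda>i. split_type (K i) (ps i)) (mset_set S) =
        {# ([d,d], [[d],[d]]), ([d,d], [[d],[d]]) #}"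
      using S I by (simp add: ps k split_type_values del: One_nat_def)
    show ?thesis unfolding T using idx0_types_memI(6)[of d] nd n by (intro exI[of _ d]) auto
  qed
qed

section \<open>Tuples in the ring of finitely supported matrices\<close>

text \<open>Transport of dimension to the carrier-based notion: coordinates with respect to a basis
  of \<open>S\<close>, followed by \<open>T\<close>, form a linear isomorphism from the coordinate
  vectors of length \<open>dim S\<close> onto \<open>U\<close>.\<close>

lemma (in complex_space) mat_subspace_dim_eq:
  assumes S: "fin_span S" "subspace S" and TU: "T ` S = U" "U \<subseteq> carrier_mat N N"
    and add: "\<And>x y. x \<in> S \<Longrightarrow> y \<in> S \<Longrightarrow> T (x + y) = T x + T y"
    and scl: "\<And>c x. x \<in> S \<Longrightarrow> T (scale c x) = c \<cdot>\<^sub>m T x"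
    and inj: "inj_on T S"
  shows "mat_subspace_dim N U = dim S"
proof -
  obtain B where B: "B \<subseteq> S" "finite B" "independent B" "span B = S" "card B = dim S"
    by (rule fin_span_basis[OF S])
  obtain bs where bs: "set bs = B" "distinct bs" using finite_distinct_list[OF B(2)] by blast
  define k where "k = dim S"
  have k: "length bs = k" using distinct_card[OF bs(2)] bs(1) B(5) by (simp add: k_def)
  have bsS: "bs ! i \<in> S" if "i < k" for i using that bs(1) k B(1) by auto
  define L where "L c = (\<Sum>i<k. scale (c $ i) (bs ! i))" for c :: "complex vec"
  have LS: "L c \<in> S" for c
    unfolding L_def using bsS by (intro subspace_sum[OF S(2)] subspace_scale[OF S(2)]) auto
  have Linj: "c = c'" if c: "c \<in> carrier_vec k" "c' \<in> carrier_vec k" "L c = L c'" for c c'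
  proof (rule eq_vecI)
    have "bij_betw ((!) bs) {..<k} B" using bij_betw_nth[OF bs(2)] bs(1) k by (simp add: lessThan_atLeast0)
    note bij = this
    define f where "f v = c $ (the_inv_into {..<k} ((!) bs) v) - c' $ (the_inv_into {..<k} ((!) bs) v)" for v
    have fi: "f (bs ! i) = c $ i - c' $ i" if "i < k" for i
      using that bij by (simp add: f_def bij_betw_def the_inv_into_f_f)
    have "(\<Sum>v\<in>B. scale (f v) v) = (\<Sum>i<k. scale (f (bs ! i)) (bs ! i))"
      by (rule sum.reindex_bij_betw[OF bij, symmetric])
    also have "\<dots> = L c - L c'" by (simp add: fi L_def scale_left_diff_distrib sum_subtractf)
    finally have z: "(\<Sum>v\<in>B. scale (f v) v) = 0" using c(3) by simp
    fix i assume "i < dim_vec c'"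
    then have "i < k" using c(2) by auto
    moreover from this have "f (bs ! i) = 0"
      using independentD[OF B(3,2) subset_refl z] bs(1) k by auto
    ultimately show "c $ i = c' $ i" by (simp add: fi)
  qed (use c in auto)
  have Lsurj: "\<exists>c\<in>carrier_vec k. L c = x" if "x \<in> S" for x
  proof -
    have "x \<in> span (set bs)" using that B(4) bs(1) by simp
    then obtain u where "(\<Sum>v\<in>set bs. scale (u v) v) = x" using B(2) bs(1) by (auto simp: span_finite)
    then have "(\<Sum>i<k. scale (u (bs ! i)) (bs ! i)) = x"
      using sum.reindex_bij_betw[OF bij_betw_nth[OF bs(2) refl refl], of "\<lambda>v. scale (u v) v"] k by (simp add: lessThan_atLeast0)
    then show ?thesis by (intro bexI[of _ "vec k (\<lambda>i. u (bs ! i))"]) (auto simp: L_def)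
  qed
  have Ladd: "L (c + c') = L c + L c'" if "c \<in> carrier_vec k" "c' \<in> carrier_vec k" for c c'
    using that by (simp add: L_def scale_left_distrib sum.distrib[symmetric])
  have Lscl: "L (a \<cdot>\<^sub>v c) = scale a (L c)" if "c \<in> carrier_vec k" for a c
    using that by (simp add: L_def scale_sum_right)
  define W where "W = (module_mat TYPE(complex) N N)\<lparr>carrier := U\<rparr>"
  interpret M: vectorspace class_ring "module_mat TYPE(complex) N N" by (rule matrix_vs)
  have U0: "0\<^sub>m N N \<in> U"
  proof -
    have "T 0 \<in> U" using TU(1) subspace_0[OF S(2)] by blast
    moreover have "T 0 = 0 \<cdot>\<^sub>m T 0" using scl[OF subspace_0[OF S(2)], of 0] by simp
    moreover have "0 \<cdot>\<^sub>m T 0 = 0\<^sub>m N N" using \<open>T 0 \<in> U\<close> TU(2) by (intro eq_matI) auto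
    ultimately show ?thesis by simp
  qed
  have Usub: "VectorSpace.subspace class_ring U (module_mat TYPE(complex) N N)"
    unfolding VectorSpace.subspace_def submodule_def
  proof (intro conjI matrix_vs allI impI)
    show "Module.module class_ring (module_mat TYPE(complex) N N)" by (rule M.module_axioms)
    show "U \<subseteq> carrier (module_mat TYPE(complex) N N)" using TU(2) by (simp add: module_mat_simps)
    show "\<zero>\<^bsub>module_mat TYPE(complex) N N\<^esub> \<in> U" using U0 by (simp add: module_mat_simps)
    fix v w assume "v \<in> U" "w \<in> U"
    then obtain x y where "v = T x" "w = T y" "x \<in> S" "y \<in> S" using TU(1) by auto
    then show "v \<oplus>\<^bsub>module_mat TYPE(complex) N N\<^esub> w \<in> U"
      using add[of x y] subspace_add[OF S(2), of x y] TU(1) by (auto simp: module_mat_simps intro: image_eqI[of _ _ "x + y"])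
  next
    fix c v assume "v \<in> U"
    then obtain x where "v = T x" "x \<in> S" using TU(1) by auto
    then show "c \<odot>\<^bsub>module_mat TYPE(complex) N N\<^esub> v \<in> U"
      using scl[of x c] subspace_scale[OF S(2), of x c] TU(1) by (auto simp: module_mat_simps intro: image_eqI[of _ _ "scale c x"])
  qed
  have Wvs: "vectorspace class_ring W" unfolding W_def by (rule M.subspace_is_vs[OF Usub])
  interpret VS: vec_space "TYPE(complex)" k .
  have Vvs: "vectorspace class_ring (module_vec TYPE(complex) k)" by (rule vec_vs)
  have lin: "linear_map class_ring (module_vec TYPE(complex) k) W (\<lambda>c. T (L c))"
    unfolding linear_map_def mod_hom_def mod_hom_axioms_def LinearCombinations.module_hom_def
    using Vvs Wvs TU(1) LS add scl Ladd Lscl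
    by (auto simp: vectorspace_def W_def module_mat_simps module_vec_simps)
  have "vectorspace.dim class_ring (module_vec TYPE(complex) k) = vectorspace.dim class_ring W"
  proof (rule linear_map.dim_eq[OF lin])
    show "vectorspace.fin_dim class_ring (module_vec TYPE(complex) k)" by (rule VS.fin_dim)
    show "inj_on (\<lambda>c. T (L c)) (carrier (module_vec TYPE(complex) k))"
      using Linj LS inj by (auto simp: inj_on_def module_vec_simps)
    show "(\<lambda>c. T (L c)) ` carrier (module_vec TYPE(complex) k) = carrier W"
      using Lsurj LS TU(1) by (fastforce simp: W_def module_vec_simps)
  qed
  then show ?thesis using VS.dim_is_n by (simp add: mat_subspace_dim_def W_def k_def)
qed

section \<open>Toeplitz matrices with two block rows, and completed tuples\<close>

definition bt :: "nat \<Rightarrow> fmat \<Rightarrow> fmat \<Rightarrow> fmat" where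
  "bt n C1 C0 = emb 0 n * C1 * prj 0 n + emb 0 n * C0 * prj n n + emb n n * C1 * prj n n"

lemma bt_mats: "C1 \<in> mats n n \<Longrightarrow> C0 \<in> mats n n \<Longrightarrow> bt n C1 C0 \<in> mats (n + n) (n + n)"
  by (simp add: bt_def mult.assoc)

lemma bt_mult:
  assumes "C1 \<in> mats n n" "C0 \<in> mats n n" "D1 \<in> mats n n" "D0 \<in> mats n n"
  shows "bt n C1 C0 * bt n D1 D0 = bt n (C1 * D1) (C1 * D0 + C0 * D1)"
  using assms by (simp add: bt_def algebra_simps)

lemma bt_inj:
  assumes "C1 \<in> mats n n" "C0 \<in> mats n n" "D1 \<in> mats n n" "D0 \<in> mats n n"
  shows "bt n C1 C0 = bt n D1 D0 \<longleftrightarrow> C1 = D1 \<and> C0 = D0"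
proof
  have 1: "prj 0 n * bt n C1 C0 * emb 0 n = C1" "prj 0 n * bt n C1 C0 * emb n n = C0"
    if "C1 \<in> mats n n" "C0 \<in> mats n n" for C1 C0
    using that by (simp_all add: bt_def algebra_simps)
  assume "bt n C1 C0 = bt n D1 D0"
  then show "C1 = D1 \<and> C0 = D0" using 1[OF assms(1,2)] 1[OF assms(3,4)] by simp
qed simp

lemma block_toeplitz_0:
  assumes "X 0 \<in> carrier_mat n n" shows "block_toeplitz n 0 X = X 0"
  using assms by (intro eq_matI) (auto simp: block_toeplitz_def)

lemma block_toeplitz_1:
  assumes "X 0 = to_mat n n X0" "X 1 = to_mat n n X1" "X0 \<in> mats n n" "X1 \<in> mats n n"
  shows "block_toeplitz n 1 X = to_mat (n + n) (n + n) (bt n X1 X0)"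
proof (rule eq_matI)
  fix i j assume "i < dim_row (to_mat (n + n) (n + n) (bt n X1 X0))" "j < dim_col (to_mat (n + n) (n + n) (bt n X1 X0))"
  then have ij: "i < n + n" "j < n + n" by simp_all
  have d: "a div n = (if a < n then 0 else 1)" "a mod n = (if a < n then a else a - n)" if "a < n + n" for a
  proof -
    show 1: "a div n = (if a < n then 0 else 1)" using that by (auto simp: div_nat_eqI)
    show "a mod n = (if a < n then a else a - n)" using that by (auto simp: mod_if)
  qed
  have lt: "i mod n < n" "j mod n < n" using ij by auto
  have "block_toeplitz n 1 X $$ (i, j) =
      (if i div n \<le> j div n then X (1 - (j div n - i div n)) $$ (i mod n, j mod n) else 0)"
    using ij by (simp add: block_toeplitz_def)
  also have "\<dots> = (if i < n then (if j < n then entry X1 i j else entry X0 i (j - n)) else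
      if j < n then 0 else entry X1 (i - n) (j - n))"
    using ij lt by (auto simp: d assms(1,2) One_nat_def[symmetric] simp del: One_nat_def)
  also have "\<dots> = entry (bt n X1 X0) i j"
    using ij by (auto simp: bt_def entry_mult_prj entry_emb_mult)
  finally show "block_toeplitz n 1 X $$ (i, j) = to_mat (n + n) (n + n) (bt n X1 X0) $$ (i, j)"
    using ij by simp
qed (simp_all add: block_toeplitz_def)

text \<open>\<open>X\<close> is the completed tuple. The vanishing sum encodes the residue at
  infinity, so index 0 needs no special treatment, and \<open>X i 1 = 0\<close> for
  \<open>m i = 0\<close> is the identification with the case \<open>m i = 1\<close>.\<close>

definition rep :: "nat \<Rightarrow> (nat \<Rightarrow> nat) \<Rightarrow> nat \<Rightarrow> mat_tuple \<Rightarrow> (nat \<Rightarrow> nat \<Rightarrow> fmat) \<Rightarrow> bool" where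
  "rep r m n A X \<longleftrightarrow> (\<forall>(i, j) \<in> entries r m. A i j = to_mat n n (X i j)) \<and>
     (\<forall>i\<le>r. X i 0 \<in> mats n n \<and> X i 1 \<in> mats n n \<and> (m i = 0 \<longrightarrow> X i 1 = 0)) \<and> (\<Sum>i\<le>r. X i 0) = 0"

lemma sum_atMost_split: "(\<Sum>i\<le>(r::nat). f i) = f 0 + (\<Sum>i=1..r. f i)" for f :: "nat \<Rightarrow> 'a::comm_monoid_add"
  by (simp add: atMost_atLeast0 sum.atLeast_Suc_atMost)

lemma rep_coef:
  assumes "rep r m n A X" "i \<le> r"
  shows "coef r m n A i 0 = to_mat n n (X i 0)" "coef r m n A i 1 = to_mat n n (X i 1) \<or> \<not> m i \<le> 1"
proof -
  have A: "\<And>i j. (i, j) \<in> entries r m \<Longrightarrow> A i j = to_mat n n (X i j)"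
    and X: "\<And>i. i \<le> r \<Longrightarrow> X i 0 \<in> mats n n \<and> X i 1 \<in> mats n n \<and> (m i = 0 \<longrightarrow> X i 1 = 0)"
    and s: "(\<Sum>i\<le>r. X i 0) = 0" using assms(1) by (auto simp: rep_def)
  show "coef r m n A i 0 = to_mat n n (X i 0)"
  proof (cases "i = 0")
    case True
    have "X 0 0 = - (\<Sum>i=1..r. X i 0)" using s by (simp add: sum_atMost_split add_eq_0_iff2)
    then have "entry (X 0 0) a b = - (\<Sum>i=1..r. entry (X i 0) a b)" for a b by simp
    moreover have "A i' 0 $$ (a, b) = entry (X i' 0) a b" if "i' \<in> {1..r}" "a < n" "b < n" for i' a b
      using A[of i' 0] that by (simp add: entries_def)
    ultimately show ?thesis unfolding True coef_def by (intro eq_matI) auto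
  next
    case False
    then show ?thesis using A[of i 0] assms(2) by (simp add: coef_def entries_def)
  qed
  show "coef r m n A i 1 = to_mat n n (X i 1) \<or> \<not> m i \<le> 1"
  proof (cases "m i = 0")
    case True
    then show ?thesis using X[OF assms(2)] by (simp add: coef_def)
  next
    case False
    then show ?thesis using A[of i 1] assms(2) by (auto simp: coef_def entries_def)
  qed
qed

lemma rep_exists:
  assumes "is_tuple r m n A" "\<forall>i\<le>r. m i \<le> 1"
  obtains X where "rep r m n A X"
proof -
  define X where "X i j = of_mat (coef r m n A i j)" for i j
  have c: "coef r m n A i j \<in> carrier_mat n n" if "i \<le> r" for i j
    using assms(1) that by (auto simp: coef_def is_tuple_def entries_def)
  have A: "A i j = coef r m n A i j" if "(i, j) \<in> entries r m" for i j
    using that by (auto simp: coef_def entries_def)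
  have "rep r m n A X"
    unfolding rep_def
  proof (intro conjI allI impI ballI)
    fix p assume "p \<in> entries r m"
    then show "case p of (i, j) \<Rightarrow> A i j = to_mat n n (X i j)"
      using A c by (auto simp: X_def entries_def split: prod.splits)
  next
    fix i assume "i \<le> r"
    then show "X i 0 \<in> mats n n" "X i 1 \<in> mats n n"
      using of_mat_mats[OF c[of i 0]] of_mat_mats[OF c[of i 1]] by (simp_all add: X_def)
    show "X i 1 = 0" if "m i = 0" using that
      by (intro fmat_eqI) (auto simp: X_def coef_def entry_of_mat)
  next
    show "(\<Sum>i\<le>r. X i 0) = 0"
    proof (rule fmat_eqI)
      fix a b
      have "entry (X i 0) a b = (if a < n \<and> b < n then A i 0 $$ (a, b) else 0)" if "i \<in> {1..r}" for i
        using c[of i 0] that A[of i 0] by (auto simp: X_def entry_of_mat entries_def)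
      then have "(\<Sum>i=1..r. entry (X i 0) a b) = (\<Sum>i=1..r. if a < n \<and> b < n then A i 0 $$ (a, b) else 0)"
        by (rule sum.cong[OF refl])
      then show "entry (\<Sum>i\<le>r. X i 0) a b = entry 0 a b"
        by (auto simp: sum_atMost_split X_def coef_def entry_of_mat)
    qed
  qed
  then show ?thesis by (rule that)
qed

text \<open>For \<open>m i = 0\<close> the completed pair has \<open>A1 = 0\<close>: the matrix
  \<open>C1\<close> lies in the ordinary centralizer and \<open>C0\<close> is arbitrary. This
  accounts for the extra \<open>n * n\<close>.\<close>

lemma dim_toeplitz_centralizer:
  assumes R: "rep r m n A X" and i: "i \<le> r" and m: "m i \<le> 1"
  shows "mat_subspace_dim (n * (m i + 1)) (toeplitz_centralizer r m n A i) + (1 - m i) * (n * n) = cdim n (X i 1) (X i 0)"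
proof -
  have X: "X i 0 \<in> mats n n" "X i 1 \<in> mats n n" "m i = 0 \<Longrightarrow> X i 1 = 0" using R i by (auto simp: rep_def)
  have c: "coef r m n A i 0 = to_mat n n (X i 0)" "coef r m n A i 1 = to_mat n n (X i 1)"
    using rep_coef[OF R i] m by auto
  show ?thesis
  proof (cases "m i = 0")
    case True
    have "mat_subspace_dim n (toeplitz_centralizer r m n A i) = fvs.dim (commutant n (X i 0))"
    proof (rule fvs.mat_subspace_dim_eq[OF commutant_space(2,1), where T = "to_mat n n"])
      show im: "to_mat n n ` commutant n (X i 0) = toeplitz_centralizer r m n A i"
      proof (intro equalityI subsetI)
        fix Z assume "Z \<in> to_mat n n ` commutant n (X i 0)"
        then obtain Y where Y: "Y \<in> mats n n" "X i 0 * Y = Y * X i 0" "Z = to_mat n n Y" by (auto simp: commutant_def)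
        have "to_mat n n (X i 0) * to_mat n n Y = to_mat n n Y * to_mat n n (X i 0)"
          using X Y by (simp add: to_mat_mult[symmetric])
        then show "Z \<in> toeplitz_centralizer r m n A i"
          unfolding toeplitz_centralizer_def
          by (intro CollectI exI[of _ "\<lambda>_. Z"]) (simp add: True block_toeplitz_0 c Y(3))
      next
        fix Z assume "Z \<in> toeplitz_centralizer r m n A i"
        then have Z: "Z \<in> carrier_mat n n" "to_mat n n (X i 0) * Z = Z * to_mat n n (X i 0)"
          by (auto simp: toeplitz_centralizer_def True block_toeplitz_0 c)
        have "X i 0 * of_mat Z = of_mat Z * X i 0"
          by (rule to_mat_inj[of _ n n]) (use X Z in \<open>simp_all add: to_mat_mult[of n]\<close>)
        then show "Z \<in> to_mat n n ` commutant n (X i 0)"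
          using Z(1) by (intro image_eqI[of _ _ "of_mat Z"]) (auto simp: commutant_def)
      qed
      show "toeplitz_centralizer r m n A i \<subseteq> carrier_mat n n" unfolding im[symmetric] by auto
      show "inj_on (to_mat n n) (commutant n (X i 0))"
        by (rule inj_onI, rule to_mat_inj[of _ n n]) (auto simp: commutant_def)
    qed simp_all
    moreover have "cdim n (X i 1) (X i 0) = fvs.dim (commutant n (X i 0)) + n * n"
    proof -
      have "ctz n (X i 1) (X i 0) = commutant n (X i 0) \<times> mats n n"
        using X(3)[OF True] by (auto simp: ctz_def commutant_def)
      then show ?thesis
        using pvs_prod(3)[OF commutant_space(2,1)[of n "X i 0"] fin_span_mats[of n n] subspace_mats]
        by (simp add: cdim_def dim_mats)
    qed
    ultimately show ?thesis using True by simp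
  next
    case False
    then have m1: "m i = 1" using m by simp
    define T where "T p = to_mat (n + n) (n + n) (bt n (fst p) (snd p))" for p
    have B: "block_toeplitz n 1 (coef r m n A i) = to_mat (n + n) (n + n) (bt n (X i 1) (X i 0))"
      by (rule block_toeplitz_1[OF c X(1,2)])
    note bm = bt_mats[of _ n]
    have comm: "to_mat (n + n) (n + n) (bt n (X i 1) (X i 0)) * T (C1, C0) = T (C1, C0) * to_mat (n + n) (n + n) (bt n (X i 1) (X i 0))
       \<longleftrightarrow> (C1, C0) \<in> ctz n (X i 1) (X i 0)" if C: "C1 \<in> mats n n" "C0 \<in> mats n n" for C1 C0
    proof -
      have cb: "colb (n + n) (bt n (X i 1) (X i 0))" "colb (n + n) (bt n C1 C0)"
        using bm[OF X(2,1)] bm[OF C] by auto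
      have "to_mat (n + n) (n + n) (bt n (X i 1) (X i 0)) * T (C1, C0) = to_mat (n + n) (n + n) (bt n (X i 1) (X i 0) * bt n C1 C0)"
        "T (C1, C0) * to_mat (n + n) (n + n) (bt n (X i 1) (X i 0)) = to_mat (n + n) (n + n) (bt n C1 C0 * bt n (X i 1) (X i 0))"
        by (simp_all only: T_def fst_conv snd_conv to_mat_mult[OF cb(1)] to_mat_mult[OF cb(2)])
      moreover have "bt n (X i 1) (X i 0) * bt n C1 C0 \<in> mats (n + n) (n + n)" "bt n C1 C0 * bt n (X i 1) (X i 0) \<in> mats (n + n) (n + n)"
        using bm[OF X(2,1)] bm[OF C] by auto
      ultimately have "to_mat (n + n) (n + n) (bt n (X i 1) (X i 0)) * T (C1, C0) = T (C1, C0) * to_mat (n + n) (n + n) (bt n (X i 1) (X i 0))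
         \<longleftrightarrow> bt n (X i 1) (X i 0) * bt n C1 C0 = bt n C1 C0 * bt n (X i 1) (X i 0)"
        using to_mat_inj by metis
      also have "\<dots> \<longleftrightarrow> X i 1 * C1 = C1 * X i 1 \<and> X i 1 * C0 + X i 0 * C1 = C1 * X i 0 + C0 * X i 1"
        using X C by (simp add: bt_mult) (subst bt_inj, auto)
      also have "\<dots> \<longleftrightarrow> (C1, C0) \<in> ctz n (X i 1) (X i 0)" using C by (simp add: ctz_def)
      finally show ?thesis .
    qed
    have "mat_subspace_dim (n + n) (toeplitz_centralizer r m n A i) = pvs.dim (ctz n (X i 1) (X i 0))"
    proof (rule pvs.mat_subspace_dim_eq[OF ctz_space(2,1), where T = T])
      show im: "T ` ctz n (X i 1) (X i 0) = toeplitz_centralizer r m n A i"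
      proof (intro equalityI subsetI)
        fix Z assume "Z \<in> T ` ctz n (X i 1) (X i 0)"
        then obtain C1 C0 where C: "C1 \<in> mats n n" "C0 \<in> mats n n" "(C1, C0) \<in> ctz n (X i 1) (X i 0)" "Z = T (C1, C0)"
          by (auto simp: ctz_def)
        define C where "C j = (if j = 0 then to_mat n n C0 else to_mat n n C1)" for j :: nat
        have "block_toeplitz n 1 C = T (C1, C0)"
          unfolding T_def fst_conv snd_conv by (rule block_toeplitz_1) (use C in \<open>auto simp: C_def\<close>)
        then show "Z \<in> toeplitz_centralizer r m n A i"
          unfolding toeplitz_centralizer_def m1
          using comm[OF C(1,2)] C(3,4) by (intro CollectI exI[of _ C]) (auto simp: B C_def simp del: One_nat_def)
      next
        fix Z assume "Z \<in> toeplitz_centralizer r m n A i"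
        then obtain C where C: "Z = block_toeplitz n 1 C" "\<forall>j\<le>1. C j \<in> carrier_mat n n"
          "block_toeplitz n 1 (coef r m n A i) * block_toeplitz n 1 C = block_toeplitz n 1 C * block_toeplitz n 1 (coef r m n A i)"
          by (auto simp: toeplitz_centralizer_def m1)
        have mC: "of_mat (C 1) \<in> mats n n" "of_mat (C 0) \<in> mats n n"
          using C(2)[rule_format, of 1] C(2)[rule_format, of 0] by auto
        have Z: "block_toeplitz n 1 C = T (of_mat (C 1), of_mat (C 0))"
          unfolding T_def fst_conv snd_conv by (rule block_toeplitz_1) (use C(2) mC in auto)
        then have "(of_mat (C 1), of_mat (C 0)) \<in> ctz n (X i 1) (X i 0)"
          using comm[OF mC] C(3) by (simp only: B)
        then show "Z \<in> T ` ctz n (X i 1) (X i 0)" using C(1) Z by blast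
      qed
      show "toeplitz_centralizer r m n A i \<subseteq> carrier_mat (n + n) (n + n)" unfolding im[symmetric] by (auto simp: T_def)
      show "T (x + y) = T x + T y" for x y by (simp add: T_def bt_def algebra_simps to_mat_simps(3)[symmetric] del: to_mat_simps(3))
      show "T (pscl c x) = c \<cdot>\<^sub>m T x" for c x
        by (simp add: T_def pscl_def bt_def fvs.scale_right_distrib[symmetric] to_mat_simps(4)[symmetric] del: to_mat_simps(3,4))
      show "inj_on T (ctz n (X i 1) (X i 0))"
      proof (rule inj_onI)
        fix x y assume xy: "x \<in> ctz n (X i 1) (X i 0)" "y \<in> ctz n (X i 1) (X i 0)" "T x = T y"
        then have m: "fst x \<in> mats n n" "snd x \<in> mats n n" "fst y \<in> mats n n" "snd y \<in> mats n n"
          by (auto simp: ctz_def)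
        have "bt n (fst x) (snd x) = bt n (fst y) (snd y)"
          by (rule to_mat_inj[OF bt_mats[OF m(1,2)] bt_mats[OF m(3,4)]]) (use xy(3) in \<open>simp add: T_def\<close>)
        then show "x = y" using bt_inj[OF m] by (simp add: prod_eq_iff)
      qed
    qed
    then show ?thesis using m1 by (simp add: cdim_def mult_2_right)
  qed
qed

text \<open>The corrections for the indices with \<open>m i = 0\<close> sum to
  \<open>r + 1 - \<Sum>m i\<close>; together with the coefficient \<open>r + \<Sum>m i - 1\<close>
  from the index they give \<open>2 * r\<close>, independently of \<open>m\<close>.\<close>

lemma idx_rep:
  assumes R: "rep r m n A X" and m: "\<forall>i\<le>r. m i \<le> 1"
  shows "idx r m n A = (\<Sum>i\<le>r. int (cdim n (X i 1) (X i 0))) - 2 * int r * (int n)\<^sup>2"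
proof -
  have "int (mat_subspace_dim (n * (m i + 1)) (toeplitz_centralizer r m n A i)) =
      int (cdim n (X i 1) (X i 0)) - (1 - int (m i)) * (int n)\<^sup>2" if "i \<le> r" for i
  proof -
    have "m i \<le> 1" using m that by simp
    have "int (mat_subspace_dim (n * (m i + 1)) (toeplitz_centralizer r m n A i) + (1 - m i) * (n * n)) = int (cdim n (X i 1) (X i 0))"
      by (simp only: dim_toeplitz_centralizer[OF R that \<open>m i \<le> 1\<close>])
    then show ?thesis using \<open>m i \<le> 1\<close> by (simp add: of_nat_diff power2_eq_square)
  qed
  then have "(\<Sum>i\<le>r. int (mat_subspace_dim (n * (m i + 1)) (toeplitz_centralizer r m n A i))) =
      (\<Sum>i\<le>r. int (cdim n (X i 1) (X i 0)) - (1 - int (m i)) * (int n)\<^sup>2)"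
    by (intro sum.cong) auto
  also have "\<dots> = (\<Sum>i\<le>r. int (cdim n (X i 1) (X i 0))) - (int r + 1 - (\<Sum>i\<le>r. int (m i))) * (int n)\<^sup>2"
    by (simp add: sum_subtractf sum_distrib_right[symmetric])
  finally show ?thesis by (simp add: idx_def num_entries_def algebra_simps)
qed

section \<open>Vectors as columns; irreducibility and semisimplicity of the completed tuple\<close>

definition of_vec :: "complex vec \<Rightarrow> fmat" where
  "of_vec w = of_mat (mat (dim_vec w) 1 (\<lambda>(i, j). w $ i))"

lemma entry_of_vec: "entry (of_vec w) i j = (if i < dim_vec w \<and> j = 0 then w $ i else 0)"
  by (simp add: of_vec_def entry_of_mat)

lemma of_vec_bounds [simp]: "rowb n (of_vec w) \<longleftrightarrow> (\<forall>i<dim_vec w. n \<le> i \<longrightarrow> w $ i = 0)" "colb (Suc k) (of_vec w)"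
  by (auto simp: rowb_def colb_def entry_of_vec)

lemma of_vec_inj: "v \<in> carrier_vec n \<Longrightarrow> w \<in> carrier_vec n \<Longrightarrow> of_vec v = of_vec w \<longleftrightarrow> v = w"
proof
  assume *: "v \<in> carrier_vec n" "w \<in> carrier_vec n" "of_vec v = of_vec w"
  then have "entry (of_vec v) i 0 = entry (of_vec w) i 0" for i by simp
  then have eq: "(if i < n then v $ i else 0) = (if i < n then w $ i else 0)" for i
    using *(1,2) by (simp add: entry_of_vec)
  show "v = w"
  proof (rule eq_vecI)
    fix i assume "i < dim_vec w"
    then show "v $ i = w $ i" using eq[of i] *(2) by simp
  qed (use *(1,2) in auto)
qed simp

lemma of_vec_simps [simp]:
  "of_vec (0\<^sub>v n) = 0" "v \<in> carrier_vec n \<Longrightarrow> w \<in> carrier_vec n \<Longrightarrow> of_vec (v + w) = of_vec v + of_vec w"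
  "of_vec (c \<cdot>\<^sub>v v) = c *\<^sub>F of_vec v" "of_vec (- v) = - of_vec v"
  "v \<in> carrier_vec n \<Longrightarrow> w \<in> carrier_vec n \<Longrightarrow> of_vec (v - w) = of_vec v - of_vec w"
  by (auto intro!: fmat_eqI simp: entry_of_vec)

lemma of_vec_mult:
  assumes "X \<in> mats m n" "w \<in> carrier_vec n" shows "of_vec (to_mat m n X *\<^sub>v w) = X * of_vec w"
proof (rule fmat_eqI)
  fix i j
  show "entry (of_vec (to_mat m n X *\<^sub>v w)) i j = entry (X * of_vec w) i j"
  proof (cases "i < m \<and> j = 0")
    case True
    then show ?thesis using assms
      by (simp add: entry_of_vec entry_times_colb[of n] scalar_prod_def atLeast0LessThan)
  next
    case False
    have "X * of_vec w \<in> mats m (Suc 0)" using assms by simp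
    from matsD[OF this, of i j] show ?thesis using False by (auto simp: entry_of_vec)
  qed
qed

definition to_vec :: "nat \<Rightarrow> fmat \<Rightarrow> complex vec" where
  "to_vec n x = vec n (\<lambda>i. entry x i 0)"

lemma to_vec_carrier [simp]: "to_vec n x \<in> carrier_vec n" "dim_vec (to_vec n x) = n"
  by (simp_all add: to_vec_def)

lemma of_vec_to_vec [simp]: "x \<in> mats n 1 \<Longrightarrow> of_vec (to_vec n x) = x"
  using matsD[of x n 1] by (intro fmat_eqI) (force simp: entry_of_vec to_vec_def)

lemma to_vec_of_vec [simp]: "w \<in> carrier_vec n \<Longrightarrow> to_vec n (of_vec w) = w"
  by (intro eq_vecI) (auto simp: entry_of_vec to_vec_def)

text \<open>The subspace attached to \<open>J\<close> consists of the vectors whose column lies in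
  \<open>J\<close>. It determines \<open>J\<close> in both extreme cases: columns are extracted by
  right multiplication with \<open>unit_mat k 0\<close>, and the identity is a sum of products of a
  unit column and a unit row.\<close>

lemma irr_mod_of_irreducible:
  assumes R: "rep r m n A X" and m: "\<forall>i\<le>r. m i \<le> 1" and irr: "irreducible_tuple r m n A"
  shows "irr_mod r n X"
  unfolding irr_mod_def
proof (intro allI impI)
  fix J assume J: "right_ideal J" and row: "\<forall>x\<in>J. rowb n x"
    and inv: "\<forall>i\<le>r. \<forall>x\<in>J. X i 0 * x \<in> J \<and> X i 1 * x \<in> J"
  note rJ = right_idealD[OF J]
  define W where "W = {w \<in> carrier_vec n. of_vec w \<in> J}"
  have X: "X i 0 \<in> mats n n" "X i 1 \<in> mats n n" if "i \<le> r" for i using R that by (auto simp: rep_def)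
  have "VectorSpace.subspace class_ring W (module_vec TYPE(complex) n)"
    unfolding VectorSpace.subspace_def submodule_def
  proof (intro conjI vec_vs vec_module allI impI)
    show "W \<subseteq> carrier (module_vec TYPE(complex) n)" by (auto simp: W_def module_vec_simps)
    show "\<zero>\<^bsub>module_vec TYPE(complex) n\<^esub> \<in> W" using rJ(1) by (simp add: W_def module_vec_simps)
    fix v w assume "v \<in> W" "w \<in> W"
    then show "v \<oplus>\<^bsub>module_vec TYPE(complex) n\<^esub> w \<in> W"
      using rJ(2) of_vec_simps(2)[of v n w] by (simp add: W_def module_vec_simps del: of_vec_simps(2))
  next
    fix c v assume "v \<in> W"
    then show "c \<odot>\<^bsub>module_vec TYPE(complex) n\<^esub> v \<in> W"
      using right_ideal_scl[OF J] by (simp add: W_def module_vec_simps)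
  qed
  moreover have "\<forall>(i, j) \<in> entries r m. \<forall>w \<in> W. A i j *\<^sub>v w \<in> W"
  proof clarify
    fix i j w assume ij: "(i, j) \<in> entries r m" and w: "w \<in> W"
    have i: "i \<le> r" and "j \<le> m i" using ij by (auto simp: entries_def)
    then have "j \<le> 1" using m by (meson order_trans)
    then have j: "j = 0 \<or> j = 1" by auto
    have mX: "X i j \<in> mats n n" using X[OF i] j by auto
    have "A i j = to_mat n n (X i j)" using R ij by (auto simp: rep_def)
    moreover have "X i j * of_vec w \<in> J" using inv i w j by (auto simp: W_def)
    ultimately show "A i j *\<^sub>v w \<in> W" using w of_vec_mult[OF mX] mult_mat_vec_carrier[OF to_mat_carrier] by (simp add: W_def)
  qed
  ultimately have "W = {0\<^sub>v n} \<or> W = carrier_vec n" using irr by (simp add: irreducible_tuple_def)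
  then show "J = {0} \<or> idm n \<in> J"
  proof
    assume W: "W = {0\<^sub>v n}"
    have "x = 0" if x: "x \<in> J" for x
    proof (rule fmat_eqI)
      fix i k
      have "x * unit_mat k 0 \<in> mats n 1" using row x by simp
      then have o: "of_vec (to_vec n (x * unit_mat k 0)) = x * unit_mat k 0" by (rule of_vec_to_vec)
      then have "to_vec n (x * unit_mat k 0) \<in> W" using rJ(3)[OF x] by (simp add: W_def)
      then have "x * unit_mat k 0 = 0" using o W by simp
      then have "entry (x * unit_mat k 0) i 0 = 0" by simp
      then show "entry x i k = entry 0 i k" by (simp add: entry_mult_unit_mat)
    qed
    then show ?thesis using rJ(1) by blast
  next
    assume W: "W = carrier_vec n"
    have "unit_mat k 0 * unit_mat 0 k \<in> J" if "k < n" for k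
    proof -
      have "to_vec n (unit_mat k 0) \<in> W" by (simp add: W)
      then show ?thesis using rJ(3) that by (simp add: W_def del: unit_mat_mult)
    qed
    then have "(\<Sum>k<n. unit_mat k 0 * unit_mat 0 k) \<in> J" by (intro right_ideal_sum[OF J]) auto
    then show ?thesis by (simp only: idm_eq_sum_unit_mat[symmetric]) simp
  qed
qed

lemma spectral_of_idempotents:
  assumes "finite D" and e: "\<And>d. d \<in> D \<Longrightarrow> e d \<in> mats n n"
    and orth: "\<And>c d. c \<in> D \<Longrightarrow> d \<in> D \<Longrightarrow> e c * e d = (if c = d then e d else 0)"
    and sum: "(\<Sum>d\<in>D. e d) = idm n" and A: "A = (\<Sum>d\<in>D. d *\<^sub>F e d)"
  shows "\<exists>k u v. spectral n A D k u v"
proof -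
  have "\<exists>k g h. g \<in> mats n k \<and> h \<in> mats k n \<and> e d = g * h \<and> h * g = idm k" if "d \<in> D" for d
    by (rule idempotent_split[of "e d" n]) (use e orth that in auto)
  then obtain k u v where uv: "\<And>d. d \<in> D \<Longrightarrow> u d \<in> mats n (k d) \<and> v d \<in> mats (k d) n \<and> e d = u d * v d \<and> v d * u d = idm (k d)"
    by metis
  have "v c * u d = 0" if "c \<in> D" "d \<in> D" "c \<noteq> d" for c d
  proof -
    have "v c * u d = v c * u c * (v c * u d) * (v d * u d)" using uv[OF that(1)] uv[OF that(2)] by simp
    also have "\<dots> = v c * ((u c * v c) * (u d * v d)) * u d" by (simp only: mult.assoc)
    also have "(u c * v c) * (u d * v d) = e c * e d" using uv that by metis
    finally show ?thesis using orth[OF that(1,2)] that(3) by simp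
  qed
  moreover have "(\<Sum>d\<in>D. u d * v d) = (\<Sum>d\<in>D. e d)" "(\<Sum>d\<in>D. d *\<^sub>F (u d * v d)) = (\<Sum>d\<in>D. d *\<^sub>F e d)"
    using uv by (auto intro!: sum.cong)
  ultimately have "spectral n A D k u v" using assms(1) uv sum A by (simp add: spectral_def)
  then show ?thesis by blast
qed

text \<open>Diagonal entries are grouped by their value, and the resulting coordinate idempotents
  are conjugated back.\<close>

lemma spectral_of_semisimple:
  assumes X: "X \<in> mats n n" and ss: "semisimple_mat (to_mat n n X)"
  shows "\<exists>D k u v. spectral n X D k u v"
proof -
  obtain Dm P Q where D: "diagonal_mat Dm" "similar_mat_wit (to_mat n n X) Dm P Q"
    using ss by (auto simp: semisimple_mat_def similar_mat_def)
  then have c: "Dm \<in> carrier_mat n n" "P \<in> carrier_mat n n" "Q \<in> carrier_mat n n"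
    and PQ: "P * Q = 1\<^sub>m n" "Q * P = 1\<^sub>m n" "to_mat n n X = P * Dm * Q"
    by (auto simp: similar_mat_wit_def Let_def)
  define p q dm where "p = of_mat P" and "q = of_mat Q" and "dm = of_mat Dm"
  have mem: "p \<in> mats n n" "q \<in> mats n n" "dm \<in> mats n n"
    using c by (simp_all add: p_def q_def dm_def)
  have tm: "to_mat n n p = P" "to_mat n n q = Q" "to_mat n n dm = Dm"
    using c by (simp_all add: p_def q_def dm_def)
  have qp: "q * p = idm n" and pq: "p * q = idm n"
    by (rule to_mat_inj[of _ n n]; use mem PQ in \<open>simp add: to_mat_mult[of n] tm\<close>)+
  have Xp: "X = p * dm * q"
  proof (rule to_mat_inj[OF X])
    show "p * dm * q \<in> mats n n" using mem by (simp add: mult.assoc)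
    have "to_mat n n (p * dm * q) = to_mat n n (p * dm) * to_mat n n q"
      by (rule to_mat_mult) (use mem in simp)
    also have "to_mat n n (p * dm) = to_mat n n p * to_mat n n dm"
      by (rule to_mat_mult) (use mem in simp)
    finally show "to_mat n n X = to_mat n n (p * dm * q)" by (simp add: tm PQ(3))
  qed
  define \<delta> where "\<delta> a = Dm $$ (a, a)" for a
  have dm: "dm = (\<Sum>a<n. \<delta> a *\<^sub>F unit_mat a a)"
  proof (rule fmat_eqI)
    fix i j
    have "entry (\<Sum>a<n. \<delta> a *\<^sub>F unit_mat a a) i j = (\<Sum>a<n. if a = i then (if i = j then \<delta> i else 0) else 0)"
      unfolding entry_sum by (rule sum.cong) auto
    also have "\<dots> = entry dm i j"
      using D(1) c(1) by (auto simp: dm_def entry_of_mat \<delta>_def diagonal_mat_def)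
    finally show "entry dm i j = entry (\<Sum>a<n. \<delta> a *\<^sub>F unit_mat a a) i j" by simp
  qed
  define D where "D = \<delta> ` {..<n}"
  define f where "f d = (\<Sum>a | a < n \<and> \<delta> a = d. unit_mat a a)" for d
  define e where "e d = p * f d * q" for d
  have mf: "f d \<in> mats n n" for d by (auto simp: f_def)
  have um: "unit_mat a a * unit_mat b b = (if a = b then unit_mat a a else 0)" for a b
    by (intro fmat_eqI) (auto simp: entry_mult_unit_mat)
  have ff: "f c * f d = (if c = d then f d else 0)" for c d
  proof -
    have "f c * f d = (\<Sum>a | a < n \<and> \<delta> a = c. \<Sum>b | b < n \<and> \<delta> b = d. if b = a then unit_mat a a else 0)"
      unfolding f_def sum_product by (auto simp: um intro!: sum.cong)
    also have "\<dots> = (\<Sum>a | a < n \<and> \<delta> a = c. if \<delta> a = d then unit_mat a a else 0)"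
      by (intro sum.cong) auto
    also have "\<dots> = (if c = d then f d else 0)" by (auto simp: f_def intro!: sum.neutral sum.cong)
    finally show ?thesis .
  qed
  have "\<exists>k u v. spectral n X D k u v"
  proof (rule spectral_of_idempotents[of D e])
    show "finite D" by (simp add: D_def)
    show "e d \<in> mats n n" for d using mem mf by (simp add: e_def mult.assoc)
    show "e c * e d = (if c = d then e d else 0)" for c d
    proof -
      have "e c * e d = p * (f c * f d) * q" using mf by (simp add: e_def mult.assoc mult_eq_assoc[OF qp])
      then show ?thesis by (simp add: ff e_def)
    qed
    have grp: "(\<Sum>d\<in>D. \<Sum>a | a < n \<and> \<delta> a = d. F a) = (\<Sum>a<n. F a)" for F :: "nat \<Rightarrow> fmat"
      using sum.group[of "{..<n}" D \<delta> F] by (simp add: D_def lessThan_def)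
    have "(\<Sum>d\<in>D. f d) = (\<Sum>a<n. unit_mat a a)" unfolding f_def by (rule grp)
    also have "\<dots> = idm n" using idm_eq_sum_unit_mat[of n 0] by simp
    finally have "(\<Sum>d\<in>D. f d) = idm n" .
    then show "(\<Sum>d\<in>D. e d) = idm n" using mem pq
      by (simp add: e_def sum_distrib_left[symmetric] sum_distrib_right[symmetric])
    have "(\<Sum>d\<in>D. d *\<^sub>F f d) = (\<Sum>d\<in>D. \<Sum>a | a < n \<and> \<delta> a = d. \<delta> a *\<^sub>F unit_mat a a)"
      unfolding f_def fvs.scale_sum_right by (intro sum.cong) auto
    then have "(\<Sum>d\<in>D. d *\<^sub>F f d) = dm" by (simp only: grp dm)
    then have "X = p * (\<Sum>d\<in>D. d *\<^sub>F f d) * q" by (simp add: Xp)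
    then show "X = (\<Sum>d\<in>D. d *\<^sub>F e d)" by (simp add: e_def sum_distrib_left sum_distrib_right)
  qed
  then show ?thesis by blast
qed

section \<open>From balanced pairs to types of multiplicities\<close>

lemma of_mat_diag_block:
  assumes "length ds = length ns"
  shows "of_mat (diag_block_mat (map2 (\<lambda>d k. d \<cdot>\<^sub>m 1\<^sub>m k) ds ns)) =
      (\<Sum>l<length ns. (ds ! l) *\<^sub>F (emb (sum_list (take l ns)) (ns ! l) * prj (sum_list (take l ns)) (ns ! l)))
    \<and> diag_block_mat (map2 (\<lambda>d k. d \<cdot>\<^sub>m 1\<^sub>m k) ds ns) \<in> carrier_mat (sum_list ns) (sum_list ns)"
  using assms
proof (induction ds ns rule: list_induct2)
  case Nil
  then show ?case by (auto intro!: fmat_eqI simp: entry_of_mat)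
next
  case (Cons d ds k ns)
  let ?B = "diag_block_mat (map2 (\<lambda>d k. d \<cdot>\<^sub>m 1\<^sub>m k) ds ns)"
  let ?s = "sum_list ns"
  have B: "?B \<in> carrier_mat ?s ?s" using Cons by blast
  let ?t = "\<lambda>b l. (ds ! l) *\<^sub>F (emb (b + sum_list (take l ns)) (ns ! l) * prj (b + sum_list (take l ns)) (ns ! l))"
  have sh: "emb k ?s * (emb p w * prj p w) * prj k ?s = emb (k + p) w * prj (k + p) w" if "p + w \<le> ?s" for p w
  proof -
    have "emb k ?s * emb p w = emb (k + p) w" using that
      by (intro fmat_eqI) (auto simp: entry_emb_mult)
    moreover have "prj p w * prj k ?s = prj (k + p) w" using that
      by (intro fmat_eqI) (auto simp: entry_mult_prj)
    moreover have "emb k ?s * (emb p w * prj p w) * prj k ?s = (emb k ?s * emb p w) * (prj p w * prj k ?s)"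
      by (simp only: mult.assoc)
    ultimately show ?thesis by simp
  qed
  have le: "sum_list (take l ns) + ns ! l \<le> ?s" if "l < length ns" for l
  proof -
    have "sum_list (take (Suc l) ns) \<le> ?s" by (metis append_take_drop_id le_add1 sum_list_append)
    then show ?thesis using that by (simp add: take_Suc_conv_app_nth)
  qed
  have "of_mat (diag_block_mat (map2 (\<lambda>d k. d \<cdot>\<^sub>m 1\<^sub>m k) (d # ds) (k # ns))) =
      d *\<^sub>F (emb 0 k * prj 0 k) + emb k ?s * of_mat ?B * prj k ?s"
    using B by (intro fmat_eqI) (auto simp: entry_of_mat entry_emb_mult entry_mult_prj Let_def)
  also have "emb k ?s * of_mat ?B * prj k ?s = (\<Sum>l<length ns. ?t k l)"
    unfolding Cons.IH[THEN conjunct1] sum_distrib_left sum_distrib_right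
    by (intro sum.cong refl) (use sh le in auto)
  also have "d *\<^sub>F (emb 0 k * prj 0 k) + (\<Sum>l<length ns. ?t k l) =
     (\<Sum>l<length (k # ns). ((d # ds) ! l) *\<^sub>F (emb (sum_list (take l (k # ns))) ((k # ns) ! l) * prj (sum_list (take l (k # ns))) ((k # ns) ! l)))"
    by (simp only: length_Cons sum.lessThan_Suc_shift) simp
  finally show ?case using B by (simp add: Let_def)
qed

lemma sum_nth_eq_take: "l \<le> length ns \<Longrightarrow> (\<Sum>j<l. ns ! j) = sum_list (take l (ns :: nat list))"
  by (induction l) (auto simp: take_Suc_conv_app_nth)

text \<open>The inclusions \<open>u d\<close>, placed side by side, form the matrix that
  diagonalises \<open>X1\<close>, and the diagonal blocks of the conjugated \<open>X0\<close> are
  the \<open>v d * X0 * u d\<close>. For \<open>ps = [1]\<close> there is one eigenspace and one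
  block \<open>L(q; c)\<close>, so both matrices are scalar; this is what lets the classification
  discard such singularities.\<close>

lemma has_mult_type_of_balanced:
  assumes bal: "balanced n X1 X0 K D p q" and X: "X1 \<in> mats n n" "X0 \<in> mats n n" and n: "1 \<le> n"
  obtains ps where "split_data n K ps" "has_mult_type n (to_mat n n X1) (to_mat n n X0) (split_type K ps)"
    "ps = [1] \<Longrightarrow> (\<exists>c. X1 = c *\<^sub>F idm n) \<and> (\<exists>c. X0 = c *\<^sub>F idm n)"
proof -
  define k where "k d = p d * q d" for d
  obtain u v where sp: "spectral n X1 D k u v"
    and pq: "\<And>d. d \<in> D \<Longrightarrow> 1 \<le> p d \<and> 1 \<le> q d \<and> k d + q d = K"
    and con: "\<And>d. d \<in> D \<Longrightarrow> \<exists>ls G H. length ls = p d \<and> G \<in> mats (k d) (k d) \<and> H \<in> mats (k d) (k d) \<and>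
          H * G = idm (k d) \<and> v d * X0 * u d * G = G * Lf (q d) ls"
    using bal unfolding balanced_def k_def by blast
  have fin: "finite D" and uv: "\<And>d. d \<in> D \<Longrightarrow> u d \<in> mats n (k d) \<and> v d \<in> mats (k d) n"
    and sum1: "(\<Sum>d\<in>D. u d * v d) = idm n" and X1: "X1 = (\<Sum>d\<in>D. d *\<^sub>F (u d * v d))"
    using sp by (auto simp: spectral_def)
  obtain es where es: "set es = D" "distinct es" "sorted (map p es)" by (rule finite_sorted_list[OF fin, of p])
  \<comment> \<open>Decreasing \<open>p\<close> is the order in which \<open>split_data\<close>
    lists the blocks.\<close>
  define ds where "ds = rev es"
  have ds: "set ds = D" "distinct ds" "sorted_wrt (\<ge>) (map p ds)"
    using es by (auto simp: ds_def rev_map[symmetric] sorted_wrt_rev)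
  define ps where "ps = map p ds"
  define ns where "ns = map k ds"
  define L where "L = length ds"
  have dsD: "ds ! l \<in> D" if "l < L" for l using that ds(1) by (auto simp: L_def)
  have qK: "K div (p d + 1) = q d" "p d + 1 dvd K" if "d \<in> D" for d
  proof -
    have K: "K = (p d + 1) * q d" using pq[OF that] by (simp add: k_def)
    show "K div (p d + 1) = q d" unfolding K by (rule nonzero_mult_div_cancel_left) simp
    show "p d + 1 dvd K" unfolding K by (rule dvd_triv_left)
  qed
  have reidx: "(\<Sum>d\<in>D. F d) = (\<Sum>l<L. F (ds ! l))" for F :: "complex \<Rightarrow> 'z::comm_monoid_add"
    using sum.reindex_bij_betw[OF bij_betw_nth[OF ds(2) refl refl], of F] ds(1) by (simp add: L_def lessThan_atLeast0)
  have sk: "sum_list ns = n"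
  proof -
    have "sum_list ns = (\<Sum>l<L. k (ds ! l))" by (simp add: ns_def sum_list_sum_nth L_def atLeast0LessThan)
    then show ?thesis using spectral_dims[OF sp] by (simp add: reidx)
  qed
  have st: "split_type K ps = (ns, map (\<lambda>d. replicate (p d) (q d)) ds)"
    using qK ds(1) by (auto simp: split_type_def ps_def ns_def k_def)
  define w where "w l = ns ! l" for l
  have w: "w l = k (ds ! l)" if "l < L" for l using that by (simp add: w_def ns_def L_def)
  define J where "J l = emb (\<Sum>j<l. w j) (w l)" for l
  define I where "I l = prj (\<Sum>j<l. w j) (w l)" for l
  have Ln: "length ns = L" by (simp add: ns_def L_def)
  have take: "(\<Sum>j<l. w j) = sum_list (take l ns)" if "l \<le> L" for l
    using sum_nth_eq_take[of l ns] that by (simp add: w_def Ln)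
  have wn: "(\<Sum>l<L. w l) = n" using take[of L] sk by (simp add: Ln[symmetric])
  have IJ: "I l * J l' = (if l = l' then idm (w l) else 0)" for l l' unfolding I_def J_def by (rule prj_emb_offsets)
  have off: "(\<Sum>j<l. w j) + w l \<le> n" if "l < L" for l
  proof -
    have "(\<Sum>j<Suc l. w j) \<le> (\<Sum>j<L. w j)" using that by (intro sum_mono2) auto
    then show ?thesis using wn by simp
  qed
  have mJ: "J l \<in> mats n (w l)" "I l \<in> mats (w l) n" if "l < L" for l
    using off[OF that] by (simp_all add: J_def I_def)
  have mu: "u (ds ! l) \<in> mats n (w l)" "v (ds ! l) \<in> mats (w l) n" if "l < L" for l
    using uv[OF dsD[OF that]] w[OF that] by auto
  define P where "P = (\<Sum>l<L. u (ds ! l) * I l)"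
  define Q where "Q = (\<Sum>l<L. J l * v (ds ! l))"
  have mPQ: "P \<in> mats n n" "Q \<in> mats n n" using mJ mu by (auto simp: P_def Q_def)
  have PJ: "P * J l = u (ds ! l)" if l: "l < L" for l
  proof -
    have "P * J l = (\<Sum>l'<L. if l' = l then u (ds ! l) else 0)"
      unfolding P_def sum_distrib_right using mu l by (intro sum.cong) (auto simp: mult.assoc IJ)
    then show ?thesis using l by simp
  qed
  have IQ: "I l * Q = v (ds ! l)" if l: "l < L" for l
  proof -
    have "I l * Q = (\<Sum>l'<L. if l' = l then v (ds ! l) else 0)"
      unfolding Q_def sum_distrib_left using mu l by (intro sum.cong) (auto simp: IJ[THEN mult_eq_assoc])
    then show ?thesis using l by simp
  qed
  have PQ: "P * Q = idm n"
  proof -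
    have "P * Q = (\<Sum>l<L. P * J l * v (ds ! l))" by (simp add: Q_def sum_distrib_left mult.assoc)
    also have "\<dots> = (\<Sum>d\<in>D. u d * v d)" unfolding reidx by (intro sum.cong) (auto simp: PJ)
    finally show ?thesis by (simp add: sum1)
  qed
  have QP: "Q * P = idm n" by (rule left_inverse_is_right_inverse[OF mPQ(2,1) PQ])
  define \<Delta> where "\<Delta> = (\<Sum>l<L. (ds ! l) *\<^sub>F (J l * I l))"
  have m\<Delta>: "\<Delta> \<in> mats n n" using mJ by (auto simp: \<Delta>_def)
  have X1': "X1 = P * \<Delta> * Q"
  proof -
    have "P * \<Delta> * Q = (\<Sum>l<L. (ds ! l) *\<^sub>F (P * J l * (I l * Q)))"
      by (simp add: \<Delta>_def sum_distrib_left sum_distrib_right mult.assoc)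
    also have "\<dots> = (\<Sum>d\<in>D. d *\<^sub>F (u d * v d))" unfolding reidx by (intro sum.cong) (auto simp: PJ IQ)
    finally show ?thesis by (simp add: X1)
  qed
  have diag: "diag_block_mat (map2 (\<lambda>d k. d \<cdot>\<^sub>m 1\<^sub>m k) ds ns) = to_mat n n \<Delta>"
  proof -
    have len: "length ds = length ns" by (simp add: ns_def)
    note od = of_mat_diag_block[OF len, unfolded sk]
    have "of_mat (diag_block_mat (map2 (\<lambda>d k. d \<cdot>\<^sub>m 1\<^sub>m k) ds ns)) = \<Delta>"
      unfolding od[THEN conjunct1] \<Delta>_def Ln using take by (intro sum.cong refl) (auto simp: J_def I_def w_def)
    then show ?thesis using od[THEN conjunct2] by (metis to_mat_of_mat)
  qed
  show ?thesis
  proof (rule that)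
    have "ps \<noteq> []" using sk n by (auto simp: ps_def ns_def)
    moreover have "n = (\<Sum>r\<leftarrow>ps. r * (K div (r + 1)))"
      using st sk by (simp add: split_type_def)
    ultimately show "split_data n K ps"
      using ds(1,3) pq qK by (auto simp: split_data_def ps_def)
    have wit: "similar_mat_wit (to_mat n n X1) (to_mat n n \<Delta>) (to_mat n n P) (to_mat n n Q)"
    proof -
      have "to_mat n n X1 = to_mat n n (P * \<Delta>) * to_mat n n Q"
        unfolding X1' by (rule to_mat_mult) (use m\<Delta> in simp)
      also have "to_mat n n (P * \<Delta>) = to_mat n n P * to_mat n n \<Delta>"
        by (rule to_mat_mult) (use mPQ in simp)
      finally show ?thesis
        using mPQ PQ QP by (intro similar_mat_witI[of _ _ n]) (auto simp: to_mat_mult[symmetric])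
    qed
    have blk: "\<exists>ls. length ls = length (replicate (p (ds ! l)) (q (ds ! l))) \<and>
        similar_mat (nth_diag_block ns l (to_mat n n Q * to_mat n n X0 * to_mat n n P))
          (L_mat (replicate (p (ds ! l)) (q (ds ! l))) ls)" if l: "l < L" for l
    proof -
      define d where "d = ds ! l"
      have d: "d \<in> D" using dsD[OF l] by (simp add: d_def)
      obtain ls G H where G: "length ls = p d" "G \<in> mats (k d) (k d)" "H \<in> mats (k d) (k d)"
          "H * G = idm (k d)" "v d * X0 * u d * G = G * Lf (q d) ls" using con[OF d] by blast
      have GH: "G * H = idm (k d)" by (rule left_inverse_is_right_inverse[OF G(2,3,4)])
      have eq: "v d * X0 * u d = G * Lf (q d) ls * H"
      proof -
        have "v d * X0 * u d = v d * X0 * u d * (G * H)" using uv[OF d] by (simp add: GH mult.assoc)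
        then show ?thesis by (simp only: mult.assoc[symmetric] G(5))
      qed
      have Lm: "Lf (q d) ls \<in> mats (k d) (k d)" using Lf_mats[of "q d" ls] by (simp add: G(1) k_def)
      have Lq: "L_mat (replicate (p d) (q d)) ls = to_mat (k d) (k d) (Lf (q d) ls)"
        using of_mat_L_mat[of ls "q d"] unfolding G(1) k_def by (metis to_mat_of_mat)
      have "nth_diag_block ns l (to_mat n n Q * to_mat n n X0 * to_mat n n P) = to_mat (k d) (k d) (v d * X0 * u d)"
      proof -
        have "to_mat n n Q * to_mat n n X0 * to_mat n n P = to_mat n n (Q * X0 * P)"
          using mPQ X by (simp add: to_mat_mult[symmetric])
        moreover have IJe: "I l * (Q * X0 * P) * J l = v d * X0 * u d"
          using IQ[OF l] PJ[OF l] by (simp add: d_def mult.assoc[symmetric]) (simp add: mult.assoc)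
        have "entry (Q * X0 * P) (sum_list (take l ns) + a) (sum_list (take l ns) + b) = entry (v d * X0 * u d) a b"
          if "a < k d" "b < k d" for a b
          using arg_cong[OF IJe, of "\<lambda>Z. entry Z a b"] that take[of l] l w[OF l]
          by (simp add: I_def J_def entry_mult_emb entry_prj_mult d_def del: mult.assoc)
        moreover have "ns ! l = k d" using w[OF l] by (simp add: w_def d_def)
        moreover have "sum_list (take l ns) + k d \<le> n" using off[OF l] take[of l] l w[OF l] by (simp add: d_def)
        ultimately show ?thesis by (intro eq_matI) (auto simp: nth_diag_block_def)
      qed
      moreover have "similar_mat (to_mat (k d) (k d) (v d * X0 * u d)) (to_mat (k d) (k d) (Lf (q d) ls))"
      proof -
        have "to_mat (k d) (k d) (v d * X0 * u d) = to_mat (k d) (k d) (G * Lf (q d) ls) * to_mat (k d) (k d) H"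
          unfolding eq by (rule to_mat_mult) (use Lm in simp)
        also have "to_mat (k d) (k d) (G * Lf (q d) ls) = to_mat (k d) (k d) G * to_mat (k d) (k d) (Lf (q d) ls)"
          by (rule to_mat_mult) (use G in simp)
        finally have "similar_mat_wit (to_mat (k d) (k d) (v d * X0 * u d)) (to_mat (k d) (k d) (Lf (q d) ls))
            (to_mat (k d) (k d) G) (to_mat (k d) (k d) H)"
          using G(2,3,4) GH by (intro similar_mat_witI[of _ _ "k d"]) (auto simp: to_mat_mult[symmetric])
        then show ?thesis unfolding similar_mat_def by blast
      qed
      ultimately show ?thesis unfolding d_def[symmetric] Lq[symmetric] using G(1) by (intro exI[of _ ls]) simp
    qed
    show "has_mult_type n (to_mat n n X1) (to_mat n n X0) (split_type K ps)"
      unfolding has_mult_type_def st prod.case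
    proof (intro conjI)
      show "length (map (\<lambda>d. replicate (p d) (q d)) ds) = length ns" by (simp add: ns_def)
      show "\<forall>k\<in>set ns. 1 \<le> k" using pq ds(1) by (auto simp: ns_def k_def)
      show "\<forall>qs\<in>set (map (\<lambda>d. replicate (p d) (q d)) ds). sorted_wrt (\<ge>) qs \<and> (\<forall>q\<in>set qs. 1 \<le> q)"
        using pq ds(1) by (auto simp: sorted_wrt_iff_nth_less)
      show "\<exists>P Q ds'. length ds' = length ns \<and> distinct ds' \<and> P \<in> carrier_mat n n \<and>
          similar_mat_wit (to_mat n n X1) (diag_block_mat (map2 (\<lambda>d k. d \<cdot>\<^sub>m 1\<^sub>m k) ds' ns)) P Q \<and>
          (\<forall>l<length ns. \<exists>ls. length ls = length (map (\<lambda>d. replicate (p d) (q d)) ds ! l) \<and>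
             similar_mat (nth_diag_block ns l (Q * to_mat n n X0 * P)) (L_mat (map (\<lambda>d. replicate (p d) (q d)) ds ! l) ls))"
        by (rule exI[of _ "to_mat n n P"], rule exI[of _ "to_mat n n Q"], rule exI[of _ ds])
          (use blk wit ds(2) Ln in \<open>auto simp: diag L_def\<close>)
    qed (rule sk)
    assume ps1: "ps = [1]"
    then obtain d where d: "ds = [d]" "p d = 1" by (auto simp: ps_def)
    then have D: "D = {d}" using ds(1) by simp
    have one: "u d * v d = idm n" using sum1 by (simp add: D)
    obtain ls G H where G: "length ls = p d" "G \<in> mats (k d) (k d)" "H \<in> mats (k d) (k d)"
        "H * G = idm (k d)" "v d * X0 * u d * G = G * Lf (q d) ls" using con[of d] D by blast
    have GH: "G * H = idm (k d)" by (rule left_inverse_is_right_inverse[OF G(2,3,4)])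
    obtain c where ls: "ls = [c]" using G(1) d(2) by (auto simp: length_Suc_conv)
    have kq: "k d = q d" using d(2) by (simp add: k_def)
    have "v d * X0 * u d = v d * X0 * u d * (G * H)" using uv[of d] D by (simp add: GH mult.assoc)
    also have "\<dots> = G * Lf (q d) ls * H" by (simp only: mult.assoc[symmetric] G(5))
    also have "\<dots> = c *\<^sub>F idm (k d)" using G(2) by (simp add: ls kq[symmetric] GH)
    finally have vX: "v d * X0 * u d = c *\<^sub>F idm (k d)" .
    have "X0 = (u d * v d) * X0 * (u d * v d)" using X by (simp add: one)
    also have "\<dots> = u d * (v d * X0 * u d) * v d" by (simp only: mult.assoc)
    also have "\<dots> = c *\<^sub>F idm n" using uv[of d] D one by (simp add: vX)
    finally have "X0 = c *\<^sub>F idm n" .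
    moreover have "X1 = d *\<^sub>F idm n" using X1 one by (simp add: D)
    ultimately show "(\<exists>c. X1 = c *\<^sub>F idm n) \<and> (\<exists>c. X0 = c *\<^sub>F idm n)" by blast
  qed
qed

section \<open>The middle convolution of a tuple\<close>

lemma conv_spaceD:
  assumes "v \<in> conv_space r m n"
  shows "v i j \<in> carrier_vec n" "dim_vec (v i j) = n" "(i, j) \<notin> entries r m \<Longrightarrow> v i j = 0\<^sub>v n"
  using assms by (auto simp: conv_space_def)

lemma of_vec_eq_0: "w \<in> carrier_vec n \<Longrightarrow> of_vec w = 0 \<longleftrightarrow> w = 0\<^sub>v n"
  using of_vec_inj[of w n "0\<^sub>v n"] by simp

lemma entries_conv:
  assumes "\<forall>i\<le>r. m i \<le> 1"
  shows "(i, j) \<in> entries r m \<longleftrightarrow> i \<le> r \<and> (j = 0 \<and> i \<noteq> 0 \<or> j = 1 \<and> m i = 1)"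
proof -
  have "m i = 0 \<or> m i = 1" if "i \<le> r" using assms that by (metis less_one linorder_not_less le_neq_implies_less)
  then show ?thesis by (auto simp: entries_def)
qed

lemma of_vec_conv_sum:
  assumes R: "rep r m n A X" and m: "\<forall>i\<le>r. m i \<le> 1" and v: "v \<in> conv_space r m n"
  shows "of_vec (conv_sum r m n A v) = (\<Sum>i\<le>r. X i 0 * of_vec (v i 0) + X i 1 * of_vec (v i 1))"
proof (rule fmat_eqI)
  fix a b
  have mX: "X i j \<in> mats n n" if "i \<le> r" "j \<le> 1" for i j
    using R that by (cases j) (auto simp: rep_def)
  show "entry (of_vec (conv_sum r m n A v)) a b = entry (\<Sum>i\<le>r. X i 0 * of_vec (v i 0) + X i 1 * of_vec (v i 1)) a b"
  proof (cases "a < n \<and> b = 0")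
    case True
    have "entry (of_vec (conv_sum r m n A v)) a b = (\<Sum>(i, j)\<in>entries r m. (A i j *\<^sub>v v i j) $ a)"
      using True by (simp add: entry_of_vec conv_sum_def)
    also have "\<dots> = (\<Sum>p\<in>entries r m. entry (X (fst p) (snd p) * of_vec (v (fst p) (snd p))) a 0)"
    proof (rule sum.cong, rule refl, clarsimp)
      fix i j assume ij: "(i, j) \<in> entries r m"
      then have "i \<le> r" "j \<le> 1" using entries_conv[OF m] by auto
      have "A i j = to_mat n n (X i j)" using R ij by (auto simp: rep_def)
      then show "(A i j *\<^sub>v v i j) $ a = entry (X i j * of_vec (v i j)) a 0"
        using of_vec_mult[OF mX[OF \<open>i \<le> r\<close> \<open>j \<le> 1\<close>] conv_spaceD(1)[OF v], of i j, symmetric] True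
        by (simp add: entry_of_vec)
    qed
    also have "\<dots> = (\<Sum>p\<in>{..r} \<times> {..1}. entry (X (fst p) (snd p) * of_vec (v (fst p) (snd p))) a 0)"
      by (rule sum.mono_neutral_left) (use entries_conv[OF m] conv_spaceD(3)[OF v] in auto)
    also have "\<dots> = (\<Sum>i\<le>r. \<Sum>j\<le>1. entry (X i j * of_vec (v i j)) a 0)"
      by (simp only: sum.cartesian_product split_def)
    finally show ?thesis using True by simp
  next
    case False
    have "(\<Sum>i\<le>r. X i 0 * of_vec (v i 0) + X i 1 * of_vec (v i 1)) \<in> mats n 1"
      using mX[of _ 0] mX[of _ 1] conv_spaceD(2)[OF v] by auto
    from matsD[OF this, of a b] show ?thesis using False by (auto simp: entry_of_vec conv_sum_def)
  qed
qed

text \<open>The stacked vector is ordered as \<open>(x 1, x 0)\<close>, so the two block rows give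
  the two equations. For \<open>k = 0\<close> the absent \<open>C1\<close> is zero and only
  \<open>C0\<close> acting on \<open>x 0\<close> remains.\<close>

lemma block_toeplitz_kernel:
  assumes k: "k \<le> 1" and C: "C0 \<in> mats n n" "C1 \<in> mats n n" "k = 0 \<Longrightarrow> C1 = 0"
    and eq: "C 0 = to_mat n n C0" "k = 1 \<Longrightarrow> C 1 = to_mat n n C1"
    and x: "x 0 \<in> carrier_vec n" "x 1 \<in> carrier_vec n"
  shows "block_toeplitz n k C *\<^sub>v stack n k x = 0\<^sub>v (n * (k + 1)) \<longleftrightarrow>
    C1 * of_vec (x 1) + C0 * of_vec (x 0) = 0 \<and> C1 * of_vec (x 0) = 0"
proof (cases "k = 0")
  case True
  have "stack n 0 x = x 0" using x by (intro eq_vecI) (auto simp: stack_def)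
  moreover have "block_toeplitz n 0 C = to_mat n n C0" using block_toeplitz_0[of C n] eq by simp
  moreover have "to_mat n n C0 *\<^sub>v x 0 = 0\<^sub>v n \<longleftrightarrow> C0 * of_vec (x 0) = 0"
    using of_vec_mult[OF C(1) x(1)] of_vec_eq_0[of "to_mat n n C0 *\<^sub>v x 0" n] by (simp add: mult_mat_vec_carrier[OF _ x(1)])
  ultimately show ?thesis using True C(3) by simp
next
  case False
  then have k1: "k = 1" using k by simp
  define y where "y = stack n 1 x"
  have y: "y \<in> carrier_vec (n + n)" by (simp add: y_def stack_def mult_2_right)
  have oy: "of_vec y = emb 0 n * of_vec (x 1) + emb n n * of_vec (x 0)"
  proof (rule fmat_eqI)
    fix a b
    have "a div n = (if a < n then 0 else 1)" "a mod n = (if a < n then a else a - n)" if "a < n + n"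
      using that by (auto simp: div_nat_eqI mod_if)
    then show "entry (of_vec y) a b = entry (emb 0 n * of_vec (x 1) + emb n n * of_vec (x 0)) a b"
      using x by (auto simp: entry_of_vec y_def stack_def entry_emb_mult)
  qed
  have bt: "block_toeplitz n 1 C = to_mat (n + n) (n + n) (bt n C1 C0)"
    by (rule block_toeplitz_1) (use C eq k1 in auto)
  have mbt: "bt n C1 C0 \<in> mats (n + n) (n + n)" by (rule bt_mats) (use C in auto)
  have "block_toeplitz n 1 C *\<^sub>v y = 0\<^sub>v (n + n) \<longleftrightarrow> bt n C1 C0 * of_vec y = 0"
    unfolding bt of_vec_mult[OF mbt y, symmetric]
    by (rule of_vec_eq_0[symmetric]) (rule mult_mat_vec_carrier[OF to_mat_carrier y])
  also have "bt n C1 C0 * of_vec y = emb 0 n * (C1 * of_vec (x 1) + C0 * of_vec (x 0)) + emb n n * (C1 * of_vec (x 0))"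
    using C x unfolding bt_def oy by (simp add: algebra_simps)
  also have "\<dots> = 0 \<longleftrightarrow> C1 * of_vec (x 1) + C0 * of_vec (x 0) = 0 \<and> C1 * of_vec (x 0) = 0"
  proof
    let ?z = "C1 * of_vec (x 1) + C0 * of_vec (x 0)" and ?y = "C1 * of_vec (x 0)"
    have r: "rowb n ?z" "rowb n ?y" using C by auto
    assume *: "emb 0 n * ?z + emb n n * ?y = 0"
    have "prj 0 n * (emb 0 n * ?z + emb n n * ?y) = ?z" "prj n n * (emb 0 n * ?z + emb n n * ?y) = ?y"
      using r by (simp_all only: distrib_left[of "prj _ _"] prj_emb_assoc idm_mult) simp_all
    then show "?z = 0 \<and> ?y = 0" unfolding * by simp
  qed simp
  finally show ?thesis by (simp add: k1 y_def mult_2_right del: One_nat_def)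
qed

text \<open>The general shape of a linear map out of the convolution space, given by its blocks; it
  serves as a model of the quotient map.\<close>

definition conv_map :: "nat \<Rightarrow> (nat \<Rightarrow> nat \<Rightarrow> fmat) \<Rightarrow> vec_family \<Rightarrow> fmat" where
  "conv_map r F v = (\<Sum>i\<le>r. F i 0 * of_vec (v i 0) + F i 1 * of_vec (v i 1))"

text \<open>A surjection with kernel \<open>KL_space\<close> that intertwines the convolution
  operators with the \<open>Y i j\<close> identifies the quotient. Preimages of the unit columns
  represent a basis, and in this basis the induced operators have the matrices
  \<open>Y i j\<close>.\<close>

lemma is_middle_convolutionI:
  assumes tup: "is_tuple r m n A"
    and F: "\<And>i. i \<le> r \<Longrightarrow> F i 0 \<in> mats N n \<and> F i 1 \<in> mats N n"
    and Y: "\<And>i j. (i, j) \<in> entries r m \<Longrightarrow> Y i j \<in> mats N N"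
    and surj: "\<And>y. y \<in> mats N 1 \<Longrightarrow> \<exists>v\<in>conv_space r m n. conv_map r F v = y"
    and ker: "\<And>v. v \<in> conv_space r m n \<Longrightarrow> v \<in> KL_space r m n \<mu> A \<longleftrightarrow> conv_map r F v = 0"
    and act: "\<And>i j v. (i, j) \<in> entries r m \<Longrightarrow> v \<in> conv_space r m n \<Longrightarrow>
       conv_op r m n \<mu> A i j v \<in> conv_space r m n \<and> conv_map r F (conv_op r m n \<mu> A i j v) = Y i j * conv_map r F v"
  shows "is_middle_convolution r m n \<mu> A N (\<lambda>i j. to_mat N N (Y i j))"
proof -
  have "\<forall>k. \<exists>v. k < N \<longrightarrow> v \<in> conv_space r m n \<and> conv_map r F v = unit_mat k 0"
    using surj[of "unit_mat _ 0"] by fastforce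
  then obtain b where b: "\<And>k. k < N \<Longrightarrow> b k \<in> conv_space r m n \<and> conv_map r F (b k) = unit_mat k 0"
    by metis
  have mF: "conv_map r F v \<in> mats N 1" if "v \<in> conv_space r m n" for v
    using F conv_spaceD(2)[OF that] unfolding conv_map_def by auto
  have ov: "of_vec c = (\<Sum>k<N. c $ k *\<^sub>F unit_mat k 0)" if "c \<in> carrier_vec N" for c
  proof (rule fmat_eqI)
    fix x y
    have "entry (\<Sum>k<N. c $ k *\<^sub>F unit_mat k 0) x y = (\<Sum>k<N. if k = x then (if y = 0 then c $ x else 0) else 0)"
      unfolding entry_sum by (rule sum.cong) auto
    then show "entry (of_vec c) x y = entry (\<Sum>k<N. c $ k *\<^sub>F unit_mat k 0) x y"
      using that by (simp add: entry_of_vec)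
  qed
  have lc: "(\<lambda>i j. v i j - lin_comb n N b c i j) \<in> conv_space r m n"
     "conv_map r F (\<lambda>i j. v i j - lin_comb n N b c i j) = conv_map r F v - of_vec c"
    if v: "v \<in> conv_space r m n" and c: "c \<in> carrier_vec N" for v c
  proof -
    have lcc: "lin_comb n N b c i j \<in> carrier_vec n" for i j by (simp add: lin_comb_def)
    have z: "lin_comb n N b c i j = 0\<^sub>v n" if "(i, j) \<notin> entries r m" for i j
    proof -
      have "b k i j = 0\<^sub>v n" if "k < N" for k using b[OF that] conv_spaceD(3) \<open>(i, j) \<notin> entries r m\<close> by blast
      then show ?thesis by (intro eq_vecI) (simp_all add: lin_comb_def)
    qed
    show "(\<lambda>i j. v i j - lin_comb n N b c i j) \<in> conv_space r m n"
      using conv_spaceD[OF v] lcc z by (auto simp: conv_space_def)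
    have l: "of_vec (lin_comb n N b c i j) = (\<Sum>k<N. c $ k *\<^sub>F of_vec (b k i j))" for i j
    proof (rule fmat_eqI)
      fix x y
      have "dim_vec (b k i j) = n" if "k < N" for k using b conv_spaceD(2) that by blast
      then show "entry (of_vec (lin_comb n N b c i j)) x y = entry (\<Sum>k<N. c $ k *\<^sub>F of_vec (b k i j)) x y"
        by (auto simp: entry_of_vec lin_comb_def intro!: sum.cong sum.neutral)
    qed
    have "conv_map r F (lin_comb n N b c) = (\<Sum>i\<le>r. \<Sum>k<N. c $ k *\<^sub>F (F i 0 * of_vec (b k i 0) + F i 1 * of_vec (b k i 1)))"
      unfolding conv_map_def l sum_distrib_left sum.distrib[symmetric] by (simp add: fvs.scale_right_distrib)
    also have "\<dots> = (\<Sum>k<N. c $ k *\<^sub>F conv_map r F (b k))"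
      unfolding conv_map_def fvs.scale_sum_right by (rule sum.swap)
    also have "\<dots> = of_vec c" unfolding ov[OF c] by (rule sum.cong) (use b in auto)
    finally have 1: "conv_map r F (lin_comb n N b c) = of_vec c" .
    have "of_vec (v i j - lin_comb n N b c i j) = of_vec (v i j) - of_vec (lin_comb n N b c i j)" for i j
      by (rule of_vec_simps) (use conv_spaceD[OF v] lcc in auto)
    then have "conv_map r F (\<lambda>i j. v i j - lin_comb n N b c i j) = conv_map r F v - conv_map r F (lin_comb n N b c)"
      by (simp only: conv_map_def right_diff_distrib sum_subtractf[symmetric] add_diff_add)
    then show "conv_map r F (\<lambda>i j. v i j - lin_comb n N b c i j) = conv_map r F v - of_vec c" by (simp add: 1)
  qed
  have mem: "(\<lambda>i j. v i j - lin_comb n N b c i j) \<in> KL_space r m n \<mu> A \<longleftrightarrow> of_vec c = conv_map r F v"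
    if "v \<in> conv_space r m n" "c \<in> carrier_vec N" for v c
    using ker[OF lc(1)[OF that]] lc(2)[OF that] by auto
  show ?thesis
    unfolding is_middle_convolution_def
  proof (intro conjI exI[of _ b])
    show "is_tuple r m n A" by fact
    show "is_tuple r m N (\<lambda>i j. to_mat N N (Y i j))" by (auto simp: is_tuple_def)
    show "quotient_basis r m n (KL_space r m n \<mu> A) N b"
      unfolding quotient_basis_def
    proof (intro conjI allI impI ballI)
      show "b k \<in> conv_space r m n" if "k < N" for k using b that by simp
      fix v assume v: "v \<in> conv_space r m n"
      show "\<exists>!c. c \<in> carrier_vec N \<and> (\<lambda>i j. v i j - lin_comb n N b c i j) \<in> KL_space r m n \<mu> A"
      proof (rule ex1I[of _ "to_vec N (conv_map r F v)"])
        show "to_vec N (conv_map r F v) \<in> carrier_vec N \<and>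
          (\<lambda>i j. v i j - lin_comb n N b (to_vec N (conv_map r F v)) i j) \<in> KL_space r m n \<mu> A"
          using mem[OF v, of "to_vec N (conv_map r F v)"] of_vec_to_vec[OF mF[OF v]] by simp
        fix c assume "c \<in> carrier_vec N \<and> (\<lambda>i j. v i j - lin_comb n N b c i j) \<in> KL_space r m n \<mu> A"
        then show "c = to_vec N (conv_map r F v)" using mem[OF v, of c] to_vec_of_vec[of c N] by simp
      qed
    qed
    show "\<forall>(i, j)\<in>entries r m. \<forall>k<N. (\<lambda>i' j'. conv_op r m n \<mu> A i j (b k) i' j' -
        lin_comb n N b (col (to_mat N N (Y i j)) k) i' j') \<in> KL_space r m n \<mu> A"
    proof clarify
      fix i j k assume ij: "(i, j) \<in> entries r m" and k: "k < N"
      have bk: "b k \<in> conv_space r m n" "conv_map r F (b k) = unit_mat k 0" using b[OF k] by auto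
      have a: "conv_op r m n \<mu> A i j (b k) \<in> conv_space r m n"
        "conv_map r F (conv_op r m n \<mu> A i j (b k)) = Y i j * unit_mat k 0" using act[OF ij bk(1)] bk(2) by auto
      have "of_vec (col (to_mat N N (Y i j)) k) = Y i j * unit_mat k 0"
        using matsD[OF Y[OF ij]] k by (intro fmat_eqI) (auto simp: entry_of_vec entry_mult_unit_mat)
      then show "(\<lambda>i' j'. conv_op r m n \<mu> A i j (b k) i' j' -
        lin_comb n N b (col (to_mat N N (Y i j)) k) i' j') \<in> KL_space r m n \<mu> A"
        using mem[OF a(1), of "col (to_mat N N (Y i j)) k"] a(2) by (simp add: carrier_vecI)
    qed
  qed
qed

section \<open>The reflection is the middle convolution\<close>

context reflection
begin

text \<open>\<open>P'\<close> and \<open>P\<close> have complementary images. Multiplying by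
  \<open>P' j\<close> gives \<open>\<mu> P j + P j * (\<Sum>Q i * P i) = 0\<close>, and applying
  \<open>\<Sum>Q' j * P' j = \<mu>\<close> recovers the sum itself.\<close>

lemma sum_Q'P: "(\<Sum>i\<le>r. Q' i * P i) = 0"
proof -
  let ?S = "\<Sum>i\<le>r. Q' i * P i"
  have "P' j * ?S = 0" if j: "j \<le> r" for j
  proof -
    have "P' j * ?S = (\<Sum>i\<le>r. (if i = j then \<mu> *\<^sub>F P j else 0) + P j * (Q i * P i))"
      unfolding sum_distrib_left
    proof (rule sum.cong)
      fix i assume "i \<in> {..r}"
      then show "P' j * (Q' i * P i) = (if i = j then \<mu> *\<^sub>F P j else 0) + P j * (Q i * P i)"
        using P'Q'_mult[OF j, of i "P i"] mem(1)[of i] by auto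
    qed simp
    also have "\<dots> = \<mu> *\<^sub>F P j + P j * (\<Sum>i\<le>r. Q i * P i)"
      using j by (simp add: sum.distrib sum_distrib_left)
    also have "\<dots> = 0" using mem(1)[OF j] by (simp add: sumQP)
    finally show ?thesis .
  qed
  then have "(\<Sum>j\<le>r. Q' j * P' j) * ?S = 0" by (simp add: sum_distrib_right mult.assoc)
  moreover have "rowb n' ?S" using mem(7) by auto
  ultimately show ?thesis using \<mu> by (simp add: sumQP')
qed

text \<open>The quotient map factors through the middle spaces: \<open>v\<close> goes to
  \<open>W v i = P i * v_0 + N i * P i * v_1\<close> and then to \<open>\<Sum>Q' i * W v i\<close>.
  The condition \<open>W v i = 0\<close> is the local kernel condition of \<open>K_space\<close>,
  and \<open>S(v)\<close> is \<open>\<Sum>Q i * W v i\<close>. If the image of \<open>v\<close> is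
  zero, then \<open>W v i = - P i * l\<close> for a common \<open>l\<close>, which is the shape of
  an element of \<open>L_space\<close> modulo \<open>K_space\<close>. The reflected residues sum to
  \<open>\<mu>\<close>, so \<open>\<mu>\<close> is subtracted at infinity.\<close>

lemma middle_convolution:
  assumes R: "rep r m n A X" and m: "\<forall>i\<le>r. m i \<le> 1"
    and X0: "\<And>i. i \<le> r \<Longrightarrow> Q i * P i = X i 0 - (if i = 0 then \<mu> *\<^sub>F idm n else 0)"
    and X1: "\<And>i. i \<le> r \<Longrightarrow> Q i * N i * P i = X i 1"
    and tup: "is_tuple r m n A"
    and X'_def: "X' = (\<lambda>i j. if j = 0 then Q' i * P' i - (if i = 0 then \<mu> *\<^sub>F idm n' else 0) else Q' i * N i * P' i)"
  shows "rep r m n' (\<lambda>i j. to_mat n' n' (X' i j)) X'"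
    "is_middle_convolution r m n \<mu> A n' (\<lambda>i j. to_mat n' n' (X' i j))"
proof -
  have mX: "X i 0 \<in> mats n n" "X i 1 \<in> mats n n" "m i = 0 \<Longrightarrow> X i 1 = 0" if "i \<le> r" for i
    using R that by (auto simp: rep_def)
  \<comment> \<open>Cancelling \<open>Q i\<close> on the left and \<open>P i\<close> on the right
    turns the absence of the entry \<open>A i 1\<close> into \<open>N i = 0\<close>, so the
    reflected tuple lacks this entry too.\<close>
  have N0: "N i = 0" if i: "i \<le> r" and "m i = 0" for i
  proof -
    have QNP: "Q i * (N i * P i) = 0" using X1[OF i] mX(3)[OF that] by (simp add: mult.assoc)
    have "N i * P i = 0"
      by (rule local_datum_cogen[OF ld[OF i] QNP]) (use mem[OF i] in \<open>simp_all add: mult.assoc\<close>)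
    then show ?thesis
      by (rule local_datum_gen[OF ld[OF i]]) (use mem(3,4)[OF i] in simp_all)
  qed
  show "rep r m n' (\<lambda>i j. to_mat n' n' (X' i j)) X'"
  proof -
    have "(\<Sum>i\<le>r. X' i 0) = 0" by (simp add: X'_def sum_subtractf sumQP')
    then show ?thesis using mem N0 by (auto simp: rep_def X'_def mult.assoc)
  qed
  define F where "F i j = (if j = 0 then Q' i * P i else Q' i * N i * P i)" for i and j :: nat
  define W where "W v i = P i * of_vec (v i 0) + N i * (P i * of_vec (v i 1))" for v :: vec_family and i
  have mW: "rowb (w i) (W v i)" if "i \<le> r" for v i using mem[OF that] by (simp add: W_def)
  have \<Phi>: "conv_map r F v = (\<Sum>i\<le>r. Q' i * W v i)" for v
    by (simp add: conv_map_def F_def W_def distrib_left mult.assoc)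
  have ov: "rowb n (of_vec (v i j))" "colb 1 (of_vec (v i j))" if "v \<in> conv_space r m n" for v i j
    using conv_spaceD(2)[OF that] by simp_all
  have v00: "v 0 0 = 0\<^sub>v n" "of_vec (v 0 0) = 0" if "v \<in> conv_space r m n" for v
    using conv_spaceD(3)[OF that, of 0 0] entries_conv[OF m] by simp_all
  have QP: "Q i * (P i * z) = X i 0 * z - (if i = 0 then \<mu> *\<^sub>F z else 0)" "Q i * (N i * (P i * z)) = X i 1 * z"
    if "i \<le> r" "rowb n z" for i z
  proof -
    have "Q i * (P i * z) = Q i * P i * z" "Q i * (N i * (P i * z)) = Q i * N i * P i * z"
      by (simp_all add: mult.assoc)
    then show "Q i * (P i * z) = X i 0 * z - (if i = 0 then \<mu> *\<^sub>F z else 0)" "Q i * (N i * (P i * z)) = X i 1 * z"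
      using that by (simp_all add: X0 X1 left_diff_distrib)
  qed
  \<comment> \<open>At infinity the shift of the residue by \<open>\<mu>\<close> does not show,
    because the component \<open>v 0 0\<close> is zero.\<close>
  have S: "of_vec (conv_sum r m n A v) = (\<Sum>i\<le>r. Q i * W v i)" if v: "v \<in> conv_space r m n" for v
    unfolding of_vec_conv_sum[OF R m v]
  proof (rule sum.cong)
    fix i assume "i \<in> {..r}"
    then show "X i 0 * of_vec (v i 0) + X i 1 * of_vec (v i 1) = Q i * W v i"
      using QP ov[OF v] v00[OF v] by (simp add: W_def distrib_left)
  qed simp
  have P'\<Phi>: "P' i * conv_map r F v = \<mu> *\<^sub>F W v i + P i * (\<Sum>j\<le>r. Q j * W v j)" if i: "i \<le> r" for i v
  proof -
    have "P' i * conv_map r F v = (\<Sum>j\<le>r. (if j = i then \<mu> *\<^sub>F W v i else 0) + P i * (Q j * W v j))"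
      unfolding \<Phi> sum_distrib_left
    proof (rule sum.cong)
      fix j assume "j \<in> {..r}"
      then show "P' i * (Q' j * W v j) = (if j = i then \<mu> *\<^sub>F W v i else 0) + P i * (Q j * W v j)"
        using P'Q'_mult[OF i, of j "W v j"] mW[of j] by auto
    qed simp
    then show ?thesis using i by (simp add: sum.distrib sum_distrib_left)
  qed
  have W0: "W v i = 0 \<longleftrightarrow> X i 1 * of_vec (v i 1) + (X i 0 - (if i = 0 then \<mu> *\<^sub>F idm n else 0)) * of_vec (v i 0) = 0 \<and> X i 1 * of_vec (v i 0) = 0"
    if i: "i \<le> r" and v: "v i 0 \<in> carrier_vec n" "v i 1 \<in> carrier_vec n" for v i
  proof -
    have r: "rowb n (of_vec (v i 0))" "rowb n (of_vec (v i 1))" using v by simp_all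
    have "Q i * W v i = X i 1 * of_vec (v i 1) + (X i 0 - (if i = 0 then \<mu> *\<^sub>F idm n else 0)) * of_vec (v i 0)"
      unfolding W_def distrib_left QP(1)[OF i r(1)] QP(2)[OF i r(2)] using idm_mult[OF r(1)] by (cases "i = 0") (simp_all add: left_diff_distrib)
    moreover have "Q i * N i * W v i = X i 1 * of_vec (v i 0)"
      using QP[OF i r(1)] mem(5)[OF i] by (simp add: W_def distrib_left mult.assoc)
    ultimately show ?thesis using local_datum_cogen[OF ld[OF i] _ _ mW[OF i], of v] by fastforce
  qed
  have coef: "coef r m n A i 0 = to_mat n n (X i 0)" "coef r m n A i 1 = to_mat n n (X i 1)" if "i \<le> r" for i
    using rep_coef[OF R that] m that by auto
  have K: "v \<in> K_space r m n A \<longleftrightarrow> (\<forall>j. v 0 j = 0\<^sub>v n) \<and> (\<forall>i\<in>{1..r}. W v i = 0)"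
    if v: "v \<in> conv_space r m n" for v
  proof -
    have "block_toeplitz n (m i) (coef r m n A i) *\<^sub>v stack n (m i) (v i) = 0\<^sub>v (n * (m i + 1)) \<longleftrightarrow> W v i = 0"
      if "i \<in> {1..r}" for i
    proof -
      have i: "i \<le> r" "i \<noteq> 0" using that by auto
      have "block_toeplitz n (m i) (coef r m n A i) *\<^sub>v stack n (m i) (v i) = 0\<^sub>v (n * (m i + 1)) \<longleftrightarrow>
        X i 1 * of_vec (v i 1) + X i 0 * of_vec (v i 0) = 0 \<and> X i 1 * of_vec (v i 0) = 0"
        by (rule block_toeplitz_kernel) (use m i mX[OF i(1)] coef[OF i(1)] conv_spaceD[OF v] in auto)
      then show ?thesis using W0[OF i(1), of v] i conv_spaceD(1)[OF v] by simp
    qed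
    then show ?thesis using v by (auto simp: K_space_def)
  qed
  have L: "v \<in> L_space r m n \<mu> A \<longleftrightarrow> (\<exists>l\<in>carrier_vec n. (\<forall>i\<in>{1..r}. v i 0 = - l \<and> v i 1 = 0\<^sub>v n) \<and>
      W (\<lambda>i. (v i)(0 := l)) 0 = 0)"
    if v: "v \<in> conv_space r m n" for v
  proof -
    have "block_toeplitz n (m 0) ((coef r m n A 0)(0 := coef r m n A 0 0 - \<mu> \<cdot>\<^sub>m 1\<^sub>m n))
          *\<^sub>v stack n (m 0) ((v 0)(0 := l)) = 0\<^sub>v (n * (m 0 + 1)) \<longleftrightarrow> W (\<lambda>i. (v i)(0 := l)) 0 = 0"
      if l: "l \<in> carrier_vec n" for l
    proof -
      have c0: "to_mat n n (X 0 0) - \<mu> \<cdot>\<^sub>m 1\<^sub>m n = to_mat n n (X 0 0 - \<mu> *\<^sub>F idm n)"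
        by (intro eq_matI) auto
      have "block_toeplitz n (m 0) ((coef r m n A 0)(0 := coef r m n A 0 0 - \<mu> \<cdot>\<^sub>m 1\<^sub>m n))
          *\<^sub>v stack n (m 0) ((v 0)(0 := l)) = 0\<^sub>v (n * (m 0 + 1)) \<longleftrightarrow>
          X 0 1 * of_vec (((v 0)(0 := l)) 1) + (X 0 0 - \<mu> *\<^sub>F idm n) * of_vec (((v 0)(0 := l)) 0) = 0 \<and>
          X 0 1 * of_vec (((v 0)(0 := l)) 0) = 0"
        by (rule block_toeplitz_kernel) (use m l mX[of 0] coef[of 0] conv_spaceD[OF v] c0 in auto)
      then show ?thesis using W0[of 0 "\<lambda>i. (v i)(0 := l)"] conv_spaceD(1)[OF v] l by simp
    qed
    moreover have "(\<forall>i \<in> {1..r}. \<forall>j \<in> {1..m i}. v i j = 0\<^sub>v n) \<longleftrightarrow> (\<forall>i\<in>{1..r}. v i 1 = 0\<^sub>v n)"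
    proof (intro ball_cong refl iffI)
      fix i assume i: "i \<in> {1..r}"
      { assume *: "\<forall>j \<in> {1..m i}. v i j = 0\<^sub>v n"
        show "v i 1 = 0\<^sub>v n"
        proof (cases "m i = 0")
          case True
          then show ?thesis using conv_spaceD(3)[OF v, of i 1] entries_conv[OF m] by simp
        qed (use * in auto) }
      show "\<forall>j \<in> {1..m i}. v i j = 0\<^sub>v n" if "v i 1 = 0\<^sub>v n"
      proof
        fix j assume "j \<in> {1..m i}"
        moreover have "m i \<le> 1" using m i by simp
        ultimately have "j = 1" by simp
        then show "v i j = 0\<^sub>v n" using that by simp
      qed
    qed
    ultimately show ?thesis using v \<mu> by (auto simp: L_space_def)
  qed
  have \<Phi>_add: "conv_map r F (\<lambda>i j. x i j + y i j) = conv_map r F x + conv_map r F y"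
    if "x \<in> conv_space r m n" "y \<in> conv_space r m n" for x y
    using of_vec_simps(2)[OF conv_spaceD(1)[OF that(1)] conv_spaceD(1)[OF that(2)]]
    by (simp add: conv_map_def distrib_left sum.distrib[symmetric] algebra_simps)
  have ker: "v \<in> KL_space r m n \<mu> A \<longleftrightarrow> conv_map r F v = 0" if v: "v \<in> conv_space r m n" for v
  proof
    assume "v \<in> KL_space r m n \<mu> A"
    then obtain x y where xy: "v = (\<lambda>i j. x i j + y i j)" "x \<in> K_space r m n A" "y \<in> L_space r m n \<mu> A"
      by (auto simp: KL_space_def)
    have x: "x \<in> conv_space r m n" using xy(2) by (simp add: K_space_def)
    have y: "y \<in> conv_space r m n" using xy(3) \<mu> by (simp add: L_space_def)
    have "W x i = 0" if "i \<le> r" for i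
    proof (cases "i = 0")
      case True
      then show ?thesis using xy(2) K[OF x] by (simp add: W_def)
    next
      case False
      then show ?thesis using xy(2) K[OF x] that by simp
    qed
    then have 1: "conv_map r F x = 0" by (simp add: \<Phi>)
    obtain l where l: "l \<in> carrier_vec n" "\<And>i. i \<in> {1..r} \<Longrightarrow> y i 0 = - l \<and> y i 1 = 0\<^sub>v n"
      "W (\<lambda>i. (y i)(0 := l)) 0 = 0" using xy(3) L[OF y] by blast
    have "W y i = - (P i * of_vec l)" if "i \<le> r" for i
    proof (cases "i = 0")
      case True
      then show ?thesis using l(3) v00(2)[OF y] by (simp add: W_def eq_neg_iff_add_eq_0 add.commute)
    next
      case False
      then show ?thesis using l(2)[of i] that by (simp add: W_def)
    qed
    then have "conv_map r F y = - ((\<Sum>i\<le>r. Q' i * P i) * of_vec l)"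
      by (simp add: \<Phi> sum_distrib_right sum_negf mult.assoc)
    then have "conv_map r F y = 0" by (simp add: sum_Q'P)
    then show "conv_map r F v = 0" using 1 \<Phi>_add[OF x y] by (simp add: xy(1))
  next
    assume \<Phi>0: "conv_map r F v = 0"
    define s where "s = (\<Sum>j\<le>r. Q j * W v j)"
    \<comment> \<open>Multiplying a vanishing image by \<open>P' i\<close> gives
      \<open>\<mu> W v i + P i * S(v) = 0\<close>, so \<open>l\<close> has to be
      \<open>S(v) / \<mu>\<close>.\<close>
    define l where "l = inverse \<mu> \<cdot>\<^sub>v conv_sum r m n A v"
    have l: "l \<in> carrier_vec n" by (simp add: l_def conv_sum_def)
    have ol: "of_vec l = inverse \<mu> *\<^sub>F s" by (simp add: l_def S[OF v] s_def)
    have Wv: "W v i = - (P i * of_vec l)" if "i \<le> r" for i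
    proof -
      have "\<mu> *\<^sub>F W v i = - (P i * s)" using P'\<Phi>[OF that, of v] \<Phi>0 by (simp add: s_def eq_neg_iff_add_eq_0)
      then have "inverse \<mu> *\<^sub>F (\<mu> *\<^sub>F W v i) = - (P i * of_vec l)" by (simp add: ol)
      then show ?thesis using \<mu> by simp
    qed
    \<comment> \<open>All components at infinity go to \<open>y\<close>, since
      \<open>K_space\<close> has none. At the other singularities \<open>y\<close> carries
      \<open>- l\<close> in position 0, and the remainder \<open>x\<close> has
      \<open>W x i = 0\<close>.\<close>
    define y where "y i j = (if i = 0 then v 0 j else if i \<le> r \<and> j = 0 then - l else 0\<^sub>v n)" for i j
    define x where "x i j = (if i = 0 then 0\<^sub>v n else if i \<le> r \<and> j = 0 then v i j + l else v i j)" for i j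
    have y: "y \<in> conv_space r m n" and x: "x \<in> conv_space r m n"
      using conv_spaceD[OF v] l entries_conv[OF m] by (auto simp: conv_space_def x_def y_def)
    have "v = (\<lambda>i j. x i j + y i j)"
      by (intro ext eq_vecI) (use l in \<open>auto simp: x_def y_def conv_spaceD(2)[OF v]\<close>)
    moreover have "x \<in> K_space r m n A"
      unfolding K[OF x]
    proof (intro conjI allI ballI)
      fix i assume i: "i \<in> {1..r}"
      have "of_vec (v i 0 + l) = of_vec (v i 0) + of_vec l" by (rule of_vec_simps(2)[OF conv_spaceD(1)[OF v] l])
      then have "W x i = W v i + P i * of_vec l" using i by (simp add: W_def x_def algebra_simps)
      then show "W x i = 0" using Wv[of i] i by simp
    qed (simp add: x_def)
    moreover have "y \<in> L_space r m n \<mu> A"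
      unfolding L[OF y]
    proof (rule bexI[OF _ l], intro conjI ballI)
      show "W (\<lambda>i. (y i)(0 := l)) 0 = 0"
        using Wv[of 0] v00(2)[OF v] by (simp add: W_def y_def)
    qed (simp_all add: y_def)
    ultimately show "v \<in> KL_space r m n \<mu> A" unfolding KL_space_def by blast
  qed
  show "is_middle_convolution r m n \<mu> A n' (\<lambda>i j. to_mat n' n' (X' i j))"
  proof (rule is_middle_convolutionI[OF tup _ _ _ ker])
    show "F i 0 \<in> mats n' n \<and> F i 1 \<in> mats n' n" if "i \<le> r" for i
      using mem[OF that] by (simp add: F_def mult.assoc)
    show "X' i j \<in> mats n' n'" if "(i, j) \<in> entries r m" for i j
      using mem[of i] that by (simp add: X'_def entries_def mult.assoc)
    fix y assume y: "y \<in> mats n' 1"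
    have "\<exists>S0 S1. S0 \<in> mats n (w i) \<and> S1 \<in> mats n (w i) \<and> P i * S0 + N i * P i * S1 = idm (w i)" if "i \<le> r" for i
      using ld[OF that] by (simp add: local_datum_def)
    then obtain S0 S1 where S01: "\<And>i. i \<le> r \<Longrightarrow> S0 i \<in> mats n (w i) \<and> S1 i \<in> mats n (w i) \<and> P i * S0 i + N i * P i * S1 i = idm (w i)"
      by metis
    define z where "z i = inverse \<mu> *\<^sub>F (P' i * y)" for i
    have mz: "z i \<in> mats (w i) 1" if "i \<le> r" for i using mem[OF that] y by (simp add: z_def)
    \<comment> \<open>\<open>S0 i\<close> and \<open>S1 i\<close> lift \<open>z i\<close> through
      \<open>P i\<close> and \<open>N i * P i\<close>. The component \<open>v 0 0\<close> must
      vanish, so \<open>S0 0 * z 0\<close> is subtracted at every singularity; by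
      \<open>sum_Q'P\<close> this does not change the image.\<close>
    define v where "v i j = (if (i, j) \<in> entries r m then
        if j = 0 then to_vec n (S0 i * z i - S0 0 * z 0) else to_vec n (S1 i * z i) else 0\<^sub>v n)" for i j
    have v: "v \<in> conv_space r m n" by (simp add: conv_space_def v_def)
    have Wv: "W v i = z i - P i * (S0 0 * z 0)" if i: "i \<le> r" for i
    proof -
      have "of_vec (v i 0) = S0 i * z i - S0 0 * z 0"
      proof (cases "i = 0")
        case False
        have "S0 i * z i - S0 0 * z 0 \<in> mats n 1" using S01[OF i] S01[of 0] mz[OF i] mz[of 0] by simp
        then show ?thesis using False i entries_conv[OF m, of i 0] by (simp add: v_def del: mats_conv)
      qed (use v00[OF v] in simp)
      moreover have "N i * (P i * of_vec (v i 1)) = N i * (P i * (S1 i * z i))"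
      proof (cases "m i = 0")
        case False
        have "S1 i * z i \<in> mats n 1" using S01[OF i] mz[OF i] by simp
        moreover have "(i, 1) \<in> entries r m" using False m i entries_conv[OF m, of i 1] by (metis le_neq_implies_less less_one)
        ultimately show ?thesis by (simp add: v_def del: mats_conv One_nat_def)
      qed (use N0[OF i] in simp)
      ultimately have "W v i = P i * (S0 i * z i - S0 0 * z 0) + N i * (P i * (S1 i * z i))"
        by (simp only: W_def)
      then have "W v i = (P i * S0 i + N i * P i * S1 i) * z i - P i * (S0 0 * z 0)"
        by (simp add: algebra_simps)
      then show ?thesis using S01[OF i] mz[OF i] by simp
    qed
    have "conv_map r F v = (\<Sum>i\<le>r. Q' i * z i) - (\<Sum>i\<le>r. Q' i * P i) * (S0 0 * z 0)"
      by (simp add: \<Phi> Wv right_diff_distrib sum_subtractf sum_distrib_right mult.assoc)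
    also have "(\<Sum>i\<le>r. Q' i * z i) = inverse \<mu> *\<^sub>F ((\<Sum>i\<le>r. Q' i * P' i) * y)"
      by (simp add: z_def fvs.scale_sum_right sum_distrib_right mult.assoc)
    also have "\<dots> = y" using y \<mu> by (simp add: sumQP')
    finally have "conv_map r F v = y" by (simp add: sum_Q'P)
    then show "\<exists>v\<in>conv_space r m n. conv_map r F v = y" using v by blast
  next
    fix i j v assume ij: "(i, j) \<in> entries r m" and v: "v \<in> conv_space r m n"
    define u where "u = conv_op r m n \<mu> A i j v"
    have i: "i \<le> r" using ij by (simp add: entries_def)
    have cs: "conv_sum r m n A v \<in> carrier_vec n" by (simp add: conv_sum_def)
    have u: "u \<in> conv_space r m n"
      using conv_spaceD[OF v] cs by (auto simp: conv_space_def u_def conv_op_def)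
    have W0: "W u i' = 0" if "i' \<noteq> i" for i' using that by (simp add: W_def u_def conv_op_def)
    have "conv_map r F u = (\<Sum>i'\<le>r. if i' = i then Q' i * W u i else 0)"
      unfolding \<Phi> by (rule sum.cong) (use W0 in auto)
    then have \<Phi>u: "conv_map r F u = Q' i * W u i" using i by simp
    define s where "s = (\<Sum>j\<le>r. Q j * W v j)"
    have os: "of_vec (if i = 0 then conv_sum r m n A v else \<mu> \<cdot>\<^sub>v v i 0 + conv_sum r m n A v) = \<mu> *\<^sub>F of_vec (v i 0) + s"
      using S[OF v] v00(2)[OF v] of_vec_simps(2)[of "\<mu> \<cdot>\<^sub>v v i 0" n "conv_sum r m n A v"] conv_spaceD(1)[OF v] cs
      by (simp add: s_def del: of_vec_simps(2))
    have P'v: "P' i * conv_map r F v = \<mu> *\<^sub>F W v i + P i * s" using P'\<Phi>[OF i] by (simp add: s_def)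
    have "conv_map r F u = X' i j * conv_map r F v"
    proof (cases "j = 0")
      case True
      then have i0: "i \<noteq> 0" using ij entries_conv[OF m] by auto
      have "of_vec (u i 0) = \<mu> *\<^sub>F of_vec (v i 0) + s" using ij os by (simp add: u_def conv_op_def True)
      moreover have "of_vec (u i 1) = \<mu> *\<^sub>F of_vec (v i 1)"
        using conv_spaceD(3)[OF v, of i 1] by (auto simp: u_def conv_op_def True)
      ultimately have "W u i = \<mu> *\<^sub>F W v i + P i * s" by (simp add: W_def algebra_simps)
      then show ?thesis using P'v i0 by (simp add: \<Phi>u X'_def True mult.assoc)
    next
      case False
      then have j: "j = 1" using ij entries_conv[OF m] by auto
      have "of_vec (u i 0) = 0" by (simp add: u_def conv_op_def j)
      moreover have "of_vec (u i 1) = \<mu> *\<^sub>F of_vec (v i 0) + s" using ij os by (simp add: u_def conv_op_def j)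
      ultimately have "W u i = N i * (\<mu> *\<^sub>F W v i + P i * s)"
        using mem(5)[OF i] by (simp add: W_def distrib_left fvs.scale_right_distrib)
      then show ?thesis using P'v by (simp add: \<Phi>u X'_def j mult.assoc)
    qed
    then show "conv_op r m n \<mu> A i j v \<in> conv_space r m n \<and>
      conv_map r F (conv_op r m n \<mu> A i j v) = X' i j * conv_map r F v"
      using u by (simp add: u_def)
  qed
qed

end

section \<open>Reduction of the size\<close>

lemma irr_mod_shift:
  assumes irr: "irr_mod r n X"
    and Y: "\<And>i. i \<le> r \<Longrightarrow> Y i 0 = X i 0 + a i *\<^sub>F idm n \<and> Y i 1 = X i 1 + b i *\<^sub>F idm n"
  shows "irr_mod r n Y"
  unfolding irr_mod_def
proof (intro allI impI)
  fix J assume J: "right_ideal J" and row: "\<forall>x\<in>J. rowb n x"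
    and inv: "\<forall>i\<le>r. \<forall>x\<in>J. Y i 0 * x \<in> J \<and> Y i 1 * x \<in> J"
  have "X i 0 * x \<in> J \<and> X i 1 * x \<in> J" if i: "i \<le> r" and x: "x \<in> J" for i x
  proof -
    have "X i 0 * x = Y i 0 * x - a i *\<^sub>F x" "X i 1 * x = Y i 1 * x - b i *\<^sub>F x"
      using Y[OF i] row x by (simp_all add: distrib_right)
    then show ?thesis using inv i x right_ideal_diff[OF J] right_ideal_scl[OF J] by simp
  qed
  then show "J = {0} \<or> idm n \<in> J" using irr J row unfolding irr_mod_def by blast
qed

lemma irr_mod_zero:
  assumes irr: "irr_mod r n X" and z: "\<And>i. i \<le> r \<Longrightarrow> X i 0 = 0 \<and> X i 1 = 0" shows "n \<le> 1"
proof (rule ccontr)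
  assume n: "\<not> n \<le> 1"
  define J where "J = range (\<lambda>y. unit_mat 0 0 * y)"
  have "right_ideal J"
    unfolding right_ideal_def
  proof (intro conjI ballI allI)
    show "0 \<in> J" unfolding J_def by (rule image_eqI[of _ _ 0]) simp_all
    fix x y assume "x \<in> J" then obtain a where x: "x = unit_mat 0 0 * a" by (auto simp: J_def)
    show "x * z \<in> J" for z unfolding J_def x by (rule image_eqI[of _ _ "a * z"]) (simp_all add: mult.assoc)
    assume "y \<in> J" then obtain b where y: "y = unit_mat 0 0 * b" by (auto simp: J_def)
    show "x + y \<in> J" unfolding J_def x y by (rule image_eqI[of _ _ "a + b"]) (simp_all add: distrib_left)
  qed
  moreover have "\<forall>x\<in>J. rowb n x" using n by (auto simp: J_def)
  ultimately have "J = {0} \<or> idm n \<in> J" using irr z by (simp add: irr_mod_def right_ideal_def)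
  then show False
  proof
    assume "J = {0}"
    moreover have "unit_mat 0 0 * unit_mat 0 0 \<in> J" unfolding J_def by (rule rangeI)
    ultimately have "unit_mat 0 0 * unit_mat 0 0 = 0" by blast
    then have "entry (unit_mat 0 0 * unit_mat 0 0) 0 0 = 0" by simp
    then show False by (simp add: entry_unit_mat_mult)
  next
    assume "idm n \<in> J"
    then obtain y where "idm n = unit_mat 0 0 * y" by (auto simp: J_def)
    then have "entry (idm n) 1 1 = entry (unit_mat 0 0 * y) 1 1" by simp
    then show False using n by (simp add: entry_unit_mat_mult)
  qed
qed

text \<open>Irreducibility makes the total \<open>P\<close> injective and the total \<open>Q\<close>
  surjective, since the kernel of the one and the image of the other are invariant. With
  \<open>Q * P = 0\<close> the image of \<open>P\<close>, of dimension \<open>n\<close>, lies in the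
  kernel of \<open>Q\<close>, of dimension \<open>\<Sum>w i - n\<close>.\<close>

lemma sum_width_ge:
  assumes ld: "\<And>i. i \<le> r \<Longrightarrow> local_datum n (w i) (P i) (Q i) (N i)"
    and irr: "irr_mod r n (\<lambda>i j. if j = 0 then Q i * P i else Q i * N i * P i)"
    and n2: "2 \<le> n" and sum: "(\<Sum>i\<le>r. Q i * P i) = 0"
  shows "2 * n \<le> (\<Sum>i\<le>r. w i)"
proof -
  have PQ: "P i \<in> mats (w i) n" "Q i \<in> mats n (w i)" if "i \<le> r" for i
    using ld[OF that] by (simp_all add: local_datum_def)
  have nz: False if "\<And>i. i \<le> r \<Longrightarrow> P i = 0 \<or> Q i = 0"
  proof -
    have "n \<le> 1" by (rule irr_mod_zero[OF irr]) (use that in fastforce)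
    then show False using n2 by simp
  qed
  have irrD: "J = {0} \<or> idm n \<in> J" if "right_ideal J" "\<And>x. x \<in> J \<Longrightarrow> rowb n x"
    "\<And>i x. i \<le> r \<Longrightarrow> x \<in> J \<Longrightarrow> Q i * (P i * x) \<in> J"
    "\<And>i x. i \<le> r \<Longrightarrow> x \<in> J \<Longrightarrow> Q i * (N i * (P i * x)) \<in> J" for J
    using irr that unfolding irr_mod_def by (simp add: mult.assoc)
  let ?W = "\<Sum>i\<le>r. w i"
  obtain J K where mJ: "\<And>i. i \<le> r \<Longrightarrow> J i \<in> mats ?W (w i)" "\<And>i. i \<le> r \<Longrightarrow> K i \<in> mats (w i) ?W"
    and KJ: "\<And>i j. K i * J j = (if i = j then idm (w i) else 0)"
    by (rule block_inclusions[where r = r and w = w]) blast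
  define PP where "PP = (\<Sum>i\<le>r. J i * P i)"
  define QQ where "QQ = (\<Sum>i\<le>r. Q i * K i)"
  have m: "PP \<in> mats ?W n" "QQ \<in> mats n ?W" using mJ PQ by (auto simp: PP_def QQ_def)
  have KP: "K i * PP = P i" if "i \<le> r" for i
  proof -
    have "K i * PP = (\<Sum>j\<le>r. if j = i then P i else 0)"
      unfolding PP_def sum_distrib_left using PQ that by (intro sum.cong) (auto simp: KJ[THEN mult_eq_assoc])
    then show ?thesis using that by simp
  qed
  have QJ: "QQ * J i = Q i" if "i \<le> r" for i
  proof -
    have "QQ * J i = (\<Sum>j\<le>r. if j = i then Q i else 0)"
      unfolding QQ_def sum_distrib_right using PQ that by (intro sum.cong) (auto simp: KJ mult.assoc)
    then show ?thesis using that by simp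
  qed
  have QP: "QQ * PP = 0"
  proof -
    have "QQ * PP = (\<Sum>i\<le>r. Q i * P i)"
      unfolding QQ_def sum_distrib_right by (intro sum.cong) (auto simp: mult.assoc KP)
    then show ?thesis by (simp add: sum)
  qed
  obtain h where h: "h \<in> mats n ?W" "h * PP = idm n"
  proof (rule left_inverse_exists[OF m(1)])
    define U where "U = {x. rowb n x \<and> PP * x = 0}"
    have PU: "P i * x = 0" if "x \<in> U" "i \<le> r" for x i
    proof -
      have "P i * x = K i * (PP * x)" using KP[OF that(2)] by (simp add: mult.assoc[symmetric])
      then show ?thesis using that(1) by (simp add: U_def)
    qed
    have "right_ideal U" by (auto simp: right_ideal_def U_def distrib_left mult.assoc[symmetric])
    then have "U = {0} \<or> idm n \<in> U"
    proof (rule irrD)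
      have "0 \<in> U" by (simp add: U_def)
      then show "Q i * (P i * x) \<in> U" "Q i * (N i * (P i * x)) \<in> U" if "i \<le> r" "x \<in> U" for i x
        using PU[OF that(2,1)] by simp_all
    qed (simp add: U_def)
    moreover have "idm n \<notin> U"
    proof
      assume "idm n \<in> U"
      then have "P i = 0" if "i \<le> r" for i using PU[of "idm n" i] PQ(1)[OF that] that by simp
      then show False using nz by blast
    qed
    ultimately show "x = 0" if "x \<in> mats n n" "PP * x = 0" for x using that by (auto simp: U_def)
  qed
  obtain s where s: "s \<in> mats ?W n" "QQ * s = idm n"
  proof -
    define U where "U = range (\<lambda>z. QQ * z)"
    have QU: "Q i * z \<in> U" if "i \<le> r" for i z
      unfolding U_def by (rule image_eqI[of _ _ "J i * z"]) (simp_all add: mult.assoc[symmetric] QJ[OF that])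
    have "right_ideal U"
      unfolding right_ideal_def
    proof (intro conjI ballI allI)
      show "0 \<in> U" unfolding U_def by (rule image_eqI[of _ _ 0]) simp_all
      fix x y assume "x \<in> U" then obtain a where x: "x = QQ * a" by (auto simp: U_def)
      show "x * z \<in> U" for z unfolding U_def x by (rule image_eqI[of _ _ "a * z"]) (simp_all add: mult.assoc)
      assume "y \<in> U" then obtain b where y: "y = QQ * b" by (auto simp: U_def)
      show "x + y \<in> U" unfolding U_def x y by (rule image_eqI[of _ _ "a + b"]) (simp_all add: distrib_left)
    qed
    then have "U = {0} \<or> idm n \<in> U" by (rule irrD) (use m QU in \<open>auto simp: U_def\<close>)
    moreover have "U \<noteq> {0}"
    proof
      assume U: "U = {0}"
      have "Q i = 0" if "i \<le> r" for i using QU[OF that, of "idm (w i)"] PQ(2)[OF that] U by simp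
      then show False using nz by blast
    qed
    ultimately have "idm n \<in> U" by blast
    then obtain z where z': "idm n = QQ * z" unfolding U_def by (rule rangeE)
    note z = z'[symmetric]
    have "QQ * (idm ?W * z * idm n) = idm n"
      using m by (simp add: mult.assoc) (simp add: mult.assoc[symmetric] z)
    then show ?thesis by (intro that[of "idm ?W * z * idm n"]) (simp_all add: mult.assoc)
  qed
  have "n + n \<le> ?W" by (rule rank_add_kernel_le[OF m(2) s(1) h(1) m(1) s(2) h(2) QP])
  then show ?thesis by simp
qed

lemma rep_is_tuple: "rep r m n A X \<Longrightarrow> is_tuple r m n A"
  by (auto simp: rep_def is_tuple_def)

lemma rep_addition:
  assumes R: "rep r m n A X" and e: "(\<Sum>i\<le>r. e i 0) = 0" and f: "\<And>i. i \<le> r \<Longrightarrow> m i = 0 \<Longrightarrow> e i 1 = 0"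
  shows "rep r m n (addition n e A) (\<lambda>i j. X i j + e i j *\<^sub>F idm n)"
  using R e f unfolding rep_def addition_def
  by (auto simp: sum.distrib fvs.scale_sum_left[symmetric])

definition rigidity :: "nat \<Rightarrow> nat \<Rightarrow> (nat \<Rightarrow> nat \<Rightarrow> fmat) \<Rightarrow> int" where
  "rigidity r n X = (\<Sum>i\<le>r. int (cdim n (X i 1) (X i 0))) - 2 * int r * (int n)\<^sup>2"

lemma cdim_scalar: "cdim n (a *\<^sub>F idm n) (b *\<^sub>F idm n) = 2 * n * n"
proof -
  have "ctz n 0 0 = mats n n \<times> mats n n" by (auto simp: ctz_def)
  then have "cdim n 0 0 = n * n + n * n" by (simp add: cdim_def pvs_mats(3))
  then show ?thesis using cdim_shift[of 0 n 0 a b] by simp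
qed

text \<open>Each choice of a shift with kernel dimension \<open>K i\<close> gives a width of at most
  \<open>2 n - K i\<close>. The hypothesis on \<open>\<Sum>K i\<close> therefore bounds the total
  width below \<open>2 n\<close>, and the new size \<open>\<Sum>w i - n\<close> lies below
  \<open>n\<close>.\<close>

lemma descent:
  assumes R: "rep r m n A X" and m: "\<forall>i\<le>r. m i \<le> 1" and n2: "2 \<le> n" and irr: "irr_mod r n X"
    and ss: "\<And>i. i \<le> r \<Longrightarrow> \<exists>D k u v. spectral n (X i 1) D k u v"
    and ch: "\<And>i. i \<le> r \<Longrightarrow> \<exists>d c g0 g1 h0 h1. g0 \<in> mats n (K i) \<and> g1 \<in> mats n (K i) \<and>
      h0 \<in> mats (K i) n \<and> h1 \<in> mats (K i) n \<and>
      (X i 1 - d *\<^sub>F idm n) * g1 + (X i 0 - c *\<^sub>F idm n) * g0 = 0 \<and> (X i 1 - d *\<^sub>F idm n) * g0 = 0 \<and>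
      h0 * g0 + h1 * g1 = idm (K i) \<and> (X i 1 = 0 \<longrightarrow> d = 0)"
    and K: "2 * r * n < (\<Sum>i\<le>r. K i)"
  obtains n' A' X' where "1 \<le> n'" "n' < n" "transforms_to r m (n, A) (n', A')" "rep r m n' A' X'" "irr_mod r n' X'"
    "\<And>i. i \<le> r \<Longrightarrow> \<exists>D k u v. spectral n' (X' i 1) D k u v" "rigidity r n' X' = rigidity r n X"
proof -
  have mX: "X i 0 \<in> mats n n" "X i 1 \<in> mats n n" "m i = 0 \<Longrightarrow> X i 1 = 0" if "i \<le> r" for i
    using R that by (auto simp: rep_def)
  have "\<exists>d c w P Q N. local_datum n w P Q N \<and> Q * P = X i 0 - c *\<^sub>F idm n \<and> Q * N * P = X i 1 - d *\<^sub>F idm n \<and>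
      w + K i \<le> 2 * n \<and> (X i 1 = 0 \<longrightarrow> d = 0)" if i: "i \<le> r" for i
  proof -
    obtain d c g0 g1 h0 h1 where *: "g0 \<in> mats n (K i)" "g1 \<in> mats n (K i)" "h0 \<in> mats (K i) n" "h1 \<in> mats (K i) n"
      "(X i 1 - d *\<^sub>F idm n) * g1 + (X i 0 - c *\<^sub>F idm n) * g0 = 0" "(X i 1 - d *\<^sub>F idm n) * g0 = 0"
      "h0 * g0 + h1 * g1 = idm (K i)" "X i 1 = 0 \<longrightarrow> d = 0" using ch[OF i] by blast
    have "X i 0 - c *\<^sub>F idm n \<in> mats n n" "X i 1 - d *\<^sub>F idm n \<in> mats n n" using mX[OF i] by auto
    from local_datum_exists[OF this *(1-7)] show ?thesis using *(8) by metis
  qed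
  then obtain d c w P Q N where
    ld: "\<And>i. i \<le> r \<Longrightarrow> local_datum n (w i) (P i) (Q i) (N i)" and
    QP: "\<And>i. i \<le> r \<Longrightarrow> Q i * P i = X i 0 - c i *\<^sub>F idm n" and
    QNP: "\<And>i. i \<le> r \<Longrightarrow> Q i * N i * P i = X i 1 - d i *\<^sub>F idm n" and
    w: "\<And>i. i \<le> r \<Longrightarrow> w i + K i \<le> 2 * n" and d0: "\<And>i. i \<le> r \<Longrightarrow> X i 1 = 0 \<Longrightarrow> d i = 0"
    by metis
  have W: "(\<Sum>i\<le>r. w i) < 2 * n"
  proof -
    have "(\<Sum>i\<le>r. w i) + (\<Sum>i\<le>r. K i) \<le> (\<Sum>i\<le>r. 2 * n)" unfolding sum.distrib[symmetric] by (rule sum_mono) (use w in simp)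
    then show ?thesis using K by simp
  qed
  define \<mu> where "\<mu> = (\<Sum>i\<le>r. c i)"
  have sumQP: "(\<Sum>i\<le>r. Q i * P i) = - \<mu> *\<^sub>F idm n"
  proof -
    have "(\<Sum>i\<le>r. Q i * P i) = (\<Sum>i\<le>r. X i 0) - \<mu> *\<^sub>F idm n"
      by (simp add: QP sum_subtractf \<mu>_def fvs.scale_sum_left)
    then show ?thesis using R by (simp add: rep_def)
  qed
  have irr1: "irr_mod r n (\<lambda>i j. if j = 0 then Q i * P i else Q i * N i * P i)"
    by (rule irr_mod_shift[OF irr, where a = "\<lambda>i. - c i" and b = "\<lambda>i. - d i"]) (simp add: QP QNP)
  \<comment> \<open>For \<open>\<mu> = 0\<close> the total width would be at least
    \<open>2 n\<close>.\<close>
  have \<mu>: "\<mu> \<noteq> 0"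
  proof
    assume "\<mu> = 0"
    then have "2 * n \<le> (\<Sum>i\<le>r. w i)" using sum_width_ge[OF ld irr1 n2] sumQP by simp
    then show False using W by simp
  qed
  have ss1: "\<exists>D k u v. spectral n (Q i * N i * P i) D k u v" if i: "i \<le> r" for i
  proof -
    obtain D k u v where "spectral n (X i 1) D k u v" using ss[OF i] by blast
    from spectral_shift[OF this, of "- d i"] show ?thesis by (auto simp: QNP[OF i])
  qed
  have mPQ: "P i \<in> mats (w i) n" "Q i \<in> mats n (w i)" if "i \<le> r" for i
    using ld[OF that] by (simp_all add: local_datum_def)
  obtain n' P' Q' where "\<And>i. i \<le> r \<Longrightarrow> P' i \<in> mats (w i) n'" "\<And>i. i \<le> r \<Longrightarrow> Q' i \<in> mats n' (w i)"
    "\<And>i j. i \<le> r \<Longrightarrow> j \<le> r \<Longrightarrow> P' i * Q' j = (if i = j then \<mu> *\<^sub>F idm (w i) else 0) + P i * Q j"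
    "(\<Sum>i\<le>r. Q' i * P' i) = \<mu> *\<^sub>F idm n'" and nn: "n + n' = (\<Sum>i\<le>r. w i)"
    by (rule reflection_exists[OF mPQ sumQP \<mu>]) blast+
  then interpret reflection r n n' \<mu> w P Q N P' Q'
    by unfold_locales (use \<mu> n2 ld sumQP irr1 ss1 in auto)
  \<comment> \<open>The shifts \<open>- c i\<close> change the residue sum by
    \<open>- \<mu>\<close>; adding \<open>\<mu>\<close> back at infinity makes them an addition of
    the tuple and leaves \<open>Q 0 * P 0\<close> as the residue minus \<open>\<mu>\<close>, the
    form required at infinity by the middle convolution.\<close>
  define e where "e i j = (if j = 0 then (if i = 0 then \<mu> else 0) - c i else - d i)" for i j :: nat
  define Y where "Y i j = X i j + e i j *\<^sub>F idm n" for i j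
  have RY: "rep r m n (addition n e A) Y"
    unfolding Y_def by (rule rep_addition[OF R]) (use mX(3) d0 in \<open>auto simp: e_def sum_subtractf \<mu>_def\<close>)
  have Y0: "Q i * P i = Y i 0 - (if i = 0 then \<mu> *\<^sub>F idm n else 0)" if "i \<le> r" for i
    using QP[OF that] by (simp add: Y_def e_def fvs.scale_left_diff_distrib)
  have Y1: "Q i * N i * P i = Y i 1" if "i \<le> r" for i using QNP[OF that] by (simp add: Y_def e_def)
  define X' where "X' = (\<lambda>i (j :: nat). if j = 0 then Q' i * P' i - (if i = 0 then \<mu> *\<^sub>F idm n' else 0) else Q' i * N i * P' i)"
  note mc = middle_convolution[OF RY m Y0 Y1 rep_is_tuple[OF RY] X'_def]
  show ?thesis
  proof (rule that)
    show "1 \<le> n'" by (rule n'_pos)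
    show "n' < n" using nn W by simp
    have "transform_step r m (n, A) (n, addition n e A)" by (rule transform_step.addition)
    moreover have "transform_step r m (n, addition n e A) (n', \<lambda>i j. to_mat n' n' (X' i j))"
      by (rule transform_step.middle_convolution) (rule mc(2))
    ultimately show "transforms_to r m (n, A) (n', \<lambda>i j. to_mat n' n' (X' i j))" by simp
    show "rep r m n' (\<lambda>i j. to_mat n' n' (X' i j)) X'" by (rule mc(1))
    show "irr_mod r n' X'"
      by (rule irr_mod_shift[OF irr', where a = "\<lambda>i. if i = 0 then - \<mu> else 0" and b = "\<lambda>i. 0"]) (auto simp: X'_def)
    show "\<exists>D k u v. spectral n' (X' i 1) D k u v" if "i \<le> r" for i
      using spectral'[OF that] by (simp add: X'_def)
    have "cdim n' (X' i 1) (X' i 0) = cdim n' (Q' i * N i * P' i) (Q' i * P' i)" if "i \<le> r" for i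
      using cdim_shift[of "Q' i * N i * P' i" n' "Q' i * P' i" 0 "if i = 0 then - \<mu> else 0"] mem[OF that]
      by (auto simp: X'_def mult.assoc)
    moreover have "cdim n (X i 1) (X i 0) = cdim n (Q i * N i * P i) (Q i * P i)" if "i \<le> r" for i
      using cdim_shift[OF mX(2,1)[OF that], of "- d i" "- c i"] by (simp add: QP[OF that] QNP[OF that])
    ultimately show "rigidity r n' X' = rigidity r n X" using index_preserved by (simp add: rigidity_def)
  qed
qed

text \<open>At a scalar singularity the centralizer is everything, so \<open>K i = 2 n\<close> and
  its term in \<open>\<Sum>(2 n - K i)\<close> is zero. The classification can thus be applied to
  the remaining singularities alone.\<close>

lemma has_mult_types_of_balanced:
  assumes R: "rep r m n A X" and m: "\<forall>i\<le>r. m i \<le> 1" and n: "1 \<le> n"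
    and bal: "\<And>i. i \<le> r \<Longrightarrow> \<exists>D p q. balanced n (X i 1) (X i 0) (K i) D p q"
    and cd: "\<And>i. i \<le> r \<Longrightarrow> cdim n (X i 1) (X i 0) = n * K i" and K: "(\<Sum>i\<le>r. K i) = 2 * r * n"
  shows "\<exists>d \<T>. d \<ge> 1 \<and> \<T> \<in> idx0_types d \<and> has_mult_types r m n A \<T>"
proof -
  have mX: "X i 0 \<in> mats n n" "X i 1 \<in> mats n n" if "i \<le> r" for i using R that by (auto simp: rep_def)
  have coef: "coef r m n A i 0 = to_mat n n (X i 0)" "coef r m n A i 1 = to_mat n n (X i 1)" if "i \<le> r" for i
    using rep_coef[OF R that] m that by auto
  have sc: "scalar_mat n (to_mat n n Y) \<longleftrightarrow> (\<exists>c. Y = c *\<^sub>F idm n)" if "Y \<in> mats n n" for Y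
  proof -
    have "to_mat n n Y = c \<cdot>\<^sub>m 1\<^sub>m n \<longleftrightarrow> Y = c *\<^sub>F idm n" for c
      using to_mat_inj[OF that, of "c *\<^sub>F idm n"] by auto
    then show ?thesis by (simp add: scalar_mat_def)
  qed
  have "\<exists>ps. split_data n (K i) ps \<and> has_mult_type n (to_mat n n (X i 1)) (to_mat n n (X i 0)) (split_type (K i) ps) \<and>
    (ps = [1] \<longrightarrow> (\<exists>c. X i 1 = c *\<^sub>F idm n) \<and> (\<exists>c. X i 0 = c *\<^sub>F idm n))" if i: "i \<le> r" for i
  proof -
    obtain D p q where b: "balanced n (X i 1) (X i 0) (K i) D p q" using bal[OF i] by blast
    show ?thesis by (rule has_mult_type_of_balanced[OF b mX(2,1)[OF i] n]) blast
  qed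
  then obtain ps where ps: "\<And>i. i \<le> r \<Longrightarrow> split_data n (K i) (ps i)"
    "\<And>i. i \<le> r \<Longrightarrow> has_mult_type n (to_mat n n (X i 1)) (to_mat n n (X i 0)) (split_type (K i) (ps i))"
    "\<And>i. i \<le> r \<Longrightarrow> ps i = [1] \<Longrightarrow> (\<exists>c. X i 1 = c *\<^sub>F idm n) \<and> (\<exists>c. X i 0 = c *\<^sub>F idm n)" by metis
  define S where "S = nonscalar_sings r m n A"
  have S: "i \<in> S \<longleftrightarrow> i \<le> r \<and> \<not> ((\<exists>c. X i 1 = c *\<^sub>F idm n) \<and> (\<exists>c. X i 0 = c *\<^sub>F idm n))" for i
    using sc[OF mX(1), of i] sc[OF mX(2), of i] coef[of i] unfolding S_def nonscalar_sings_def mem_Collect_eq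
    by (cases "i \<le> r") (simp_all only: simp_thms)
  have Sr: "S \<subseteq> {..r}" using S by auto
  have K2: "K i = 2 * n" if i: "i \<le> r" "i \<notin> S" for i
  proof -
    obtain a b where "X i 1 = a *\<^sub>F idm n" "X i 0 = b *\<^sub>F idm n" using i S by blast
    then have "n * K i = 2 * n * n" using cd[OF i(1)] cdim_scalar[of n a b] by metis
    then show ?thesis using n by simp
  qed
  have "(\<Sum>i\<in>S. 2 * real n - real (K i)) = (\<Sum>i\<le>r. 2 * real n - real (K i))"
    by (rule sum.mono_neutral_left) (use Sr K2 in auto)
  also have "\<dots> = 2 * real n * (real r + 1) - real (\<Sum>i\<le>r. K i)" by (simp add: sum_subtractf algebra_simps)
  also have "\<dots> = 2 * real n" unfolding K by (simp add: algebra_simps)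
  finally have sum: "(\<Sum>i\<in>S. 2 * real n - real (K i)) = 2 * real n" .
  have "\<exists>d\<ge>1. image_mset (\<lambda>i. split_type (K i) (ps i)) (mset_set S) \<in> idx0_types d"
  proof (rule classification[OF finite_subset[OF Sr] n _ _ sum])
    fix i assume "i \<in> S"
    then show "split_data n (K i) (ps i)" "ps i \<noteq> [1]" using ps(1,3)[of i] S by blast+
  qed simp
  then obtain d where d: "1 \<le> d" "image_mset (\<lambda>i. split_type (K i) (ps i)) (mset_set S) \<in> idx0_types d" by blast
  have "has_mult_types r m n A (image_mset (\<lambda>i. split_type (K i) (ps i)) (mset_set S))"
    unfolding has_mult_types_def S_def[symmetric]
    by (rule exI[of _ "\<lambda>i. split_type (K i) (ps i)"]) (use ps(2) S coef in auto)
  then show ?thesis using d by blast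
qed

text \<open>Induction on the size. At size one all centralizers are full and the index is 2, so the
  second claim is vacuous there. At larger size either \<open>descent\<close> applies, or
  \<open>\<Sum>K i \<le> 2 r n\<close> bounds the index by zero; the first claim is then vacuous,
  and the second holds for the tuple as it stands.\<close>

lemma reduction:
  assumes m: "\<forall>i\<le>r. m i \<le> 1"
  shows "1 \<le> n \<Longrightarrow> rep r m n A X \<Longrightarrow> irr_mod r n X \<Longrightarrow> (\<And>i. i \<le> r \<Longrightarrow> \<exists>D k u v. spectral n (X i 1) D k u v) \<Longrightarrow>
    (rigidity r n X = 2 \<longrightarrow> (\<exists>B. is_tuple r m 1 B \<and> transforms_to r m (n, A) (1, B))) \<and>
    (rigidity r n X = 0 \<longrightarrow> (\<exists>N B d \<T>. is_tuple r m N B \<and> transforms_to r m (n, A) (N, B) \<and>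
       d \<ge> 1 \<and> \<T> \<in> idx0_types d \<and> has_mult_types r m N B \<T>))"
proof (induction n arbitrary: A X rule: less_induct)
  case (less n)
  note R = less.prems(2)
  have mX: "X i 0 \<in> mats n n" "X i 1 \<in> mats n n" if "i \<le> r" for i using R that by (auto simp: rep_def)
  show ?case
  proof (cases "n = 1")
    case True
    have sc: "Y = entry Y 0 0 *\<^sub>F idm 1" if "Y \<in> mats 1 1" for Y
    proof (rule fmat_eqI)
      fix i j
      show "entry Y i j = entry (entry Y 0 0 *\<^sub>F idm 1) i j"
        using matsD[OF that, of i j] by (cases "i = 0 \<and> j = 0") auto
    qed
    have "cdim n (X i 1) (X i 0) = 2" if "i \<le> r" for i
      using trans[OF arg_cong2[OF sc sc, of "X i 1" "X i 0" "cdim 1"] cdim_scalar] mX[OF that] unfolding True by simp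
    then have "rigidity r n X = 2" by (simp add: rigidity_def True)
    then show ?thesis using rep_is_tuple[OF R] True by auto
  next
    case False
    then have n2: "2 \<le> n" using less.prems(1) by simp
    have "\<exists>K d c g0 g1 h0 h1. g0 \<in> mats n K \<and> g1 \<in> mats n K \<and> h0 \<in> mats K n \<and> h1 \<in> mats K n \<and>
      (X i 1 - d *\<^sub>F idm n) * g1 + (X i 0 - c *\<^sub>F idm n) * g0 = 0 \<and> (X i 1 - d *\<^sub>F idm n) * g0 = 0 \<and>
      h0 * g0 + h1 * g1 = idm K \<and> (X i 1 = 0 \<longrightarrow> d = 0) \<and> cdim n (X i 1) (X i 0) \<le> n * K \<and>
      (cdim n (X i 1) (X i 0) = n * K \<longrightarrow> (\<exists>D p q. balanced n (X i 1) (X i 0) K D p q))" if i: "i \<le> r" for i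
    proof -
      obtain D k u v where sp: "spectral n (X i 1) D k u v" using less.prems(4)[OF i] by blast
      show ?thesis by (rule local_choice[OF sp mX(1)[OF i] less.prems(1)]) blast
    qed
    then obtain K where ch: "\<And>i. i \<le> r \<Longrightarrow> \<exists>d c g0 g1 h0 h1. g0 \<in> mats n (K i) \<and> g1 \<in> mats n (K i) \<and>
      h0 \<in> mats (K i) n \<and> h1 \<in> mats (K i) n \<and>
      (X i 1 - d *\<^sub>F idm n) * g1 + (X i 0 - c *\<^sub>F idm n) * g0 = 0 \<and> (X i 1 - d *\<^sub>F idm n) * g0 = 0 \<and>
      h0 * g0 + h1 * g1 = idm (K i) \<and> (X i 1 = 0 \<longrightarrow> d = 0)"
      and cd: "\<And>i. i \<le> r \<Longrightarrow> cdim n (X i 1) (X i 0) \<le> n * K i"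
      and bal: "\<And>i. i \<le> r \<Longrightarrow> cdim n (X i 1) (X i 0) = n * K i \<Longrightarrow> \<exists>D p q. balanced n (X i 1) (X i 0) (K i) D p q"
      by metis
    show ?thesis
    proof (cases "2 * r * n < (\<Sum>i\<le>r. K i)")
      case True
      obtain n' A' X' where *: "1 \<le> n'" "n' < n" "transforms_to r m (n, A) (n', A')" "rep r m n' A' X'" "irr_mod r n' X'"
        "\<And>i. i \<le> r \<Longrightarrow> \<exists>D k u v. spectral n' (X' i 1) D k u v" "rigidity r n' X' = rigidity r n X"
        by (rule descent[OF R m n2 less.prems(3,4) ch True]) blast+
      show ?thesis using less.IH[OF *(2,1,4,5,6)] rtranclp_trans[OF *(3)] unfolding *(7) by blast
    next
      case False
      define c where "c i = cdim n (X i 1) (X i 0)" for i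
      have le: "(\<Sum>i\<le>r. c i) \<le> n * (\<Sum>i\<le>r. K i)"
        unfolding sum_distrib_left by (rule sum_mono) (use cd in \<open>simp add: c_def\<close>)
      have le2: "n * (\<Sum>i\<le>r. K i) \<le> n * (2 * r * n)" using False by simp
      have rig: "rigidity r n X = int (\<Sum>i\<le>r. c i) - int (n * (2 * r * n))"
        by (simp add: rigidity_def c_def power2_eq_square)
      have "rigidity r n X \<noteq> 2" using le le2 unfolding rig by linarith
      moreover have "\<exists>d \<T>. d \<ge> 1 \<and> \<T> \<in> idx0_types d \<and> has_mult_types r m n A \<T>" if "rigidity r n X = 0"
      proof -
        have eq: "(\<Sum>i\<le>r. c i) = n * (\<Sum>i\<le>r. K i)" "n * (\<Sum>i\<le>r. K i) = n * (2 * r * n)"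
          using that le le2 unfolding rig by linarith+
        have ceq: "c i = n * K i" if "i \<le> r" for i
          by (rule sum_mono_inv[of c "{..r}" "\<lambda>i. n * K i"]) (use eq(1) cd that in \<open>auto simp: c_def sum_distrib_left\<close>)
        show ?thesis
          by (rule has_mult_types_of_balanced[OF R m less.prems(1) bal])
            (use ceq eq(2) less.prems(1) in \<open>auto simp: c_def\<close>)
      qed
      ultimately show ?thesis using rep_is_tuple[OF R] by blast
    qed
  qed
qed

theorem proposition4p3:
  fixes r n :: nat and m :: "nat \<Rightarrow> nat" and A :: mat_tuple
  assumes "r \<ge> 1" and "n \<ge> 1"
    and "\<forall>i \<le> r. m i \<le> 1"
    and "is_tuple r m n A"
    and "\<forall>i \<le> r. semisimple_mat (coef r m n A i 1)"
    and "irreducible_tuple r m n A"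
  shows "(idx r m n A = 2 \<longrightarrow>
            (\<exists>B. is_tuple r m 1 B \<and> transforms_to r m (n, A) (1, B))) \<and>
         (idx r m n A = 0 \<longrightarrow>
            (\<exists>N B d \<T>. is_tuple r m N B \<and> transforms_to r m (n, A) (N, B) \<and>
               d \<ge> 1 \<and> \<T> \<in> idx0_types d \<and> has_mult_types r m N B \<T>))"
proof -
  obtain X where R: "rep r m n A X" by (rule rep_exists[OF assms(4,3)])
  have "\<exists>D k u v. spectral n (X i 1) D k u v" if i: "i \<le> r" for i
  proof (rule spectral_of_semisimple)
    show "X i 1 \<in> mats n n" using R i by (auto simp: rep_def)
    show "semisimple_mat (to_mat n n (X i 1))" using rep_coef(2)[OF R i] assms(3,5) i by auto
  qed
  moreover have "idx r m n A = rigidity r n X" using idx_rep[OF R assms(3)] by (simp add: rigidity_def)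
  ultimately show ?thesis
    using reduction[OF assms(3,2) R irr_mod_of_irreducible[OF R assms(3,6)]] by simp
qed

end
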